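(* Let $dS_t=\sigma S_t\,dW_t$ with $W$ a Brownian motion and $\sigma$ a constant, and let $$\tau=\sup\{t\le1:\ S_1-2S_t=0\}.$$ Then the No Arbitrage condition (NA) holds before $\tau$, i.e. in the market $(S^\tau,\mathbb G)$, and there are classical arbitrages after $\tau$, i.e. in the market $(S-S^\tau,\mathbb G)$.
   Context: $W$ is a one-dimensional Brownian motion on $(\Omega,\mathcal A,\mathbb P)$ with (augmented natural) filtration $\mathbb F=(\mathcal F_t)$; $\sigma>0$; $S_0>0$ is a constant; zero interest rate. The convention $\sup\emptyset=0$ is used, so that $\{\tau\le t\}=\{\inf_{t\le s\le1}2S_s\ge S_1\}$ for $0\le t\le 1$. $\mathbb G=(\mathcal G_t)$ is the progressive enlargement of $\mathbb F$ by $\tau$: $\mathcal G_t=\bigcap_{\epsilon>0}\big(\mathcal F_{t+\epsilon}\vee\sigma(\tau\wedge(t+\epsilon))\big)$. $S^\tau_t=S_{t\wedge\tau}$. Classical arbitrage and NA: for a filtration $\mathbb K$ and a price process $X$ (with stochastic integrals $\theta\cdot X$ of $\mathbb K$-predictable integrands), a $\mathbb K$-predictable $X$-integrable $\theta$ is admissible if for some $c\ge0$, $(\theta\cdot X)_t\ge-c$ a.s. for all $t\ge0$ and $(\theta\cdot X)_\infty:=\lim_{t\to\infty}(\theta\cdot X)_t$ exists. An admissible $\theta$ is a classical arbitrage in $(X,\mathbb K)$ if $(\theta\cdot X)_\infty\ge0$ a.s. and $\mathbb P((\theta\cdot X)_\infty>0)>0$; NA holds in $(X,\mathbb K)$ if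 there is no classical arbitrage. *)

theory Defs
  imports "HOL-Probability.Probability"
begin

text \<open>
  Time is the half-line \<open>0 \<le> t\<close> inside \<open>real\<close>; nothing below depends on values at negative times.
  A filtration is a family \<open>K :: real \<Rightarrow> 'a measure\<close> of which only the \<open>\<sigma>\<close>-algebras
  \<open>sets (K t)\<close> with \<open>t \<ge> 0\<close> matter.  A process is a function \<open>real \<Rightarrow> 'a \<Rightarrow> real\<close>.
\<close>

section \<open>Processes and filtrations\<close>

definition adapted :: "(real \<Rightarrow> 'a measure) \<Rightarrow> (real \<Rightarrow> 'a \<Rightarrow> real) \<Rightarrow> bool" where
  "adapted K X \<longleftrightarrow> (\<forall>t\<ge>0. X t \<in> borel_measurable (K t))"

definition continuous_paths :: "'a measure \<Rightarrow> (real \<Rightarrow> 'a \<Rightarrow> real) \<Rightarrow> bool" where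
  "continuous_paths M X \<longleftrightarrow> (AE \<omega> in M. continuous_on {0..} (\<lambda>t. X t \<omega>))"

definition cadlag_paths :: "'a measure \<Rightarrow> (real \<Rightarrow> 'a \<Rightarrow> real) \<Rightarrow> bool" where
  "cadlag_paths M X \<longleftrightarrow> (AE \<omega> in M. \<forall>t\<ge>0.
     ((\<lambda>s. X s \<omega>) \<longlongrightarrow> X t \<omega>) (at_right t) \<and>
     (t > 0 \<longrightarrow> (\<exists>l. ((\<lambda>s. X s \<omega>) \<longlongrightarrow> l) (at_left t))))"

definition stopped :: "(real \<Rightarrow> 'a \<Rightarrow> real) \<Rightarrow> ('a \<Rightarrow> real) \<Rightarrow> real \<Rightarrow> 'a \<Rightarrow> real" where
  "stopped X \<tau> t \<omega> = X (min t (\<tau> \<omega>)) \<omega>"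

definition brownian_motion :: "'a measure \<Rightarrow> (real \<Rightarrow> 'a \<Rightarrow> real) \<Rightarrow> bool" where
  "brownian_motion M W \<longleftrightarrow>
     (\<forall>t\<ge>0. W t \<in> borel_measurable M) \<and>
     (AE \<omega> in M. W 0 \<omega> = 0) \<and>
     continuous_paths M W \<and>
     (\<forall>s t. 0 \<le> s \<and> s < t \<longrightarrow>
        distributed M lborel (\<lambda>\<omega>. W t \<omega> - W s \<omega>) (normal_density 0 (sqrt (t - s)))) \<and>
     (\<forall>n. \<forall>u::nat \<Rightarrow> real. 0 \<le> u 0 \<and> (\<forall>i<n. u i < u (Suc i)) \<longrightarrow>
        prob_space.indep_vars M (\<lambda>_. borel) (\<lambda>i \<omega>. W (u (Suc i)) \<omega> - W (u i) \<omega>) {..<n})"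

definition augmented_filtration :: "'a measure \<Rightarrow> (real \<Rightarrow> 'a \<Rightarrow> real) \<Rightarrow> real \<Rightarrow> 'a measure" where
  "augmented_filtration M W t = sigma (space M)
     ({W s -` B \<inter> space M | s B. 0 \<le> s \<and> s \<le> t \<and> B \<in> sets borel} \<union> null_sets M)"

definition progressive_enlargement ::
    "'a measure \<Rightarrow> (real \<Rightarrow> 'a measure) \<Rightarrow> ('a \<Rightarrow> real) \<Rightarrow> real \<Rightarrow> 'a measure" where
  "progressive_enlargement M F \<tau> t = sigma (space M)
     (\<Inter>\<epsilon>\<in>{0<..}. sigma_sets (space M)
        (sets (F (t + \<epsilon>)) \<union>
         {(\<lambda>\<omega>. min (\<tau> \<omega>) (t + \<epsilon>)) -` B \<inter> space M | B. B \<in> sets borel}))"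

definition predictable_sigma :: "'a measure \<Rightarrow> (real \<Rightarrow> 'a measure) \<Rightarrow> (real \<times> 'a) measure" where
  "predictable_sigma M K = sigma ({0..} \<times> space M)
     ({{0} \<times> A | A. A \<in> sets (K 0)} \<union>
      {{s<..t} \<times> A | s t A. 0 \<le> s \<and> s < t \<and> A \<in> sets (K s)})"

definition predictable :: "'a measure \<Rightarrow> (real \<Rightarrow> 'a measure) \<Rightarrow> (real \<Rightarrow> 'a \<Rightarrow> real) \<Rightarrow> bool" where
  "predictable M K \<theta> \<longleftrightarrow> (\<lambda>(t, \<omega>). \<theta> t \<omega>) \<in> borel_measurable (predictable_sigma M K)"

section \<open>Stochastic integration\<close>

text \<open>
  Elementary integrands are \<open>g 1\<^bsub>{0}\<^esub> + (\<Sum>i<n. f i 1\<^bsub>(u i, u (i+1)]\<^esub>)\<close> with bounded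
  \<open>g\<close>, \<open>f i\<close>, measurable for \<open>K 0\<close> and \<open>K (u i)\<close>.  Integrals start at 0, so \<open>g\<close> does not
  contribute.
\<close>

definition elementary ::
    "'a measure \<Rightarrow> (real \<Rightarrow> 'a measure) \<Rightarrow> ('a \<Rightarrow> real) \<Rightarrow> nat \<Rightarrow> (nat \<Rightarrow> real) \<Rightarrow> (nat \<Rightarrow> 'a \<Rightarrow> real) \<Rightarrow> bool" where
  "elementary M K g n u f \<longleftrightarrow>
     g \<in> borel_measurable (K 0) \<and> (\<exists>C. \<forall>\<omega>\<in>space M. \<bar>g \<omega>\<bar> \<le> C) \<and>
     0 \<le> u 0 \<and> (\<forall>i<n. u i \<le> u (Suc i)) \<and>
     (\<forall>i<n. f i \<in> borel_measurable (K (u i)) \<and> (\<exists>C. \<forall>\<omega>\<in>space M. \<bar>f i \<omega>\<bar> \<le> C))"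

definition elem_process ::
    "('a \<Rightarrow> real) \<Rightarrow> nat \<Rightarrow> (nat \<Rightarrow> real) \<Rightarrow> (nat \<Rightarrow> 'a \<Rightarrow> real) \<Rightarrow> real \<Rightarrow> 'a \<Rightarrow> real" where
  "elem_process g n u f t \<omega> =
     g \<omega> * indicator {0} t + (\<Sum>i<n. f i \<omega> * indicator {u i<..u (Suc i)} t)"

definition elem_integral ::
    "nat \<Rightarrow> (nat \<Rightarrow> real) \<Rightarrow> (nat \<Rightarrow> 'a \<Rightarrow> real) \<Rightarrow> (real \<Rightarrow> 'a \<Rightarrow> real) \<Rightarrow> real \<Rightarrow> 'a \<Rightarrow> real" where
  "elem_integral n u f X t \<omega> =
     (\<Sum>i<n. f i \<omega> * (X (min t (u (Suc i))) \<omega> - X (min t (u i)) \<omega>))"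

definition bounded_by :: "'a measure \<Rightarrow> (real \<Rightarrow> 'a \<Rightarrow> real) \<Rightarrow> real \<Rightarrow> bool" where
  "bounded_by M H C \<longleftrightarrow> (\<forall>t\<ge>0. \<forall>\<omega>\<in>space M. \<bar>H t \<omega>\<bar> \<le> C)"

text \<open>
  Semimartingales as good integrators (equivalent to local martingale plus finite variation by
  the Bichteler--Dellacherie theorem): the elementary integral up to any fixed time is continuous
  from uniform convergence of integrands to convergence in probability.
\<close>

definition semimartingale :: "'a measure \<Rightarrow> (real \<Rightarrow> 'a measure) \<Rightarrow> (real \<Rightarrow> 'a \<Rightarrow> real) \<Rightarrow> bool" where
  "semimartingale M K X \<longleftrightarrow> adapted K X \<and> cadlag_paths M X \<and>
     (\<forall>t\<ge>0. \<forall>\<epsilon>>0. \<exists>\<delta>>0. \<forall>g n u f.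
        elementary M K g n u f \<and> bounded_by M (elem_process g n u f) \<delta> \<longrightarrow>
        measure M {\<omega>\<in>space M. \<bar>elem_integral n u f X t \<omega>\<bar> > \<epsilon>} \<le> \<epsilon>)"

text \<open>
  \<open>unif_small M Z t \<epsilon>\<close> means \<open>P(sup\<^bsub>s \<le> t\<^esub> |Z\<^sub>s| > \<epsilon>) \<le> \<epsilon>\<close>; the covering set \<open>A\<close> makes
  it independent of the measurability of the supremum.
\<close>

definition unif_small :: "'a measure \<Rightarrow> (real \<Rightarrow> 'a \<Rightarrow> real) \<Rightarrow> real \<Rightarrow> real \<Rightarrow> bool" where
  "unif_small M Z t \<epsilon> \<longleftrightarrow>
     (\<exists>A\<in>sets M. measure M A \<le> \<epsilon> \<and> (\<forall>\<omega>\<in>space M - A. \<forall>s\<in>{0..t}. \<bar>Z s \<omega>\<bar> \<le> \<epsilon>))"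

definition ucp_tendsto :: "'a measure \<Rightarrow> (nat \<Rightarrow> real \<Rightarrow> 'a \<Rightarrow> real) \<Rightarrow> (real \<Rightarrow> 'a \<Rightarrow> real) \<Rightarrow> bool" where
  "ucp_tendsto M Y Z \<longleftrightarrow>
     (\<forall>t\<ge>0. \<forall>\<epsilon>>0. \<forall>\<^sub>F n in sequentially. unif_small M (\<lambda>s \<omega>. Y n s \<omega> - Z s \<omega>) t \<epsilon>)"

text \<open>Convergence in the Emery (semimartingale) topology.\<close>

definition emery_tendsto ::
    "'a measure \<Rightarrow> (real \<Rightarrow> 'a measure) \<Rightarrow> (nat \<Rightarrow> real \<Rightarrow> 'a \<Rightarrow> real) \<Rightarrow> (real \<Rightarrow> 'a \<Rightarrow> real) \<Rightarrow> bool" where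
  "emery_tendsto M K Y Z \<longleftrightarrow> ucp_tendsto M Y Z \<and>
     (\<forall>t\<ge>0. \<forall>\<epsilon>>0. \<forall>\<^sub>F k in sequentially. \<forall>g n u f.
        elementary M K g n u f \<and> bounded_by M (elem_process g n u f) 1 \<longrightarrow>
        unif_small M (elem_integral n u f (\<lambda>s \<omega>. Y k s \<omega> - Z s \<omega>)) t \<epsilon>)"

text \<open>
  The integral of bounded predictable integrands, as the least extension of the elementary
  integral that is closed under bounded pointwise convergence of integrands with ucp convergence
  of integrals.  For a semimartingale \<open>X\<close> (and a filtration containing the null sets) the monotone
  class theorem and the dominated convergence theorem for stochastic integrals show that every
  bounded predictable \<open>H\<close> is related to exactly one \<open>Y\<close> up to indistinguishability, namely
  \<open>H \<cdot> X\<close>.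
\<close>

inductive bounded_integral ::
    "'a measure \<Rightarrow> (real \<Rightarrow> 'a measure) \<Rightarrow> (real \<Rightarrow> 'a \<Rightarrow> real) \<Rightarrow>
     (real \<Rightarrow> 'a \<Rightarrow> real) \<Rightarrow> (real \<Rightarrow> 'a \<Rightarrow> real) \<Rightarrow> bool"
  for M K X where
  elem: "elementary M K g n u f \<Longrightarrow>
     bounded_integral M K X (elem_process g n u f) (elem_integral n u f X)"
| lim: "(\<And>k. bounded_integral M K X (H k) (Y k)) \<Longrightarrow> (\<And>k. bounded_by M (H k) C) \<Longrightarrow>
     (\<And>t \<omega>. t \<ge> 0 \<Longrightarrow> \<omega> \<in> space M \<Longrightarrow> (\<lambda>k. H k t \<omega>) \<longlonglongrightarrow> H' t \<omega>) \<Longrightarrow>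
     ucp_tendsto M Y Y' \<Longrightarrow> bounded_integral M K X H' Y'"

text \<open>
  \<open>stoch_integral M K X \<theta> Y\<close>: the predictable process \<open>\<theta>\<close> is integrable with respect to the
  \<open>K\<close>-semimartingale \<open>X\<close> and \<open>Y\<close> is a version of \<open>\<theta> \<cdot> X\<close>.  For unbounded \<open>\<theta>\<close> this is the
  definition through convergence of the integrals of \<open>\<theta> 1\<^bsub>{|\<theta>| \<le> k}\<^esub>\<close> in the Emery topology
  (Chou, Meyer and Stricker).
\<close>

definition stoch_integral ::
    "'a measure \<Rightarrow> (real \<Rightarrow> 'a measure) \<Rightarrow> (real \<Rightarrow> 'a \<Rightarrow> real) \<Rightarrow>
     (real \<Rightarrow> 'a \<Rightarrow> real) \<Rightarrow> (real \<Rightarrow> 'a \<Rightarrow> real) \<Rightarrow> bool" where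
  "stoch_integral M K X \<theta> Y \<longleftrightarrow>
     semimartingale M K X \<and> predictable M K \<theta> \<and> adapted K Y \<and> cadlag_paths M Y \<and>
     (\<exists>Z. (\<forall>k. bounded_integral M K X
                 (\<lambda>t \<omega>. if \<bar>\<theta> t \<omega>\<bar> \<le> real k then \<theta> t \<omega> else 0) (Z k)) \<and>
          emery_tendsto M K Z Y)"

section \<open>Classical arbitrage\<close>

text \<open>\<open>Y\<close> is the wealth process \<open>\<theta> \<cdot> X\<close>.\<close>

definition admissible ::
    "'a measure \<Rightarrow> (real \<Rightarrow> 'a measure) \<Rightarrow> (real \<Rightarrow> 'a \<Rightarrow> real) \<Rightarrow>
     (real \<Rightarrow> 'a \<Rightarrow> real) \<Rightarrow> (real \<Rightarrow> 'a \<Rightarrow> real) \<Rightarrow> bool" where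
  "admissible M K X \<theta> Y \<longleftrightarrow> stoch_integral M K X \<theta> Y \<and>
     (\<exists>c\<ge>0. \<forall>t\<ge>0. AE \<omega> in M. Y t \<omega> \<ge> - c) \<and>
     (AE \<omega> in M. \<exists>l::real. ((\<lambda>t. Y t \<omega>) \<longlongrightarrow> l) at_top)"

definition classical_arbitrage ::
    "'a measure \<Rightarrow> (real \<Rightarrow> 'a measure) \<Rightarrow> (real \<Rightarrow> 'a \<Rightarrow> real) \<Rightarrow> (real \<Rightarrow> 'a \<Rightarrow> real) \<Rightarrow> bool" where
  "classical_arbitrage M K X \<theta> \<longleftrightarrow> (\<exists>Y. admissible M K X \<theta> Y \<and>
     (AE \<omega> in M. Lim at_top (\<lambda>t. Y t \<omega>) \<ge> 0) \<and>
     measure M {\<omega>\<in>space M. Lim at_top (\<lambda>t. Y t \<omega>) > 0} > 0)"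

text \<open>
  The price process of a market is a semimartingale; without that conjunct \<open>NA\<close> would hold
  vacuously for other processes, since then no integrand is integrable.
\<close>

definition NA :: "'a measure \<Rightarrow> (real \<Rightarrow> 'a measure) \<Rightarrow> (real \<Rightarrow> 'a \<Rightarrow> real) \<Rightarrow> bool" where
  "NA M K X \<longleftrightarrow> semimartingale M K X \<and> \<not> (\<exists>\<theta>. classical_arbitrage M K X \<theta>)"

section \<open>The market\<close>

text \<open>\<open>dS\<^sub>t = \<sigma> S\<^sub>t dW\<^sub>t\<close> with initial value \<open>S0\<close>, in integral form.\<close>

definition solves_black_scholes ::
    "'a measure \<Rightarrow> (real \<Rightarrow> 'a measure) \<Rightarrow> (real \<Rightarrow> 'a \<Rightarrow> real) \<Rightarrow> real \<Rightarrow> real \<Rightarrow> (real \<Rightarrow> 'a \<Rightarrow> real) \<Rightarrow> bool" where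
  "solves_black_scholes M F W \<sigma> S0 S \<longleftrightarrow>
     adapted F S \<and> continuous_paths M S \<and> (AE \<omega> in M. S 0 \<omega> = S0) \<and>
     stoch_integral M F W (\<lambda>t \<omega>. \<sigma> * S t \<omega>) (\<lambda>t \<omega>. S t \<omega> - S0)"

text \<open>Here \<open>sup \<emptyset> = 0\<close>, whereas \<open>Sup {}\<close> is unspecified on \<open>real\<close>.\<close>

definition last_half_time :: "(real \<Rightarrow> 'a \<Rightarrow> real) \<Rightarrow> 'a \<Rightarrow> real" where
  "last_half_time S \<omega> =
     (let T = {t. 0 \<le> t \<and> t \<le> 1 \<and> S 1 \<omega> - 2 * S t \<omega> = 0} in if T = {} then 0 else Sup T)"

end

theory Submission
  imports Defs
begin

text \<open>
  The proof uses the multiplicative structure of the price.  Up to indistinguishability \<open>S\<close> is \<open>S0\<close>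
  times the exponential martingale of \<open>\<sigma> W\<close> (\<open>black_scholes_unique\<close>), so quotients of prices are
  functions of increments of the Brownian motion.

  There is no arbitrage before \<open>\<tau>\<close> for the following reason.  The event \<open>w \<le> \<tau>\<close> says that \<open>S 1 = 2 S s\<close> for some \<open>s\<close> between \<open>w\<close> and 1; after division
  by \<open>S w\<close> it depends on the increments after \<open>w\<close> only and is therefore independent of the past of
  \<open>w\<close> (\<open>half_time_future\<close>).  Hence \<open>\<tau>\<close> is a pseudo-stopping time, and a martingale of the Brownian
  filtration stopped at \<open>\<tau>\<close> is a martingale of the enlarged filtration: approximate it by sums over
  the grid cells whose right end lies before \<open>\<tau>\<close>, and use that the restriction to these cells is
  independent of the increments over them (\<open>stopped_martingale\<close>).  In a market with a continuous
  square integrable martingale as price there is no arbitrage: the wealth of an admissible strategy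
  is a local martingale that is bounded below, so its terminal value has expectation at most 0
  (\<open>continuous_martingale_NA\<close>).

  The arbitrage after \<open>\<tau>\<close> is explicit.  On the event that \<open>\<tau>\<close> is positive, \<open>S 1 = 2 S \<tau>\<close>, and between \<open>\<tau>\<close> and 1 the price cannot
  fall below \<open>S \<tau>\<close>, since it would have to pass through half of its final value again.  Buying at
  \<open>\<tau>\<close> and selling at 1 thus never leads below 0 and ends with the gain \<open>S \<tau> > 0\<close>.  As \<open>S - stopped S \<tau>\<close>
  is 0 up to \<open>\<tau>\<close>, this is the elementary strategy that holds one unit during \<open>(0, 1]\<close> on the event
  \<open>\<tau> > 0\<close>, and this event has positive probability because \<open>S 1 > 2 S 0\<close> does
  (\<open>arbitrage_after\<close>).

  That \<open>S - stopped S \<tau>\<close> is a semimartingale of the enlarged filtration takes the most work.  On the event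
  \<open>\<tau> \<le> u\<close> the value of \<open>\<tau>\<close> can be computed from the path up to \<open>u\<close> and the value \<open>S 1\<close>, so that after \<open>\<tau>\<close>
  the coefficients of an elementary integrand may be taken measurable for the filtration that knows
  the terminal value \<open>W 1\<close>.  In that filtration the increments of \<open>S\<close> are martingale differences up
  to a compensator, the drift of a Brownian bridge in disguise, which is summable although it is
  singular at time 1 (\<open>compensator_moments\<close>).  Doob's inequality bounds the elementary integrals in
  probability, uniformly in the starting index (\<open>tail_bound\<close>), and the single grid cell that contains
  \<open>\<tau>\<close> contributes a bounded multiple of the maximal price (\<open>after_straddle\<close>).

  General stochastic integrals enter only through the closure of elementary integrals under ucp
  limits.  The two facts needed about them, the local martingale property and the Ito isometry in
  the proof of uniqueness, are therefore formulated at bounded stopping times up to which the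
  integral is bounded, where they pass to ucp limits by localisation (\<open>ucp_localize\<close>).
\<close>

section \<open>Sub-sigma-algebras containing the null sets\<close>

text \<open>
  Paths are continuous only almost surely, and the enlarged filtration is compared with other
  \<open>\<sigma>\<close>-algebras only up to null events.  Over a complete measure a sub-\<open>\<sigma>\<close>-algebra that contains
  the null sets absorbs all such exceptions.
\<close>

definition full_subalgebra :: "'a measure \<Rightarrow> 'a measure \<Rightarrow> bool" where
  "full_subalgebra M N \<longleftrightarrow> subalgebra M N \<and> null_sets M \<subseteq> sets N"

lemma full_subalgebraD:
  assumes "full_subalgebra M N"
  shows "space N = space M" "sets N \<subseteq> sets M" "null_sets M \<subseteq> sets N" "subalgebra M N"
  using assms by (auto simp: full_subalgebra_def subalgebra_def)

lemma (in complete_measure) null_sets_subset: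
  assumes "B \<in> null_sets M" "A \<subseteq> B" shows "A \<in> null_sets M"
  using assms complete2 by blast

lemma (in complete_measure) full_subalgebra_AE_cong:
  fixes f g :: "'a \<Rightarrow> 'b::topological_space"
  assumes N: "full_subalgebra M N" and f: "f \<in> borel_measurable N"
    and ae: "AE x in M. f x = g x"
  shows "g \<in> borel_measurable N"
proof (rule measurableI)
  note [simp] = full_subalgebraD(1)[OF N]
  obtain n where n: "{x \<in> space M. f x \<noteq> g x} \<subseteq> n" "n \<in> null_sets M"
    using ae by (auto elim!: AE_E simp: null_sets_def)
  fix B :: "'b set" assume B: "B \<in> sets borel"
  have "g -` B \<inter> space N = ((f -` B \<inter> space N) - n) \<union> (g -` B \<inter> space M \<inter> n)"
    using n(1) by auto
  moreover have "f -` B \<inter> space N \<in> sets N" using f B by (rule measurable_sets)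
  moreover have "n \<in> sets N" using n full_subalgebraD(3)[OF N] by auto
  moreover have "g -` B \<inter> space M \<inter> n \<in> sets N"
    using null_sets_subset[OF n(2), of "g -` B \<inter> space M \<inter> n"] full_subalgebraD(3)[OF N] by auto
  ultimately show "g -` B \<inter> space N \<in> sets N" by (metis sets.Diff sets.Un)
qed simp

lemma (in complete_measure) full_subalgebra_AE_sets:
  assumes N: "full_subalgebra M N" and A: "A \<in> sets N" and B: "B \<subseteq> space M"
    and ae: "AE x in M. x \<in> A \<longleftrightarrow> x \<in> B"
  shows "B \<in> sets N"
proof -
  have sp: "space N = space M" using full_subalgebraD(1)[OF N] .
  have "(indicator B :: 'a \<Rightarrow> real) \<in> borel_measurable N"
    by (rule full_subalgebra_AE_cong[OF N, where f="indicator A"])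
      (use A ae in \<open>auto simp: indicator_def\<close>)
  then show ?thesis
    using B sp by (simp add: borel_measurable_indicator_iff Int_absorb2)
qed

lemma (in complete_measure) full_subalgebra_AE_lim:
  fixes f :: "nat \<Rightarrow> 'a \<Rightarrow> real"
  assumes N: "full_subalgebra M N" and f: "\<And>n. f n \<in> borel_measurable N"
    and ae: "AE x in M. (\<lambda>n. f n x) \<longlonglongrightarrow> g x"
  shows "g \<in> borel_measurable N"
proof (rule full_subalgebra_AE_cong[OF N])
  show "(\<lambda>x. lim (\<lambda>n. f n x)) \<in> borel_measurable N"
    by (rule borel_measurable_lim_metric) (rule f)
  show "AE x in M. lim (\<lambda>n. f n x) = g x" using ae by eventually_elim (rule limI)
qed

lemma full_subalgebra_self: "full_subalgebra M M"
  by (auto simp: full_subalgebra_def subalgebra_def)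

text \<open>
  Martingale properties below are stated against indicators of past events; this passes to
  arbitrary past-measurable weights, because the hypothesis says that the conditional expectation
  of \<open>D\<close> is zero.
\<close>

lemma integral_sub_test:
  fixes D g :: "'a \<Rightarrow> real"
  assumes "finite_measure M" and N: "subalgebra M N" and D: "integrable M D"
    and zero: "\<And>A. A \<in> sets N \<Longrightarrow> (\<integral>x. indicator A x * D x \<partial>M) = 0"
    and g: "g \<in> borel_measurable N" and gD: "integrable M (\<lambda>x. g x * D x)"
  shows "(\<integral>x. g x * D x \<partial>M) = 0"
proof -
  interpret finite_measure M by fact
  interpret finite_measure_subalgebra M N by unfold_locales (rule N)
  have "AE x in M. real_cond_exp M N D x = 0"
    by (rule real_cond_exp_charact) (use D zero in \<open>auto simp: set_lebesgue_integral_def\<close>)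
  then have "(\<integral>x. g x * real_cond_exp M N D x \<partial>M) = (\<integral>x. 0 \<partial>M)"
    by (intro integral_cong_AE) (use N g in \<open>auto intro!: borel_measurable_times measurable_from_subalg[OF N]\<close>)
  moreover have "(\<integral>x. g x * real_cond_exp M N D x \<partial>M) = (\<integral>x. g x * D x \<partial>M)"
    using gD g D by (intro real_cond_exp_intg) auto
  ultimately show ?thesis by simp
qed

lemma rational_dense_near:
  fixes s a b e :: real
  assumes "a \<le> s" "s \<le> b" "e > 0"
  obtains q where "q \<in> insert a (\<rat> \<inter> {a..b})" "\<bar>q - s\<bar> < e"
proof (cases "s = a")
  case True then show ?thesis using that[of a] assms by auto
next
  case False
  then have "max a (s - e) < s" using assms by auto
  from Rats_dense_in_real[OF this] obtain q where "q \<in> \<rat>" "max a (s - e) < q" "q < s" by auto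
  then show ?thesis using that[of q] assms by auto
qed

text \<open>
  By compactness a continuous function on an interval has a zero iff it is arbitrarily small on
  the countable set of rational points (together with the left end point, in case the interval is
  a single point).  This makes the existence of a zero of a continuous process an event of any
  \<open>\<sigma>\<close>-algebra for which the process is measurable at each time.
\<close>

lemma zero_exists_iff_rational:
  fixes z :: "real \<Rightarrow> real"
  assumes c: "continuous_on {a..b} z" and ab: "a \<le> b"
  shows "(\<exists>s\<in>{a..b}. z s = 0) \<longleftrightarrow> (\<forall>n. \<exists>q\<in>insert a (\<rat> \<inter> {a..b}). \<bar>z q\<bar> < inverse (real (Suc n)))"
    (is "_ \<longleftrightarrow> ?R")
proof
  assume "\<exists>s\<in>{a..b}. z s = 0"
  then obtain s where s: "s \<in> {a..b}" "z s = 0" by auto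
  show ?R
  proof
    fix n
    have "inverse (real (Suc n)) > 0" by simp
    then obtain d where d: "d > 0" "\<And>x. x \<in> {a..b} \<Longrightarrow> dist x s < d \<Longrightarrow> dist (z x) (z s) < inverse (real (Suc n))"
      using c s(1) unfolding continuous_on_iff by blast
    obtain q where q: "q \<in> insert a (\<rat> \<inter> {a..b})" "\<bar>q - s\<bar> < d"
      using rational_dense_near[of a s b d] s d by auto
    have "q \<in> {a..b}" using q ab by auto
    then have "\<bar>z q\<bar> < inverse (real (Suc n))" using d(2)[of q] q s(2) by (auto simp: dist_real_def)
    then show "\<exists>q\<in>insert a (\<rat> \<inter> {a..b}). \<bar>z q\<bar> < inverse (real (Suc n))" using q by blast
  qed
next
  assume R: ?R
  have "continuous_on {a..b} (\<lambda>s. \<bar>z s\<bar>)" using c by (intro continuous_intros)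
  then obtain s where s: "s \<in> {a..b}" "\<And>x. x \<in> {a..b} \<Longrightarrow> \<bar>z s\<bar> \<le> \<bar>z x\<bar>"
    using continuous_attains_inf[of "{a..b}" "\<lambda>s. \<bar>z s\<bar>"] ab by auto
  have "\<bar>z s\<bar> \<le> 0"
  proof (rule ccontr)
    assume "\<not> \<bar>z s\<bar> \<le> 0"
    then obtain n where n: "inverse (real (Suc n)) < \<bar>z s\<bar>" using reals_Archimedean[of "\<bar>z s\<bar>"] by auto
    obtain q where "q\<in>insert a (\<rat> \<inter> {a..b})" "\<bar>z q\<bar> < inverse (real (Suc n))" using R by blast
    moreover have "q \<in> {a..b}" using calculation ab by auto
    ultimately show False using s(2)[of q] n by auto
  qed
  then show "\<exists>s\<in>{a..b}. z s = 0" using s(1) by (intro bexI[of _ s]) auto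
qed

lemma zero_exists_sets:
  fixes Z :: "real \<Rightarrow> 'a \<Rightarrow> real"
  assumes Z: "\<And>s. s \<in> {a..b} \<Longrightarrow> Z s \<in> borel_measurable N" and ab: "a \<le> b"
    and c: "\<And>x. x \<in> space N \<Longrightarrow> continuous_on {a..b} (\<lambda>s. Z s x)"
  shows "{x \<in> space N. \<exists>s\<in>{a..b}. Z s x = 0} \<in> sets N"
proof -
  have "{x \<in> space N. \<exists>s\<in>{a..b}. Z s x = 0} =
    {x \<in> space N. \<forall>n. \<exists>q\<in>insert a (\<rat> \<inter> {a..b}). \<bar>Z q x\<bar> < inverse (real (Suc n))}"
    using zero_exists_iff_rational[OF c ab] by auto
  also have "\<dots> = (\<Inter>n. \<Union>q\<in>insert a (\<rat> \<inter> {a..b}). {x \<in> space N. \<bar>Z q x\<bar> < inverse (real (Suc n))})"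
    by auto
  also have "\<dots> \<in> sets N"
  proof -
    have ctbl: "countable (insert a (\<rat> \<inter> {a..b}))"
      by (intro countable_insert countable_Int1) (rule countable_rat)
    have "{x \<in> space N. \<bar>Z q x\<bar> < inverse (real (Suc n))} \<in> sets N"
      if "q \<in> insert a (\<rat> \<inter> {a..b})" for q and n :: nat
    proof -
      have [measurable]: "Z q \<in> borel_measurable N" using Z ab that by auto
      show ?thesis by measurable
    qed
    then have "(\<Union>q\<in>insert a (\<rat> \<inter> {a..b}). {x \<in> space N. \<bar>Z q x\<bar> < inverse (real (Suc n))}) \<in> sets N" for n
      by (intro sets.countable_UN'[OF ctbl]) auto
    then show ?thesis by (intro sets.countable_INT) auto
  qed
  finally show ?thesis .
qed

lemma (in complete_measure) zero_exists_sets_AE: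
  fixes Z :: "real \<Rightarrow> 'a \<Rightarrow> real"
  assumes N: "full_subalgebra M N"
    and Z: "\<And>s. s \<in> {a..b} \<Longrightarrow> Z s \<in> borel_measurable N" and ab: "a \<le> b"
    and c: "AE x in M. continuous_on {a..b} (\<lambda>s. Z s x)"
  shows "{x \<in> space M. \<exists>s\<in>{a..b}. Z s x = 0} \<in> sets N"
proof -
  obtain n where n: "{x \<in> space M. \<not> continuous_on {a..b} (\<lambda>s. Z s x)} \<subseteq> n" "n \<in> null_sets M"
    using c by (auto elim!: AE_E simp: null_sets_def)
  have nN: "n \<in> sets N" using n full_subalgebraD(3)[OF N] by auto
  have sp: "space N = space M" using full_subalgebraD(1)[OF N] .
  let ?Z = "\<lambda>s x. if x \<in> n then 0 else Z s x"
  have *: "{x \<in> space N. \<exists>s\<in>{a..b}. ?Z s x = 0} \<in> sets N"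
  proof (rule zero_exists_sets[OF _ ab])
    fix s assume "s \<in> {a..b}"
    with Z nN show "?Z s \<in> borel_measurable N"
      by (intro measurable_If_set) (auto simp: Int_absorb2 sets.Int_space_eq2)
  next
    fix x assume "x \<in> space N"
    then show "continuous_on {a..b} (\<lambda>s. ?Z s x)" using n(1) sp by (cases "x \<in> n") auto
  qed
  have "AE x in M. x \<notin> n" using n(2) by (rule AE_not_in)
  then have "AE x in M. (x \<in> {x \<in> space N. \<exists>s\<in>{a..b}. ?Z s x = 0}) = (x \<in> {x \<in> space M. \<exists>s\<in>{a..b}. Z s x = 0})"
    by eventually_elim (simp add: sp)
  with * show ?thesis by (intro full_subalgebra_AE_sets[OF N *]) auto
qed

section \<open>Filtrations, stopping times and martingales\<close>

lemma continuous_halfline_bounded: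
  fixes f :: "real \<Rightarrow> real"
  assumes "continuous_on {0..} f"
  shows "\<exists>m. \<forall>s\<in>{0..N}. \<bar>f s\<bar> < real m"
proof -
  have "compact (f ` {0..N})" by (rule compact_continuous_image) (rule continuous_on_subset[OF assms], auto)
  then have "bounded (f ` {0..N})" by (rule compact_imp_bounded)
  then have "\<exists>D. \<forall>s\<in>{0..N}. \<bar>f s\<bar> \<le> D" unfolding bounded_iff by auto
  then obtain D where D: "\<And>s. s \<in> {0..N} \<Longrightarrow> \<bar>f s\<bar> \<le> D" by blast
  obtain m :: nat where m: "D < real m" using reals_Archimedean2 by blast
  have "\<bar>f s\<bar> < real m" if "s \<in> {0..N}" for s using D[OF that] m by linarith
  then show ?thesis by blast
qed

lemma floor_approximation:
  fixes t :: real assumes "0 \<le> t"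
  shows "(\<lambda>n. real (nat \<lfloor>real (Suc n) * t\<rfloor>) / real (Suc n)) \<longlonglongrightarrow> t"
proof (rule LIMSEQ_I)
  fix r :: real assume "r > 0"
  then obtain n0 where n0: "inverse (real (Suc n0)) < r" using reals_Archimedean by auto
  show "\<exists>no. \<forall>n\<ge>no. norm (real (nat \<lfloor>real (Suc n) * t\<rfloor>) / real (Suc n) - t) < r"
  proof (intro exI[of _ n0] allI impI)
    fix n assume "n \<ge> n0"
    have p: "real (Suc n) > 0" by simp
    have t: "0 \<le> real (Suc n) * t" using assms by simp
    let ?g = "nat \<lfloor>real (Suc n) * t\<rfloor>"
    have "real ?g \<le> real (Suc n) * t" "real (Suc n) * t < real ?g + 1"
      using t by (simp_all only: of_nat_floor) linarith
    then have "real ?g / real (Suc n) \<le> t" "t < real ?g / real (Suc n) + 1 / real (Suc n)"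
      using p by (simp_all add: field_simps)
    moreover have "1 / real (Suc n) \<le> inverse (real (Suc n0))" using \<open>n \<ge> n0\<close> by (simp add: field_simps)
    ultimately show "norm (real ?g / real (Suc n) - t) < r" using n0 by simp
  qed
qed

locale filtered_space = prob_space M + complete_measure M for M :: "'a measure" +
  fixes K :: "real \<Rightarrow> 'a measure"
  assumes filt_full: "t \<ge> 0 \<Longrightarrow> full_subalgebra M (K t)"
    and filt_mono: "0 \<le> s \<Longrightarrow> s \<le> t \<Longrightarrow> sets (K s) \<subseteq> sets (K t)"
begin

lemmas filt_space[simp] = full_subalgebraD(1)[OF filt_full]
lemmas filt_sub = full_subalgebraD(4)[OF filt_full]

lemma filt_measurable_mono:
  "0 \<le> s \<Longrightarrow> s \<le> t \<Longrightarrow> f \<in> borel_measurable (K s) \<Longrightarrow> f \<in> borel_measurable (K t)"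
  using filt_mono[of s t] by (auto simp: measurable_def)

lemma filt_measurable: "0 \<le> s \<Longrightarrow> f \<in> borel_measurable (K s) \<Longrightarrow> f \<in> borel_measurable M"
  using measurable_from_subalg[OF filt_sub] .

text \<open>
  The martingale property as orthogonality of increments to past events.  Adaptedness is a
  separate hypothesis, since for a process stopped at a random time the two are proved by
  different arguments.
\<close>

definition martingale :: "(real \<Rightarrow> 'a \<Rightarrow> real) \<Rightarrow> bool" where
  "martingale X \<longleftrightarrow> (\<forall>t\<ge>0. integrable M (X t)) \<and>
     (\<forall>s t A. 0 \<le> s \<longrightarrow> s \<le> t \<longrightarrow> A \<in> sets (K s) \<longrightarrow> (\<integral>x. indicator A x * (X t x - X s x) \<partial>M) = 0)"

lemma martingaleD:
  assumes "martingale X"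
  shows "t \<ge> 0 \<Longrightarrow> integrable M (X t)"
    and "0 \<le> s \<Longrightarrow> s \<le> t \<Longrightarrow> A \<in> sets (K s) \<Longrightarrow> (\<integral>x. indicator A x * (X t x - X s x) \<partial>M) = 0"
  using assms by (auto simp: martingale_def)

lemma martingale_test:
  assumes X: "martingale X" and st: "0 \<le> s" "s \<le> t" and g: "g \<in> borel_measurable (K s)"
    and i: "integrable M (\<lambda>x. g x * (X t x - X s x))"
  shows "(\<integral>x. g x * (X t x - X s x) \<partial>M) = 0"
  by (rule integral_sub_test[OF finite_measure_axioms filt_sub[of s]])
    (use assms martingaleD[OF X] in auto)

definition bounded_stopping_time :: "real \<Rightarrow> ('a \<Rightarrow> real) \<Rightarrow> bool" where
  "bounded_stopping_time N T \<longleftrightarrow> (\<forall>x\<in>space M. 0 \<le> T x \<and> T x \<le> N) \<and>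
     (\<forall>v\<ge>0. {x\<in>space M. T x \<le> v} \<in> sets (K v))"

lemma bounded_stopping_timeD:
  assumes "bounded_stopping_time N T"
  shows "x \<in> space M \<Longrightarrow> 0 \<le> T x" "x \<in> space M \<Longrightarrow> T x \<le> N" "v \<ge> 0 \<Longrightarrow> {x\<in>space M. T x \<le> v} \<in> sets (K v)"
  using assms by (auto simp: bounded_stopping_time_def)

lemma bounded_stopping_time_measurable:
  assumes T: "bounded_stopping_time N T" shows "T \<in> borel_measurable M"
proof (rule borel_measurableI_le)
  fix v show "{x \<in> space M. T x \<le> v} \<in> sets M"
  proof (cases "v \<ge> 0")
    case True
    then show ?thesis using bounded_stopping_timeD(3)[OF T True] full_subalgebraD(2)[OF filt_full[OF True]] by auto
  next
    case False
    then have "{x \<in> space M. T x \<le> v} = {}" using bounded_stopping_timeD(1)[OF T] by force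
    then show ?thesis by (simp only: sets.empty_sets)
  qed
qed

lemma bounded_stopping_time_gt:
  assumes T: "bounded_stopping_time N T" and v: "v \<ge> 0"
  shows "{x\<in>space M. v < T x} \<in> sets (K v)"
proof -
  have "{x\<in>space M. v < T x} = space (K v) - {x\<in>space M. T x \<le> v}" using v by auto
  then show ?thesis using bounded_stopping_timeD(3)[OF T v] by (metis sets.compl_sets)
qed

lemma bounded_stopping_time_const: "0 \<le> c \<Longrightarrow> bounded_stopping_time c (\<lambda>_. c)"
  unfolding bounded_stopping_time_def
proof (intro conjI ballI allI impI)
  fix v :: real assume c: "0 \<le> c" "0 \<le> v"
  have "{x \<in> space M. c \<le> v} = (if c \<le> v then space (K v) else {})" using c by auto
  then show "{x \<in> space M. c \<le> v} \<in> sets (K v)" by auto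
qed auto

lemma bounded_stopping_time_min:
  assumes "bounded_stopping_time N T" "bounded_stopping_time N' T'"
  shows "bounded_stopping_time N (\<lambda>x. min (T x) (T' x))"
  unfolding bounded_stopping_time_def
proof (intro conjI ballI allI impI)
  fix v :: real assume v: "0 \<le> v"
  have "{x \<in> space M. min (T x) (T' x) \<le> v} = {x \<in> space M. T x \<le> v} \<union> {x \<in> space M. T' x \<le> v}" by auto
  then show "{x \<in> space M. min (T x) (T' x) \<le> v} \<in> sets (K v)"
    using bounded_stopping_timeD(3)[OF assms(1) v] bounded_stopping_timeD(3)[OF assms(2) v]
    by (simp only: sets.Un)
next
  fix x assume x: "x \<in> space M"
  show "0 \<le> min (T x) (T' x)" using bounded_stopping_timeD(1)[OF assms(1) x] bounded_stopping_timeD(1)[OF assms(2) x] by simp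
  show "min (T x) (T' x) \<le> N" using bounded_stopping_timeD(2)[OF assms(1) x] by simp
qed

text \<open>
  The first time in \<open>[0, N]\<close> at which \<open>\<bar>Z\<bar>\<close> reaches the level \<open>a\<close>, and \<open>N\<close> if it never does: such
  times localise all arguments about continuous local martingales, and the cut-off keeps them
  bounded.
\<close>

definition hitting :: "real \<Rightarrow> real \<Rightarrow> (real \<Rightarrow> 'a \<Rightarrow> real) \<Rightarrow> 'a \<Rightarrow> real" where
  "hitting N a Z x = (if \<exists>s\<in>{0..N}. a \<le> \<bar>Z s x\<bar> then Inf {s\<in>{0..N}. a \<le> \<bar>Z s x\<bar>} else N)"

lemma hitting_bounds: "0 \<le> N \<Longrightarrow> 0 \<le> hitting N a Z x \<and> hitting N a Z x \<le> N"
proof -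
  assume N: "0 \<le> N"
  let ?H = "{s\<in>{0..N}. a \<le> \<bar>Z s x\<bar>}"
  show ?thesis
  proof (cases "?H = {}")
    case True then have "hitting N a Z x = N" by (auto simp: hitting_def)
    with N show ?thesis by simp
  next
    case False
    then have "hitting N a Z x = Inf ?H" by (auto simp: hitting_def)
    moreover have "0 \<le> Inf ?H" using False by (intro cInf_greatest) auto
    moreover obtain s where "s \<in> ?H" using False by blast
    then have "Inf ?H \<le> s" by (intro cInf_lower bdd_belowI[of _ 0]) auto
    ultimately show ?thesis using \<open>s \<in> ?H\<close> by auto
  qed
qed

lemma hitting_before: "s \<in> {0..N} \<Longrightarrow> s < hitting N a Z x \<Longrightarrow> \<bar>Z s x\<bar> < a"
proof (rule ccontr)
  assume s: "s \<in> {0..N}" "s < hitting N a Z x" "\<not> \<bar>Z s x\<bar> < a"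
  then have "\<exists>s\<in>{0..N}. a \<le> \<bar>Z s x\<bar>" by (intro bexI[of _ s]) auto
  then have "hitting N a Z x = Inf {s\<in>{0..N}. a \<le> \<bar>Z s x\<bar>}" by (simp add: hitting_def)
  moreover have "Inf {s\<in>{0..N}. a \<le> \<bar>Z s x\<bar>} \<le> s" using s by (intro cInf_lower bdd_belowI[of _ 0]) auto
  ultimately show False using s by auto
qed

lemma hitting_upto:
  assumes c: "continuous_on {0..} (\<lambda>s. Z s x)" and N: "0 \<le> N" and 0: "\<bar>Z 0 x\<bar> \<le> a"
    and s: "0 \<le> s" "s \<le> hitting N a Z x"
  shows "\<bar>Z s x\<bar> \<le> a"
proof (cases "s = 0")
  case True then show ?thesis using 0 by simp
next
  case False
  have sN: "s \<le> N" using hitting_bounds[OF N, of a Z x] s by simp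
  have "((\<lambda>r. \<bar>Z r x\<bar>) \<longlongrightarrow> \<bar>Z s x\<bar>) (at s within {0..})"
    using c s by (intro tendsto_rabs) (auto simp: continuous_on_def)
  then have l: "((\<lambda>r. \<bar>Z r x\<bar>) \<longlongrightarrow> \<bar>Z s x\<bar>) (at s within {0..<s})"
    by (rule tendsto_within_subset) auto
  have "s \<in> closure ({0..<s} - {s})" using False s by (simp add: closure_atLeastLessThan)
  then have nt: "at s within {0..<s} \<noteq> bot" by (simp add: at_within_eq_bot_iff)
  show ?thesis
  proof (rule tendsto_upperbound[OF l _ nt])
    show "\<forall>\<^sub>F i in at s within {0..<s}. \<bar>Z i x\<bar> \<le> a"
      unfolding eventually_at_filter
      using hitting_before[of _ N a Z x] s sN by (intro always_eventually) (force intro: less_imp_le)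
  qed
qed

text \<open>
  The level is reached at the infimum itself because the set of times at which \<open>\<bar>Z\<bar>\<close> is at least
  \<open>a\<close> is closed.  The event is phrased as the existence of a zero so that
  \<open>zero_exists_sets_AE\<close> applies.
\<close>

lemma hitting_le_iff:
  assumes c: "continuous_on {0..} (\<lambda>s. Z s x)" and v: "0 \<le> v" "v < N"
  shows "hitting N a Z x \<le> v \<longleftrightarrow> (\<exists>s\<in>{0..v}. max (a - \<bar>Z s x\<bar>) 0 = 0)"
proof
  assume "\<exists>s\<in>{0..v}. max (a - \<bar>Z s x\<bar>) 0 = 0"
  then obtain s where s: "s \<in> {0..v}" "a \<le> \<bar>Z s x\<bar>" by (auto simp: max_def split: if_splits)
  then show "hitting N a Z x \<le> v" using hitting_before[of s N a Z x] v by (force simp: not_less)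
next
  assume h: "hitting N a Z x \<le> v"
  let ?H = "{s\<in>{0..N}. a \<le> \<bar>Z s x\<bar>}"
  have ne: "?H \<noteq> {}" using h v by (auto simp: hitting_def split: if_splits)
  have cl: "closed ?H"
  proof -
    have "continuous_on {0..N} (\<lambda>s. \<bar>Z s x\<bar>)" using c by (intro continuous_intros) (auto elim: continuous_on_subset)
    then have "closed ({0..N} \<inter> (\<lambda>s. \<bar>Z s x\<bar>) -` {a..})" by (intro continuous_closed_preimage) auto
    moreover have "?H = {0..N} \<inter> (\<lambda>s. \<bar>Z s x\<bar>) -` {a..}" by auto
    ultimately show ?thesis by simp
  qed
  have "Inf ?H \<in> ?H" using ne cl by (intro closed_contains_Inf bdd_belowI[of _ 0]) auto
  moreover have "hitting N a Z x = Inf ?H" using ne by (auto simp: hitting_def)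
  ultimately show "\<exists>s\<in>{0..v}. max (a - \<bar>Z s x\<bar>) 0 = 0" using h by (intro bexI[of _ "hitting N a Z x"]) auto
qed

lemma hitting_eq_N: 
  assumes "\<And>s. s \<in> {0..N} \<Longrightarrow> \<bar>Z s x\<bar> < a" shows "hitting N a Z x = N"
  using assms by (force simp: hitting_def)

lemma hitting_stopping_time:
  assumes ad: "adapted K Z" and c: "continuous_paths M Z" and N: "0 \<le> N"
  shows "bounded_stopping_time N (hitting N a Z)"
  unfolding bounded_stopping_time_def
proof (intro conjI ballI allI impI)
  fix v :: real assume v: "0 \<le> v"
  show "{x \<in> space M. hitting N a Z x \<le> v} \<in> sets (K v)"
  proof (cases "v < N")
    case False
    then have "hitting N a Z x \<le> v" for x using hitting_bounds[OF N, of a Z x] by simp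
    then have "{x \<in> space M. hitting N a Z x \<le> v} = space (K v)" using v by simp
    then show ?thesis by simp
  next
    case True
    have m: "\<And>s. s \<in> {0..v} \<Longrightarrow> Z s \<in> borel_measurable (K v)"
      using ad v by (auto simp: adapted_def intro: filt_measurable_mono)
    have "{x \<in> space M. \<exists>s\<in>{0..v}. max (a - \<bar>Z s x\<bar>) 0 = 0} \<in> sets (K v)"
    proof (rule zero_exists_sets_AE[OF filt_full[OF v] _ v])
      show "(\<lambda>x. max (a - \<bar>Z s x\<bar>) 0) \<in> borel_measurable (K v)" if "s \<in> {0..v}" for s
        using m[OF that] by measurable
      show "AE x in M. continuous_on {0..v} (\<lambda>s. max (a - \<bar>Z s x\<bar>) 0)"
        using c unfolding continuous_paths_def
        by eventually_elim (intro continuous_intros, auto elim: continuous_on_subset)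
    qed
    then show ?thesis
    proof (rule full_subalgebra_AE_sets[OF filt_full[OF v]])
      show "AE x in M. (x \<in> {x \<in> space M. \<exists>s\<in>{0..v}. max (a - \<bar>Z s x\<bar>) 0 = 0}) = (x \<in> {x \<in> space M. hitting N a Z x \<le> v})"
        using c unfolding continuous_paths_def
      proof eventually_elim
        case (elim x)
        show ?case using hitting_le_iff[where Z=Z and a=a, OF elim v True] by simp
      qed
    qed auto
  qed
qed (use hitting_bounds[OF N] in auto)

lemma eval_measurable:
  assumes Y: "\<And>t. 0 \<le> t \<Longrightarrow> Y t \<in> borel_measurable M" and c: "continuous_paths M Y"
    and T: "T \<in> borel_measurable M" "\<And>x. x \<in> space M \<Longrightarrow> 0 \<le> T x"
  shows "(\<lambda>x. Y (T x) x) \<in> borel_measurable M"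
proof (rule full_subalgebra_AE_lim[OF full_subalgebra_self])
  define g where "g n x = nat \<lfloor>real (Suc n) * T x\<rfloor>" for n x
  show "(\<lambda>x. Y (real (g n x) / real (Suc n)) x) \<in> borel_measurable M" for n
  proof (rule measurable_compose_countable[where f="\<lambda>i x. Y (real i / real (Suc n)) x" and g="g n"])
    show "Y (real i / real (Suc n)) \<in> borel_measurable M" for i by (intro Y) auto
    show "g n \<in> measurable M (count_space UNIV)" unfolding g_def using T(1) by measurable
  qed
  show "AE x in M. (\<lambda>n. Y (real (g n x) / real (Suc n)) x) \<longlonglongrightarrow> Y (T x) x"
    using c AE_space unfolding continuous_paths_def
  proof eventually_elim
    fix x assume cx: "continuous_on {0..} (\<lambda>t. Y t x)" and x: "x \<in> space M"
    have "(\<lambda>n. real (g n x) / real (Suc n)) \<longlonglongrightarrow> T x"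
      unfolding g_def by (rule floor_approximation[OF T(2)[OF x]])
    then show "(\<lambda>n. Y (real (g n x) / real (Suc n)) x) \<longlonglongrightarrow> Y (T x) x"
      by (intro continuous_on_tendsto_compose[OF cx]) (use T(2)[OF x] in auto)
  qed
qed

end

text \<open>
  The passage from a grid to a random time.  A property \<open>P n\<close> of the grid cells which holds up to
  the cell of \<open>c\<close> and fails afterwards selects an initial segment of cells, so the sum of the
  increments of \<open>z\<close> over the selected cells telescopes to \<open>z w - z u\<close> with a grid point \<open>w\<close> within
  one mesh width of \<open>c\<close>.  For a stopping time the cells are selected by an event known at their
  left end, for a pseudo-stopping time by an event of the future of their right end.
\<close>

lemma grid_sum_limit:
  fixes z :: "real \<Rightarrow> real" and P :: "nat \<Rightarrow> nat \<Rightarrow> bool"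
  assumes z: "continuous_on {u..v} z" and c: "c \<in> {u..v}"
    and g_def: "\<And>n j. g n j = u + (v - u) * real j / real (Suc n)"
    and down: "\<And>n i j. i \<le> j \<Longrightarrow> j < Suc n \<Longrightarrow> P n j \<Longrightarrow> P n i"
    and P1: "\<And>n j. j < Suc n \<Longrightarrow> P n j \<Longrightarrow> g n j \<le> c"
    and P2: "\<And>n j. j < Suc n \<Longrightarrow> \<not> P n j \<Longrightarrow> c \<le> g n (Suc j)"
  shows "(\<lambda>n. \<Sum>j<Suc n. of_bool (P n j) * (z (g n (Suc j)) - z (g n j))) \<longlonglongrightarrow> z c - z u"
    and "\<exists>w\<in>{u..v}. (\<Sum>j<Suc n. of_bool (P n j) * (z (g n (Suc j)) - z (g n j))) = z w - z u"
proof -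
  have uv: "u \<le> v" using c by auto
  define m where "m n = card {j. j < Suc n \<and> P n j}" for n
  have set: "{j. j < Suc n \<and> P n j} = {..<m n}" for n
  proof -
    let ?J = "{j. j < Suc n \<and> P n j}"
    have fin: "finite ?J" by auto
    have "\<exists>k. ?J = {..<k}"
    proof (cases "?J = {}")
      case True then show ?thesis by auto
    next
      case False
      let ?k = "Suc (Max ?J)"
      have "?J = {..<?k}"
      proof
        show "?J \<subseteq> {..<?k}" using Max_ge[OF fin] by (auto simp: less_Suc_eq_le)
        have "Max ?J \<in> ?J" using Max_in[OF fin False] .
        then have M: "Max ?J < Suc n" "P n (Max ?J)" by blast+
        show "{..<?k} \<subseteq> ?J"
        proof
          fix i assume "i \<in> {..<?k}"
          then have "i \<le> Max ?J" by simp
          then show "i \<in> ?J" using down[of i "Max ?J" n] M by simp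
        qed
      qed
      then show ?thesis by auto
    qed
    then obtain k where k: "?J = {..<k}" by auto
    have "m n = k" unfolding m_def k by simp
    then show ?thesis using k by simp
  qed
  have mle: "m n \<le> Suc n" for n
  proof -
    have "card {j. j < Suc n \<and> P n j} \<le> card {..<Suc n}" by (intro card_mono) auto
    then show ?thesis by (simp add: m_def)
  qed
  have gin: "g n j \<in> {u..v}" if "j \<le> Suc n" for n j
  proof -
    have "0 \<le> real j / real (Suc n)" "real j / real (Suc n) \<le> 1" using that by (auto simp: field_simps)
    then have "0 \<le> (v - u) * (real j / real (Suc n))" "(v - u) * (real j / real (Suc n)) \<le> v - u"
      using uv by (simp, intro mult_left_le) auto
    then show ?thesis by (auto simp: g_def)
  qed
  have sum: "(\<Sum>j<Suc n. of_bool (P n j) * (z (g n (Suc j)) - z (g n j))) = z (g n (m n)) - z u" for n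
  proof -
    have "(\<Sum>j<Suc n. of_bool (P n j) * (z (g n (Suc j)) - z (g n j))) =
       (\<Sum>j\<in>{j. j < Suc n \<and> P n j}. z (g n (Suc j)) - z (g n j))"
      by (intro sum.mono_neutral_cong_right) auto
    also have "\<dots> = z (g n (m n)) - z (g n 0)" unfolding set by (rule sum_lessThan_telescope)
    finally show ?thesis by (simp add: g_def)
  qed
  have step: "g n (Suc j) = g n j + (v - u) / real (Suc n)" for n j
  proof -
    have "(v - u) * real (Suc j) = (v - u) * real j + (v - u)" by (simp add: algebra_simps)
    then show ?thesis by (simp only: g_def add_divide_distrib add.assoc)
  qed
  have near: "\<bar>g n (m n) - c\<bar> \<le> (v - u) / real (Suc n)" for n
  proof -
    have h: "0 \<le> (v - u) / real (Suc n)" using uv by simp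
    have "g n (m n) \<le> c + (v - u) / real (Suc n)"
    proof (cases "m n")
      case 0
      then have "g n (m n) = u" by (simp add: g_def)
      then show ?thesis using c h by (simp only: atLeastAtMost_iff) linarith
    next
      case (Suc k)
      then have "k \<in> {j. j < Suc n \<and> P n j}" unfolding set by auto
      then show ?thesis using P1[of k n] step[of n k] Suc by auto
    qed
    moreover have "c \<le> g n (m n) + (v - u) / real (Suc n)"
    proof (cases "m n < Suc n")
      case True
      have "m n \<notin> {j. j < Suc n \<and> P n j}" unfolding set by auto
      then show ?thesis using P2[of "m n" n] step[of n "m n"] True by auto
    next
      case False
      then have "m n = Suc n" using mle[of n] by auto
      then have "g n (m n) = v" by (simp add: g_def del: of_nat_Suc)
      then show ?thesis using c h by (simp only: atLeastAtMost_iff) linarith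
    qed
    ultimately show ?thesis by linarith
  qed
  have "(\<lambda>n. g n (m n) - c) \<longlonglongrightarrow> 0"
  proof (rule Lim_null_comparison[of _ "\<lambda>n. (v - u) / real (Suc n)"])
    show "\<forall>\<^sub>F x in sequentially. norm (g x (m x) - c) \<le> (v - u) / real (Suc x)" using near by auto
    show "(\<lambda>x. (v - u) / real (Suc x)) \<longlonglongrightarrow> 0"
      using tendsto_mult_right_zero[OF LIMSEQ_inverse_real_of_nat, of "v - u"] by (simp add: divide_inverse)
  qed
  then have "(\<lambda>n. g n (m n)) \<longlonglongrightarrow> c" by (simp add: LIM_zero_iff)
  then have "(\<lambda>n. z (g n (m n))) \<longlonglongrightarrow> z c"
    by (intro continuous_on_tendsto_compose[OF z]) (use c gin mle in auto)
  then show "(\<lambda>n. \<Sum>j<Suc n. of_bool (P n j) * (z (g n (Suc j)) - z (g n j))) \<longlonglongrightarrow> z c - z u"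
    unfolding sum by (intro tendsto_intros)
  show "\<exists>w\<in>{u..v}. (\<Sum>j<Suc n. of_bool (P n j) * (z (g n (Suc j)) - z (g n j))) = z w - z u"
    unfolding sum using gin[OF mle] by blast
qed

definition dominated :: "'a measure \<Rightarrow> (real \<Rightarrow> 'a \<Rightarrow> real) \<Rightarrow> bool" where
  "dominated M X \<longleftrightarrow> (\<forall>N. \<exists>Z. integrable M Z \<and> (AE x in M. \<forall>s\<in>{0..N}. \<bar>X s x\<bar> \<le> Z x))"

lemma dominated_integrable:
  assumes "dominated M X" "X t \<in> borel_measurable M" "0 \<le> t" shows "integrable M (X t)"
proof -
  obtain Z where Z: "integrable M Z" "AE x in M. \<forall>s\<in>{0..t}. \<bar>X s x\<bar> \<le> Z x"
    using assms(1) unfolding dominated_def by blast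
  show ?thesis
  proof (rule Bochner_Integration.integrable_bound[OF Z(1) assms(2)])
    show "AE x in M. norm (X t x) \<le> norm (Z x)"
      using Z(2)
    proof eventually_elim
      case (elim x)
      then have "\<bar>X t x\<bar> \<le> Z x" using assms(3) by simp
      then show ?case by simp
    qed
  qed
qed

context filtered_space begin

text \<open>
  The stopped increment is the limit of the grid sums of \<open>X\<close> over the cells whose left end lies
  before \<open>T\<close>.  Each term of such a sum has zero expectation against \<open>f\<close>, since being before \<open>T\<close>
  is known at the left end; the sums are increments of the path itself, so a dominating variable
  for \<open>X\<close> dominates them.
\<close>

lemma optional_stopping:
  assumes X: "martingale X" and c: "continuous_paths M X" and dom: "dominated M X"
    and T: "bounded_stopping_time N T" and st: "0 \<le> s" "s \<le> t"
    and f: "f \<in> borel_measurable (K s)" "\<And>x. x \<in> space M \<Longrightarrow> \<bar>f x\<bar> \<le> C"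
  shows "(\<integral>x. f x * (X (min (T x) t) x - X (min (T x) s) x) \<partial>M) = 0"
proof -
  obtain Z where Z: "integrable M Z" "AE x in M. \<forall>r\<in>{0..t}. \<bar>X r x\<bar> \<le> Z x"
    using dom unfolding dominated_def by blast
  define g where "g n j = s + (t - s) * real j / real (Suc n)" for n j
  have fM[measurable]: "f \<in> borel_measurable M" using filt_measurable[OF st(1) f(1)] .
  have XM[measurable]: "X r \<in> borel_measurable M" if "0 \<le> r" for r
    using martingaleD(1)[OF X that] by auto
  have TM[measurable]: "T \<in> borel_measurable M" using T by (rule bounded_stopping_time_measurable)
  have g0: "0 \<le> g n j" "s \<le> g n j" "g n j \<le> g n (Suc j)" for n j
    using st by (auto simp: g_def intro!: add_nonneg_nonneg divide_right_mono mult_left_mono)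
  have C0: "C \<ge> 0" 
    using f(2) not_empty by (meson abs_ge_zero order_trans ex_in_conv)
  define S where "S n x = (\<Sum>j<Suc n. of_bool (g n j < T x) * (X (g n (Suc j)) x - X (g n j) x))" for n x
  define L where "L x = X (min (T x) t) x - X (min (T x) s) x" for x
  have Smeas: "S n \<in> borel_measurable M" for n
    unfolding S_def using XM g0 by (intro borel_measurable_sum borel_measurable_times borel_measurable_diff) auto
  have Lm: "L \<in> borel_measurable M"
  proof -
    have "(\<lambda>x. X (min (T x) r) x) \<in> borel_measurable M" if r: "0 \<le> r" for r
    proof (rule eval_measurable[OF _ c])
      show "X t \<in> borel_measurable M" if "0 \<le> t" for t by (rule XM[OF that])
      show "0 \<le> min (T x) r" if "x \<in> space M" for x using bounded_stopping_timeD(1)[OF T that] r by simp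
    qed measurable
    then show ?thesis unfolding L_def using st by (intro borel_measurable_diff) auto
  qed
  have AEb: "AE x in M. (\<lambda>n. S n x) \<longlonglongrightarrow> L x \<and> (\<forall>n. \<bar>S n x\<bar> \<le> 2 * Z x)"
    using c Z(2) AE_space unfolding continuous_paths_def
  proof eventually_elim
    fix x assume cx: "continuous_on {0..} (\<lambda>t. X t x)" and Zx: "\<forall>r\<in>{0..t}. \<bar>X r x\<bar> \<le> Z x" and x: "x \<in> space M"
    define cc where "cc = max s (min (T x) t)"
    have cin: "cc \<in> {s..t}" using st by (auto simp: cc_def)
    have L: "L x = X cc x - X s x" unfolding L_def cc_def using st by (auto simp: max_def min_def)
    note gs = grid_sum_limit[of s t "\<lambda>r. X r x" cc g "\<lambda>n j. g n j < T x"]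
    have gg: "g n i \<le> g n j" if "i \<le> j" for n i j
      using that st unfolding g_def by (intro add_left_mono divide_right_mono mult_left_mono) auto
    have pre1: "continuous_on {s..t} (\<lambda>r. X r x)" and pre2: "cc \<in> {s..t}" and pre3: "\<And>n j. g n j = s + (t - s) * real j / real (Suc n)"
        and pre4: "\<And>n i j. i \<le> j \<Longrightarrow> j < Suc n \<Longrightarrow> g n j < T x \<Longrightarrow> g n i < T x"
        and pre5: "\<And>n j. j < Suc n \<Longrightarrow> g n j < T x \<Longrightarrow> g n j \<le> cc"
        and pre6: "\<And>n j. j < Suc n \<Longrightarrow> \<not> g n j < T x \<Longrightarrow> cc \<le> g n (Suc j)"
    proof -
      show "continuous_on {s..t} (\<lambda>r. X r x)" using cx st by (auto elim: continuous_on_subset)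
      show "g n i < T x" if "i \<le> j" "g n j < T x" for n i j using gg[OF that(1), of n] that by simp
      show "cc \<le> g n (Suc j)" if "\<not> g n j < T x" for n j
        unfolding cc_def using that g0(2)[of n "Suc j"] g0(3)[of n j] by auto
      show "g n j \<le> cc" if "j < Suc n" "g n j < T x" for n j
      proof -
        have "g n j \<le> g n (Suc n)" using that by (intro gg) auto
        then show ?thesis using that by (auto simp: cc_def g_def)
      qed
    qed (use cin g_def in auto)
    have "(\<lambda>n. S n x) \<longlonglongrightarrow> L x" unfolding S_def L by (rule gs(1)[OF pre1 pre2 pre3 pre4 pre5 pre6]; assumption)
    moreover have "\<bar>S n x\<bar> \<le> 2 * Z x" for n
    proof -
      have "\<exists>w\<in>{s..t}. S n x = X w x - X s x" unfolding S_def
        by (rule gs(2)[OF pre1 pre2 pre3 pre4 pre5 pre6]; assumption)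
      then obtain w where w: "w \<in> {s..t}" "S n x = X w x - X s x" by blast
      have "\<bar>X w x\<bar> \<le> Z x" "\<bar>X s x\<bar> \<le> Z x" using Zx w st by auto
      then show ?thesis using w by auto
    qed
    ultimately show "(\<lambda>n. S n x) \<longlonglongrightarrow> L x \<and> (\<forall>n. \<bar>S n x\<bar> \<le> 2 * Z x)" by blast
  qed
  have "(\<lambda>n. \<integral>x. f x * S n x \<partial>M) \<longlonglongrightarrow> (\<integral>x. f x * L x \<partial>M)"
  proof (rule integral_dominated_convergence[where w="\<lambda>x. C * (2 * Z x)"])
    show "integrable M (\<lambda>x. C * (2 * Z x))" using Z(1) by auto
    show "AE x in M. (\<lambda>n. f x * S n x) \<longlonglongrightarrow> f x * L x" using AEb by eventually_elim (auto intro!: tendsto_intros)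
    show "AE x in M. norm (f x * S n x) \<le> C * (2 * Z x)" for n
      using AEb AE_space by eventually_elim (auto simp: abs_mult intro!: mult_mono f(2) C0)
  qed (use Smeas Lm in measurable)
  moreover have "(\<integral>x. f x * S n x \<partial>M) = 0" for n
  proof -
    have ib: "integrable M (\<lambda>x. h x * (X (g n (Suc j)) x - X (g n j) x))"
      if "h \<in> borel_measurable M" "\<And>x. x \<in> space M \<Longrightarrow> \<bar>h x\<bar> \<le> C" for j h
    proof (rule Bochner_Integration.integrable_bound[where f="\<lambda>x. C * (X (g n (Suc j)) x - X (g n j) x)"])
      show "integrable M (\<lambda>x. C * (X (g n (Suc j)) x - X (g n j) x))" using martingaleD(1)[OF X] g0 by auto
      show "AE x in M. norm (h x * (X (g n (Suc j)) x - X (g n j) x)) \<le> norm (C * (X (g n (Suc j)) x - X (g n j) x))"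
        using that(2) C0 by (auto simp: abs_mult intro!: mult_right_mono AE_I2)
    qed (use that XM g0 in measurable)
    have e: "f x * S n x = (\<Sum>j<Suc n. (f x * of_bool (g n j < T x)) * (X (g n (Suc j)) x - X (g n j) x))" for x
      by (simp only: S_def sum_distrib_left mult.assoc)
    have hb: "\<bar>f x * of_bool (g n j < T x)\<bar> \<le> C" if "x \<in> space M" for x j
      using f(2)[OF that] C0 by (auto simp: abs_mult)
    have hm: "(\<lambda>x. f x * of_bool (g n j < T x)) \<in> borel_measurable (K (g n j))" for j
    proof -
      have "f \<in> borel_measurable (K (g n j))" by (rule filt_measurable_mono[OF st(1) g0(2) f(1)])
      moreover have "(\<lambda>x. of_bool (g n j < T x) :: real) \<in> borel_measurable (K (g n j))"
      proof -
        have "(indicator {x\<in>space M. g n j < T x} :: 'a \<Rightarrow> real) \<in> borel_measurable (K (g n j))"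
          using bounded_stopping_time_gt[OF T g0(1)] by auto
        then show ?thesis using g0
          by (subst measurable_cong[where g="indicator {x\<in>space M. g n j < T x} :: 'a \<Rightarrow> real"]) auto
      qed
      ultimately show ?thesis by measurable
    qed
    have "(\<integral>x. f x * S n x \<partial>M) = (\<Sum>j<Suc n. \<integral>x. (f x * of_bool (g n j < T x)) * (X (g n (Suc j)) x - X (g n j) x) \<partial>M)"
      unfolding e by (intro Bochner_Integration.integral_sum ib hb) (use hm g0 filt_measurable in auto)
    also have "\<dots> = 0"
      by (intro sum.neutral ballI martingale_test[OF X] g0 hm ib hb) (use hm g0 filt_measurable in auto)
    finally show ?thesis .
  qed
  ultimately have "(\<integral>x. f x * L x \<partial>M) = 0" by (simp add: LIMSEQ_const_iff)
  then show ?thesis by (simp add: L_def)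
qed

end

section \<open>Square integrable martingale differences\<close>

lemma integrable_product_of_squares:
  fixes f g :: "'a \<Rightarrow> real"
  assumes [measurable]: "f \<in> borel_measurable M" "g \<in> borel_measurable M"
    and f: "integrable M (\<lambda>x. (f x)\<^sup>2)" and g: "integrable M (\<lambda>x. (g x)\<^sup>2)"
  shows "integrable M (\<lambda>x. f x * g x)"
proof (rule Bochner_Integration.integrable_bound)
  show "integrable M (\<lambda>x. (f x)\<^sup>2 + (g x)\<^sup>2)" using f g by auto
  show "AE x in M. norm (f x * g x) \<le> norm ((f x)\<^sup>2 + (g x)\<^sup>2)"
  proof (rule AE_I2)
    fix x
    have "2 * (\<bar>f x\<bar> * \<bar>g x\<bar>) \<le> (f x)\<^sup>2 + (g x)\<^sup>2"
      using sum_squares_bound[of "\<bar>f x\<bar>" "\<bar>g x\<bar>"] by simp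
    moreover have "0 \<le> \<bar>f x\<bar> * \<bar>g x\<bar>" by simp
    ultimately have "\<bar>f x\<bar> * \<bar>g x\<bar> \<le> (f x)\<^sup>2 + (g x)\<^sup>2" by linarith
    then show "norm (f x * g x) \<le> norm ((f x)\<^sup>2 + (g x)\<^sup>2)"
      by (simp add: abs_mult)
  qed
qed measurable

lemma integrable_square_add:
  fixes f g :: "'a \<Rightarrow> real"
  assumes [measurable]: "f \<in> borel_measurable M" "g \<in> borel_measurable M"
    and f: "integrable M (\<lambda>x. (f x)\<^sup>2)" and g: "integrable M (\<lambda>x. (g x)\<^sup>2)"
  shows "integrable M (\<lambda>x. (f x + g x)\<^sup>2)"
proof -
  have "integrable M (\<lambda>x. (f x)\<^sup>2 + (g x)\<^sup>2 + 2 * (f x * g x))"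
    using f g integrable_product_of_squares[OF assms] by simp
  then show ?thesis by (simp add: power2_sum mult.assoc)
qed

lemma integrable_square_bounded_mult:
  fixes f g :: "'a \<Rightarrow> real"
  assumes [measurable]: "f \<in> borel_measurable M" "g \<in> borel_measurable M"
    and f: "\<And>x. x \<in> space M \<Longrightarrow> \<bar>f x\<bar> \<le> C" and g: "integrable M (\<lambda>x. (g x)\<^sup>2)"
  shows "integrable M (\<lambda>x. (f x * g x)\<^sup>2)"
    and "(\<integral>x. (f x * g x)\<^sup>2 \<partial>M) \<le> C\<^sup>2 * (\<integral>x. (g x)\<^sup>2 \<partial>M)"
proof -
  have le: "(f x * g x)\<^sup>2 \<le> C\<^sup>2 * (g x)\<^sup>2" if "x \<in> space M" for x
    using power_mono[OF f[OF that], of 2] by (auto simp: power_mult_distrib intro!: mult_right_mono)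
  show i: "integrable M (\<lambda>x. (f x * g x)\<^sup>2)"
    by (rule Bochner_Integration.integrable_bound[of M "\<lambda>x. C\<^sup>2 * (g x)\<^sup>2"]) (use g le in auto)
  show "(\<integral>x. (f x * g x)\<^sup>2 \<partial>M) \<le> C\<^sup>2 * (\<integral>x. (g x)\<^sup>2 \<partial>M)"
    using integral_mono[OF i _ le] g by simp
qed

lemma (in prob_space) chebyshev_second_moment:
  fixes f :: "'a \<Rightarrow> real"
  assumes [measurable]: "f \<in> borel_measurable M" and f: "integrable M (\<lambda>x. (f x)\<^sup>2)" and a: "a > 0"
  shows "prob {x \<in> space M. a \<le> \<bar>f x\<bar>} \<le> (\<integral>x. (f x)\<^sup>2 \<partial>M) / a\<^sup>2"
proof -
  have "{x \<in> space M. a \<le> \<bar>f x\<bar>} = {x \<in> space M. a\<^sup>2 \<le> (f x)\<^sup>2}"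
    using a by (auto simp: abs_le_square_iff[symmetric])
  then show ?thesis using integral_Markov_inequality_measure[OF f, of "{}" "a\<^sup>2"] a by simp
qed

text \<open>
  Finitely many square integrable martingale differences \<open>D i\<close> with bounded predictable weights
  \<open>k i\<close>.  The filtration is a parameter, because increments are taken both in a given filtration
  and in its enlargement by the terminal value.
\<close>

locale martingale_differences = prob_space M for M :: "'a measure" +
  fixes G :: "nat \<Rightarrow> 'a measure" and k D :: "nat \<Rightarrow> 'a \<Rightarrow> real" and \<delta> :: real
  assumes G_sub: "subalgebra M (G i)" and G_mono: "sets (G i) \<subseteq> sets (G (Suc i))"
    and k_meas: "k i \<in> borel_measurable (G i)" and k_bound: "x \<in> space M \<Longrightarrow> \<bar>k i x\<bar> \<le> \<delta>"
    and D_meas: "D i \<in> borel_measurable (G (Suc i))" and D_sq: "integrable M (\<lambda>x. (D i x)\<^sup>2)"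
    and D_zero: "A \<in> sets (G i) \<Longrightarrow> (\<integral>x. indicator A x * D i x \<partial>M) = 0"
begin

lemma G_measurable_mono:
  assumes "i \<le> j" "f \<in> borel_measurable (G i)" shows "f \<in> borel_measurable (G j)"
proof -
  have "sets (G i) \<subseteq> sets (G j)" using assms(1) G_mono by (rule lift_Suc_mono_le[rotated])
  then show ?thesis using assms(2) G_sub[of i] G_sub[of j]
    by (auto simp: measurable_def subalgebra_def)
qed

lemma G_meas: "f \<in> borel_measurable (G i) \<Longrightarrow> f \<in> borel_measurable M"
  by (rule measurable_from_subalg[OF G_sub])

lemma D_measM[measurable]: "D i \<in> borel_measurable M" using D_meas G_meas by blast
lemma k_measM[measurable]: "k i \<in> borel_measurable M" using k_meas G_meas by blast

lemma D_integrable: "integrable M (D i)"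
  using square_integrable_imp_integrable[OF D_measM D_sq] .

lemma D_test:
  assumes "g \<in> borel_measurable (G i)" "integrable M (\<lambda>x. (g x)\<^sup>2)"
  shows "(\<integral>x. g x * D i x \<partial>M) = 0"
proof (rule integral_sub_test[OF finite_measure_axioms G_sub D_integrable D_zero assms(1)])
  show "integrable M (\<lambda>x. g x * D i x)"
    by (rule integrable_product_of_squares[OF G_meas[OF assms(1)] D_measM assms(2) D_sq])
qed

definition partial :: "nat \<Rightarrow> 'a \<Rightarrow> real" where
  "partial n x = (\<Sum>i<n. k i x * D i x)"

lemma partial_meas: "partial n \<in> borel_measurable (G n)"
proof -
  have "(\<lambda>x. k i x * D i x) \<in> borel_measurable (G n)" if "i < n" for i
    using G_measurable_mono[OF _ k_meas, of i n] G_measurable_mono[OF _ D_meas, of i n] that by auto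
  then show ?thesis unfolding partial_def[abs_def] by (intro borel_measurable_sum) auto
qed

lemma partial_measM[measurable]: "partial n \<in> borel_measurable M"
  using partial_meas G_meas by blast

lemma kD_sq: "integrable M (\<lambda>x. (k i x * D i x)\<^sup>2)"
  by (rule integrable_square_bounded_mult[OF k_measM D_measM k_bound D_sq])

lemma partial_sq: "integrable M (\<lambda>x. (partial n x)\<^sup>2)"
proof (induction n)
  case 0 then show ?case by (simp add: partial_def)
next
  case (Suc n)
  have "integrable M (\<lambda>x. (partial n x + k n x * D n x)\<^sup>2)"
    by (rule integrable_square_add) (use Suc kD_sq in auto)
  then show ?case by (simp add: partial_def)
qed

text \<open>Orthogonality of the differences removes all mixed terms from the square of the sum.\<close>

lemma partial_second_moment:
  "(\<integral>x. (partial n x)\<^sup>2 \<partial>M) \<le> \<delta>\<^sup>2 * (\<Sum>i<n. \<integral>x. (D i x)\<^sup>2 \<partial>M)"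
proof (induction n)
  case 0 then show ?case by (simp add: partial_def)
next
  case (Suc n)
  have e: "(partial (Suc n) x)\<^sup>2 = (partial n x)\<^sup>2 + (k n x * D n x)\<^sup>2 + 2 * ((partial n x * k n x) * D n x)" for x
    by (simp add: partial_def power2_sum mult.assoc)
  have g: "(\<lambda>x. partial n x * k n x) \<in> borel_measurable (G n)" using partial_meas k_meas by measurable
  have gs: "integrable M (\<lambda>x. (partial n x * k n x)\<^sup>2)"
    using integrable_square_bounded_mult(1)[OF k_measM partial_measM k_bound partial_sq, of n n]
    by (simp add: mult.commute)
  have i: "integrable M (\<lambda>x. (partial n x * k n x) * D n x)"
    by (rule integrable_product_of_squares) (use gs D_sq in auto)
  have "(\<integral>x. (partial (Suc n) x)\<^sup>2 \<partial>M) =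
     (\<integral>x. (partial n x)\<^sup>2 \<partial>M) + (\<integral>x. (k n x * D n x)\<^sup>2 \<partial>M) + 2 * (\<integral>x. (partial n x * k n x) * D n x \<partial>M)"
    unfolding e using i partial_sq kD_sq by (simp add: mult.assoc)
  also have "\<dots> = (\<integral>x. (partial n x)\<^sup>2 \<partial>M) + (\<integral>x. (k n x * D n x)\<^sup>2 \<partial>M)"
    using D_test[OF g gs] by simp
  also have "\<dots> \<le> \<delta>\<^sup>2 * (\<Sum>i<n. \<integral>x. (D i x)\<^sup>2 \<partial>M) + \<delta>\<^sup>2 * (\<integral>x. (D n x)\<^sup>2 \<partial>M)"
    by (intro add_mono Suc integrable_square_bounded_mult(2)[OF k_measM D_measM k_bound D_sq])
  finally show ?case by (simp add: distrib_left)
qed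

lemma partial_orthogonal:
  assumes jn: "j \<le> n" and g: "g \<in> borel_measurable (G j)" "integrable M (\<lambda>x. (g x)\<^sup>2)"
  shows "(\<integral>x. g x * (partial n x - partial j x) \<partial>M) = 0"
  using jn
proof (induction n)
  case 0 then show ?case by (simp add: partial_def)
next
  case (Suc n)
  show ?case
  proof (cases "j = Suc n")
    case False
    then have jn: "j \<le> n" using Suc.prems by simp
    note [measurable] = G_meas[OF g(1)]
    have h: "(\<lambda>x. g x * k n x) \<in> borel_measurable (G n)"
      using G_measurable_mono[OF jn g(1)] k_meas by measurable
    have hs: "integrable M (\<lambda>x. (g x * k n x)\<^sup>2)"
      using integrable_square_bounded_mult(1)[OF k_measM G_meas[OF g(1)] k_bound g(2), of n]
      by (simp add: mult.commute)
    have i: "integrable M (\<lambda>x. (g x * k n x) * D n x)"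
      by (rule integrable_product_of_squares) (use hs D_sq in auto)
    have i2: "integrable M (\<lambda>x. g x * (partial n x - partial j x))"
      using integrable_product_of_squares[OF G_meas[OF g(1)] partial_measM g(2) partial_sq, of n]
       integrable_product_of_squares[OF G_meas[OF g(1)] partial_measM g(2) partial_sq, of j]
      by (simp add: right_diff_distrib)
    have "g x * (partial (Suc n) x - partial j x) = g x * (partial n x - partial j x) + (g x * k n x) * D n x" for x
      by (simp add: partial_def algebra_simps)
    then have "(\<integral>x. g x * (partial (Suc n) x - partial j x) \<partial>M) =
        (\<integral>x. g x * (partial n x - partial j x) \<partial>M) + (\<integral>x. (g x * k n x) * D n x \<partial>M)"
      using i i2 by simp
    then show ?thesis using D_test[OF h hs] Suc.IH[OF jn] by simp
  qed simp
qed

text \<open>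
  The classical argument: \<open>C j\<close> is the event that the level is reached first at step \<open>j\<close>.  It is
  known at step \<open>j\<close>, so on it the second moment of the final sum is at least that of the sum at
  step \<open>j\<close>, which is at least \<open>a\<^sup>2\<close> there.
\<close>

lemma doob_maximal:
  assumes a: "a > 0"
  shows "prob {x \<in> space M. \<exists>j\<le>n. a \<le> \<bar>partial j x\<bar>} \<le> (\<integral>x. (partial n x)\<^sup>2 \<partial>M) / a\<^sup>2"
proof -
  define C where "C j = {x \<in> space M. a \<le> \<bar>partial j x\<bar> \<and> (\<forall>i<j. \<bar>partial i x\<bar> < a)}" for j
  have CG: "C j \<in> sets (G j)" for j
  proof -
    have [measurable]: "partial i \<in> borel_measurable (G j)" if "i \<le> j" for i
      using G_measurable_mono[OF that partial_meas] .
    have "C j = {x \<in> space (G j). a \<le> \<bar>partial j x\<bar> \<and> (\<forall>i\<in>{..<j}. \<bar>partial i x\<bar> < a)}"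
      using G_sub[of j] by (auto simp: C_def subalgebra_def)
    also have "\<dots> \<in> sets (G j)"
    proof -
      have 1: "{x \<in> space (G j). a \<le> \<bar>partial j x\<bar>} \<in> sets (G j)" by measurable
      have "{x \<in> space (G j). \<bar>partial i x\<bar> < a} \<in> sets (G j)" if "i \<in> {..<j}" for i
        using that by (intro borel_measurable_less) (auto intro!: borel_measurable_abs)
      then have "{x \<in> space (G j). \<forall>i\<in>{..<j}. \<bar>partial i x\<bar> < a} \<in> sets (G j)"
        by (intro sets.sets_Collect_finite_All) auto
      from sets.sets_Collect_conj[OF this 1] show ?thesis .
    qed
    finally show ?thesis .
  qed
  have CM[measurable]: "C j \<in> sets M" for j using CG[of j] G_sub[of j] unfolding subalgebra_def by blast
  have disj: "disjoint_family_on C {..n}"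
    unfolding disjoint_family_on_def
  proof (intro ballI impI)
    fix i j :: nat assume "i \<noteq> j"
    then consider "i < j" | "j < i" by linarith
    then show "C i \<inter> C j = {}" by cases (fastforce simp: C_def)+
  qed
  have un: "{x \<in> space M. \<exists>j\<le>n. a \<le> \<bar>partial j x\<bar>} = (\<Union>j\<in>{..n}. C j)"
  proof (intro set_eqI iffI)
    fix x assume "x \<in> {x \<in> space M. \<exists>j\<le>n. a \<le> \<bar>partial j x\<bar>}"
    then have x: "x \<in> space M" and ex: "\<exists>j. j \<le> n \<and> a \<le> \<bar>partial j x\<bar>" by auto
    define j where "j = (LEAST j. j \<le> n \<and> a \<le> \<bar>partial j x\<bar>)"
    have j: "j \<le> n" "a \<le> \<bar>partial j x\<bar>" using LeastI_ex[OF ex] by (auto simp: j_def)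
    have "\<bar>partial i x\<bar> < a" if "i < j" for i
      using not_less_Least[of i "\<lambda>j. j \<le> n \<and> a \<le> \<bar>partial j x\<bar>"] that j unfolding j_def by auto
    then show "x \<in> (\<Union>j\<in>{..n}. C j)" using x j by (auto simp: C_def)
  qed (auto simp: C_def)
  have int1: "integrable M (\<lambda>x. indicator (C j) x * (partial n x)\<^sup>2)" for j
    using partial_sq using integrable_real_mult_indicator[OF CM, of "\<lambda>x. (partial n x)\<^sup>2" j] by (simp add: mult.commute)
  have ge: "a\<^sup>2 * prob (C j) \<le> (\<integral>x. indicator (C j) x * (partial n x)\<^sup>2 \<partial>M)" if "j \<le> n" for j
  proof -
    have i1: "integrable M (\<lambda>x. (indicator (C j) x * partial j x)\<^sup>2)"
      by (rule integrable_square_bounded_mult[OF _ partial_measM _ partial_sq, where C=1]) (auto simp: indicator_def)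
    have g: "(\<lambda>x. indicator (C j) x * partial j x) \<in> borel_measurable (G j)"
      using partial_meas[of j] CG[of j] by auto
    have z: "(\<integral>x. (indicator (C j) x * partial j x) * (partial n x - partial j x) \<partial>M) = 0"
      by (rule partial_orthogonal[OF that g i1])
    have i2: "integrable M (\<lambda>x. (indicator (C j) x * partial j x) * (partial n x - partial j x))"
    proof -
      have "integrable M (\<lambda>x. (indicator (C j) x * partial j x) * partial m x)" for m
        by (rule integrable_product_of_squares) (use i1 partial_sq in auto)
      from Bochner_Integration.integrable_diff[OF this this] show ?thesis by (simp add: right_diff_distrib)
    qed
    have "a\<^sup>2 * prob (C j) = (\<integral>x. a\<^sup>2 * indicator (C j) x \<partial>M)" by simp
    also have "\<dots> \<le> (\<integral>x. indicator (C j) x * (partial n x)\<^sup>2 -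
        2 * ((indicator (C j) x * partial j x) * (partial n x - partial j x)) \<partial>M)"
    proof (rule integral_mono)
      show "integrable M (\<lambda>x. a\<^sup>2 * indicator (C j) x)" by (auto simp: emeasure_eq_measure)
      show "integrable M (\<lambda>x. indicator (C j) x * (partial n x)\<^sup>2 -
        2 * ((indicator (C j) x * partial j x) * (partial n x - partial j x)))"
        using int1[of j] i2 by auto
      fix x
      have "a\<^sup>2 \<le> (partial n x)\<^sup>2 - 2 * (partial j x * (partial n x - partial j x))" if "x \<in> C j"
      proof -
        have "a\<^sup>2 \<le> (partial j x)\<^sup>2" using that a by (auto simp: C_def abs_le_square_iff[symmetric])
        also have "\<dots> \<le> (partial j x)\<^sup>2 + (partial n x - partial j x)\<^sup>2" by simp
        finally show ?thesis by (simp add: power2_eq_square algebra_simps)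
      qed
      then show "a\<^sup>2 * indicator (C j) x \<le> indicator (C j) x * (partial n x)\<^sup>2 -
        2 * ((indicator (C j) x * partial j x) * (partial n x - partial j x))"
        by (cases "x \<in> C j") auto
    qed
    also have "\<dots> = (\<integral>x. indicator (C j) x * (partial n x)\<^sup>2 \<partial>M)"
      using int1[of j] i2 z by simp
    finally show ?thesis .
  qed
  have "a\<^sup>2 * prob {x \<in> space M. \<exists>j\<le>n. a \<le> \<bar>partial j x\<bar>} = (\<Sum>j\<le>n. a\<^sup>2 * prob (C j))"
    unfolding un using finite_measure_finite_Union[of "{..n}" C] disj CM
    by (simp add: image_subset_iff sum_distrib_left)
  also have "\<dots> \<le> (\<Sum>j\<le>n. \<integral>x. indicator (C j) x * (partial n x)\<^sup>2 \<partial>M)"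
    by (intro sum_mono ge) auto
  also have "\<dots> = (\<integral>x. (\<Sum>j\<le>n. indicator (C j) x * (partial n x)\<^sup>2) \<partial>M)"
    by (rule Bochner_Integration.integral_sum[symmetric]) (rule int1)
  also have "\<dots> \<le> (\<integral>x. (partial n x)\<^sup>2 \<partial>M)"
  proof (rule integral_mono)
    show "integrable M (\<lambda>x. \<Sum>j\<le>n. indicator (C j) x * (partial n x)\<^sup>2)" by (intro Bochner_Integration.integrable_sum int1)
    fix x
    have "(\<Sum>j\<le>n. indicator (C j) x) = (indicator (\<Union>j\<in>{..n}. C j) x :: real)"
      using disj by (intro indicator_UN_disjoint[symmetric]) auto
    then have "(\<Sum>j\<le>n. indicator (C j) x * (partial n x)\<^sup>2) = indicator (\<Union>j\<in>{..n}. C j) x * (partial n x)\<^sup>2"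
      by (simp add: sum_distrib_right[symmetric])
    then show "(\<Sum>j\<le>n. indicator (C j) x * (partial n x)\<^sup>2) \<le> (partial n x)\<^sup>2"
      by (auto simp: indicator_def)
  qed (rule partial_sq)
  finally show ?thesis using a by (simp add: field_simps)
qed

end

section \<open>Uniform convergence in probability\<close>

text \<open>
  Borel--Cantelli along a subsequence with errors \<open>(1/2)^j\<close>, on the time intervals \<open>[0, j]\<close> in turn.
\<close>

lemma (in prob_space) ucp_subsequence:
  assumes ucp: "ucp_tendsto M Y Z"
  obtains r :: "nat \<Rightarrow> nat" where "filterlim r at_top sequentially"
    and "AE x in M. \<forall>N. uniform_limit {0..N} (\<lambda>k s. Y (r k) s x) (\<lambda>s. Z s x) sequentially"
proof -
  have "\<forall>j. \<exists>n0. \<forall>n\<ge>n0. unif_small M (\<lambda>s \<omega>. Y n s \<omega> - Z s \<omega>) (real j) ((1/2) ^ j)"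
    using ucp unfolding ucp_tendsto_def eventually_sequentially by simp
  then obtain n0 where n0: "\<And>j n. n \<ge> n0 j \<Longrightarrow> unif_small M (\<lambda>s \<omega>. Y n s \<omega> - Z s \<omega>) (real j) ((1/2) ^ j)"
    by metis
  define r where "r j = n0 j + j" for j
  have r: "filterlim r at_top sequentially"
    by (rule filterlim_at_top_mono[OF filterlim_ident]) (auto simp: r_def)
  have "\<forall>j. \<exists>A\<in>sets M. measure M A \<le> (1/2)^j \<and> (\<forall>x\<in>space M - A. \<forall>s\<in>{0..real j}. \<bar>Y (r j) s x - Z s x\<bar> \<le> (1/2)^j)"
    using n0[of _ "r _"] unfolding unif_small_def r_def by simp
  then obtain A where A: "\<And>j. A j \<in> sets M" "\<And>j. measure M (A j) \<le> (1/2)^j"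
     "\<And>j x s. x \<in> space M - A j \<Longrightarrow> s \<in> {0..real j} \<Longrightarrow> \<bar>Y (r j) s x - Z s x\<bar> \<le> (1/2)^j"
    by metis
  have "AE x in M. eventually (\<lambda>n. x \<in> space M - A n) sequentially"
  proof (rule borel_cantelli_AE1)
    show "summable (\<lambda>n. measure M (A n))"
      by (rule summable_comparison_test[OF _ summable_geometric[of "1/2::real"]]) (use A(2) in auto)
  qed (use A in \<open>auto simp: emeasure_eq_measure\<close>)
  then have "AE x in M. \<forall>N. uniform_limit {0..N} (\<lambda>k s. Y (r k) s x) (\<lambda>s. Z s x) sequentially"
  proof eventually_elim
    fix x assume ev: "eventually (\<lambda>n. x \<in> space M - A n) sequentially"
    show "\<forall>N. uniform_limit {0..N} (\<lambda>k s. Y (r k) s x) (\<lambda>s. Z s x) sequentially"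
    proof
      fix N :: real
      show "uniform_limit {0..N} (\<lambda>k s. Y (r k) s x) (\<lambda>s. Z s x) sequentially"
      proof (rule uniform_limitI)
        fix e :: real assume e: "e > 0"
        obtain j0 where j0: "(1/2::real)^j0 < e" using real_arch_pow_inv[OF e, of "1/2"] by auto
        obtain j1 :: nat where j1: "N \<le> real j1" using real_arch_simple by blast
        show "\<forall>\<^sub>F n in sequentially. \<forall>s\<in>{0..N}. dist (Y (r n) s x) (Z s x) < e"
          using ev eventually_ge_at_top[of j0] eventually_ge_at_top[of j1]
        proof eventually_elim
          case (elim n)
          have "(1/2::real)^n \<le> (1/2)^j0" using elim(2) by (intro power_decreasing) auto
          moreover have "\<bar>Y (r n) s x - Z s x\<bar> \<le> (1/2)^n" if "s \<in> {0..N}" for s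
            using A(3)[OF elim(1), of s] that elim(3) j1 by simp
          ultimately show ?case using j0 unfolding dist_real_def by (meson le_less_trans order_trans)
        qed
      qed
    qed
  qed
  with r show ?thesis by (rule that)
qed

lemma continuous_on_halfline:
  fixes f :: "real \<Rightarrow> real"
  assumes "\<And>N::real. continuous_on {0..N} f"
  shows "continuous_on {0..} f"
  unfolding continuous_on_eq_continuous_within
proof
  fix s :: real assume s: "s \<in> {0..}"
  have "(f \<longlongrightarrow> f s) (at s within {0..s + 1})"
    using assms[of "s + 1"] s by (auto simp: continuous_on_def)
  moreover have "at s within {0..s + 1} = at s within {0..}"
  proof (rule at_within_nhd[of s "{..<s+1}"])
    show "{0..s + 1} \<inter> {..<s + 1} - {s} = {0..} \<inter> {..<s + 1} - {s}" by auto
  qed auto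
  ultimately show "continuous (at s within {0..}) f" by (simp add: continuous_within)
qed

lemma elementary_grid:
  assumes el: "elementary M K g n u f" and ij: "i \<le> j" "j \<le> n"
  shows "0 \<le> u i" "u i \<le> u j"
proof -
  have mono: "u i \<le> u j" if "i \<le> j" "j \<le> n" for i j
    using that
  proof (induction j rule: dec_induct)
    case (step k)
    then have "u i \<le> u k" by simp
    also have "u k \<le> u (Suc k)" using el step by (auto simp: elementary_def)
    finally show ?case .
  qed simp
  show "u i \<le> u j" using mono ij by blast
  have "0 \<le> u 0" using el by (simp add: elementary_def)
  also have "u 0 \<le> u i" using mono[of 0 i] ij by simp
  finally show "0 \<le> u i" .
qed

context filtered_space begin

lemma ucp_limit:
  assumes ad: "\<And>k. adapted K (Y k)" and c: "\<And>k. continuous_paths M (Y k)" and ucp: "ucp_tendsto M Y Z"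
  shows "adapted K Z" "continuous_paths M Z"
    and "(\<And>k. AE x in M. Y k 0 x = 0) \<Longrightarrow> AE x in M. Z 0 x = 0"
proof -
  obtain r where r: "AE x in M. \<forall>N. uniform_limit {0..N} (\<lambda>k s. Y (r k) s x) (\<lambda>s. Z s x) sequentially"
    using ucp_subsequence[OF ucp] by blast
  have p: "AE x in M. \<forall>s\<ge>0. (\<lambda>k. Y (r k) s x) \<longlonglongrightarrow> Z s x"
    using r
  proof eventually_elim
    case (elim x)
    show ?case
    proof (intro allI impI)
      fix s :: real assume "s \<ge> 0"
      then show "(\<lambda>k. Y (r k) s x) \<longlonglongrightarrow> Z s x" by (intro tendsto_uniform_limitI[OF elim[rule_format, of s]]) auto
    qed
  qed
  show "adapted K Z"
    unfolding adapted_def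
  proof (intro allI impI)
    fix t :: real assume t: "0 \<le> t"
    show "Z t \<in> borel_measurable (K t)"
      by (rule full_subalgebra_AE_lim[OF filt_full[OF t], of "\<lambda>k. Y (r k) t"])
        (use ad p t in \<open>auto simp: adapted_def elim: eventually_mono\<close>)
  qed
  have "AE x in M. \<forall>k. continuous_on {0..} (\<lambda>s. Y (r k) s x)"
    using c unfolding AE_all_countable continuous_paths_def by blast
  then show "continuous_paths M Z" unfolding continuous_paths_def using r
  proof eventually_elim
    case (elim x)
    show ?case
    proof (rule continuous_on_halfline)
      fix N :: real
      show "continuous_on {0..N} (\<lambda>s. Z s x)"
        by (rule uniform_limit_theorem[OF _ elim(2)[rule_format]])
          (use elim(1) in \<open>auto intro!: always_eventually continuous_on_subset[of "{0..}" _ "{0..N}"]\<close>)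
    qed
  qed
  show "AE x in M. Z 0 x = 0" if "\<And>k. AE x in M. Y k 0 x = 0"
  proof -
    have "AE x in M. \<forall>k. Y (r k) 0 x = 0" using that unfolding AE_all_countable by blast
    then show ?thesis using p
    proof eventually_elim
      case (elim x)
      have "(\<lambda>k. Y (r k) 0 x) \<longlonglongrightarrow> Z 0 x" by (rule elim(2)[rule_format]) simp
      then show ?case using elim(1) by (simp add: LIMSEQ_const_iff)
    qed
  qed
qed

text \<open>
  Properties of integrals tested at bounded stopping times pass to ucp limits by stopping the
  approximants when they differ from the limit by 1.  Along the almost surely convergent
  subsequence this stops before \<open>T\<close> only finitely often.
\<close>

lemma ucp_localize:
  assumes ad: "\<And>k. adapted K (Y k)" and c: "\<And>k. continuous_paths M (Y k)"
    and z: "\<And>k. AE x in M. Y k 0 x = 0" and ucp: "ucp_tendsto M Y Z"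
    and T: "bounded_stopping_time N T"
  obtains r T' where "filterlim r at_top sequentially"
    "\<And>k. bounded_stopping_time N (T' k)" "\<And>k x. T' k x \<le> T x"
    "\<And>k. AE x in M. \<forall>s\<in>{0..T' k x}. \<bar>Y (r k) s x - Z s x\<bar> \<le> 1"
    "AE x in M. \<forall>\<^sub>F k in sequentially. T' k x = T x"
    "AE x in M. (\<lambda>k. Y (r k) (T' k x) x) \<longlonglongrightarrow> Z (T x) x"
proof -
  note Z = ucp_limit[OF ad c ucp]
  obtain r where r: "filterlim r at_top sequentially"
    and u: "AE x in M. \<forall>N. uniform_limit {0..N} (\<lambda>k s. Y (r k) s x) (\<lambda>s. Z s x) sequentially"
    using ucp_subsequence[OF ucp] by blast
  define D where "D k s x = Y (r k) s x - Z s x" for k s x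
  obtain x0 where x0: "x0 \<in> space M" using not_empty by auto
  have N: "0 \<le> N" using bounded_stopping_timeD(1,2)[OF T x0] by simp
  have Dad: "adapted K (D k)" for k
    unfolding adapted_def
  proof (intro allI impI)
    fix t :: real assume t: "0 \<le> t"
    have "D k t = (\<lambda>x. Y (r k) t x - Z t x)" by (simp add: D_def fun_eq_iff)
    then show "D k t \<in> borel_measurable (K t)"
      using ad[of "r k"] Z(1) t unfolding adapted_def by (simp add: borel_measurable_diff)
  qed
  have Dc: "continuous_paths M (D k)" for k
    using c[of "r k"] Z(2) unfolding continuous_paths_def D_def
    by eventually_elim (rule continuous_on_diff)
  have D0: "AE x in M. D k 0 x = 0" for k
    using z[of "r k"] Z(3)[OF z] unfolding D_def by eventually_elim simp
  define T' where "T' k x = min (T x) (hitting N 1 (D k) x)" for k x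
  show ?thesis
  proof (rule that[OF r, of T'])
    show "bounded_stopping_time N (T' k)" for k
      unfolding T'_def by (rule bounded_stopping_time_min[OF T hitting_stopping_time[OF Dad Dc N]])
    show "T' k x \<le> T x" for k x by (simp add: T'_def)
    show "AE x in M. \<forall>s\<in>{0..T' k x}. \<bar>Y (r k) s x - Z s x\<bar> \<le> 1" for k
      using Dc[of k] D0[of k] unfolding continuous_paths_def
    proof eventually_elim
      case (elim x)
      have "\<bar>D k s x\<bar> \<le> 1" if "0 \<le> s" "s \<le> hitting N 1 (D k) x" for s
        by (rule hitting_upto[OF elim(1) N _ that]) (simp add: elim)
      then show ?case by (auto simp: T'_def D_def)
    qed
    have ev: "AE x in M. \<forall>\<^sub>F k in sequentially. T' k x = T x"
      using u AE_space
    proof eventually_elim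
      case (elim x)
      have "\<forall>\<^sub>F k in sequentially. \<forall>s\<in>{0..N}. dist (Y (r k) s x) (Z s x) < 1"
        using elim(1) by (intro uniform_limitD) auto
      then show ?case
      proof eventually_elim
        case (elim k)
        then have "hitting N 1 (D k) x = N" by (intro hitting_eq_N) (auto simp: D_def dist_real_def)
        then show ?case using bounded_stopping_timeD(2)[OF T \<open>x \<in> space M\<close>] by (simp add: T'_def)
      qed
    qed
    then show "AE x in M. \<forall>\<^sub>F k in sequentially. T' k x = T x" .
    show "AE x in M. (\<lambda>k. Y (r k) (T' k x) x) \<longlonglongrightarrow> Z (T x) x"
      using ev u AE_space
    proof eventually_elim
      case (elim x)
      have "(\<lambda>k. Y (r k) (T x) x) \<longlonglongrightarrow> Z (T x) x"
        by (rule tendsto_uniform_limitI[OF elim(2)[rule_format, of "T x"]])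
          (use bounded_stopping_timeD(1)[OF T elim(3)] in auto)
      then show ?case
        by (rule Lim_transform_eventually) (use elim(1) in \<open>auto elim: eventually_mono\<close>)
    qed
  qed
qed

section \<open>Continuous local martingales\<close>

text \<open>
  A form of the local martingale property that mentions no localising sequence: zero expectation
  at every bounded stopping time up to which the process is bounded.  Unlike the martingale
  property it survives ucp limits, so that it holds for all integrals in the closure by which
  \<open>bounded_integral\<close> is defined.
\<close>

definition local_martingale :: "(real \<Rightarrow> 'a \<Rightarrow> real) \<Rightarrow> bool" where
  "local_martingale Y \<longleftrightarrow> adapted K Y \<and> continuous_paths M Y \<and> (AE x in M. Y 0 x = 0) \<and>
     (\<forall>N T m. bounded_stopping_time N T \<longrightarrow> (AE x in M. \<forall>s\<in>{0..T x}. \<bar>Y s x\<bar> \<le> m) \<longrightarrow>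
        (\<integral>x. Y (T x) x \<partial>M) = 0)"

lemma local_martingaleD:
  assumes "local_martingale Y"
  shows "adapted K Y" "continuous_paths M Y" "AE x in M. Y 0 x = 0"
    and "bounded_stopping_time N T \<Longrightarrow> AE x in M. \<forall>s\<in>{0..T x}. \<bar>Y s x\<bar> \<le> m \<Longrightarrow> (\<integral>x. Y (T x) x \<partial>M) = 0"
  using assms by (auto simp: local_martingale_def)

lemma eval_stopping_measurable:
  assumes "adapted K Y" "continuous_paths M Y" "bounded_stopping_time N T"
  shows "(\<lambda>x. Y (T x) x) \<in> borel_measurable M"
proof (rule eval_measurable[OF _ assms(2) bounded_stopping_time_measurable[OF assms(3)]])
  show "Y t \<in> borel_measurable M" if "0 \<le> t" for t
    using assms(1) that filt_measurable[OF that] by (auto simp: adapted_def)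
  show "0 \<le> T x" if "x \<in> space M" for x by (rule bounded_stopping_timeD(1)[OF assms(3) that])
qed

lemma local_martingale_ucp_limit:
  assumes Y: "\<And>k. local_martingale (Y k)" and ucp: "ucp_tendsto M Y Z"
  shows "local_martingale Z"
  unfolding local_martingale_def
proof (intro conjI allI impI)
  note YD = local_martingaleD[OF Y]
  note Z = ucp_limit[OF YD(1,2) ucp]
  show "adapted K Z" "continuous_paths M Z" "AE x in M. Z 0 x = 0" using Z(1,2) Z(3)[OF YD(3)] by auto
  fix N T m assume T: "bounded_stopping_time N T" and b: "AE x in M. \<forall>s\<in>{0..T x}. \<bar>Z s x\<bar> \<le> m"
  obtain r T' where r: "filterlim r at_top sequentially" and T': "\<And>k. bounded_stopping_time N (T' k)" "\<And>k x. T' k x \<le> T x"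
    "\<And>k. AE x in M. \<forall>s\<in>{0..T' k x}. \<bar>Y (r k) s x - Z s x\<bar> \<le> 1"
    "AE x in M. \<forall>\<^sub>F k in sequentially. T' k x = T x"
    "AE x in M. (\<lambda>k. Y (r k) (T' k x) x) \<longlonglongrightarrow> Z (T x) x"
    by (rule ucp_localize[OF YD(1,2,3) ucp T]) (rule that)
  have bk: "AE x in M. \<forall>s\<in>{0..T' k x}. \<bar>Y (r k) s x\<bar> \<le> m + 1" for k
    using b T'(3)[of k]
  proof eventually_elim
    case (elim x)
    show ?case
    proof
      fix s assume s: "s \<in> {0..T' k x}"
      then have "\<bar>Z s x\<bar> \<le> m" "\<bar>Y (r k) s x - Z s x\<bar> \<le> 1" using elim T'(2)[of k x] by auto
      then show "\<bar>Y (r k) s x\<bar> \<le> m + 1" by linarith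
    qed
  qed
  have "(\<lambda>k. \<integral>x. Y (r k) (T' k x) x \<partial>M) \<longlonglongrightarrow> (\<integral>x. Z (T x) x \<partial>M)"
  proof (rule integral_dominated_convergence[where w="\<lambda>_. m + 1"])
    show "(\<lambda>x. Z (T x) x) \<in> borel_measurable M" by (rule eval_stopping_measurable[OF Z(1,2) T])
    show "(\<lambda>x. Y (r k) (T' k x) x) \<in> borel_measurable M" for k
      by (rule eval_stopping_measurable[OF YD(1,2) T'(1)])
    show "AE x in M. norm (Y (r k) (T' k x) x) \<le> m + 1" for k
      using bk[of k] AE_space
      by eventually_elim (use bounded_stopping_timeD(1)[OF T'(1)] in auto)
  qed (use T'(5) in auto)
  moreover have "(\<integral>x. Y (r k) (T' k x) x \<partial>M) = 0" for k
    by (rule YD(4)[OF T'(1) bk])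
  ultimately show "(\<integral>x. Z (T x) x \<partial>M) = 0" by (simp add: LIMSEQ_const_iff)
qed

lemma bounded_integral_local_martingale:
  assumes base: "\<And>g n u f. elementary M K g n u f \<Longrightarrow> local_martingale (elem_integral n u f X)"
    and HY: "bounded_integral M K X H Y"
  shows "local_martingale Y"
  using HY
proof induction
  case (elem g n u f) then show ?case by (rule base)
next
  case (lim H Y C H' Y') then show ?case by (intro local_martingale_ucp_limit[of Y Y']) auto
qed

lemma elem_integral_adapted:
  assumes ad: "adapted K X" and el: "elementary M K g n u f"
  shows "adapted K (elem_integral n u f X)"
  unfolding adapted_def elem_integral_def[abs_def]
proof (intro allI impI borel_measurable_sum)
  fix t :: real and i assume t: "0 \<le> t" and i: "i \<in> {..<n}"
  have u: "0 \<le> u i" "u i \<le> u (Suc i)" using elementary_grid[OF el, of i "Suc i"] i by auto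
  have X: "X (min t v) \<in> borel_measurable (K t)" if "0 \<le> v" for v
    using ad t that by (intro filt_measurable_mono[of "min t v" t]) (auto simp: adapted_def)
  show "(\<lambda>x. f i x * (X (min t (u (Suc i))) x - X (min t (u i)) x)) \<in> borel_measurable (K t)"
  proof (cases "u i \<le> t")
    case True
    have "f i \<in> borel_measurable (K t)"
      using el i u True by (intro filt_measurable_mono[of "u i" t]) (auto simp: elementary_def)
    then show ?thesis using X u by (intro borel_measurable_times borel_measurable_diff) auto
  qed (use u in auto)
qed

lemma stopped_value_integrable:
  assumes ad: "adapted K X" and c: "continuous_paths M X" and dom: "dominated M X"
    and T: "bounded_stopping_time N T" and t: "0 \<le> t"
  shows "integrable M (\<lambda>x. X (min (T x) t) x)"
proof -
  obtain Z where Z: "integrable M Z" "AE x in M. \<forall>r\<in>{0..t}. \<bar>X r x\<bar> \<le> Z x"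
    using dom unfolding dominated_def by blast
  have "bounded_stopping_time N (\<lambda>x. min (T x) t)"
    by (rule bounded_stopping_time_min[OF T bounded_stopping_time_const[OF t]])
  from eval_stopping_measurable[OF ad c this]
  have m: "(\<lambda>x. X (min (T x) t) x) \<in> borel_measurable M" .
  show ?thesis
  proof (rule Bochner_Integration.integrable_bound[OF Z(1) m])
    show "AE x in M. norm (X (min (T x) t) x) \<le> norm (Z x)"
      using Z(2) AE_space
    proof eventually_elim
      case (elim x)
      have "min (T x) t \<in> {0..t}" using bounded_stopping_timeD(1)[OF T elim(2)] t by simp
      then have "\<bar>X (min (T x) t) x\<bar> \<le> Z x" using elim(1) by blast
      then show ?case by simp
    qed
  qed
qed

lemma elem_integral_continuous:
  assumes c: "continuous_paths M X" and el: "elementary M K g n u f"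
  shows "continuous_paths M (elem_integral n u f X)"
  using c unfolding continuous_paths_def
proof eventually_elim
  case (elim x)
  have "continuous_on {0..} (\<lambda>t. X (min t v) x)" if "0 \<le> v" for v
    by (rule continuous_on_compose2[OF elim]) (use that in \<open>auto intro!: continuous_intros\<close>)
  moreover have "0 \<le> u i" if "i \<le> n" for i using elementary_grid(1)[OF el order_refl that] .
  ultimately show ?case
    unfolding elem_integral_def
    by (intro continuous_on_sum continuous_on_mult continuous_on_diff continuous_on_const) auto
qed

lemma elem_integral_0:
  assumes el: "elementary M K g n u f" shows "elem_integral n u f X 0 x = 0"
proof -
  have "0 \<le> u i" if "i \<le> n" for i using elementary_grid(1)[OF el order_refl that] .
  then show ?thesis unfolding elem_integral_def by (intro sum.neutral) (auto simp: min_def)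
qed

lemma elem_integral_local_martingale:
  assumes X: "martingale X" and ad: "adapted K X" and c: "continuous_paths M X" and dom: "dominated M X"
    and el: "elementary M K g n u f"
  shows "local_martingale (elem_integral n u f X)"
  unfolding local_martingale_def
proof (intro conjI allI impI)
  show "adapted K (elem_integral n u f X)" by (rule elem_integral_adapted[OF ad el])
  show "continuous_paths M (elem_integral n u f X)" by (rule elem_integral_continuous[OF c el])
  show "AE x in M. elem_integral n u f X 0 x = 0" using elem_integral_0[OF el] by simp
  fix N T m assume T: "bounded_stopping_time N T"
  have i: "integrable M (\<lambda>x. f i x * (X (min (T x) (u (Suc i))) x - X (min (T x) (u i)) x))"
    and z: "(\<integral>x. f i x * (X (min (T x) (u (Suc i))) x - X (min (T x) (u i)) x) \<partial>M) = 0" if i: "i < n" for i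
  proof -
    have u: "0 \<le> u i" "u i \<le> u (Suc i)" "0 \<le> u (Suc i)"
      using elementary_grid[OF el, of i "Suc i"] i by auto
    obtain C where f: "f i \<in> borel_measurable (K (u i))" "\<And>x. x \<in> space M \<Longrightarrow> \<bar>f i x\<bar> \<le> C"
      using el i unfolding elementary_def by blast
    show "(\<integral>x. f i x * (X (min (T x) (u (Suc i))) x - X (min (T x) (u i)) x) \<partial>M) = 0"
      by (rule optional_stopping[OF X c dom T u(1,2) f])
    have d: "integrable M (\<lambda>x. X (min (T x) (u (Suc i))) x - X (min (T x) (u i)) x)"
      using stopped_value_integrable[OF ad c dom T] u by auto
    show "integrable M (\<lambda>x. f i x * (X (min (T x) (u (Suc i))) x - X (min (T x) (u i)) x))"
    proof (rule Bochner_Integration.integrable_bound[of M "\<lambda>x. C * (X (min (T x) (u (Suc i))) x - X (min (T x) (u i)) x)"])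
      show "AE x in M. norm (f i x * (X (min (T x) (u (Suc i))) x - X (min (T x) (u i)) x))
          \<le> norm (C * (X (min (T x) (u (Suc i))) x - X (min (T x) (u i)) x))"
      proof (rule AE_I2)
        fix x assume "x \<in> space M"
        then have "\<bar>f i x\<bar> \<le> \<bar>C\<bar>" using f(2)[of x] by linarith
        then show "norm (f i x * (X (min (T x) (u (Suc i))) x - X (min (T x) (u i)) x))
          \<le> norm (C * (X (min (T x) (u (Suc i))) x - X (min (T x) (u i)) x))"
          by (simp add: abs_mult mult_right_mono)
      qed
      show "(\<lambda>x. f i x * (X (min (T x) (u (Suc i))) x - X (min (T x) (u i)) x)) \<in> borel_measurable M"
        by (intro borel_measurable_times borel_measurable_integrable[OF d] filt_measurable[OF u(1) f(1)])
    qed (use d in simp)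
  qed
  have "(\<integral>x. elem_integral n u f X (T x) x \<partial>M) =
    (\<Sum>i<n. \<integral>x. f i x * (X (min (T x) (u (Suc i))) x - X (min (T x) (u i)) x) \<partial>M)"
    unfolding elem_integral_def by (rule Bochner_Integration.integral_sum) (use i in auto)
  also have "\<dots> = 0" using z by simp
  finally show "(\<integral>x. elem_integral n u f X (T x) x \<partial>M) = 0" .
qed

section \<open>Martingales are good integrators\<close>

lemma martingale_square_diff:
  assumes X: "martingale X" and ad: "adapted K X" and sq: "\<And>t. 0 \<le> t \<Longrightarrow> integrable M (\<lambda>x. (X t x)\<^sup>2)"
    and st: "0 \<le> s" "s \<le> t"
  shows "integrable M (\<lambda>x. (X t x - X s x)\<^sup>2)"
    and "(\<integral>x. (X t x - X s x)\<^sup>2 \<partial>M) = (\<integral>x. (X t x)\<^sup>2 \<partial>M) - (\<integral>x. (X s x)\<^sup>2 \<partial>M)"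
proof -
  have t: "0 \<le> t" using st by simp
  have [measurable]: "X t \<in> borel_measurable M" "X s \<in> borel_measurable M"
    using martingaleD(1)[OF X] st t by auto
  show i: "integrable M (\<lambda>x. (X t x - X s x)\<^sup>2)"
    using integrable_square_add[of "X t" M "\<lambda>x. - X s x"] sq[OF t] sq[OF st(1)] by simp
  have pi: "integrable M (\<lambda>x. X s x * (X t x - X s x))"
    by (rule integrable_product_of_squares) (use sq st i in auto)
  have "(\<integral>x. X s x * (X t x - X s x) \<partial>M) = 0"
    by (rule martingale_test[OF X st _ pi]) (use ad st in \<open>auto simp: adapted_def\<close>)
  moreover have "(X t x)\<^sup>2 = (X s x)\<^sup>2 + (X t x - X s x)\<^sup>2 + 2 * (X s x * (X t x - X s x))" for x
    by (simp add: power2_eq_square algebra_simps)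
  ultimately show "(\<integral>x. (X t x - X s x)\<^sup>2 \<partial>M) = (\<integral>x. (X t x)\<^sup>2 \<partial>M) - (\<integral>x. (X s x)\<^sup>2 \<partial>M)"
    using i pi sq[OF st(1)] by simp
qed

end

text \<open>
  A uniform bound of the integrand bounds the coefficients, but only those of nonempty intervals.
\<close>

lemma elem_process_bound:
  assumes el: "elementary M K g n u f" and b: "bounded_by M (elem_process g n u f) \<delta>"
    and i: "i < n" "u i < u (Suc i)" and x: "x \<in> space M"
  shows "\<bar>f i x\<bar> \<le> \<delta>"
proof -
  let ?t = "u (Suc i)"
  have t: "?t > 0" using elementary_grid(1)[OF el, of i i] i by auto
  have "(\<Sum>j<n. f j x * indicator {u j<..u (Suc j)} ?t) = (\<Sum>j<n. if j = i then f i x else 0)"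
  proof (rule sum.cong[OF refl])
    fix j assume j: "j \<in> {..<n}"
    consider "j < i" | "j = i" | "i < j" by linarith
    then show "f j x * indicator {u j<..u (Suc j)} ?t = (if j = i then f i x else 0)"
    proof cases
      case 1
      then have "u (Suc j) \<le> u i" using elementary_grid(2)[OF el, of "Suc j" i] i by auto
      then show ?thesis using 1 i by auto
    next
      case 3
      then have "u (Suc i) \<le> u j" using elementary_grid(2)[OF el, of "Suc i" j] j by auto
      then show ?thesis using 3 by auto
    qed (use i in auto)
  qed
  then have "elem_process g n u f ?t x = f i x" using t i by (simp add: elem_process_def)
  then show ?thesis using b t x unfolding bounded_by_def by (metis less_imp_le)
qed

context filtered_space begin

lemma elem_integral_second_moment:
  assumes X: "martingale X" and ad: "adapted K X" and sq: "\<And>t. 0 \<le> t \<Longrightarrow> integrable M (\<lambda>x. (X t x)\<^sup>2)"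
    and el: "elementary M K g n u f" and b: "bounded_by M (elem_process g n u f) \<delta>" and d: "0 \<le> \<delta>" and t: "0 \<le> t"
  shows "integrable M (\<lambda>x. (elem_integral n u f X t x)\<^sup>2)"
    and "(\<integral>x. (elem_integral n u f X t x)\<^sup>2 \<partial>M) \<le> \<delta>\<^sup>2 * (\<integral>x. (X t x)\<^sup>2 \<partial>M)"
proof -
  define v where "v i = min t (u (min i n))" for i
  \<comment> \<open>Coefficients of empty intervals and of intervals after \<open>t\<close> multiply zero increments; they are
    not bounded by \<open>\<delta>\<close>, or not yet measurable, and are set to zero.\<close>
  define k where "k i = (if i < n \<and> u i < t \<and> u i < u (Suc i) then f i else (\<lambda>_. 0))" for i
  define D where "D i x = X (v (Suc i)) x - X (v i) x" for i x
  have v0: "0 \<le> v i" for i using elementary_grid(1)[OF el, of "min i n" "min i n"] t by (auto simp: v_def)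
  have vmono: "v i \<le> v (Suc i)" for i
    using elementary_grid(2)[OF el, of "min i n" "min (Suc i) n"] by (auto simp: v_def min_le_iff_disj)
  have vt: "v i \<le> t" for i by (simp add: v_def)
  interpret martingale_differences M "\<lambda>i. K (v i)" k D \<delta>
  proof
    fix i
    show "subalgebra M (K (v i))" by (rule filt_sub[OF v0])
    show "sets (K (v i)) \<subseteq> sets (K (v (Suc i)))" by (rule filt_mono[OF v0 vmono])
    show "k i \<in> borel_measurable (K (v i))"
    proof (cases "i < n \<and> u i < t \<and> u i < u (Suc i)")
      case True
      then have "v i = u i" by (simp add: v_def)
      then show ?thesis using True el by (auto simp: k_def elementary_def)
    qed (auto simp: k_def)
    show "\<bar>k i x\<bar> \<le> \<delta>" if "x \<in> space M" for x
      using elem_process_bound[OF el b _ _ that, of i] d by (auto simp: k_def)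
    show "D i \<in> borel_measurable (K (v (Suc i)))"
    proof -
      have "X (v i) \<in> borel_measurable (K (v (Suc i)))" 
        by (rule filt_measurable_mono[OF v0 vmono]) (use ad v0 in \<open>auto simp: adapted_def\<close>)
      moreover have "X (v (Suc i)) \<in> borel_measurable (K (v (Suc i)))"
        using ad v0 by (auto simp: adapted_def)
      ultimately show ?thesis unfolding D_def[abs_def] by (rule borel_measurable_diff[rotated])
    qed
    show "integrable M (\<lambda>x. (D i x)\<^sup>2)"
      unfolding D_def by (rule martingale_square_diff(1)[OF X ad sq v0 vmono])
    show "(\<integral>x. indicator A x * D i x \<partial>M) = 0" if "A \<in> sets (K (v i))" for A
      unfolding D_def by (rule martingaleD(2)[OF X v0 vmono that])
  qed
  have e: "partial n = elem_integral n u f X t"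
    unfolding partial_def[abs_def] elem_integral_def[abs_def]
  proof (intro ext sum.cong[OF refl])
    fix i x assume i: "i \<in> {..<n}"
    show "k i x * D i x = f i x * (X (min t (u (Suc i))) x - X (min t (u i)) x)"
    proof (cases "u i < t \<and> u i < u (Suc i)")
      case True then show ?thesis using i by (simp add: k_def D_def v_def min_absorb1 Suc_le_eq)
    next
      case False
      then have "min t (u (Suc i)) = min t (u i)" using elementary_grid(2)[OF el, of i "Suc i"] i by auto
      then show ?thesis using False by (auto simp: k_def)
    qed
  qed
  show "integrable M (\<lambda>x. (elem_integral n u f X t x)\<^sup>2)" using partial_sq[of n] by (simp add: e)
  have "(\<Sum>i<n. \<integral>x. (D i x)\<^sup>2 \<partial>M) = (\<Sum>i<n. (\<integral>x. (X (v (Suc i)) x)\<^sup>2 \<partial>M) - (\<integral>x. (X (v i) x)\<^sup>2 \<partial>M))"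
    unfolding D_def using martingale_square_diff(2)[OF X ad sq v0 vmono] by simp
  also have "\<dots> = (\<integral>x. (X (v n) x)\<^sup>2 \<partial>M) - (\<integral>x. (X (v 0) x)\<^sup>2 \<partial>M)"
    by (rule sum_lessThan_telescope)
  also have "\<dots> \<le> (\<integral>x. (X (v n) x)\<^sup>2 \<partial>M)" by simp
  also have "\<dots> \<le> (\<integral>x. (X t x)\<^sup>2 \<partial>M)"
  proof -
    have "0 \<le> (\<integral>x. (X t x - X (v n) x)\<^sup>2 \<partial>M)" by simp
    then show ?thesis using martingale_square_diff(2)[OF X ad sq v0 vt, of n] by simp
  qed
  finally have "\<delta>\<^sup>2 * (\<Sum>i<n. \<integral>x. (D i x)\<^sup>2 \<partial>M) \<le> \<delta>\<^sup>2 * (\<integral>x. (X t x)\<^sup>2 \<partial>M)"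
    by (rule mult_left_mono) simp
  then show "(\<integral>x. (elem_integral n u f X t x)\<^sup>2 \<partial>M) \<le> \<delta>\<^sup>2 * (\<integral>x. (X t x)\<^sup>2 \<partial>M)"
    using partial_second_moment[of n] by (simp add: e)
qed

definition good_integrator :: "(real \<Rightarrow> 'a \<Rightarrow> real) \<Rightarrow> bool" where
  "good_integrator X \<longleftrightarrow> (\<forall>t\<ge>0. \<forall>\<epsilon>>0. \<exists>\<delta>>0. \<forall>g n u f.
        elementary M K g n u f \<and> bounded_by M (elem_process g n u f) \<delta> \<longrightarrow>
        measure M {\<omega>\<in>space M. \<bar>elem_integral n u f X t \<omega>\<bar> > \<epsilon>} \<le> \<epsilon>)"

lemma semimartingale_iff: "semimartingale M K X \<longleftrightarrow> adapted K X \<and> cadlag_paths M X \<and> good_integrator X"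
  by (simp add: semimartingale_def good_integrator_def)

text \<open>Chebyshev, with the \<open>L\<^sup>2\<close> bound for elementary integrals.\<close>

lemma martingale_good_integrator:
  assumes X: "martingale X" and ad: "adapted K X" and sq: "\<And>t. 0 \<le> t \<Longrightarrow> integrable M (\<lambda>x. (X t x)\<^sup>2)"
  shows "good_integrator X"
  unfolding good_integrator_def
proof (intro allI impI)
  fix t \<epsilon> :: real assume t: "0 \<le> t" and e: "0 < \<epsilon>"
  define V where "V = (\<integral>x. (X t x)\<^sup>2 \<partial>M)"
  have V: "0 \<le> V" unfolding V_def by simp
  define \<delta> where "\<delta> = sqrt (\<epsilon>^3 / (V + 1))"
  have d: "\<delta> > 0" "\<delta>\<^sup>2 = \<epsilon>^3 / (V + 1)" using e V by (auto simp: \<delta>_def)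
  show "\<exists>\<delta>>0. \<forall>g n u f. elementary M K g n u f \<and> bounded_by M (elem_process g n u f) \<delta> \<longrightarrow>
        measure M {\<omega>\<in>space M. \<bar>elem_integral n u f X t \<omega>\<bar> > \<epsilon>} \<le> \<epsilon>"
  proof (intro exI[of _ \<delta>] conjI d(1) allI impI)
    fix g n u f assume el: "elementary M K g n u f \<and> bounded_by M (elem_process g n u f) \<delta>"
    let ?Y = "elem_integral n u f X t"
    have Ym: "?Y \<in> borel_measurable M"
      using elem_integral_adapted[OF ad conjunct1[OF el]] t filt_measurable[OF t] by (auto simp: adapted_def)
    note m = elem_integral_second_moment[OF X ad sq conjunct1[OF el] conjunct2[OF el] less_imp_le[OF d(1)] t]
    have "measure M {\<omega>\<in>space M. \<bar>?Y \<omega>\<bar> > \<epsilon>} \<le> measure M {\<omega>\<in>space M. \<epsilon> \<le> \<bar>?Y \<omega>\<bar>}"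
      using Ym by (intro finite_measure_mono) auto
    also have "\<dots> \<le> (\<integral>x. (?Y x)\<^sup>2 \<partial>M) / \<epsilon>\<^sup>2"
      by (rule chebyshev_second_moment[OF Ym m(1) e])
    also have "\<dots> \<le> (\<delta>\<^sup>2 * V) / \<epsilon>\<^sup>2" using m(2) e by (intro divide_right_mono) (auto simp: V_def)
    also have "\<dots> \<le> \<epsilon>"
    proof -
      have "\<delta>\<^sup>2 * V \<le> \<epsilon>^3" unfolding d(2) using V e by (simp add: field_simps)
      then show ?thesis using e by (simp add: field_simps power3_eq_cube power2_eq_square)
    qed
    finally show "measure M {\<omega>\<in>space M. \<bar>?Y \<omega>\<bar> > \<epsilon>} \<le> \<epsilon>" .
  qed
qed

end

section \<open>Maximal functions of continuous square integrable martingales\<close>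

text \<open>
  Fatou's lemma for almost sure limits.  Applied to indicators it lets probability bounds pass to
  limits.
\<close>

lemma nn_integral_AE_limit_le:
  fixes f :: "nat \<Rightarrow> 'a \<Rightarrow> real"
  assumes m: "\<And>n. f n \<in> borel_measurable M"
    and lim: "AE x in M. (\<lambda>n. f n x) \<longlonglongrightarrow> g x"
    and le: "\<And>n. (\<integral>\<^sup>+x. ennreal (f n x) \<partial>M) \<le> C"
  shows "(\<integral>\<^sup>+x. ennreal (g x) \<partial>M) \<le> C"
proof -
  have "(\<integral>\<^sup>+x. ennreal (g x) \<partial>M) = (\<integral>\<^sup>+x. liminf (\<lambda>n. ennreal (f n x)) \<partial>M)"
  proof (rule nn_integral_cong_AE)
    show "AE x in M. ennreal (g x) = liminf (\<lambda>n. ennreal (f n x))"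
      using lim
    proof eventually_elim
      case (elim x)
      from tendsto_ennrealI[OF this] show ?case by (intro lim_imp_Liminf[symmetric]) auto
    qed
  qed
  also have "\<dots> \<le> liminf (\<lambda>n. \<integral>\<^sup>+x. ennreal (f n x) \<partial>M)"
    by (rule nn_integral_liminf) (use m in measurable)
  also have "\<dots> \<le> C"
  proof -
    have "liminf (\<lambda>n. \<integral>\<^sup>+x. ennreal (f n x) \<partial>M) \<le> liminf (\<lambda>n. C)"
      by (rule Liminf_mono) (use le in auto)
    then show ?thesis by (simp add: Liminf_const)
  qed
  finally show ?thesis .
qed

context filtered_space begin

lemma adapted_measurable: "adapted K X \<Longrightarrow> 0 \<le> t \<Longrightarrow> X t \<in> borel_measurable M"
  using filt_measurable by (auto simp: adapted_def)

text \<open>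
  Doob's inequality on finer and finer grids.  A path that reaches the level \<open>a\<close> exceeds \<open>a / 2\<close> on
  all sufficiently fine grids, which costs the factor 4 and avoids monotone unions.
\<close>

lemma maximal_prob_bound:
  assumes X: "martingale X" and ad: "adapted K X" and c: "continuous_paths M X"
    and sq: "\<And>t. 0 \<le> t \<Longrightarrow> integrable M (\<lambda>x. (X t x)\<^sup>2)"
    and N: "0 \<le> N" and a: "0 < a"
  shows "{x \<in> space M. \<exists>s\<in>{0..N}. a \<le> \<bar>X s x - X 0 x\<bar>} \<in> sets M" (is "?A \<in> _")
    and "prob {x \<in> space M. \<exists>s\<in>{0..N}. a \<le> \<bar>X s x - X 0 x\<bar>} \<le> 4 * (\<integral>x. (X N x - X 0 x)\<^sup>2 \<partial>M) / a\<^sup>2"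
proof -
  have Xm: "X t \<in> borel_measurable M" if "0 \<le> t" for t using adapted_measurable[OF ad that] .
  have "{x \<in> space M. \<exists>s\<in>{0..N}. max (a - \<bar>X s x - X 0 x\<bar>) 0 = 0} \<in> sets M"
  proof (rule zero_exists_sets_AE[OF full_subalgebra_self _ N])
    show "(\<lambda>x. max (a - \<bar>X s x - X 0 x\<bar>) 0) \<in> borel_measurable M" if "s \<in> {0..N}" for s
      using Xm[of s] Xm[of 0] that by auto
    show "AE x in M. continuous_on {0..N} (\<lambda>s. max (a - \<bar>X s x - X 0 x\<bar>) 0)"
      using c unfolding continuous_paths_def
    proof eventually_elim
      case (elim x)
      then have "continuous_on {0..N} (\<lambda>t. X t x)" by (rule continuous_on_subset) auto
      then show ?case by (intro continuous_intros)
    qed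
  qed
  moreover have "(max (a - y) 0 = 0) = (a \<le> y)" for y :: real by (auto simp: max_def)
  ultimately show A: "?A \<in> sets M" by simp
  define g where "g k j = N * real j / real (Suc k)" for k j
  have g0: "0 \<le> g k j" for k j using N by (auto simp: g_def)
  have gm: "g k j \<le> g k (Suc j)" for k j using N by (auto simp: g_def intro!: divide_right_mono mult_left_mono)
  define E where "E k = {x \<in> space M. \<exists>j\<le>Suc k. a / 2 \<le> \<bar>X (g k j) x - X 0 x\<bar>}" for k
  have Em: "E k \<in> sets M" for k
  proof -
    have "E k = (\<Union>j\<in>{..Suc k}. {x \<in> space M. a / 2 \<le> \<bar>X (g k j) x - X 0 x\<bar>})" by (auto simp: E_def)
    also have "\<dots> \<in> sets M"
    proof (rule sets.finite_UN)
      show "{x \<in> space M. a / 2 \<le> \<bar>X (g k j) x - X 0 x\<bar>} \<in> sets M" for j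
        using Xm[OF g0[of k j]] Xm[of 0] by measurable
    qed simp
    finally show ?thesis .
  qed
  have PE: "prob (E k) \<le> 4 * (\<integral>x. (X N x - X 0 x)\<^sup>2 \<partial>M) / a\<^sup>2" for k
  proof -
    interpret martingale_differences M "\<lambda>i. K (g k i)" "\<lambda>_ _. 1" "\<lambda>i x. X (g k (Suc i)) x - X (g k i) x" 1
    proof
      fix i
      show "subalgebra M (K (g k i))" by (rule filt_sub[OF g0])
      show "sets (K (g k i)) \<subseteq> sets (K (g k (Suc i)))" by (rule filt_mono[OF g0 gm])
      show "(\<lambda>x. X (g k (Suc i)) x - X (g k i) x) \<in> borel_measurable (K (g k (Suc i)))"
      proof (rule borel_measurable_diff)
        show "X (g k (Suc i)) \<in> borel_measurable (K (g k (Suc i)))" using ad g0 by (auto simp: adapted_def)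
        show "X (g k i) \<in> borel_measurable (K (g k (Suc i)))"
          by (rule filt_measurable_mono[OF g0 gm]) (use ad g0 in \<open>auto simp: adapted_def\<close>)
      qed
      show "integrable M (\<lambda>x. (X (g k (Suc i)) x - X (g k i) x)\<^sup>2)"
        by (rule martingale_square_diff(1)[OF X ad sq g0 gm])
      show "(\<integral>x. indicator A x * (X (g k (Suc i)) x - X (g k i) x) \<partial>M) = 0" if "A \<in> sets (K (g k i))" for A
        by (rule martingaleD(2)[OF X g0 gm that])
    qed auto
    have p: "partial j x = X (g k j) x - X 0 x" for j x
    proof -
      have "partial j x = (\<Sum>i<j. X (g k (Suc i)) x - X (g k i) x)" by (simp add: partial_def)
      also have "\<dots> = X (g k j) x - X (g k 0) x" by (rule sum_lessThan_telescope)
      finally show ?thesis by (simp add: g_def)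
    qed
    have "prob (E k) \<le> (\<integral>x. (X (g k (Suc k)) x - X 0 x)\<^sup>2 \<partial>M) / (a / 2)\<^sup>2"
      using doob_maximal[of "a / 2" "Suc k"] a by (simp add: p E_def)
    also have "g k (Suc k) = N" by (simp add: g_def del: of_nat_Suc)
    finally show ?thesis by (simp add: power_divide mult.commute)
  qed
  have lim: "AE x in M. (\<lambda>k. indicator (?A \<inter> E k) x :: real) \<longlonglongrightarrow> indicator ?A x"
    using c unfolding continuous_paths_def
  proof eventually_elim
    case (elim x)
    show ?case
    proof (cases "x \<in> ?A")
      case True
      then obtain s where s: "s \<in> {0..N}" "a \<le> \<bar>X s x - X 0 x\<bar>" and x: "x \<in> space M" by blast
      define j where "j k = nat \<lfloor>real (Suc k) * (s / N)\<rfloor>" for k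
      have sN: "0 \<le> s / N" "s / N \<le> 1" "N * (s / N) = s" using s(1) N by (auto simp: divide_le_eq)
      have jk: "j k \<le> Suc k" for k
      proof -
        have "real (Suc k) * (s / N) \<le> real (Suc k)" by (rule mult_left_le) (use sN in auto)
        from nat_mono[OF floor_mono[OF this]] show ?thesis unfolding j_def by (simp only: floor_of_nat nat_int)
      qed
      have "(\<lambda>k. N * (real (j k) / real (Suc k))) \<longlonglongrightarrow> N * (s / N)"
        unfolding j_def by (intro tendsto_mult tendsto_const floor_approximation sN(1))
      then have "(\<lambda>k. g k (j k)) \<longlonglongrightarrow> s" unfolding sN(3) by (simp add: g_def)
      then have "(\<lambda>k. X (g k (j k)) x) \<longlonglongrightarrow> X s x"
        by (intro continuous_on_tendsto_compose[OF elim]) (use s g0 in auto)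
      then have "(\<lambda>k. \<bar>X (g k (j k)) x - X 0 x\<bar>) \<longlonglongrightarrow> \<bar>X s x - X 0 x\<bar>" by (intro tendsto_intros)
      then have "\<forall>\<^sub>F k in sequentially. a / 2 < \<bar>X (g k (j k)) x - X 0 x\<bar>"
        by (rule order_tendstoD) (use s(2) a in linarith)
      then have "\<forall>\<^sub>F k in sequentially. indicator ?A x = (indicator (?A \<inter> E k) x :: real)"
      proof eventually_elim
        case (elim k)
        then have "x \<in> E k" using jk[of k] x by (auto simp: E_def intro!: exI[of _ "j k"])
        then show ?case using True by (simp only: indicator_simps Int_iff simp_thms)
      qed
      then show ?thesis by (rule Lim_transform_eventually[OF tendsto_const])
    next
      case False
      then have "indicator (?A \<inter> E k) x = (0::real)" "indicator ?A x = (0::real)" for k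
        by (simp_all only: indicator_simps Int_iff simp_thms)
      then show ?thesis by (simp only: tendsto_const)
    qed
  qed
  have "(\<integral>\<^sup>+x. ennreal (indicator ?A x) \<partial>M) \<le> ennreal (4 * (\<integral>x. (X N x - X 0 x)\<^sup>2 \<partial>M) / a\<^sup>2)"
  proof (rule nn_integral_AE_limit_le[OF _ lim])
    show "(\<integral>\<^sup>+x. ennreal (indicator (?A \<inter> E k) x) \<partial>M) \<le> ennreal (4 * (\<integral>x. (X N x - X 0 x)\<^sup>2 \<partial>M) / a\<^sup>2)" for k
    proof -
      have "(\<integral>\<^sup>+x. ennreal (indicator (?A \<inter> E k) x) \<partial>M) = ennreal (prob (?A \<inter> E k))"
        using A Em by (simp add: ennreal_indicator emeasure_eq_measure)
      also have "\<dots> \<le> ennreal (prob (E k))" using Em by (intro ennreal_leI finite_measure_mono) auto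
      also have "\<dots> \<le> ennreal (4 * (\<integral>x. (X N x - X 0 x)\<^sup>2 \<partial>M) / a\<^sup>2)" by (intro ennreal_leI PE)
      finally show ?thesis .
    qed
  qed (use A Em in auto)
  then show "prob ?A \<le> 4 * (\<integral>x. (X N x - X 0 x)\<^sup>2 \<partial>M) / a\<^sup>2"
    using A by (simp add: ennreal_indicator emeasure_eq_measure)
qed

text \<open>
  The maximal function exceeds \<open>n + 1\<close> with probability \<open>O(1 / n\<^sup>2)\<close>, so the number of integers that
  it exceeds is integrable.
\<close>

lemma martingale_dominated:
  assumes X: "martingale X" and ad: "adapted K X" and c: "continuous_paths M X"
    and sq: "\<And>t. 0 \<le> t \<Longrightarrow> integrable M (\<lambda>x. (X t x)\<^sup>2)"
  shows "dominated M X"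
  unfolding dominated_def
proof
  fix N :: real
  define N' where "N' = max N 0"
  have N': "0 \<le> N'" by (simp add: N'_def)
  define V where "V = (\<integral>x. (X N' x - X 0 x)\<^sup>2 \<partial>M)"
  define A where "A n = {x \<in> space M. \<exists>s\<in>{0..N'}. real (Suc n) \<le> \<bar>X s x - X 0 x\<bar>}" for n :: nat
  have A: "A n \<in> sets M" "prob (A n) \<le> 4 * V / (real (Suc n))\<^sup>2" for n
    unfolding A_def V_def using maximal_prob_bound[OF X ad c sq N', of "real (Suc n)"] by simp_all
  have fin: "AE x in M. \<exists>m. \<forall>n. x \<in> A n \<longrightarrow> n < m"
    using c unfolding continuous_paths_def
  proof eventually_elim
    case (elim x)
    have "continuous_on {0..} (\<lambda>s. X s x - X 0 x)" by (intro continuous_intros elim)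
    then obtain m where m: "\<forall>s\<in>{0..N'}. \<bar>X s x - X 0 x\<bar> < real m" using continuous_halfline_bounded by blast
    have "n < m" if "x \<in> A n" for n
    proof -
      from that obtain s where "s \<in> {0..N'}" "real (Suc n) \<le> \<bar>X s x - X 0 x\<bar>" by (auto simp: A_def)
      with m have "real (Suc n) < real m" by force
      then show ?thesis by simp
    qed
    then show ?case by blast
  qed
  have summ: "summable (\<lambda>n. indicator (A n) x :: real)" if "\<forall>n. x \<in> A n \<longrightarrow> n < m" for x m
    by (rule summable_finite[of "{..<m}"]) (use that in \<open>auto simp: indicator_def\<close>)
  define Z where "Z x = \<bar>X 0 x\<bar> + (1 + (\<Sum>n. indicator (A n) x :: real))" for x
  have "integrable M (\<lambda>x. \<Sum>n. indicator (A n) x :: real)"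
  proof (rule integrable_suminf)
    show "integrable M (indicator (A n) :: 'a \<Rightarrow> real)" for n using A(1) by (simp add: emeasure_eq_measure)
    show "AE x in M. summable (\<lambda>n. norm (indicator (A n) x :: real))"
      using fin by eventually_elim (auto intro: summ)
    show "summable (\<lambda>n. \<integral>x. norm (indicator (A n) x :: real) \<partial>M)"
    proof (rule summable_comparison_test)
      show "\<exists>n0. \<forall>n\<ge>n0. norm (\<integral>x. norm (indicator (A n) x :: real) \<partial>M) \<le> 4 * V * inverse ((real (Suc n))\<^sup>2)"
        using A by (intro exI[of _ 0]) (simp add: divide_inverse)
      show "summable (\<lambda>n. 4 * V * inverse ((real (Suc n))\<^sup>2))"
        using inverse_power_summable[of 2, where 'a=real] by (intro summable_mult) (subst summable_Suc_iff, simp)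
    qed
  qed
  then have "integrable M Z"
    unfolding Z_def using martingaleD(1)[OF X, of 0] by simp
  moreover have "AE x in M. \<forall>s\<in>{0..N}. \<bar>X s x\<bar> \<le> Z x"
    using fin AE_space
  proof eventually_elim
    case (elim x)
    then obtain m where m: "\<forall>n. x \<in> A n \<longrightarrow> n < m" by blast
    show ?case
    proof
      fix s assume s: "s \<in> {0..N}"
      define k where "k = nat \<lfloor>\<bar>X s x - X 0 x\<bar>\<rfloor>"
      have k: "real k \<le> \<bar>X s x - X 0 x\<bar>" "\<bar>X s x - X 0 x\<bar> < real k + 1"
        unfolding k_def by linarith+
      have "x \<in> A n" if "n < k" for n
      proof -
        have "real (Suc n) \<le> real k" using that by simp
        then show ?thesis using k(1) s elim(2) unfolding A_def N'_def by (auto intro!: bexI[of _ s])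
      qed
      then have "real k = (\<Sum>n<k. indicator (A n) x :: real)" by (simp add: indicator_def)
      also have "\<dots> \<le> (\<Sum>n. indicator (A n) x :: real)"
        by (rule sum_le_suminf[OF summ[OF m]]) auto
      finally have "\<bar>X s x - X 0 x\<bar> \<le> 1 + (\<Sum>n. indicator (A n) x :: real)" using k(2) by linarith
      then show "\<bar>X s x\<bar> \<le> Z x" unfolding Z_def by linarith
    qed
  qed
  ultimately show "\<exists>Z. integrable M Z \<and> (AE x in M. \<forall>s\<in>{0..N}. \<bar>X s x\<bar> \<le> Z x)" by blast
qed

end

section \<open>No arbitrage for continuous martingales\<close>

lemma continuous_lower_bound:
  fixes y :: "real \<Rightarrow> real"
  assumes c: "continuous_on {0..} y" and q: "\<And>q. q \<in> \<rat> \<inter> {0..} \<Longrightarrow> a \<le> y q" and t: "0 \<le> t"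
  shows "a \<le> y t"
proof (rule ccontr)
  assume "\<not> a \<le> y t"
  then have "a - y t > 0" by simp
  then obtain d where d: "d > 0" "\<And>s. s \<in> {0..} \<Longrightarrow> dist s t < d \<Longrightarrow> dist (y s) (y t) < a - y t"
    using c t unfolding continuous_on_iff by (metis atLeast_iff)
  obtain p where p: "p \<in> insert 0 (\<rat> \<inter> {0..t})" "\<bar>p - t\<bar> < d"
    using rational_dense_near[of 0 t t d] t d by auto
  then have "p \<in> \<rat> \<inter> {0..}" by auto
  from q[OF this] d(2)[of p] p this show False by (auto simp: dist_real_def)
qed

context filtered_space begin

text \<open>
  A local martingale that is bounded below is a supermartingale: stop when \<open>\<bar>Y\<bar>\<close> reaches a high
  level, and use Fatou.
\<close>

lemma local_martingale_lower_bound_expectation: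
  assumes Y: "local_martingale Y" and c: "0 \<le> c" and lb: "AE x in M. \<forall>t\<ge>0. - c \<le> Y t x" and N: "0 \<le> N"
  shows "(\<integral>\<^sup>+x. ennreal (Y N x + c) \<partial>M) \<le> ennreal c"
proof -
  note D = local_martingaleD[OF Y]
  define T where "T m = hitting N (real (Suc m)) Y" for m
  have T: "bounded_stopping_time N (T m)" for m
    unfolding T_def by (rule hitting_stopping_time[OF D(1,2) N])
  have b: "AE x in M. \<forall>s\<in>{0..T m x}. \<bar>Y s x\<bar> \<le> real (Suc m)" for m
    using D(2,3) unfolding continuous_paths_def
  proof eventually_elim
    case (elim x)
    show ?case
    proof
      fix s assume s: "s \<in> {0..T m x}"
      show "\<bar>Y s x\<bar> \<le> real (Suc m)"
        by (rule hitting_upto[where Z=Y and a="real (Suc m)" and s=s, OF elim(1) N]) (use s elim(2) in \<open>auto simp: T_def\<close>)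
    qed
  qed
  have meas: "(\<lambda>x. Y (T m x) x) \<in> borel_measurable M" for m
    by (rule eval_stopping_measurable[OF D(1,2) T])
  have int: "integrable M (\<lambda>x. Y (T m x) x)" for m
  proof (rule Bochner_Integration.integrable_bound[of M "\<lambda>_. real (Suc m)"])
    show "AE x in M. norm (Y (T m x) x) \<le> norm (real (Suc m))"
      using b[of m] AE_space by eventually_elim (use bounded_stopping_timeD(1)[OF T] in auto)
  qed (use meas in auto)
  show ?thesis
  proof (rule nn_integral_AE_limit_le[of "\<lambda>m x. Y (T m x) x + c"])
    show "(\<lambda>x. Y (T m x) x + c) \<in> borel_measurable M" for m using meas by auto
    show "AE x in M. (\<lambda>m. Y (T m x) x + c) \<longlonglongrightarrow> Y N x + c"
      using D(2) unfolding continuous_paths_def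
    proof eventually_elim
      case (elim x)
      obtain m0 where m0: "\<forall>s\<in>{0..N}. \<bar>Y s x\<bar> < real m0" using continuous_halfline_bounded[OF elim] by blast
      have "\<forall>\<^sub>F m in sequentially. Y N x + c = Y (T m x) x + c"
        using eventually_ge_at_top[of m0]
      proof eventually_elim
        case (elim m)
        have "T m x = N" unfolding T_def
        proof (rule hitting_eq_N)
          fix s assume "s \<in> {0..N}"
          then have "\<bar>Y s x\<bar> < real m0" using m0 by blast
          then show "\<bar>Y s x\<bar> < real (Suc m)" using elim by simp
        qed
        then show ?case by simp
      qed
      then show ?case by (rule Lim_transform_eventually[OF tendsto_const])
    qed
    show "(\<integral>\<^sup>+x. ennreal (Y (T m x) x + c) \<partial>M) \<le> ennreal c" for m
    proof -
      have "(\<integral>\<^sup>+x. ennreal (Y (T m x) x + c) \<partial>M) = ennreal (\<integral>x. Y (T m x) x + c \<partial>M)"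
      proof (rule nn_integral_eq_integral)
        show "AE x in M. 0 \<le> Y (T m x) x + c" using lb AE_space
        proof eventually_elim
          case (elim x)
          have "- c \<le> Y (T m x) x" using elim(1) bounded_stopping_timeD(1)[OF T elim(2)] by blast
          then show ?case by simp
        qed
      qed (use int in auto)
      also have "(\<integral>x. Y (T m x) x + c \<partial>M) = (\<integral>x. Y (T m x) x \<partial>M) + c"
        using int by (simp add: prob_space)
      also have "\<dots> = c" using D(4)[OF T b] by simp
      finally show ?thesis by simp
    qed
  qed
qed

text \<open>
  By Fatou once more the terminal value has expectation at most the initial value 0, so it is not
  an arbitrage profit.
\<close>

lemma local_martingale_no_profit:
  assumes Y: "local_martingale Y" and c: "0 \<le> c" and lb: "\<And>t. 0 \<le> t \<Longrightarrow> AE x in M. - c \<le> Y t x"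
    and conv: "AE x in M. \<exists>l. ((\<lambda>t. Y t x) \<longlongrightarrow> l) at_top"
    and nn: "AE x in M. 0 \<le> Lim at_top (\<lambda>t. Y t x)"
  shows "measure M {x\<in>space M. Lim at_top (\<lambda>t. Y t x) > 0} = 0"
proof -
  note D = local_martingaleD[OF Y]
  define L where "L x = Lim at_top (\<lambda>t. Y t x)" for x
  have "countable (\<rat> \<inter> {0::real..})" by (intro countable_Int1) (rule countable_rat)
  then have "AE x in M. \<forall>q\<in>\<rat> \<inter> {0..}. - c \<le> Y q x"
    using lb by (subst AE_ball_countable) auto
  then have lb': "AE x in M. \<forall>t\<ge>0. - c \<le> Y t x"
    using D(2) unfolding continuous_paths_def
    by eventually_elim (use continuous_lower_bound in blast)
  have lim: "AE x in M. (\<lambda>n. Y (real n) x) \<longlonglongrightarrow> L x"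
    using conv
  proof eventually_elim
    case (elim x)
    then obtain l where l: "((\<lambda>t. Y t x) \<longlongrightarrow> l) at_top" by blast
    then have "L x = l" unfolding L_def by (intro tendsto_Lim) auto
    then show ?case using filterlim_compose[OF l filterlim_real_sequentially] by simp
  qed
  have Ym: "Y (real n) \<in> borel_measurable M" for n
    by (rule adapted_measurable[OF D(1)]) simp
  have Lm[measurable]: "L \<in> borel_measurable M"
    by (rule full_subalgebra_AE_lim[OF full_subalgebra_self Ym lim])
  have "(\<integral>\<^sup>+x. ennreal (L x + c) \<partial>M) \<le> ennreal c"
  proof (rule nn_integral_AE_limit_le[of "\<lambda>n x. Y (real n) x + c"])
    show "AE x in M. (\<lambda>n. Y (real n) x + c) \<longlonglongrightarrow> L x + c"
      using lim by eventually_elim (intro tendsto_intros)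
    show "(\<integral>\<^sup>+x. ennreal (Y (real n) x + c) \<partial>M) \<le> ennreal c" for n
      by (rule local_martingale_lower_bound_expectation[OF Y c lb']) simp
  qed (use Ym in auto)
  moreover have "(\<integral>\<^sup>+x. ennreal (L x + c) \<partial>M) = (\<integral>\<^sup>+x. ennreal (L x) \<partial>M) + ennreal c"
  proof -
    have "(\<integral>\<^sup>+x. ennreal (L x + c) \<partial>M) = (\<integral>\<^sup>+x. ennreal (L x) + ennreal c \<partial>M)"
      by (rule nn_integral_cong_AE) (use nn c in \<open>auto simp: L_def ennreal_plus elim!: eventually_mono\<close>)
    also have "\<dots> = (\<integral>\<^sup>+x. ennreal (L x) \<partial>M) + ennreal c"
      by (subst nn_integral_add) (auto simp: emeasure_space_1)
    finally show ?thesis .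
  qed
  ultimately have "(\<integral>\<^sup>+x. ennreal (L x) \<partial>M) + ennreal c \<le> 0 + ennreal c" by simp
  then have "(\<integral>\<^sup>+x. ennreal (L x) \<partial>M) \<le> 0"
    by (subst (asm) add.commute, subst (asm) (2) add.commute) (simp add: ennreal_add_left_cancel_le)
  then have "(\<integral>\<^sup>+x. ennreal (L x) \<partial>M) = 0" by simp
  then have "AE x in M. ennreal (L x) = 0" by (subst (asm) nn_integral_0_iff_AE) auto
  then have "AE x in M. \<not> 0 < L x" by eventually_elim (simp add: ennreal_eq_0_iff)
  then have "measure M {x\<in>space M. L x > 0} = 0"
    by (subst (asm) AE_iff_measurable[OF _ refl]) (auto simp: measure_def)
  then show ?thesis by (simp add: L_def)
qed

lemma continuous_paths_cadlag:
  assumes "continuous_paths M X" shows "cadlag_paths M X"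
  using assms unfolding cadlag_paths_def continuous_paths_def
proof eventually_elim
  case (elim x)
  show ?case
  proof (intro allI impI conjI)
    fix t :: real assume t: "0 \<le> t"
    have w: "((\<lambda>s. X s x) \<longlongrightarrow> X t x) (at t within {0..})" using elim t by (auto simp: continuous_on_def)
    show "((\<lambda>s. X s x) \<longlongrightarrow> X t x) (at_right t)"
      by (rule tendsto_within_subset[OF w]) (use t in auto)
    assume t: "0 < t"
    have "isCont (\<lambda>s. X s x) t"
      by (rule continuous_on_interior[OF elim]) (use t in auto)
    then have "((\<lambda>s. X s x) \<longlongrightarrow> X t x) (at_left t)"
      unfolding isCont_def by (rule filterlim_mono) (auto simp: at_le)
    then show "\<exists>l. ((\<lambda>s. X s x) \<longlongrightarrow> l) (at_left t)" by blast
  qed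
qed

lemma stoch_integral_local_martingale:
  assumes base: "\<And>g n u f. elementary M K g n u f \<Longrightarrow> local_martingale (elem_integral n u f X)"
    and Y: "stoch_integral M K X \<theta> Y"
  shows "local_martingale Y"
proof -
  from Y obtain Z where Z: "\<And>k. bounded_integral M K X (\<lambda>t \<omega>. if \<bar>\<theta> t \<omega>\<bar> \<le> real k then \<theta> t \<omega> else 0) (Z k)"
    and e: "emery_tendsto M K Z Y" unfolding stoch_integral_def by blast
  show ?thesis
  proof (rule local_martingale_ucp_limit)
    show "local_martingale (Z k)" for k by (rule bounded_integral_local_martingale[OF base Z])
    show "ucp_tendsto M Z Y" using e by (simp add: emery_tendsto_def)
  qed
qed

theorem continuous_martingale_NA:
  assumes X: "martingale X" and ad: "adapted K X" and c: "continuous_paths M X"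
    and sq: "\<And>t. 0 \<le> t \<Longrightarrow> integrable M (\<lambda>x. (X t x)\<^sup>2)"
  shows "NA M K X"
  unfolding NA_def
proof
  show "semimartingale M K X"
    unfolding semimartingale_iff
    using ad continuous_paths_cadlag[OF c] martingale_good_integrator[OF X ad sq] by blast
  show "\<not> (\<exists>\<theta>. classical_arbitrage M K X \<theta>)"
  proof
    assume "\<exists>\<theta>. classical_arbitrage M K X \<theta>"
    then obtain \<theta> Y where si: "stoch_integral M K X \<theta> Y"
      and ex: "\<exists>c\<ge>0. \<forall>t\<ge>0. AE \<omega> in M. Y t \<omega> \<ge> - c"
      and conv: "AE \<omega> in M. \<exists>l. ((\<lambda>t. Y t \<omega>) \<longlongrightarrow> l) at_top"
      and nn: "AE \<omega> in M. Lim at_top (\<lambda>t. Y t \<omega>) \<ge> 0"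
      and pos: "measure M {\<omega>\<in>space M. Lim at_top (\<lambda>t. Y t \<omega>) > 0} > 0"
      unfolding classical_arbitrage_def admissible_def by blast
    from ex obtain c' where c': "c' \<ge> 0" "\<And>t. 0 \<le> t \<Longrightarrow> AE \<omega> in M. - c' \<le> Y t \<omega>" by blast
    have "local_martingale Y"
      by (rule stoch_integral_local_martingale[OF elem_integral_local_martingale[OF X ad c martingale_dominated[OF X ad c sq]] si])
    from local_martingale_no_profit[OF this c' conv nn] pos show False by simp
  qed
qed

text \<open>
  The price of the market solves its equation only almost surely.  What is proved for the explicit
  exponential is transferred along indistinguishability.
\<close>

definition indistinguishable :: "(real \<Rightarrow> 'a \<Rightarrow> real) \<Rightarrow> (real \<Rightarrow> 'a \<Rightarrow> real) \<Rightarrow> bool" where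
  "indistinguishable X X' \<longleftrightarrow> (AE x in M. \<forall>t\<ge>0. X t x = X' t x)"

lemma indistinguishable_adapted:
  assumes "indistinguishable X X'" "adapted K X" shows "adapted K X'"
  unfolding adapted_def
proof (intro allI impI)
  fix t :: real assume t: "0 \<le> t"
  show "X' t \<in> borel_measurable (K t)"
    by (rule full_subalgebra_AE_cong[OF filt_full[OF t], of "X t"])
      (use assms t in \<open>auto simp: adapted_def indistinguishable_def elim!: eventually_mono\<close>)
qed

lemma indistinguishable_continuous:
  assumes "indistinguishable X X'" "continuous_paths M X" shows "continuous_paths M X'"
  using assms unfolding continuous_paths_def indistinguishable_def
proof eventually_elim
  case (elim x)
  show ?case by (rule continuous_on_eq[OF elim(2)]) (use elim(1) in auto)
qed

lemma indistinguishable_martingale: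
  assumes i: "indistinguishable X X'" and X: "martingale X" "adapted K X" shows "martingale X'"
proof -
  have ad: "X t \<in> borel_measurable M" "X' t \<in> borel_measurable M" if "0 \<le> t" for t
    using adapted_measurable[OF X(2) that] adapted_measurable[OF indistinguishable_adapted[OF i X(2)] that] by auto
  have e: "AE x in M. X t x = X' t x" if "0 \<le> t" for t
    using i that by (auto simp: indistinguishable_def elim!: eventually_mono)
  show ?thesis
    unfolding martingale_def
  proof (intro conjI allI impI)
    fix t :: real assume t: "0 \<le> t"
    show "integrable M (X' t)"
      using integrable_cong_AE[OF ad(1)[OF t] ad(2)[OF t] e[OF t]] martingaleD(1)[OF X(1) t] by simp
  next
    fix s t :: real and A assume st: "0 \<le> s" "s \<le> t" and A: "A \<in> sets (K s)"
    then have t: "0 \<le> t" by simp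
    have [measurable]: "A \<in> sets M" using A filt_sub[OF st(1)] by (auto simp: subalgebra_def)
    note [measurable] = ad[OF st(1)] ad[OF t]
    have "(\<integral>x. indicator A x * (X' t x - X' s x) \<partial>M) = (\<integral>x. indicator A x * (X t x - X s x) \<partial>M)"
    proof (rule integral_cong_AE)
      show "AE x in M. indicator A x * (X' t x - X' s x) = indicator A x * (X t x - X s x)"
        using e[OF t] e[OF st(1)] by eventually_elim simp
    qed measurable
    then show "(\<integral>x. indicator A x * (X' t x - X' s x) \<partial>M) = 0"
      using martingaleD(2)[OF X(1) st A] by simp
  qed
qed

lemma indistinguishable_elem_integral:
  assumes i: "indistinguishable X X'" and el: "elementary M K g n u f"
  shows "indistinguishable (elem_integral n u f X) (elem_integral n u f X')"
  using i unfolding indistinguishable_def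
proof eventually_elim
  case (elim x)
  have "0 \<le> u i" if "i \<le> n" for i using elementary_grid(1)[OF el order_refl that] .
  then show ?case using elim by (auto simp: elem_integral_def intro!: sum.cong)
qed

lemma indistinguishable_good_integrator:
  assumes i: "indistinguishable X X'" and X: "good_integrator X" "adapted K X" shows "good_integrator X'"
  unfolding good_integrator_def
proof (intro allI impI)
  fix t \<epsilon> :: real assume t: "0 \<le> t" and e: "0 < \<epsilon>"
  obtain \<delta> where d: "\<delta> > 0" and D: "\<And>g n u f. elementary M K g n u f \<Longrightarrow> bounded_by M (elem_process g n u f) \<delta> \<Longrightarrow>
        measure M {\<omega>\<in>space M. \<bar>elem_integral n u f X t \<omega>\<bar> > \<epsilon>} \<le> \<epsilon>"
    using X(1)[unfolded good_integrator_def, rule_format, OF t e] by auto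
  show "\<exists>\<delta>>0. \<forall>g n u f. elementary M K g n u f \<and> bounded_by M (elem_process g n u f) \<delta> \<longrightarrow>
        measure M {\<omega>\<in>space M. \<bar>elem_integral n u f X' t \<omega>\<bar> > \<epsilon>} \<le> \<epsilon>"
  proof (intro exI[of _ \<delta>] conjI d allI impI, elim conjE)
    fix g n u f assume el: "elementary M K g n u f" and b: "bounded_by M (elem_process g n u f) \<delta>"
    have [measurable]: "elem_integral n u f X t \<in> borel_measurable M" "elem_integral n u f X' t \<in> borel_measurable M"
      using adapted_measurable[OF elem_integral_adapted[OF X(2) el] t]
        adapted_measurable[OF elem_integral_adapted[OF indistinguishable_adapted[OF i X(2)] el] t] by auto
    have "measure M {\<omega>\<in>space M. \<bar>elem_integral n u f X' t \<omega>\<bar> > \<epsilon>} = measure M {\<omega>\<in>space M. \<bar>elem_integral n u f X t \<omega>\<bar> > \<epsilon>}"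
    proof (rule measure_eq_AE)
      show "AE x in M. (x \<in> {\<omega>\<in>space M. \<bar>elem_integral n u f X' t \<omega>\<bar> > \<epsilon>}) = (x \<in> {\<omega>\<in>space M. \<bar>elem_integral n u f X t \<omega>\<bar> > \<epsilon>})"
        using indistinguishable_elem_integral[OF i el] unfolding indistinguishable_def
          by eventually_elim (use t in auto)
    qed measurable
    then show "measure M {\<omega>\<in>space M. \<bar>elem_integral n u f X' t \<omega>\<bar> > \<epsilon>} \<le> \<epsilon>" using D[OF el b] by simp
  qed
qed

lemma good_integrator_add:
  assumes X: "good_integrator X" "adapted K X" and Y: "good_integrator Y" "adapted K Y"
  shows "good_integrator (\<lambda>t x. X t x + Y t x)"
  unfolding good_integrator_def
proof (intro allI impI)
  fix t \<epsilon> :: real assume t: "0 \<le> t" and e: "0 < \<epsilon>"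
  then have e2: "0 < \<epsilon> / 2" by simp
  obtain d1 where d1: "d1 > 0" "\<And>g n u f. elementary M K g n u f \<and> bounded_by M (elem_process g n u f) d1 \<Longrightarrow>
        measure M {\<omega>\<in>space M. \<bar>elem_integral n u f X t \<omega>\<bar> > \<epsilon> / 2} \<le> \<epsilon> / 2"
    using X(1)[unfolded good_integrator_def, rule_format, OF t e2] by auto
  obtain d2 where d2: "d2 > 0" "\<And>g n u f. elementary M K g n u f \<and> bounded_by M (elem_process g n u f) d2 \<Longrightarrow>
        measure M {\<omega>\<in>space M. \<bar>elem_integral n u f Y t \<omega>\<bar> > \<epsilon> / 2} \<le> \<epsilon> / 2"
    using Y(1)[unfolded good_integrator_def, rule_format, OF t e2] by auto
  show "\<exists>\<delta>>0. \<forall>g n u f. elementary M K g n u f \<and> bounded_by M (elem_process g n u f) \<delta> \<longrightarrow>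
        measure M {\<omega>\<in>space M. \<bar>elem_integral n u f (\<lambda>t x. X t x + Y t x) t \<omega>\<bar> > \<epsilon>} \<le> \<epsilon>"
  proof (intro exI[of _ "min d1 d2"] conjI allI impI)
    show "0 < min d1 d2" using d1 d2 by simp
    fix g n u f assume A: "elementary M K g n u f \<and> bounded_by M (elem_process g n u f) (min d1 d2)"
    then have el: "elementary M K g n u f" by simp
    have b: "bounded_by M (elem_process g n u f) d1" "bounded_by M (elem_process g n u f) d2"
      using A by (auto simp: bounded_by_def)
    let ?X = "{\<omega>\<in>space M. \<bar>elem_integral n u f X t \<omega>\<bar> > \<epsilon> / 2}" and ?Y = "{\<omega>\<in>space M. \<bar>elem_integral n u f Y t \<omega>\<bar> > \<epsilon> / 2}"
    have [measurable]: "elem_integral n u f X t \<in> borel_measurable M" "elem_integral n u f Y t \<in> borel_measurable M"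
      using adapted_measurable[OF elem_integral_adapted[OF X(2) el] t] adapted_measurable[OF elem_integral_adapted[OF Y(2) el] t] by auto
    have e: "elem_integral n u f (\<lambda>t x. X t x + Y t x) t x = elem_integral n u f X t x + elem_integral n u f Y t x" for x
      unfolding elem_integral_def sum.distrib[symmetric] by (intro sum.cong refl) (simp add: algebra_simps)
    have "measure M {\<omega>\<in>space M. \<bar>elem_integral n u f (\<lambda>t x. X t x + Y t x) t \<omega>\<bar> > \<epsilon>} \<le> measure M (?X \<union> ?Y)"
      unfolding e by (rule finite_measure_mono) auto
    also have "\<dots> \<le> measure M ?X + measure M ?Y" by (rule measure_Un_le) measurable
    also have "\<dots> \<le> \<epsilon> / 2 + \<epsilon> / 2" using d1(2)[of g n u f] d2(2)[of g n u f] el b by (intro add_mono) auto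
    finally show "measure M {\<omega>\<in>space M. \<bar>elem_integral n u f (\<lambda>t x. X t x + Y t x) t \<omega>\<bar> > \<epsilon>} \<le> \<epsilon>" by simp
  qed
qed

end

section \<open>Gaussian shifts\<close>

text \<open>
  The Cameron--Martin formula in dimension one.  It evaluates all exponential moments below, and it
  identifies the compensator of the price after \<open>\<tau>\<close>.
\<close>

lemma normal_density_shift:
  assumes "\<sigma> > 0"
  shows "normal_density 0 \<sigma> (y - c * \<sigma>\<^sup>2) = normal_density 0 \<sigma> y * exp (c * y - c\<^sup>2 * \<sigma>\<^sup>2 / 2)"
proof -
  have "- (y - c * \<sigma>\<^sup>2)\<^sup>2 / (2 * \<sigma>\<^sup>2) = - y\<^sup>2 / (2 * \<sigma>\<^sup>2) + (c * y - c\<^sup>2 * \<sigma>\<^sup>2 / 2)"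
    using assms by (simp add: field_simps power2_eq_square)
  then show ?thesis by (simp add: normal_density_def exp_add[symmetric])
qed

lemma gaussian_shift:
  fixes \<phi> :: "real \<Rightarrow> real"
  assumes Z: "distributed M lborel Z (normal_density 0 \<sigma>)" and s: "\<sigma> > 0" and [measurable]: "\<phi> \<in> borel_measurable borel"
  shows "integrable M (\<lambda>x. \<phi> (Z x + c * \<sigma>\<^sup>2)) \<longleftrightarrow> integrable M (\<lambda>x. \<phi> (Z x) * exp (c * Z x - c\<^sup>2 * \<sigma>\<^sup>2 / 2))"
    and "(\<integral>x. \<phi> (Z x + c * \<sigma>\<^sup>2) \<partial>M) = (\<integral>x. \<phi> (Z x) * exp (c * Z x - c\<^sup>2 * \<sigma>\<^sup>2 / 2) \<partial>M)"
proof -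
  let ?n = "normal_density 0 \<sigma>"
  let ?f = "\<lambda>y. ?n (y - c * \<sigma>\<^sup>2) * \<phi> y"
  have e: "?f y = ?n y * (\<phi> y * exp (c * y - c\<^sup>2 * \<sigma>\<^sup>2 / 2))" for y
    unfolding normal_density_shift[OF s] by simp
  have "integrable M (\<lambda>x. \<phi> (Z x + c * \<sigma>\<^sup>2)) \<longleftrightarrow> integrable lborel (\<lambda>y. ?n y * \<phi> (y + c * \<sigma>\<^sup>2))"
    by (rule distributed_integrable[OF Z, symmetric]) auto
  also have "\<dots> \<longleftrightarrow> integrable lborel (\<lambda>y. ?f (c * \<sigma>\<^sup>2 + 1 * y))" by (simp add: add.commute)
  also have "\<dots> \<longleftrightarrow> integrable lborel ?f" by (rule lborel_integrable_real_affine_iff) simp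
  also have "\<dots> \<longleftrightarrow> integrable M (\<lambda>x. \<phi> (Z x) * exp (c * Z x - c\<^sup>2 * \<sigma>\<^sup>2 / 2))"
    unfolding e by (rule distributed_integrable[OF Z]) auto
  finally show "integrable M (\<lambda>x. \<phi> (Z x + c * \<sigma>\<^sup>2)) \<longleftrightarrow> integrable M (\<lambda>x. \<phi> (Z x) * exp (c * Z x - c\<^sup>2 * \<sigma>\<^sup>2 / 2))" .
  have "(\<integral>x. \<phi> (Z x + c * \<sigma>\<^sup>2) \<partial>M) = (\<integral>y. ?n y * \<phi> (y + c * \<sigma>\<^sup>2) \<partial>lborel)"
    by (rule distributed_integral[OF Z, symmetric]) auto
  also have "\<dots> = (\<integral>y. ?f (c * \<sigma>\<^sup>2 + 1 * y) \<partial>lborel)" by (simp add: add.commute)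
  also have "\<dots> = (\<integral>y. ?f y \<partial>lborel)"
    by (subst lborel_integral_real_affine[where c=1 and t="c * \<sigma>\<^sup>2"]) auto
  also have "\<dots> = (\<integral>x. \<phi> (Z x) * exp (c * Z x - c\<^sup>2 * \<sigma>\<^sup>2 / 2) \<partial>M)"
    unfolding e by (rule distributed_integral[OF Z]) auto
  finally show "(\<integral>x. \<phi> (Z x + c * \<sigma>\<^sup>2) \<partial>M) = (\<integral>x. \<phi> (Z x) * exp (c * Z x - c\<^sup>2 * \<sigma>\<^sup>2 / 2) \<partial>M)" .
qed

lemma gaussian_moments:
  assumes Z: "distributed M lborel Z (normal_density 0 \<sigma>)" and s: "\<sigma> > 0"
  shows "integrable M Z" "(\<integral>x. Z x \<partial>M) = 0" "integrable M (\<lambda>x. (Z x)\<^sup>2)" "(\<integral>x. (Z x)\<^sup>2 \<partial>M) = \<sigma>\<^sup>2"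
proof -
  show "integrable M Z"
    using distributed_integrable[OF Z, of "\<lambda>x. x"] integrable_normal_moment[OF s, of 0 1] by simp
  show "(\<integral>x. Z x \<partial>M) = 0"
    using distributed_integral[OF Z, of "\<lambda>x. x"] integral_normal_moment_odd[OF s, of 0 0] by simp
  show "integrable M (\<lambda>x. (Z x)\<^sup>2)"
    using distributed_integrable[OF Z, of "\<lambda>x. x\<^sup>2"] integrable_normal_moment[OF s, of 0 2] by simp
  show "(\<integral>x. (Z x)\<^sup>2 \<partial>M) = \<sigma>\<^sup>2"
    using distributed_integral[OF Z, of "\<lambda>x. x\<^sup>2"] integral_normal_moment_even[OF s, of 0 1] by simp
qed

lemma (in prob_space) gaussian_exponential:
  assumes Z: "distributed M lborel Z (normal_density 0 \<sigma>)" and s: "\<sigma> > 0"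
  shows "integrable M (\<lambda>x. exp (c * Z x - c\<^sup>2 * \<sigma>\<^sup>2 / 2))"
    and "(\<integral>x. exp (c * Z x - c\<^sup>2 * \<sigma>\<^sup>2 / 2) \<partial>M) = 1"
    and "integrable M (\<lambda>x. Z x * exp (c * Z x - c\<^sup>2 * \<sigma>\<^sup>2 / 2))"
    and "(\<integral>x. Z x * exp (c * Z x - c\<^sup>2 * \<sigma>\<^sup>2 / 2) \<partial>M) = c * \<sigma>\<^sup>2"
proof -
  show "integrable M (\<lambda>x. exp (c * Z x - c\<^sup>2 * \<sigma>\<^sup>2 / 2))"
    using gaussian_shift(1)[OF Z s, of "\<lambda>_. 1" c] by simp
  show "(\<integral>x. exp (c * Z x - c\<^sup>2 * \<sigma>\<^sup>2 / 2) \<partial>M) = 1"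
    using gaussian_shift(2)[OF Z s, of "\<lambda>_. 1" c] by (simp add: prob_space)
  note m = gaussian_moments[OF Z s]
  show "integrable M (\<lambda>x. Z x * exp (c * Z x - c\<^sup>2 * \<sigma>\<^sup>2 / 2))"
    using gaussian_shift(1)[OF Z s, of "\<lambda>x. x" c] m by simp
  show "(\<integral>x. Z x * exp (c * Z x - c\<^sup>2 * \<sigma>\<^sup>2 / 2) \<partial>M) = c * \<sigma>\<^sup>2"
    using gaussian_shift(2)[OF Z s, of "\<lambda>x. x" c] m by (simp add: prob_space)
qed

section \<open>Brownian motion: past and future\<close>

locale brownian = prob_space M + complete_measure M for M :: "'a measure" +
  fixes W :: "real \<Rightarrow> 'a \<Rightarrow> real"
  assumes BM: "brownian_motion M W"
begin

abbreviation F :: "real \<Rightarrow> 'a measure" where "F \<equiv> augmented_filtration M W"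

lemma W_meas: "0 \<le> t \<Longrightarrow> W t \<in> borel_measurable M" and W_zero: "AE x in M. W 0 x = 0"
  and W_cont: "continuous_paths M W"
  and W_dist: "0 \<le> s \<Longrightarrow> s < t \<Longrightarrow> distributed M lborel (\<lambda>x. W t x - W s x) (normal_density 0 (sqrt (t - s)))"
  and W_indep: "0 \<le> u 0 \<Longrightarrow> \<forall>i<n. u i < u (Suc i) \<Longrightarrow>
     indep_vars (\<lambda>_. borel) (\<lambda>i x. W (u (Suc i)) x - W (u i) x) {..<n}"
  using BM unfolding brownian_motion_def by blast+

lemma null_sets_sub: "null_sets M \<subseteq> sets M" by auto

lemma sets_F: "sets (F t) = sigma_sets (space M)
     ({W s -` B \<inter> space M | s B. 0 \<le> s \<and> s \<le> t \<and> B \<in> sets borel} \<union> null_sets M)"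
  and space_F[simp]: "space (F t) = space M"
proof -
  have "({W s -` B \<inter> space M | s B. 0 \<le> s \<and> s \<le> t \<and> B \<in> sets borel} \<union> null_sets M) \<subseteq> Pow (space M)"
    using sets.sets_into_space null_sets_sub by blast
  then show "sets (F t) = sigma_sets (space M)
     ({W s -` B \<inter> space M | s B. 0 \<le> s \<and> s \<le> t \<and> B \<in> sets borel} \<union> null_sets M)"
    and "space (F t) = space M"
    by (auto simp: augmented_filtration_def)
qed

lemma filtered_F: "filtered_space M F"
proof
  fix t :: real assume t: "0 \<le> t"
  have "sets (F t) \<subseteq> sets M"
    unfolding sets_F
  proof (rule sets.sigma_sets_subset)
    show "{W s -` B \<inter> space M | s B. 0 \<le> s \<and> s \<le> t \<and> B \<in> sets borel} \<union> null_sets M \<subseteq> sets M"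
      using measurable_sets[OF W_meas] by auto
  qed
  moreover have "null_sets M \<subseteq> sets (F t)" unfolding sets_F by blast
  ultimately show "full_subalgebra M (F t)" by (simp add: full_subalgebra_def subalgebra_def)
next
  fix s t :: real assume "0 \<le> s" "s \<le> t"
  then show "sets (F s) \<subseteq> sets (F t)"
    unfolding sets_F
    by (intro sigma_sets_mono' Un_mono order_refl Collect_mono) (metis order_trans)
qed

sublocale FF: filtered_space M F by (rule filtered_F)

lemma W_adapted: "0 \<le> s \<Longrightarrow> s \<le> t \<Longrightarrow> W s \<in> borel_measurable (F t)"
  by (rule measurableI) (auto simp: sets_F intro!: sigma_sets.Basic)

definition future_increments :: "real \<Rightarrow> 'a measure" where
  "future_increments w = sigma (space M)
     ({(\<lambda>x. W s x - W w x) -` B \<inter> space M | s B. w \<le> s \<and> B \<in> sets borel} \<union> null_sets M)"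

text \<open>
  The common generators of the past (\<open>I = {0..w}\<close>, base point \<open>0\<close>) and of the future (\<open>I = {w..}\<close>,
  base point \<open>w\<close>).
\<close>

definition cylinders :: "real set \<Rightarrow> real \<Rightarrow> 'a set set" where
  "cylinders I w = {{x \<in> space M. \<forall>s\<in>J. W s x - W w x \<in> A s} | J A. finite J \<and> J \<subseteq> I \<and> (\<forall>s. A s \<in> sets borel)}"

lemma increment_cylinder:
  assumes "s \<in> I" "A \<in> sets borel" shows "{x \<in> space M. W s x - W w x \<in> A} \<in> cylinders I w"
  unfolding cylinders_def
  by (rule CollectI, rule exI[of _ "{s}"], rule exI[of _ "\<lambda>_. A"]) (use assms in auto)

lemma Int_stable_cylinders: "Int_stable (cylinders I w)"
proof (rule Int_stableI)
  fix a b assume "a \<in> cylinders I w" "b \<in> cylinders I w"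
  then obtain J A J' A' where a: "a = {x \<in> space M. \<forall>s\<in>J. W s x - W w x \<in> A s}" "finite J" "J \<subseteq> I" "\<And>s. A s \<in> sets borel"
    and b: "b = {x \<in> space M. \<forall>s\<in>J'. W s x - W w x \<in> A' s}" "finite J'" "J' \<subseteq> I" "\<And>s. A' s \<in> sets borel"
    unfolding cylinders_def by blast
  let ?A = "\<lambda>s. (if s \<in> J then A s else UNIV) \<inter> (if s \<in> J' then A' s else UNIV)"
  have "a \<inter> b = {x \<in> space M. \<forall>s\<in>J \<union> J'. W s x - W w x \<in> ?A s}" unfolding a(1) b(1) by auto
  then show "a \<inter> b \<in> cylinders I w"
    unfolding cylinders_def by (intro CollectI exI[of _ "J \<union> J'"] exI[of _ ?A]) (use a b in auto)
qed

lemma cylinders_sets: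
  assumes "0 \<le> w" "I \<subseteq> {0..}" shows "cylinders I w \<subseteq> sets M"
proof
  fix a assume "a \<in> cylinders I w"
  then obtain J A where a: "a = {x \<in> space M. \<forall>s\<in>J. W s x - W w x \<in> A s}" "finite J" "J \<subseteq> I" "\<And>s. A s \<in> sets borel"
    unfolding cylinders_def by blast
  show "a \<in> sets M"
    unfolding a(1)
  proof (intro sets.sets_Collect_finite_All a(2))
    fix s assume "s \<in> J"
    then have "(\<lambda>x. W s x - W w x) \<in> borel_measurable M" using a(3) assms W_meas by auto
    from measurable_sets[OF this a(4)[of s]]
    show "{x \<in> space M. W s x - W w x \<in> A s} \<in> sets M" by (simp add: vimage_def Int_def conj_commute)
  qed
qed

text \<open>
  Independence is given for consecutive increments over one grid.  The grid of all times that occur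
  in either cylinder, together with \<open>0\<close> and \<open>w\<close>, expresses both cylinders by partial sums of
  increments, over the cells before \<open>w\<close> and after \<open>w\<close> respectively.
\<close>

lemma cylinders_independent:
  assumes w: "0 \<le> w" and J: "finite J" "J \<subseteq> {0..w}" "\<And>s. A s \<in> sets borel"
    and J': "finite J'" "J' \<subseteq> {w..}" "\<And>s. A' s \<in> sets borel"
  shows "prob ({x \<in> space M. \<forall>s\<in>J. W s x - W 0 x \<in> A s} \<inter> {x \<in> space M. \<forall>s\<in>J'. W s x - W w x \<in> A' s}) =
    prob {x \<in> space M. \<forall>s\<in>J. W s x - W 0 x \<in> A s} * prob {x \<in> space M. \<forall>s\<in>J'. W s x - W w x \<in> A' s}"
proof -
  define U where "U = insert 0 (insert w (J \<union> J'))"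
  define xs where "xs = sorted_list_of_set U"
  have U: "finite U" "U \<subseteq> {0..}" using J J' w by (auto simp: U_def)
  have xs: "set xs = U" "sorted_wrt (<) xs" using U(1) by (auto simp: xs_def)
  have "xs \<noteq> []" using xs(1) by (auto simp: U_def)
  then obtain n where n: "length xs = Suc n" by (cases xs) auto
  define u where "u i = xs ! i" for i
  have umono: "u i < u j" if "i < j" "j \<le> n" for i j
    using sorted_wrt_nth_less[OF xs(2) that(1)] that(2) n by (simp add: u_def)
  have uU: "u i \<in> U" if "i \<le> n" for i using nth_mem[of i xs] that n xs(1) by (auto simp: u_def)
  have ex: "\<exists>i\<le>n. u i = s" if "s \<in> U" for s
    using that n unfolding xs(1)[symmetric] in_set_conv_nth u_def by (metis less_Suc_eq_le)
  then obtain idx where idx: "\<And>s. s \<in> U \<Longrightarrow> idx s \<le> n" "\<And>s. s \<in> U \<Longrightarrow> u (idx s) = s" by metis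
  have u0: "u 0 = 0"
  proof -
    have "idx 0 = 0"
    proof (rule ccontr)
      assume "idx 0 \<noteq> 0"
      then have "u 0 < u (idx 0)" using idx(1)[of 0] by (intro umono) (auto simp: U_def)
      then show False using idx(2)[of 0] uU[of 0] U(2) by (auto simp: U_def)
    qed
    then show ?thesis using idx(2)[of 0] by (auto simp: U_def)
  qed
  define p where "p = idx w"
  have p: "p \<le> n" "u p = w" using idx[of w] by (auto simp: p_def U_def)
  have idxp: "idx s \<le> p" if "s \<in> J" for s
  proof (rule ccontr)
    assume "\<not> idx s \<le> p"
    then have "u p < u (idx s)" using idx(1)[of s] that by (intro umono) (auto simp: U_def)
    then show False using p(2) idx(2)[of s] that J(2) by (auto simp: U_def)
  qed
  have pidx: "p \<le> idx s" if "s \<in> J'" for s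
  proof (rule ccontr)
    assume "\<not> p \<le> idx s"
    then have "u (idx s) < u p" using p(1) by (intro umono) auto
    then show False using p(2) idx(2)[of s] that J'(2) by (auto simp: U_def)
  qed
  define inc where "inc i x = W (u (Suc i)) x - W (u i) x" for i x
  have "indep_vars (\<lambda>_. borel) inc {..<n}"
    unfolding inc_def[abs_def] by (rule W_indep) (use u0 umono in auto)
  then have ind: "indep_var (PiM {..<p} (\<lambda>_. borel)) (\<lambda>x. restrict (\<lambda>i. inc i x) {..<p})
     (PiM {p..<n} (\<lambda>_. borel)) (\<lambda>x. restrict (\<lambda>i. inc i x) {p..<n})"
    by (rule indep_var_restrict) (use p in auto)
  define Ea where "Ea = {f \<in> space (PiM {..<p} (\<lambda>_. borel :: real measure)). \<forall>s\<in>J. (\<Sum>i<idx s. f i) \<in> A s}"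
  define Eb where "Eb = {f \<in> space (PiM {p..<n} (\<lambda>_. borel :: real measure)). \<forall>s\<in>J'. (\<Sum>i\<in>{p..<idx s}. f i) \<in> A' s}"
  have Ea: "Ea \<in> sets (PiM {..<p} (\<lambda>_. borel))"
    unfolding Ea_def
  proof (intro sets.sets_Collect_finite_All J(1))
    fix s assume s: "s \<in> J"
    have "(\<lambda>f. \<Sum>i<idx s. f i) \<in> borel_measurable (PiM {..<p} (\<lambda>_. borel :: real measure))"
      using idxp[OF s] by (intro borel_measurable_sum measurable_component_singleton) auto
    from measurable_sets[OF this J(3)[of s]]
    show "{f \<in> space (PiM {..<p} (\<lambda>_. borel :: real measure)). (\<Sum>i<idx s. f i) \<in> A s} \<in> sets (PiM {..<p} (\<lambda>_. borel))"
      by (simp add: vimage_def Int_def conj_commute)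
  qed
  have Eb: "Eb \<in> sets (PiM {p..<n} (\<lambda>_. borel))"
    unfolding Eb_def
  proof (intro sets.sets_Collect_finite_All J'(1))
    fix s assume s: "s \<in> J'"
    then have "idx s \<le> n" using idx(1)[of s] by (auto simp: U_def)
    then have "(\<lambda>f. \<Sum>i\<in>{p..<idx s}. f i) \<in> borel_measurable (PiM {p..<n} (\<lambda>_. borel :: real measure))"
      by (intro borel_measurable_sum measurable_component_singleton) auto
    from measurable_sets[OF this J'(3)[of s]]
    show "{f \<in> space (PiM {p..<n} (\<lambda>_. borel :: real measure)). (\<Sum>i\<in>{p..<idx s}. f i) \<in> A' s} \<in> sets (PiM {p..<n} (\<lambda>_. borel))"
      by (simp add: vimage_def Int_def conj_commute)
  qed
  have suma: "(\<Sum>i<idx s. restrict (\<lambda>i. inc i x) {..<p} i) = W s x - W 0 x" if "s \<in> J" for s x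
  proof -
    have "(\<Sum>i<idx s. restrict (\<lambda>i. inc i x) {..<p} i) = (\<Sum>i<idx s. W (u (Suc i)) x - W (u i) x)"
      using idxp[OF that] by (intro sum.cong) (auto simp: inc_def)
    also have "\<dots> = W (u (idx s)) x - W (u 0) x" by (rule sum_lessThan_telescope)
    finally show ?thesis using idx(2)[of s] that u0 by (auto simp: U_def)
  qed
  have sumb: "(\<Sum>i\<in>{p..<idx s}. restrict (\<lambda>i. inc i x) {p..<n} i) = W s x - W w x" if "s \<in> J'" for s x
  proof -
    have "idx s \<le> n" using idx(1)[of s] that by (auto simp: U_def)
    then have "(\<Sum>i\<in>{p..<idx s}. restrict (\<lambda>i. inc i x) {p..<n} i) = (\<Sum>i\<in>{p..<idx s}. W (u (Suc i)) x - W (u i) x)"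
      by (intro sum.cong) (auto simp: inc_def)
    also have "\<dots> = W (u (idx s)) x - W (u p) x" by (rule sum_Suc_diff'[OF pidx[OF that]])
    finally show ?thesis using idx(2)[of s] that p by (auto simp: U_def)
  qed
  have a: "(\<lambda>x. restrict (\<lambda>i. inc i x) {..<p}) -` Ea \<inter> space M = {x \<in> space M. \<forall>s\<in>J. W s x - W 0 x \<in> A s}"
    unfolding Ea_def using suma by (auto simp: space_PiM)
  have b: "(\<lambda>x. restrict (\<lambda>i. inc i x) {p..<n}) -` Eb \<inter> space M = {x \<in> space M. \<forall>s\<in>J'. W s x - W w x \<in> A' s}"
    unfolding Eb_def using sumb by (auto simp: space_PiM)
  have ab: "(\<lambda>x. (restrict (\<lambda>i. inc i x) {..<p}, restrict (\<lambda>i. inc i x) {p..<n})) -` (Ea \<times> Eb) \<inter> space M =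
    ((\<lambda>x. restrict (\<lambda>i. inc i x) {..<p}) -` Ea \<inter> space M) \<inter> ((\<lambda>x. restrict (\<lambda>i. inc i x) {p..<n}) -` Eb \<inter> space M)"
    by auto
  show ?thesis using indep_varD[OF ind Ea Eb] unfolding ab a b .
qed

lemma increment_measurable:
  "0 \<le> w \<Longrightarrow> 0 \<le> s \<Longrightarrow> (\<lambda>x. W s x - W w x) \<in> borel_measurable M"
  using W_meas by simp

lemma past_cylinders_future_cylinders:
  assumes w: "0 \<le> w"
  shows "indep_set (sigma_sets (space M) (cylinders {0..w} 0)) (sigma_sets (space M) (cylinders {w..} w))"
proof (rule indep_set_sigma_sets[OF _ Int_stable_cylinders Int_stable_cylinders], rule indep_setI)
  show "cylinders {0..w} 0 \<subseteq> sets M" "cylinders {w..} w \<subseteq> sets M"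
    by (rule cylinders_sets; use w in auto)+
  fix a b assume "a \<in> cylinders {0..w} 0" "b \<in> cylinders {w..} w"
  then obtain J A J' A' where a: "a = {x \<in> space M. \<forall>s\<in>J. W s x - W 0 x \<in> A s}" "finite J" "J \<subseteq> {0..w}" "\<And>s. A s \<in> sets borel"
    and b: "b = {x \<in> space M. \<forall>s\<in>J'. W s x - W w x \<in> A' s}" "finite J'" "J' \<subseteq> {w..}" "\<And>s. A' s \<in> sets borel"
    unfolding cylinders_def by blast
  show "prob (a \<inter> b) = prob a * prob b"
    unfolding a(1) b(1) by (rule cylinders_independent[OF w a(2-4) b(2-4)])
qed

text \<open>
  Events generated by null sets and by sets that agree with events of \<open>C\<close> almost surely agree
  almost surely with events of \<open>C\<close>: this removes the completion.
\<close>

lemma sigma_sets_AE_eq: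
  assumes A: "A \<in> sigma_sets (space M) G"
    and G: "\<And>a. a \<in> G \<Longrightarrow> \<exists>a'\<in>sigma_sets (space M) C. AE x in M. x \<in> a \<longleftrightarrow> x \<in> a'"
  shows "\<exists>A'\<in>sigma_sets (space M) C. AE x in M. x \<in> A \<longleftrightarrow> x \<in> A'"
  using A
proof induction
  case (Basic a) then show ?case by (rule G)
next
  case Empty then show ?case by (intro bexI[of _ "{}"]) (auto intro: sigma_sets.Empty)
next
  case (Compl a)
  then obtain a' where a': "a' \<in> sigma_sets (space M) C" "AE x in M. x \<in> a \<longleftrightarrow> x \<in> a'" by blast
  have "AE x in M. x \<in> space M - a \<longleftrightarrow> x \<in> space M - a'" using a'(2) by eventually_elim auto
  then show ?case using sigma_sets.Compl[OF a'(1)] by blast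
next
  case (Union a)
  then have "\<forall>i. \<exists>a'. a' \<in> sigma_sets (space M) C \<and> (AE x in M. x \<in> a i \<longleftrightarrow> x \<in> a')" by blast
  then obtain a' where a': "\<And>i. a' i \<in> sigma_sets (space M) C" "\<And>i. AE x in M. x \<in> a i \<longleftrightarrow> x \<in> a' i" by metis
  have "AE x in M. \<forall>i. x \<in> a i \<longleftrightarrow> x \<in> a' i" using a'(2) unfolding AE_all_countable by blast
  then have "AE x in M. x \<in> (\<Union>i. a i) \<longleftrightarrow> x \<in> (\<Union>i. a' i)" by eventually_elim auto
  then show ?case by (intro bexI[of _ "\<Union>i. a' i"] sigma_sets.Union a'(1))
qed

lemma null_AE_eq_empty:
  "a \<in> null_sets M \<Longrightarrow> \<exists>a'\<in>sigma_sets (space M) C. AE x in M. x \<in> a \<longleftrightarrow> x \<in> a'"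
  using AE_not_in[of a M] by (intro bexI[of _ "{}"]) (auto intro: sigma_sets.Empty)

lemma past_AE_cylinder:
  assumes w: "0 \<le> w" and A: "A \<in> sets (F w)"
  shows "\<exists>A'\<in>sigma_sets (space M) (cylinders {0..w} 0). AE x in M. x \<in> A \<longleftrightarrow> x \<in> A'"
proof (rule sigma_sets_AE_eq[OF A[unfolded sets_F]])
  fix a assume "a \<in> {W s -` B \<inter> space M | s B. 0 \<le> s \<and> s \<le> w \<and> B \<in> sets borel} \<union> null_sets M"
  then consider s B where "a = W s -` B \<inter> space M" "0 \<le> s" "s \<le> w" "B \<in> sets borel" | "a \<in> null_sets M" by blast
  then show "\<exists>a'\<in>sigma_sets (space M) (cylinders {0..w} 0). AE x in M. x \<in> a \<longleftrightarrow> x \<in> a'"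
  proof cases
    case 1
    let ?a = "{x \<in> space M. W s x - W 0 x \<in> B}"
    have "?a \<in> cylinders {0..w} 0" by (rule increment_cylinder) (use 1 in auto)
    moreover have "AE x in M. x \<in> a \<longleftrightarrow> x \<in> ?a" using W_zero by eventually_elim (auto simp: 1)
    ultimately show ?thesis by (intro bexI[of _ ?a]) (auto intro: sigma_sets.Basic)
  qed (rule null_AE_eq_empty)
qed

lemma sets_future: "sets (future_increments w) = sigma_sets (space M)
     ({(\<lambda>x. W s x - W w x) -` B \<inter> space M | s B. w \<le> s \<and> B \<in> sets borel} \<union> null_sets M)"
  and space_future[simp]: "space (future_increments w) = space M"
proof -
  have "{(\<lambda>x. W s x - W w x) -` B \<inter> space M | s B. w \<le> s \<and> B \<in> sets borel} \<union> null_sets M \<subseteq> Pow (space M)"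
    using sets.sets_into_space null_sets_sub by blast
  then show "sets (future_increments w) = sigma_sets (space M)
     ({(\<lambda>x. W s x - W w x) -` B \<inter> space M | s B. w \<le> s \<and> B \<in> sets borel} \<union> null_sets M)"
    and "space (future_increments w) = space M"
    unfolding future_increments_def by simp_all
qed

lemma future_AE_cylinder:
  assumes A: "A \<in> sets (future_increments w)"
  shows "\<exists>A'\<in>sigma_sets (space M) (cylinders {w..} w). AE x in M. x \<in> A \<longleftrightarrow> x \<in> A'"
proof (rule sigma_sets_AE_eq[OF A[unfolded sets_future]])
  fix a assume "a \<in> {(\<lambda>x. W s x - W w x) -` B \<inter> space M | s B. w \<le> s \<and> B \<in> sets borel} \<union> null_sets M"
  then consider s B where "a = (\<lambda>x. W s x - W w x) -` B \<inter> space M" "w \<le> s" "B \<in> sets borel" | "a \<in> null_sets M" by blast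
  then show "\<exists>a'\<in>sigma_sets (space M) (cylinders {w..} w). AE x in M. x \<in> a \<longleftrightarrow> x \<in> a'"
  proof cases
    case 1
    have "a = {x \<in> space M. W s x - W w x \<in> B}" using 1 by auto
    also have "\<dots> \<in> cylinders {w..} w" by (rule increment_cylinder) (use 1 in auto)
    finally show ?thesis by (intro bexI[of _ a]) (auto intro: sigma_sets.Basic)
  qed (rule null_AE_eq_empty)
qed

lemma future_full: assumes "0 \<le> w" shows "full_subalgebra M (future_increments w)"
  unfolding full_subalgebra_def subalgebra_def
proof (intro conjI)
  show "sets (future_increments w) \<subseteq> sets M"
    unfolding sets_future
  proof (rule sets.sigma_sets_subset)
    show "{(\<lambda>x. W s x - W w x) -` B \<inter> space M | s B. w \<le> s \<and> B \<in> sets borel} \<union> null_sets M \<subseteq> sets M"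
      using measurable_sets[OF increment_measurable[OF assms]] assms by auto
  qed
  show "null_sets M \<subseteq> sets (future_increments w)" unfolding sets_future by blast
qed simp

lemmas future_sub = full_subalgebraD(4)[OF future_full]

lemma increment_future: "w \<le> s \<Longrightarrow> (\<lambda>x. W s x - W w x) \<in> borel_measurable (future_increments w)"
  by (rule measurableI) (auto simp: sets_future intro!: sigma_sets.Basic)

lemma past_future_independent:
  assumes w: "0 \<le> w" and A: "A \<in> sets (F w)" and B: "B \<in> sets (future_increments w)"
  shows "prob (A \<inter> B) = prob A * prob B"
proof -
  obtain A' where A': "A' \<in> sigma_sets (space M) (cylinders {0..w} 0)" "AE x in M. x \<in> A \<longleftrightarrow> x \<in> A'"
    using past_AE_cylinder[OF w A] by blast
  obtain B' where B': "B' \<in> sigma_sets (space M) (cylinders {w..} w)" "AE x in M. x \<in> B \<longleftrightarrow> x \<in> B'"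
    using future_AE_cylinder[OF B] by blast
  note ind = past_cylinders_future_cylinders[OF w]
  have M: "A \<in> sets M" "A' \<in> sets M" "B \<in> sets M" "B' \<in> sets M"
    using A B FF.filt_sub[OF w] future_sub[OF w] indep_setD_ev1[OF ind] indep_setD_ev2[OF ind] A'(1) B'(1)
    by (auto simp: subalgebra_def)
  have "prob (A \<inter> B) = prob (A' \<inter> B')"
  proof (rule measure_eq_AE)
    show "AE x in M. x \<in> A \<inter> B \<longleftrightarrow> x \<in> A' \<inter> B'" using A'(2) B'(2) by eventually_elim auto
  qed (use M in auto)
  also have "\<dots> = prob A' * prob B'" by (rule indep_setD[OF ind A'(1) B'(1)])
  also have "prob A' = prob A" by (rule measure_eq_AE) (use M A'(2) in auto)
  also have "prob B' = prob B" by (rule measure_eq_AE) (use M B'(2) in auto)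
  finally show ?thesis .
qed

lemma past_future_indep_var:
  fixes g h :: "'a \<Rightarrow> real"
  assumes w: "0 \<le> w" and g: "g \<in> borel_measurable (F w)" and h: "h \<in> borel_measurable (future_increments w)"
  shows "indep_var borel g borel h"
  unfolding indep_var_eq
proof
  show "random_variable borel g \<and> random_variable borel h"
    using FF.filt_measurable[OF w g] measurable_from_subalg[OF future_sub[OF w] h] by blast
  have sub1: "sigma_sets (space M) {g -` A \<inter> space M |A. A \<in> sets borel} \<subseteq> sets (F w)"
    using measurable_sets[OF g] by (intro sets.sigma_sets_subset[of _ "F w", unfolded space_F]) auto
  have sub2: "sigma_sets (space M) {h -` A \<inter> space M |A. A \<in> sets borel} \<subseteq> sets (future_increments w)"
    using measurable_sets[OF h] by (intro sets.sigma_sets_subset[of _ "future_increments w", unfolded space_future]) auto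
  show "indep_set (sigma_sets (space M) {g -` A \<inter> space M |A. A \<in> sets borel})
     (sigma_sets (space M) {h -` A \<inter> space M |A. A \<in> sets borel})"
  proof (rule indep_setI)
    show "sigma_sets (space M) {g -` A \<inter> space M |A. A \<in> sets borel} \<subseteq> sets M"
      using sub1 FF.filt_sub[OF w] by (auto simp: subalgebra_def)
    show "sigma_sets (space M) {h -` A \<inter> space M |A. A \<in> sets borel} \<subseteq> sets M"
      using sub2 future_sub[OF w] by (auto simp: subalgebra_def)
    show "prob (a \<inter> b) = prob a * prob b"
      if "a \<in> sigma_sets (space M) {g -` A \<inter> space M |A. A \<in> sets borel}"
        "b \<in> sigma_sets (space M) {h -` A \<inter> space M |A. A \<in> sets borel}" for a b
      using past_future_independent[OF w] that sub1 sub2 by blast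
  qed
qed

lemma past_future_expectation:
  fixes g h :: "'a \<Rightarrow> real"
  assumes w: "0 \<le> w" and g: "g \<in> borel_measurable (F w)" "integrable M g"
    and h: "h \<in> borel_measurable (future_increments w)" "integrable M h"
  shows "integrable M (\<lambda>x. g x * h x)" "(\<integral>x. g x * h x \<partial>M) = (\<integral>x. g x \<partial>M) * (\<integral>x. h x \<partial>M)"
  using indep_var_integrable[OF past_future_indep_var[OF w g(1) h(1)] g(2) h(2)]
    indep_var_lebesgue_integral[OF past_future_indep_var[OF w g(1) h(1)] g(2) h(2)] by auto

end

section \<open>Exponential martingales\<close>

context brownian begin

text \<open>A version of the Brownian motion all of whose paths are continuous and start at 0.\<close>

definition good :: "'a set" where
  "good = {x \<in> space M. continuous_on {0..} (\<lambda>t. W t x) \<and> W 0 x = 0}"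

definition B :: "real \<Rightarrow> 'a \<Rightarrow> real" where
  "B t x = (if x \<in> good then W t x else 0)"

lemma AE_good: "AE x in M. x \<in> good"
  using W_cont W_zero AE_space unfolding continuous_paths_def good_def by eventually_elim simp

lemma B_AE: "AE x in M. \<forall>t. B t x = W t x"
  using AE_good by eventually_elim (simp add: B_def)

lemma B_zero[simp]: "B 0 x = 0" by (simp add: B_def good_def)

lemma B_continuous: "continuous_on {0..} (\<lambda>t. B t x)"
  by (cases "x \<in> good") (auto simp: B_def good_def)

lemma B_F: "0 \<le> s \<Longrightarrow> s \<le> t \<Longrightarrow> B s \<in> borel_measurable (F t)"
  by (rule full_subalgebra_AE_cong[OF FF.filt_full W_adapted[of s t]])
    (use B_AE in \<open>auto elim!: eventually_mono\<close>)

lemma B_meas[measurable]: "0 \<le> s \<Longrightarrow> B s \<in> borel_measurable M"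
  using FF.filt_measurable[OF _ B_F[of s s]] by simp

lemma B_future: "0 \<le> w \<Longrightarrow> w \<le> s \<Longrightarrow> (\<lambda>x. B s x - B w x) \<in> borel_measurable (future_increments w)"
  by (rule full_subalgebra_AE_cong[OF future_full increment_future[of w s]])
    (use B_AE in \<open>auto elim!: eventually_mono\<close>)

lemma B_dist:
  assumes "0 \<le> s" "s < t"
  shows "distributed M lborel (\<lambda>x. B t x - B s x) (normal_density 0 (sqrt (t - s)))"
proof -
  have d: "distributed M lborel (\<lambda>x. W t x - W s x) (normal_density 0 (sqrt (t - s)))" by (rule W_dist[OF assms])
  have [measurable]: "B t \<in> borel_measurable M" "B s \<in> borel_measurable M" "W t \<in> borel_measurable M" "W s \<in> borel_measurable M"
    using assms W_meas by auto
  have "distr M lborel (\<lambda>x. B t x - B s x) = distr M lborel (\<lambda>x. W t x - W s x)"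
    by (rule distr_cong_AE) (use B_AE in \<open>auto elim!: eventually_mono\<close>)
  then show ?thesis using d by (simp add: distributed_def)
qed

text \<open>
  The exponential martingale with parameter \<open>a\<close>, and its quotient at two times, which is a function
  of the increment of the Brownian motion alone.
\<close>

definition expm :: "real \<Rightarrow> real \<Rightarrow> 'a \<Rightarrow> real" where
  "expm a t x = exp (a * B t x - a\<^sup>2 * t / 2)"

definition ratio :: "real \<Rightarrow> real \<Rightarrow> real \<Rightarrow> 'a \<Rightarrow> real" where
  "ratio a s t x = exp (a * (B t x - B s x) - a\<^sup>2 * (t - s) / 2)"

lemma expm_pos[simp]: "0 < expm a t x" by (simp add: expm_def)
lemma expm_0[simp]: "expm a 0 x = 1" by (simp add: expm_def)

lemma expm_ratio: "expm a t x = expm a s x * ratio a s t x"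
  unfolding expm_def ratio_def exp_add[symmetric] by (simp add: field_simps)

lemma expm_continuous: "continuous_on {0..} (\<lambda>t. expm a t x)"
  unfolding expm_def by (intro continuous_intros B_continuous) simp

lemma expm_F: "0 \<le> s \<Longrightarrow> s \<le> t \<Longrightarrow> expm a s \<in> borel_measurable (F t)"
  unfolding expm_def[abs_def] using B_F[of s t] by measurable

lemma expm_meas[measurable]: "0 \<le> s \<Longrightarrow> expm a s \<in> borel_measurable M"
  unfolding expm_def[abs_def] by measurable

lemma ratio_future: "0 \<le> s \<Longrightarrow> s \<le> t \<Longrightarrow> ratio a s t \<in> borel_measurable (future_increments s)"
  unfolding ratio_def[abs_def] using B_future[of s t] by measurable

lemma ratio_expectation:
  assumes "0 \<le> s" "s \<le> t"
  shows "integrable M (ratio a s t)" "(\<integral>x. ratio a s t x \<partial>M) = 1"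
proof -
  have "integrable M (ratio a s t) \<and> (\<integral>x. ratio a s t x \<partial>M) = 1"
  proof (cases "s = t")
    case True then show ?thesis by (simp add: ratio_def[abs_def] prob_space)
  next
    case False
    with assms have st: "s < t" by simp
    have e: "ratio a s t x = exp (a * (B t x - B s x) - a\<^sup>2 * (sqrt (t - s))\<^sup>2 / 2)" for x
      using st by (simp add: ratio_def)
    show ?thesis
      using gaussian_exponential(1,2)[OF B_dist[OF assms(1) st], of a] st by (simp add: e[abs_def])
  qed
  then show "integrable M (ratio a s t)" "(\<integral>x. ratio a s t x \<partial>M) = 1" by auto
qed

lemma expm_eq_ratio: "expm a t = ratio a 0 t"
  by (simp add: expm_def[abs_def] ratio_def[abs_def])

lemma expm_expectation:
  assumes "0 \<le> t" shows "integrable M (expm a t)" "(\<integral>x. expm a t x \<partial>M) = 1"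
  using ratio_expectation[OF order_refl assms, of a] by (simp_all add: expm_eq_ratio)

lemma expm_square: "(expm a t x)\<^sup>2 = exp (a\<^sup>2 * t) * expm (2 * a) t x"
  and ratio_square: "(ratio a s t x)\<^sup>2 = exp (a\<^sup>2 * (t - s)) * ratio (2 * a) s t x"
  unfolding expm_def ratio_def exp_add[symmetric] exp_double[symmetric] by (simp_all add: field_simps power2_eq_square)

lemma expm_square_expectation:
  assumes "0 \<le> t" shows "integrable M (\<lambda>x. (expm a t x)\<^sup>2)" "(\<integral>x. (expm a t x)\<^sup>2 \<partial>M) = exp (a\<^sup>2 * t)"
  unfolding expm_square using expm_expectation[OF assms, of "2 * a"] by simp_all

lemma ratio_square_expectation:
  assumes "0 \<le> s" "s \<le> t"
  shows "integrable M (\<lambda>x. (ratio a s t x)\<^sup>2)" "(\<integral>x. (ratio a s t x)\<^sup>2 \<partial>M) = exp (a\<^sup>2 * (t - s))"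
  unfolding ratio_square using ratio_expectation[OF assms, of "2 * a"] by simp_all

lemma expm_adapted: "adapted F (expm a)"
  using expm_F by (auto simp: adapted_def)

lemma expm_paths: "continuous_paths M (expm a)"
  by (simp add: continuous_paths_def expm_continuous)

lemma expm_martingale: "FF.martingale (expm a)"
  unfolding FF.martingale_def
proof (intro conjI allI impI)
  show "integrable M (expm a t)" if "0 \<le> t" for t by (rule expm_expectation[OF that])
  fix s t A assume st: "0 \<le> s" "s \<le> (t::real)" and A: "A \<in> sets (F s)"
  have AM: "A \<in> sets M" using A FF.filt_sub[OF st(1)] by (auto simp: subalgebra_def)
  let ?g = "\<lambda>x. indicator A x * expm a s x"
  have g: "?g \<in> borel_measurable (F s)" using A expm_F[OF st(1) order_refl, of a] by measurable
  have gi: "integrable M ?g"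
    using integrable_real_mult_indicator[OF AM expm_expectation(1)[OF st(1), of a]] by (simp add: mult.commute)
  have h: "(\<lambda>x. ratio a s t x - 1) \<in> borel_measurable (future_increments s)" using ratio_future[OF st, of a] by measurable
  have "(\<integral>x. ?g x * (ratio a s t x - 1) \<partial>M) = (\<integral>x. ?g x \<partial>M) * (\<integral>x. ratio a s t x - 1 \<partial>M)"
    by (rule past_future_expectation(2)[OF st(1) g gi h]) (use ratio_expectation(1)[OF st, of a] in auto)
  also have "(\<integral>x. ratio a s t x - 1 \<partial>M) = 0" using ratio_expectation[OF st, of a] by (simp add: prob_space)
  finally have "(\<integral>x. ?g x * (ratio a s t x - 1) \<partial>M) = 0" by simp
  moreover have "(\<lambda>x. indicator A x * (expm a t x - expm a s x)) = (\<lambda>x. ?g x * (ratio a s t x - 1))"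
    by (simp add: expm_ratio[of a t _ s] algebra_simps)
  ultimately show "(\<integral>x. indicator A x * (expm a t x - expm a s x) \<partial>M) = 0" by (simp only:)
qed

text \<open>
  The two exponential martingales with parameters \<open>a\<close> and \<open>- a\<close> control \<open>B\<close> from above and from
  below.
\<close>

lemma exp_abs_B_dominated: "dominated M (\<lambda>t x. exp (a * \<bar>B t x\<bar>))"
  unfolding dominated_def
proof
  fix N :: real
  have dom: "dominated M (expm b)" for b
    by (rule FF.martingale_dominated[OF expm_martingale expm_adapted expm_paths expm_square_expectation(1)])
  obtain Z where Z: "integrable M Z" "AE x in M. \<forall>s\<in>{0..N}. \<bar>expm a s x\<bar> \<le> Z x"
    using dom[of a] unfolding dominated_def by blast
  obtain Z' where Z': "integrable M Z'" "AE x in M. \<forall>s\<in>{0..N}. \<bar>expm (- a) s x\<bar> \<le> Z' x"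
    using dom[of "- a"] unfolding dominated_def by blast
  let ?Z = "\<lambda>x. exp (a\<^sup>2 * N / 2) * (Z x + Z' x)"
  have "AE x in M. \<forall>s\<in>{0..N}. \<bar>exp (a * \<bar>B s x\<bar>)\<bar> \<le> ?Z x"
    using Z(2) Z'(2)
  proof eventually_elim
    case (elim x)
    show ?case
    proof
      fix s assume s: "s \<in> {0..N}"
      have "exp (a * \<bar>B s x\<bar>) \<le> exp (a * B s x) + exp (- (a * B s x))" by (cases "0 \<le> B s x") auto
      also have "\<dots> = exp (a\<^sup>2 * s / 2) * (expm a s x + expm (- a) s x)"
        by (simp add: expm_def distrib_left exp_add[symmetric])
      also have "\<dots> \<le> ?Z x"
      proof (rule mult_mono)
        show "exp (a\<^sup>2 * s / 2) \<le> exp (a\<^sup>2 * N / 2)" using s by (auto intro!: mult_left_mono divide_right_mono)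
        have "\<bar>expm a s x\<bar> \<le> Z x" "\<bar>expm (- a) s x\<bar> \<le> Z' x" using elim s by auto
        then show "expm a s x + expm (- a) s x \<le> Z x + Z' x" by linarith
        show "0 \<le> expm a s x + expm (- a) s x" using expm_pos[of a s x] expm_pos[of "- a" s x] by linarith
      qed simp
      finally show "\<bar>exp (a * \<bar>B s x\<bar>)\<bar> \<le> ?Z x" by simp
    qed
  qed
  moreover have "integrable M ?Z" using Z(1) Z'(1) by simp
  ultimately show "\<exists>Z. integrable M Z \<and> (AE x in M. \<forall>s\<in>{0..N}. \<bar>exp (a * \<bar>B s x\<bar>)\<bar> \<le> Z x)" by blast
qed

end

section \<open>Uniqueness for the Black--Scholes equation\<close>

lemma jointly_measurable:
  fixes X :: "real \<Rightarrow> 'a \<Rightarrow> real"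
  assumes X: "\<And>t. 0 \<le> t \<Longrightarrow> X t \<in> borel_measurable M"
    and c: "\<And>x. x \<in> space M \<Longrightarrow> continuous_on {0..} (\<lambda>t. X t x)"
  shows "(\<lambda>p. X (max (fst p) 0) (snd p)) \<in> borel_measurable (lborel \<Otimes>\<^sub>M M)"
proof (rule borel_measurable_LIMSEQ_real)
  define g where "g n p = nat \<lfloor>real (Suc n) * max (fst p) 0\<rfloor>" for n and p :: "real \<times> 'a"
  show "(\<lambda>p. X (real (g n p) / real (Suc n)) (snd p)) \<in> borel_measurable (lborel \<Otimes>\<^sub>M M)" for n
  proof (rule measurable_compose_countable[where f="\<lambda>i p. X (real i / real (Suc n)) (snd p)" and g="g n"])
    show "(\<lambda>p. X (real i / real (Suc n)) (snd p)) \<in> borel_measurable (lborel \<Otimes>\<^sub>M M)" for i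
      by (rule measurable_compose[OF measurable_snd X]) simp
    show "g n \<in> measurable (lborel \<Otimes>\<^sub>M M) (count_space UNIV)" unfolding g_def by measurable
  qed
  fix p :: "real \<times> 'a" assume "p \<in> space (lborel \<Otimes>\<^sub>M M)"
  then have x: "snd p \<in> space M" by (auto simp: space_pair_measure)
  have "(\<lambda>n. real (g n p) / real (Suc n)) \<longlonglongrightarrow> max (fst p) 0"
    unfolding g_def by (rule floor_approximation) simp
  then show "(\<lambda>n. X (real (g n p) / real (Suc n)) (snd p)) \<longlonglongrightarrow> X (max (fst p) 0) (snd p)"
    by (intro continuous_on_tendsto_compose[OF c[OF x]]) auto
qed

lemma section_measurable:
  assumes h: "(\<lambda>p. h (fst p) (snd p)) \<in> borel_measurable (lborel \<Otimes>\<^sub>M M)" and x: "x \<in> space M"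
  shows "(\<lambda>r. h r x) \<in> borel_measurable lborel"
  using measurable_compose[OF measurable_Pair2'[OF x] h] by simp

lemma emeasure_lborel_Ioc_finite: "emeasure lborel {0<..t::real} < \<infinity>"
  by (cases "0 \<le> t") auto

lemma integrable_bounded_interval:
  fixes h :: "real \<Rightarrow> real"
  assumes m: "(\<lambda>r. indicator {0<..t} r * h r) \<in> borel_measurable lborel"
    and b: "\<And>r. 0 < r \<Longrightarrow> r \<le> t \<Longrightarrow> \<bar>h r\<bar> \<le> D"
  shows "integrable lborel (\<lambda>r. indicator {0<..t} r * h r)"
proof (rule Bochner_Integration.integrable_bound[OF _ m])
  show "integrable lborel (\<lambda>r. D * indicator {0<..t} r)" 
    by (intro integrable_mult_right integrable_real_indicator) (use emeasure_lborel_Ioc_finite in auto)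
  show "AE r in lborel. norm (indicator {0<..t} r * h r) \<le> norm (D * indicator {0<..t} r)"
    using b by (intro AE_I2) (force simp: indicator_def)
qed

lemma interval_integral_diff:
  fixes h :: "real \<Rightarrow> real"
  assumes m: "\<And>t. (\<lambda>r. indicator {0<..t} r * h r) \<in> borel_measurable lborel"
    and b: "\<And>r. 0 < r \<Longrightarrow> r \<le> t \<Longrightarrow> \<bar>h r\<bar> \<le> D" and st: "0 \<le> s" "s \<le> t"
  shows "(LINT r|lborel. indicator {0<..t} r * h r) - (LINT r|lborel. indicator {0<..s} r * h r) =
      (LINT r|lborel. indicator {s<..t} r * h r)"
    and "\<bar>LINT r|lborel. indicator {s<..t} r * h r\<bar> \<le> D * (t - s)"
proof -
  have e: "indicator {s<..t} r * h r = indicator {0<..t} r * h r - indicator {0<..s} r * h r" for r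
    using st by (auto simp: indicator_def)
  have i: "integrable lborel (\<lambda>r. indicator {0<..t} r * h r)" "integrable lborel (\<lambda>r. indicator {0<..s} r * h r)"
    by (rule integrable_bounded_interval[OF m, where D=D], use b st in auto)+
  show "(LINT r|lborel. indicator {0<..t} r * h r) - (LINT r|lborel. indicator {0<..s} r * h r) =
      (LINT r|lborel. indicator {s<..t} r * h r)"
    unfolding e using i by simp
  have "\<bar>LINT r|lborel. indicator {s<..t} r * h r\<bar> \<le> (LINT r|lborel. \<bar>indicator {s<..t} r * h r\<bar>)"
    by (rule integral_abs_bound)
  also have "\<dots> \<le> (LINT r|lborel. D * indicator {s<..t} r)"
  proof (rule integral_mono)
    show "integrable lborel (\<lambda>r. \<bar>indicator {s<..t} r * h r\<bar>)" unfolding e using i by auto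
    show "integrable lborel (\<lambda>r. D * indicator {s<..t} r)"
      by (intro integrable_mult_right integrable_real_indicator) (use st in auto)
    show "\<bar>indicator {s<..t} r * h r\<bar> \<le> D * indicator {s<..t} r" for r
      using b[of r] st by (auto simp: indicator_def)
  qed
  also have "\<dots> = D * (t - s)" using st by simp
  finally show "\<bar>LINT r|lborel. indicator {s<..t} r * h r\<bar> \<le> D * (t - s)" .
qed

lemma integral_bounded_interval:
  fixes h :: "real \<Rightarrow> real"
  assumes m: "\<And>t. (\<lambda>r. indicator {0<..t} r * h r) \<in> borel_measurable lborel"
    and b: "\<And>r. 0 < r \<Longrightarrow> r \<le> t \<Longrightarrow> \<bar>h r\<bar> \<le> D" and t: "0 \<le> t"
  shows "\<bar>LINT r|lborel. indicator {0<..t} r * h r\<bar> \<le> D * t"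
  using interval_integral_diff(2)[OF m b order_refl t] by simp

context brownian begin

lemma B_paths: "continuous_paths M B"
  by (simp add: continuous_paths_def B_continuous)

lemma B_adapted: "adapted F B"
  using B_F by (auto simp: adapted_def)

lemma increment_moments:
  assumes "0 \<le> s" "s \<le> t"
  shows "integrable M (\<lambda>x. B t x - B s x)" "(\<integral>x. B t x - B s x \<partial>M) = 0"
    "integrable M (\<lambda>x. (B t x - B s x)\<^sup>2)" "(\<integral>x. (B t x - B s x)\<^sup>2 \<partial>M) = t - s"
    "integrable M (\<lambda>x. (B t x - B s x) * ratio a s t x)" "(\<integral>x. (B t x - B s x) * ratio a s t x \<partial>M) = a * (t - s)"
proof -
  have "integrable M (\<lambda>x. B t x - B s x) \<and> (\<integral>x. B t x - B s x \<partial>M) = 0 \<and>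
    integrable M (\<lambda>x. (B t x - B s x)\<^sup>2) \<and> (\<integral>x. (B t x - B s x)\<^sup>2 \<partial>M) = t - s \<and>
    integrable M (\<lambda>x. (B t x - B s x) * ratio a s t x) \<and> (\<integral>x. (B t x - B s x) * ratio a s t x \<partial>M) = a * (t - s)"
  proof (cases "s = t")
    case False
    with assms have st: "s < t" by simp
    have sq: "(sqrt (t - s))\<^sup>2 = t - s" "sqrt (t - s) > 0" using st by auto
    have e: "ratio a s t x = exp (a * (B t x - B s x) - a\<^sup>2 * (sqrt (t - s))\<^sup>2 / 2)" for x
      using st by (simp add: ratio_def)
    show ?thesis
      using gaussian_moments[OF B_dist[OF assms(1) st] sq(2)] gaussian_exponential(3,4)[OF B_dist[OF assms(1) st] sq(2), of a]
      unfolding e sq(1) by auto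
  qed simp
  then show "integrable M (\<lambda>x. B t x - B s x)" "(\<integral>x. B t x - B s x \<partial>M) = 0"
    "integrable M (\<lambda>x. (B t x - B s x)\<^sup>2)" "(\<integral>x. (B t x - B s x)\<^sup>2 \<partial>M) = t - s"
    "integrable M (\<lambda>x. (B t x - B s x) * ratio a s t x)" "(\<integral>x. (B t x - B s x) * ratio a s t x \<partial>M) = a * (t - s)"
    by auto
qed

end

text \<open>\<open>S\<close> is the explicit solution of the equation with respect to the regular version \<open>B\<close>.\<close>

locale black_scholes = brownian +
  fixes \<sigma> S0 :: real
begin

definition S where "S t x = S0 * expm \<sigma> t x"

lemma S_0[simp]: "S 0 x = S0" by (simp add: S_def)

lemma S_continuous: "continuous_on {0..} (\<lambda>t. S t x)"
  unfolding S_def by (intro continuous_intros expm_continuous)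

lemma S_F: "0 \<le> s \<Longrightarrow> s \<le> t \<Longrightarrow> S s \<in> borel_measurable (F t)"
  unfolding S_def[abs_def] using expm_F by auto

lemma S_meas[measurable]: "0 \<le> s \<Longrightarrow> S s \<in> borel_measurable M"
  unfolding S_def[abs_def] by measurable

lemma S_square: "0 \<le> t \<Longrightarrow> integrable M (\<lambda>x. (S t x)\<^sup>2)"
  unfolding S_def power_mult_distrib using expm_square_expectation(1) by auto

lemma S_le: "0 \<le> t \<Longrightarrow> \<bar>S t x\<bar> \<le> \<bar>S0\<bar> * exp (\<bar>\<sigma>\<bar> * \<bar>B t x\<bar>)"
proof -
  assume t: "0 \<le> t"
  have "\<sigma> * B t x \<le> \<bar>\<sigma>\<bar> * \<bar>B t x\<bar>" by (metis abs_ge_self abs_mult)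
  moreover have "0 \<le> \<sigma>\<^sup>2 * t / 2" using t by simp
  ultimately have "\<sigma> * B t x - \<sigma>\<^sup>2 * t / 2 \<le> \<bar>\<sigma>\<bar> * \<bar>B t x\<bar>" by linarith
  then show ?thesis by (auto simp: S_def expm_def abs_mult intro!: mult_left_mono)
qed

lemma S_martingale: "FF.martingale S"
  unfolding FF.martingale_def
proof (intro conjI allI impI)
  show "integrable M (S t)" if "0 \<le> t" for t unfolding S_def[abs_def] using expm_expectation(1)[OF that] by simp
  fix s t A assume st: "0 \<le> s" "s \<le> (t::real)" "A \<in> sets (F s)"
  have "(\<lambda>x. indicator A x * (S t x - S s x)) = (\<lambda>x. S0 * (indicator A x * (expm \<sigma> t x - expm \<sigma> s x)))"
    by (simp add: S_def algebra_simps)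
  then show "(\<integral>x. indicator A x * (S t x - S s x) \<partial>M) = 0"
    using FF.martingaleD(2)[OF expm_martingale[of \<sigma>] st] by simp
qed

lemma S_adapted: "adapted F S" using S_F by (auto simp: adapted_def)
lemma S_paths: "continuous_paths M S" by (simp add: continuous_paths_def S_continuous)

lemma S_dominated: "dominated M S"
  by (rule FF.martingale_dominated[OF S_martingale S_adapted S_paths S_square])

lemma S_square_dominated: "dominated M (\<lambda>t x. (S t x)\<^sup>2)"
  unfolding dominated_def
proof
  fix N
  obtain Z where Z: "integrable M Z" "AE x in M. \<forall>s\<in>{0..N}. \<bar>exp (2 * \<bar>\<sigma>\<bar> * \<bar>B s x\<bar>)\<bar> \<le> Z x"
    using exp_abs_B_dominated[of "2 * \<bar>\<sigma>\<bar>"] unfolding dominated_def by auto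
  have "AE x in M. \<forall>s\<in>{0..N}. \<bar>(S s x)\<^sup>2\<bar> \<le> S0\<^sup>2 * Z x"
    using Z(2)
  proof eventually_elim
    case (elim x)
    show ?case
    proof
      fix s assume s: "s \<in> {0..N}"
      have "\<bar>S s x\<bar>\<^sup>2 \<le> (\<bar>S0\<bar> * exp (\<bar>\<sigma>\<bar> * \<bar>B s x\<bar>))\<^sup>2" by (rule power_mono[OF S_le]) (use s in auto)
      also have "\<dots> = S0\<^sup>2 * exp (2 * \<bar>\<sigma>\<bar> * \<bar>B s x\<bar>)"
        by (simp add: power_mult_distrib exp_double[symmetric] mult.assoc)
      also have "\<dots> \<le> S0\<^sup>2 * Z x" using elim s by (intro mult_left_mono) auto
      finally show "\<bar>(S s x)\<^sup>2\<bar> \<le> S0\<^sup>2 * Z x" by simp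
    qed
  qed
  moreover have "integrable M (\<lambda>x. S0\<^sup>2 * Z x)" using Z(1) by simp
  ultimately show "\<exists>Z. integrable M Z \<and> (AE x in M. \<forall>s\<in>{0..N}. \<bar>(S s x)\<^sup>2\<bar> \<le> Z x)" by (intro exI[of _ "\<lambda>x. S0\<^sup>2 * Z x"] conjI)
qed

text \<open>The quadratic variation of \<open>S0 + H \<cdot> B - S\<close>.\<close>

definition quad :: "(real \<Rightarrow> 'a \<Rightarrow> real) \<Rightarrow> real \<Rightarrow> 'a \<Rightarrow> real" where
  "quad H t x = (LINT r|lborel. indicator {0<..t} r * (H r x - \<sigma> * S r x)\<^sup>2)"

lemma quad_integrand_measurable:
  assumes H: "(\<lambda>p. indicator {0<..} (fst p) * H (fst p) (snd p)) \<in> borel_measurable (lborel \<Otimes>\<^sub>M M)"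
    and T: "T \<in> borel_measurable M"
  shows "(\<lambda>p. indicator {0<..T (snd p)} (fst p) * (H (fst p) (snd p) - \<sigma> * S (fst p) (snd p))\<^sup>2) \<in> borel_measurable (lborel \<Otimes>\<^sub>M M)"
proof -
  have Sm: "(\<lambda>p. S (max (fst p) 0) (snd p)) \<in> borel_measurable (lborel \<Otimes>\<^sub>M M)"
    by (rule jointly_measurable[OF S_meas S_continuous])
  have Tm: "(\<lambda>p. T (snd p)) \<in> borel_measurable (lborel \<Otimes>\<^sub>M M)" using T by (rule measurable_compose[OF measurable_snd])
  have e: "indicator {0<..T (snd p)} (fst p) * (H (fst p) (snd p) - \<sigma> * S (fst p) (snd p))\<^sup>2 =
    of_bool (0 < fst p \<and> fst p \<le> T (snd p)) * (indicator {0<..} (fst p) * H (fst p) (snd p) - \<sigma> * S (max (fst p) 0) (snd p))\<^sup>2" for p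
    by (auto simp: indicator_def max_def)
  show ?thesis unfolding e using Sm H Tm by measurable
qed

lemma quad_measurable:
  assumes H: "(\<lambda>p. indicator {0<..} (fst p) * H (fst p) (snd p)) \<in> borel_measurable (lborel \<Otimes>\<^sub>M M)"
    and T: "T \<in> borel_measurable M"
  shows "(\<lambda>x. quad H (T x) x) \<in> borel_measurable M"
proof -
  have "(\<lambda>(x, r). indicator {0<..T x} r * (H r x - \<sigma> * S r x)\<^sup>2) \<in> borel_measurable (M \<Otimes>\<^sub>M lborel)"
    using measurable_pair_swap[OF quad_integrand_measurable[OF assms]] by (simp add: split_def)
  then show ?thesis unfolding quad_def
    by (rule lborel.borel_measurable_lebesgue_integral)
qed

lemma quad_section_measurable:
  assumes H: "(\<lambda>p. indicator {0<..} (fst p) * H (fst p) (snd p)) \<in> borel_measurable (lborel \<Otimes>\<^sub>M M)"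
    and x: "x \<in> space M"
  shows "(\<lambda>r. indicator {0<..t} r * (H r x - \<sigma> * S r x)\<^sup>2) \<in> borel_measurable lborel"
  using section_measurable[OF quad_integrand_measurable[OF H, of "\<lambda>_. t"] x] by simp

text \<open>
  The Ito isometry for \<open>S0 + Y - S\<close> where \<open>Y\<close> is thought of as \<open>H \<cdot> B\<close>, at bounded stopping times
  up to which everything is bounded.  Like \<open>local_martingale\<close>, this form passes through the
  closure by which stochastic integrals are defined.  A solution \<open>X = S0 + (\<sigma> X) \<cdot> B\<close> then satisfies
  \<open>E (X\<^sub>T - S\<^sub>T)\<^sup>2 = \<sigma>\<^sup>2 E \<integral>\<^sub>0\<^sup>T (X\<^sub>r - S\<^sub>r)\<^sup>2 dr\<close>, and Gronwall's lemma gives uniqueness without Ito's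
  formula.
\<close>

definition isometry :: "(real \<Rightarrow> 'a \<Rightarrow> real) \<Rightarrow> (real \<Rightarrow> 'a \<Rightarrow> real) \<Rightarrow> bool" where
  "isometry H Y \<longleftrightarrow> adapted F Y \<and> continuous_paths M Y \<and> (AE x in M. Y 0 x = 0) \<and>
     (\<lambda>p. indicator {0<..} (fst p) * H (fst p) (snd p)) \<in> borel_measurable (lborel \<Otimes>\<^sub>M M) \<and>
     (\<forall>N T m. FF.bounded_stopping_time N T \<longrightarrow> (AE x in M. \<forall>s\<in>{0..T x}. \<bar>Y s x\<bar> \<le> m \<and> \<bar>B s x\<bar> \<le> m) \<longrightarrow>
        (\<exists>C. AE x in M. \<forall>s\<in>{0<..T x}. \<bar>H s x\<bar> \<le> C) \<longrightarrow>
        (\<integral>x. (S0 + Y (T x) x - S (T x) x)\<^sup>2 \<partial>M) = (\<integral>x. quad H (T x) x \<partial>M))"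

lemma isometryD:
  assumes "isometry H Y"
  shows "adapted F Y" "continuous_paths M Y" "AE x in M. Y 0 x = 0"
    "(\<lambda>p. indicator {0<..} (fst p) * H (fst p) (snd p)) \<in> borel_measurable (lborel \<Otimes>\<^sub>M M)"
    "FF.bounded_stopping_time N T \<Longrightarrow> AE x in M. \<forall>s\<in>{0..T x}. \<bar>Y s x\<bar> \<le> m \<and> \<bar>B s x\<bar> \<le> m \<Longrightarrow>
       AE x in M. \<forall>s\<in>{0<..T x}. \<bar>H s x\<bar> \<le> C \<Longrightarrow>
       (\<integral>x. (S0 + Y (T x) x - S (T x) x)\<^sup>2 \<partial>M) = (\<integral>x. quad H (T x) x \<partial>M)"
  using assms unfolding isometry_def by blast+

lemma S_le_bounded: "0 \<le> t \<Longrightarrow> \<bar>B t x\<bar> \<le> m \<Longrightarrow> \<bar>S t x\<bar> \<le> \<bar>S0\<bar> * exp (\<bar>\<sigma>\<bar> * m)"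
  by (rule order_trans[OF S_le]) (auto intro!: mult_left_mono)

lemma isometry_limit_measurable:
  assumes HY: "\<And>k. isometry (H k) (Y k)"
    and Hlim: "\<And>t x. 0 < t \<Longrightarrow> x \<in> space M \<Longrightarrow> (\<lambda>k. H k t x) \<longlonglongrightarrow> H' t x"
  shows "(\<lambda>p. indicator {0<..} (fst p) * H' (fst p) (snd p)) \<in> borel_measurable (lborel \<Otimes>\<^sub>M M)"
proof (rule borel_measurable_LIMSEQ_real[OF _ isometryD(4)[OF HY]])
  fix p :: "real \<times> 'a" assume "p \<in> space (lborel \<Otimes>\<^sub>M M)"
  then have x: "snd p \<in> space M" by (auto simp: space_pair_measure)
  show "(\<lambda>k. indicator {0<..} (fst p) * H k (fst p) (snd p)) \<longlonglongrightarrow> indicator {0<..} (fst p) * H' (fst p) (snd p)"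
    by (cases "0 < fst p") (auto intro: Hlim x tendsto_intros)
qed

text \<open>
  Stopped at the approximants' stopping times the integrals are uniformly bounded, so both sides
  converge by dominated convergence.  The bound \<open>C\<close> refers to times before \<open>T\<close>, because the
  truncations of an unbounded integrand have no common bound on the whole time axis.
\<close>

lemma isometry_limit_identity:
  assumes HY: "\<And>k. isometry (H k) (Y k)" and ucp: "ucp_tendsto M Y Y'"
    and Hlim: "\<And>t x. 0 < t \<Longrightarrow> x \<in> space M \<Longrightarrow> (\<lambda>k. H k t x) \<longlonglongrightarrow> H' t x"
    and T: "FF.bounded_stopping_time N T"
    and b: "AE x in M. \<forall>s\<in>{0..T x}. \<bar>Y' s x\<bar> \<le> m \<and> \<bar>B s x\<bar> \<le> m"
    and C: "AE x in M. \<forall>s\<in>{0<..T x}. \<forall>k. \<bar>H k s x\<bar> \<le> C"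
  shows "(\<integral>x. (S0 + Y' (T x) x - S (T x) x)\<^sup>2 \<partial>M) = (\<integral>x. quad H' (T x) x \<partial>M)"
proof -
  note D = isometryD[OF HY]
  note Y' = FF.ucp_limit[OF D(1,2) ucp]
  obtain r T' where r: "filterlim r at_top sequentially" and T': "\<And>k. FF.bounded_stopping_time N (T' k)" "\<And>k x. T' k x \<le> T x"
    "\<And>k. AE x in M. \<forall>s\<in>{0..T' k x}. \<bar>Y (r k) s x - Y' s x\<bar> \<le> 1"
    "AE x in M. \<forall>\<^sub>F k in sequentially. T' k x = T x"
    "AE x in M. (\<lambda>k. Y (r k) (T' k x) x) \<longlonglongrightarrow> Y' (T x) x"
    by (rule FF.ucp_localize[OF D(1,2,3) ucp T]) (rule that)
  have Sad: "adapted F S" "continuous_paths M S"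
    using S_F by (auto simp: adapted_def continuous_paths_def S_continuous)
  define K where "K = \<bar>S0\<bar> * exp (\<bar>\<sigma>\<bar> * m)"
  define D1 where "D1 = (C + \<bar>\<sigma>\<bar> * K)\<^sup>2"
  have T'0: "0 \<le> T' k x" "T' k x \<le> N" if "x \<in> space M" for k x
    using FF.bounded_stopping_timeD(1,2)[OF T'(1) that] by auto
  have bk: "AE x in M. \<forall>s\<in>{0..T' k x}. \<bar>Y (r k) s x\<bar> \<le> m + 1 \<and> \<bar>B s x\<bar> \<le> m + 1" for k
    using b T'(3)[of k]
  proof eventually_elim
    case (elim x)
    show ?case
    proof
      fix s assume s: "s \<in> {0..T' k x}"
      then have "\<bar>Y' s x\<bar> \<le> m" "\<bar>B s x\<bar> \<le> m" "\<bar>Y (r k) s x - Y' s x\<bar> \<le> 1" using elim T'(2)[of k x] by auto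
      then show "\<bar>Y (r k) s x\<bar> \<le> m + 1 \<and> \<bar>B s x\<bar> \<le> m + 1" by linarith
    qed
  qed
  have Ck: "AE x in M. \<forall>s\<in>{0<..T' k x}. \<bar>H (r k) s x\<bar> \<le> C" for k
    using C
  proof eventually_elim
    case (elim x) then show ?case using T'(2)[of k x] by auto
  qed
  have id: "(\<integral>x. (S0 + Y (r k) (T' k x) x - S (T' k x) x)\<^sup>2 \<partial>M) = (\<integral>x. quad (H (r k)) (T' k x) x \<partial>M)" for k
    by (rule D(5)[OF T'(1) bk Ck])
  have "(\<lambda>k. \<integral>x. (S0 + Y (r k) (T' k x) x - S (T' k x) x)\<^sup>2 \<partial>M) \<longlonglongrightarrow> (\<integral>x. (S0 + Y' (T x) x - S (T x) x)\<^sup>2 \<partial>M)"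
  proof (rule integral_dominated_convergence[where w="\<lambda>_. (\<bar>S0\<bar> + (m + 1) + K)\<^sup>2"])
    show "(\<lambda>x. (S0 + Y' (T x) x - S (T x) x)\<^sup>2) \<in> borel_measurable M"
      using FF.eval_stopping_measurable[OF Y'(1,2) T] FF.eval_stopping_measurable[OF Sad T] by measurable
    show "(\<lambda>x. (S0 + Y (r k) (T' k x) x - S (T' k x) x)\<^sup>2) \<in> borel_measurable M" for k
      using FF.eval_stopping_measurable[OF D(1,2) T'(1)] FF.eval_stopping_measurable[OF Sad T'(1)] by measurable
    show "AE x in M. (\<lambda>k. (S0 + Y (r k) (T' k x) x - S (T' k x) x)\<^sup>2) \<longlonglongrightarrow> (S0 + Y' (T x) x - S (T x) x)\<^sup>2"
      using T'(4,5)
    proof eventually_elim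
      case (elim x)
      have "(\<lambda>k. S (T' k x) x) \<longlonglongrightarrow> S (T x) x"
        by (rule Lim_transform_eventually[OF tendsto_const]) (use elim(1) in \<open>auto elim: eventually_mono\<close>)
      then show ?case using elim(2) by (intro tendsto_intros)
    qed
    show "AE x in M. norm ((S0 + Y (r k) (T' k x) x - S (T' k x) x)\<^sup>2) \<le> (\<bar>S0\<bar> + (m + 1) + K)\<^sup>2" for k
      using bk[of k] b AE_space
    proof eventually_elim
      case (elim x)
      have t: "0 \<le> T' k x" using T'0[OF elim(3)] by simp
      have 1: "\<bar>Y (r k) (T' k x) x\<bar> \<le> m + 1" using elim(1) t by auto
      have "\<bar>B (T' k x) x\<bar> \<le> m" using elim(2) t T'(2)[of k x] by auto
      then have 2: "\<bar>S (T' k x) x\<bar> \<le> K" unfolding K_def by (rule S_le_bounded[OF t])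
      have "\<bar>S0 + Y (r k) (T' k x) x - S (T' k x) x\<bar> \<le> \<bar>S0\<bar> + (m + 1) + K" using 1 2 by linarith
      then have "\<bar>S0 + Y (r k) (T' k x) x - S (T' k x) x\<bar>\<^sup>2 \<le> (\<bar>S0\<bar> + (m + 1) + K)\<^sup>2" by (rule power_mono) simp
      then show ?case by simp
    qed
  qed auto
  moreover have "(\<lambda>k. \<integral>x. quad (H (r k)) (T' k x) x \<partial>M) \<longlonglongrightarrow> (\<integral>x. quad H' (T x) x \<partial>M)"
  proof (rule integral_dominated_convergence[where w="\<lambda>_. D1 * N"])
    note Hm = isometry_limit_measurable[OF HY Hlim]
    show "(\<lambda>x. quad H' (T x) x) \<in> borel_measurable M"
      by (rule quad_measurable[OF Hm FF.bounded_stopping_time_measurable[OF T]])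
    show "(\<lambda>x. quad (H (r k)) (T' k x) x) \<in> borel_measurable M" for k
      by (rule quad_measurable[OF D(4) FF.bounded_stopping_time_measurable[OF T'(1)]])
    have bnd: "AE x in M. \<forall>k. \<forall>s. 0 < s \<longrightarrow> s \<le> T x \<longrightarrow> \<bar>(H k s x - \<sigma> * S s x)\<^sup>2\<bar> \<le> D1"
      using b C
    proof eventually_elim
      case (elim x)
      show ?case
      proof (intro allI impI)
        fix k s assume s: "0 < s" "s \<le> T x"
        have "\<bar>H k s x\<bar> \<le> C" "\<bar>S s x\<bar> \<le> K" using elim s by (auto simp: K_def intro!: S_le_bounded)
        then have "\<bar>H k s x\<bar> + \<bar>\<sigma>\<bar> * \<bar>S s x\<bar> \<le> C + \<bar>\<sigma>\<bar> * K" by (intro add_mono mult_left_mono) auto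
        then have "\<bar>H k s x - \<sigma> * S s x\<bar> \<le> C + \<bar>\<sigma>\<bar> * K"
          using abs_triangle_ineq4[of "H k s x" "\<sigma> * S s x"] by (simp add: abs_mult)
        then have "\<bar>H k s x - \<sigma> * S s x\<bar>\<^sup>2 \<le> D1" unfolding D1_def by (rule power_mono) simp
        then show "\<bar>(H k s x - \<sigma> * S s x)\<^sup>2\<bar> \<le> D1" by simp
      qed
    qed
    show "AE x in M. norm (quad (H (r k)) (T' k x) x) \<le> D1 * N" for k
      using bnd AE_space
    proof eventually_elim
      case (elim x)
      have "\<bar>quad (H (r k)) (T' k x) x\<bar> \<le> D1 * T' k x" unfolding quad_def
        by (rule integral_bounded_interval[OF quad_section_measurable[OF D(4) elim(2)]])
          (use elim(1) T'(2)[of k x] T'0[OF elim(2)] in \<open>auto intro: order_trans\<close>)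
      also have "\<dots> \<le> D1 * N" using T'0[OF elim(2)] by (intro mult_left_mono) (auto simp: D1_def)
      finally show ?case by simp
    qed
    show "AE x in M. (\<lambda>k. quad (H (r k)) (T' k x) x) \<longlonglongrightarrow> quad H' (T x) x"
      using bnd AE_space T'(4)
    proof eventually_elim
      case (elim x)
      have "(\<lambda>k. quad (H (r k)) (T x) x) \<longlonglongrightarrow> quad H' (T x) x"
        unfolding quad_def
      proof (rule integral_dominated_convergence[where w="\<lambda>s. D1 * indicator {0<..T x} s"])
        show "(\<lambda>s. indicator {0<..T x} s * (H' s x - \<sigma> * S s x)\<^sup>2) \<in> borel_measurable lborel"
          by (rule quad_section_measurable[OF Hm elim(2)])
        show "(\<lambda>s. indicator {0<..T x} s * (H (r k) s x - \<sigma> * S s x)\<^sup>2) \<in> borel_measurable lborel" for k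
          by (rule quad_section_measurable[OF D(4) elim(2)])
        show "integrable lborel (\<lambda>s. D1 * indicator {0<..T x} s)"
          by (intro integrable_mult_right integrable_real_indicator) (use emeasure_lborel_Ioc_finite in auto)
        show "AE s in lborel. (\<lambda>k. indicator {0<..T x} s * (H (r k) s x - \<sigma> * S s x)\<^sup>2) \<longlonglongrightarrow> indicator {0<..T x} s * (H' s x - \<sigma> * S s x)\<^sup>2"
        proof (rule AE_I2)
          fix s
          show "(\<lambda>k. indicator {0<..T x} s * (H (r k) s x - \<sigma> * S s x)\<^sup>2) \<longlonglongrightarrow> indicator {0<..T x} s * (H' s x - \<sigma> * S s x)\<^sup>2"
          proof (cases "0 < s")
            case True
            have "(\<lambda>k. H (r k) s x) \<longlonglongrightarrow> H' s x" by (rule filterlim_compose[OF Hlim[OF True elim(2)] r])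
            then show ?thesis by (intro tendsto_intros)
          qed simp
        qed
        show "AE s in lborel. norm (indicator {0<..T x} s * (H (r k) s x - \<sigma> * S s x)\<^sup>2) \<le> D1 * indicator {0<..T x} s" for k
          using elim(1) by (intro AE_I2) (auto simp: indicator_def)
      qed
      then show ?case by (rule Lim_transform_eventually) (use elim(3) in \<open>auto elim: eventually_mono\<close>)
    qed
  qed simp
  ultimately show ?thesis unfolding id by (rule LIMSEQ_unique)
qed

lemma isometry_limit:
  assumes HY: "\<And>k. isometry (H k) (Y k)" and ucp: "ucp_tendsto M Y Y'"
    and Hlim: "\<And>t x. 0 \<le> t \<Longrightarrow> x \<in> space M \<Longrightarrow> (\<lambda>k. H k t x) \<longlonglongrightarrow> H' t x"
    and C: "\<And>k. bounded_by M (H k) C"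
  shows "isometry H' Y'"
  unfolding isometry_def
proof (intro conjI allI impI)
  note D = isometryD[OF HY]
  note Y' = FF.ucp_limit[OF D(1,2) ucp]
  show "adapted F Y'" "continuous_paths M Y'" "AE x in M. Y' 0 x = 0" using Y'(1,2) Y'(3)[OF D(3)] by auto
  show "(\<lambda>p. indicator {0<..} (fst p) * H' (fst p) (snd p)) \<in> borel_measurable (lborel \<Otimes>\<^sub>M M)"
    by (rule isometry_limit_measurable[OF HY Hlim]) simp_all
  fix N T m assume T: "FF.bounded_stopping_time N T" and b: "AE x in M. \<forall>s\<in>{0..T x}. \<bar>Y' s x\<bar> \<le> m \<and> \<bar>B s x\<bar> \<le> m"
  show "(\<integral>x. (S0 + Y' (T x) x - S (T x) x)\<^sup>2 \<partial>M) = (\<integral>x. quad H' (T x) x \<partial>M)"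
  proof (rule isometry_limit_identity[OF HY ucp _ T b])
    show "AE x in M. \<forall>s\<in>{0<..T x}. \<forall>k. \<bar>H k s x\<bar> \<le> C"
      using C by (intro AE_I2) (auto simp: bounded_by_def)
  qed (use Hlim in auto)
qed

end

lemma interval_integral_continuous:
  fixes h :: "real \<Rightarrow> real"
  assumes m: "\<And>t. (\<lambda>r. indicator {0<..t} r * h r) \<in> borel_measurable lborel"
    and b: "\<And>t. \<exists>D. \<forall>r. 0 < r \<longrightarrow> r \<le> t \<longrightarrow> \<bar>h r\<bar> \<le> D"
  shows "continuous_on {0..} (\<lambda>t. LINT r|lborel. indicator {0<..t} r * h r)"
proof (rule continuous_on_halfline)
  fix N :: real
  obtain D where D: "\<And>r. 0 < r \<Longrightarrow> r \<le> N \<Longrightarrow> \<bar>h r\<bar> \<le> D" using b[of N] by blast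
  define K where "K = \<bar>D\<bar>"
  let ?I = "\<lambda>t. LINT r|lborel. indicator {0<..t} r * h r"
  have d: "\<bar>?I t - ?I s\<bar> \<le> K * \<bar>t - s\<bar>" if "s \<in> {0..N}" "t \<in> {0..N}" for s t
    using that
  proof (induction s t rule: linorder_wlog)
    case (le s t)
    have D': "\<bar>h r\<bar> \<le> K" if "0 < r" "r \<le> t" for r
      using D[of r] that le unfolding K_def by auto
    have "\<bar>?I t - ?I s\<bar> \<le> K * (t - s)"
      using interval_integral_diff[where h=h and t=t and D=K and s=s, OF m D'] le by simp
    then show ?case using le by simp
  next
    case (sym s t) then show ?case by (simp add: abs_minus_commute)
  qed
  show "continuous_on {0..N} ?I"
  proof (rule continuous_onI)
    fix x e :: real assume x: "x \<in> {0..N}" and e: "0 < e"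
    have K: "0 < K + 1" by (simp add: K_def)
    show "\<exists>d>0. \<forall>x'\<in>{0..N}. dist x' x < d \<longrightarrow> dist (?I x') (?I x) \<le> e"
    proof (intro exI[of _ "e / (K + 1)"] conjI ballI impI)
      show "0 < e / (K + 1)" using e K by simp
      fix x' assume x': "x' \<in> {0..N}" "dist x' x < e / (K + 1)"
      have "K * \<bar>x' - x\<bar> \<le> (K + 1) * \<bar>x' - x\<bar>" by (intro mult_right_mono) auto
      also have "\<dots> \<le> e" using x'(2) K by (simp add: dist_real_def field_simps)
      finally show "dist (?I x') (?I x) \<le> e" using d[OF x x'(1)] by (simp add: dist_real_def)
    qed
  qed
qed

context black_scholes begin

lemma S_ratio: "S t x = S s x * ratio \<sigma> s t x"
  by (simp add: S_def expm_ratio[of \<sigma> t x s])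

lemma future_factor:
  fixes g h :: "'a \<Rightarrow> real"
  assumes s: "0 \<le> s" and C: "C \<in> sets (F s)" and g: "g \<in> borel_measurable (F s)" "integrable M g"
    and h: "h \<in> borel_measurable (future_increments s)" "integrable M h"
  shows "integrable M (\<lambda>x. indicator C x * (g x * h x))"
    and "(\<integral>x. indicator C x * (g x * h x) \<partial>M) = (\<integral>x. indicator C x * g x \<partial>M) * (\<integral>x. h x \<partial>M)"
proof -
  have CM: "C \<in> sets M" using C FF.filt_sub[OF s] by (auto simp: subalgebra_def)
  have gi: "integrable M (\<lambda>x. indicator C x * g x)"
    using integrable_real_mult_indicator[OF CM g(2)] by (simp add: mult.commute)
  have gm: "(\<lambda>x. indicator C x * g x) \<in> borel_measurable (F s)" using C g(1) by measurable
  show "integrable M (\<lambda>x. indicator C x * (g x * h x))"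
    using past_future_expectation(1)[OF s gm gi h] by (simp add: mult.assoc)
  show "(\<integral>x. indicator C x * (g x * h x) \<partial>M) = (\<integral>x. indicator C x * g x \<partial>M) * (\<integral>x. h x \<partial>M)"
    using past_future_expectation(2)[OF s gm gi h] by (simp add: mult.assoc)
qed

text \<open>
  The isometry for an integrand that is constant in time on \<open>[s, t]\<close>.  Everything is explicit: the
  increments of \<open>B\<close> and \<open>S\<close> are products of variables of the past with functions of the increment
  of \<open>B\<close>, whose moments are Gaussian integrals.  Both sides reduce to the same linear form in the
  three past moments \<open>\<alpha>\<close>, \<open>\<beta>\<close>, \<open>\<gamma>\<close>, the right one by integrating its time derivative.
\<close>

lemma isometry_on_piece:
  assumes st: "0 \<le> s" "s < t"
    and \<phi>: "\<phi> \<in> borel_measurable (F s)" "\<And>x. x \<in> space M \<Longrightarrow> \<bar>\<phi> x\<bar> \<le> C\<phi>"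
    and Q: "q \<in> borel_measurable (F s)" "integrable M (\<lambda>x. (q x)\<^sup>2)"
    and C: "C \<in> sets (F s)"
  shows "(\<integral>x. indicator C x * ((q x + \<phi> x * (B t x - B s x) - (S t x - S s x))\<^sup>2 - (q x)\<^sup>2) \<partial>M) =
     (\<integral>x. indicator C x * (LINT r|lborel. indicator {s<..t} r * (\<phi> x - \<sigma> * S r x)\<^sup>2) \<partial>M)"
proof -
  have st': "s \<le> t" and t: "0 \<le> t" using st by auto
  have CM[measurable]: "C \<in> sets M" using C FF.filt_sub[OF st(1)] by (auto simp: subalgebra_def)
  note \<phi>M[measurable] = FF.filt_measurable[OF st(1) \<phi>(1)] and qM[measurable] = FF.filt_measurable[OF st(1) Q(1)]
  have SF: "S s \<in> borel_measurable (F s)" using S_F[of s s] st by simp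
  have SM[measurable]: "S r \<in> borel_measurable M" if "0 \<le> r" for r by (rule S_meas[OF that])
  have Ssq: "integrable M (\<lambda>x. (S s x)\<^sup>2)" by (rule S_square[OF st(1)])
  have \<phi>sq: "integrable M (\<lambda>x. (\<phi> x)\<^sup>2)"
    using integrable_square_bounded_mult(1)[of \<phi> M "\<lambda>_. 1" C\<phi>] \<phi>(2) by simp
  have i: "integrable M (\<lambda>x. q x * \<phi> x)" "integrable M (\<lambda>x. q x * S s x)" "integrable M (\<lambda>x. \<phi> x * S s x)"
    by (rule integrable_product_of_squares; use Q(2) Ssq \<phi>sq SM[OF st(1)] in simp)+
  have gm: "(\<lambda>x. q x * \<phi> x) \<in> borel_measurable (F s)" "(\<lambda>x. q x * S s x) \<in> borel_measurable (F s)"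
    "(\<lambda>x. \<phi> x * S s x) \<in> borel_measurable (F s)" "(\<lambda>x. (\<phi> x)\<^sup>2) \<in> borel_measurable (F s)" "(\<lambda>x. (S s x)\<^sup>2) \<in> borel_measurable (F s)"
    using Q(1) \<phi>(1) SF by measurable
  define \<alpha> where "\<alpha> = (\<integral>x. indicator C x * (\<phi> x)\<^sup>2 \<partial>M)"
  define \<beta> where "\<beta> = (\<integral>x. indicator C x * (\<phi> x * S s x) \<partial>M)"
  define \<gamma> where "\<gamma> = (\<integral>x. indicator C x * (S s x)\<^sup>2 \<partial>M)"
  let ?\<Delta> = "\<lambda>x. B t x - B s x" and ?\<rho> = "ratio \<sigma> s t"
  note mom = increment_moments(1-4)[OF st(1) st'] increment_moments(5,6)[OF st(1) st', of \<sigma>] and rat = ratio_expectation[OF st(1) st', of \<sigma>]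
    and rat2 = ratio_square_expectation[OF st(1) st', of \<sigma>]
  have hm: "?\<Delta> \<in> borel_measurable (future_increments s)" "?\<rho> \<in> borel_measurable (future_increments s)"
    using B_future[OF st(1) st'] ratio_future[OF st(1) st'] by auto
  have hm2: "(\<lambda>x. ?\<rho> x - 1) \<in> borel_measurable (future_increments s)" "(\<lambda>x. (?\<Delta> x)\<^sup>2) \<in> borel_measurable (future_increments s)"
    "(\<lambda>x. ?\<Delta> x * ?\<rho> x - ?\<Delta> x) \<in> borel_measurable (future_increments s)" "(\<lambda>x. (?\<rho> x)\<^sup>2 - 2 * ?\<rho> x + 1) \<in> borel_measurable (future_increments s)"
    using hm by measurable
  have hi: "integrable M (\<lambda>x. ?\<rho> x - 1)" "integrable M (\<lambda>x. ?\<Delta> x * ?\<rho> x - ?\<Delta> x)" "integrable M (\<lambda>x. (?\<rho> x)\<^sup>2 - 2 * ?\<rho> x + 1)"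
    using mom rat rat2 by auto
  have hE: "(\<integral>x. ?\<rho> x - 1 \<partial>M) = 0" "(\<integral>x. ?\<Delta> x * ?\<rho> x - ?\<Delta> x \<partial>M) = \<sigma> * (t - s)"
    "(\<integral>x. (?\<rho> x)\<^sup>2 - 2 * ?\<rho> x + 1 \<partial>M) = exp (\<sigma>\<^sup>2 * (t - s)) - 1"
    using mom rat rat2 by (simp_all add: prob_space)
  note F1 = future_factor[OF st(1) C gm(1) i(1) hm(1) mom(1)]
  note F2 = future_factor[OF st(1) C gm(2) i(2) hm2(1) hi(1)]
  note F3 = future_factor[OF st(1) C gm(4) \<phi>sq hm2(2) mom(3)]
  note F4 = future_factor[OF st(1) C gm(3) i(3) hm2(3) hi(2)]
  note F5 = future_factor[OF st(1) C gm(5) Ssq hm2(4) hi(3)]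
  have e: "indicator C x * ((q x + \<phi> x * ?\<Delta> x - (S t x - S s x))\<^sup>2 - (q x)\<^sup>2) =
     2 * (indicator C x * ((q x * \<phi> x) * ?\<Delta> x)) - 2 * (indicator C x * ((q x * S s x) * (?\<rho> x - 1)))
     + indicator C x * ((\<phi> x)\<^sup>2 * (?\<Delta> x)\<^sup>2) - 2 * (indicator C x * ((\<phi> x * S s x) * (?\<Delta> x * ?\<rho> x - ?\<Delta> x)))
     + indicator C x * ((S s x)\<^sup>2 * ((?\<rho> x)\<^sup>2 - 2 * ?\<rho> x + 1))" for x
    unfolding S_ratio[of t x s] by (simp add: power2_eq_square algebra_simps)
  have L: "(\<integral>x. indicator C x * ((q x + \<phi> x * ?\<Delta> x - (S t x - S s x))\<^sup>2 - (q x)\<^sup>2) \<partial>M) =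
     \<alpha> * (t - s) - 2 * \<sigma> * \<beta> * (t - s) + \<gamma> * (exp (\<sigma>\<^sup>2 * (t - s)) - 1)"
    unfolding e using F1 F2 F3 F4 F5 mom(2,4) hE by (simp add: \<alpha>_def \<beta>_def \<gamma>_def)
  define G where "G r = \<alpha> - 2 * \<sigma> * \<beta> + \<sigma>\<^sup>2 * \<gamma> * exp (\<sigma>\<^sup>2 * (r - s))" for r
  define f where "f r x = indicator C x * (indicator {s<..t} r * (\<phi> x - \<sigma> * S r x)\<^sup>2)" for r x
  have fr: "integrable M (f r) \<and> (\<integral>x. f r x \<partial>M) = indicator {s<..t} r * G r" for r
  proof (cases "r \<in> {s<..t}")
    case True
    then have sr: "s \<le> r" by simp
    note rr = ratio_expectation[OF st(1) sr, of \<sigma>] and rr2 = ratio_square_expectation[OF st(1) sr, of \<sigma>]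
    have rm: "ratio \<sigma> s r \<in> borel_measurable (future_increments s)" using ratio_future[OF st(1) sr] .
    then have rm2: "(\<lambda>x. (ratio \<sigma> s r x)\<^sup>2) \<in> borel_measurable (future_increments s)" by measurable
    note G2 = future_factor[OF st(1) C gm(3) i(3) rm rr(1)]
    note G3 = future_factor[OF st(1) C gm(5) Ssq rm2 rr2(1)]
    have G1: "integrable M (\<lambda>x. indicator C x * (\<phi> x)\<^sup>2)"
      using integrable_real_mult_indicator[OF CM \<phi>sq] by (simp add: mult.commute)
    have "f r = (\<lambda>x. indicator C x * (\<phi> x)\<^sup>2 - 2 * \<sigma> * (indicator C x * ((\<phi> x * S s x) * ratio \<sigma> s r x))
       + \<sigma>\<^sup>2 * (indicator C x * ((S s x)\<^sup>2 * (ratio \<sigma> s r x)\<^sup>2)))"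
      unfolding f_def[abs_def] S_ratio[of r _ s] using True by (auto simp: power2_eq_square algebra_simps)
    then show ?thesis using G1 G2 G3 rr rr2 True by (simp add: G_def \<alpha>_def \<beta>_def \<gamma>_def)
  next
    case False
    then have "f r = (\<lambda>_. 0)" by (simp add: f_def[abs_def])
    then show ?thesis using False by simp
  qed
  have fM: "(\<lambda>(r, x). f r x) \<in> borel_measurable (lborel \<Otimes>\<^sub>M M)"
  proof -
    have Sm: "(\<lambda>p. S (max (fst p) 0) (snd p)) \<in> borel_measurable (lborel \<Otimes>\<^sub>M M)"
      by (rule jointly_measurable[OF S_meas S_continuous])
    have e: "(\<lambda>(r, x). f r x) = (\<lambda>p. indicator C (snd p) * (indicator {s<..t} (fst p) * (\<phi> (snd p) - \<sigma> * S (max (fst p) 0) (snd p))\<^sup>2))"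
      using st by (auto simp: f_def fun_eq_iff indicator_def max_def)
    show ?thesis unfolding e using Sm by measurable
  qed
  have Gint: "has_bochner_integral lborel (\<lambda>r. indicator {s<..t} r * G r) (\<alpha> * (t - s) - 2 * \<sigma> * \<beta> * (t - s) + \<gamma> * (exp (\<sigma>\<^sup>2 * (t - s)) - 1))"
  proof -
    define P where "P r = (\<alpha> - 2 * \<sigma> * \<beta>) * r + \<gamma> * exp (\<sigma>\<^sup>2 * (r - s))" for r
    have "has_bochner_integral lborel (\<lambda>r. G r * indicator {s..t} r) (P t - P s)"
    proof (rule has_bochner_integral_FTC_Icc_real[OF st'])
      show "DERIV P r :> G r" for r unfolding P_def G_def
        by (auto intro!: derivative_eq_intros)
      show "isCont G r" for r unfolding G_def by (intro continuous_intros)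
    qed
    moreover have "AE r in lborel. indicator {s<..t} r * G r = G r * indicator {s..t} r"
      using AE_lborel_singleton[of s] by eventually_elim (auto simp: indicator_def)
    moreover have "(\<lambda>r. indicator {s<..t} r * G r) \<in> borel_measurable lborel" unfolding G_def by measurable
    moreover have "P t - P s = \<alpha> * (t - s) - 2 * \<sigma> * \<beta> * (t - s) + \<gamma> * (exp (\<sigma>\<^sup>2 * (t - s)) - 1)"
      by (simp add: P_def algebra_simps)
    ultimately show ?thesis
      using has_bochner_integral_cong_AE[of "\<lambda>r. indicator {s<..t} r * G r" lborel "\<lambda>r. G r * indicator {s..t} r"]
      by (auto dest: has_bochner_integral_integrable borel_measurable_has_bochner_integral)
  qed
  interpret P: pair_sigma_finite lborel M by unfold_locales
  have fint: "integrable (lborel \<Otimes>\<^sub>M M) (\<lambda>(r, x). f r x)"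
  proof (rule P.Fubini_integrable[OF fM])
    have "norm (f r x) = f r x" for r x by (simp add: f_def)
    then show "integrable lborel (\<lambda>r. \<integral>x. norm (case (r, x) of (r, x) \<Rightarrow> f r x) \<partial>M)"
      using fr Gint by (simp add: has_bochner_integral_iff)
    show "AE r in lborel. integrable M (\<lambda>x. case (r, x) of (r, x) \<Rightarrow> f r x)" using fr by simp
  qed
  have "(\<integral>x. indicator C x * (LINT r|lborel. indicator {s<..t} r * (\<phi> x - \<sigma> * S r x)\<^sup>2) \<partial>M) = (\<integral>x. (LINT r|lborel. f r x) \<partial>M)"
    by (simp add: f_def)
  also have "\<dots> = (LINT r|lborel. (\<integral>x. f r x \<partial>M))" by (rule P.Fubini_integral[OF fint])
  also have "\<dots> = (LINT r|lborel. indicator {s<..t} r * G r)" using fr by simp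
  also have "\<dots> = \<alpha> * (t - s) - 2 * \<sigma> * \<beta> * (t - s) + \<gamma> * (exp (\<sigma>\<^sup>2 * (t - s)) - 1)"
    using Gint by (simp add: has_bochner_integral_iff)
  finally show ?thesis using L by simp
qed

end

context black_scholes begin

lemma isometry_cong:
  assumes HY: "isometry H Y" and i: "FF.indistinguishable Y Y'"
  shows "isometry H Y'"
  unfolding isometry_def
proof (intro conjI allI impI)
  note D = isometryD[OF HY]
  note ad = FF.indistinguishable_adapted[OF i D(1)] and c = FF.indistinguishable_continuous[OF i D(2)]
  show "adapted F Y'" "continuous_paths M Y'" by (rule ad, rule c)
  show "AE x in M. Y' 0 x = 0" using i D(3) unfolding FF.indistinguishable_def by eventually_elim force
  show "(\<lambda>p. indicator {0<..} (fst p) * H (fst p) (snd p)) \<in> borel_measurable (lborel \<Otimes>\<^sub>M M)" by (rule D(4))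
  fix N T m assume T: "FF.bounded_stopping_time N T" and b: "AE x in M. \<forall>s\<in>{0..T x}. \<bar>Y' s x\<bar> \<le> m \<and> \<bar>B s x\<bar> \<le> m"
    and C: "\<exists>C. AE x in M. \<forall>s\<in>{0<..T x}. \<bar>H s x\<bar> \<le> C"
  have b': "AE x in M. \<forall>s\<in>{0..T x}. \<bar>Y s x\<bar> \<le> m \<and> \<bar>B s x\<bar> \<le> m"
    using b i unfolding FF.indistinguishable_def by eventually_elim auto
  have S: "(\<lambda>x. S (T x) x) \<in> borel_measurable M"
    by (rule FF.eval_stopping_measurable[OF _ _ T]) (use S_F in \<open>auto simp: adapted_def continuous_paths_def S_continuous\<close>)
  have "(\<integral>x. (S0 + Y' (T x) x - S (T x) x)\<^sup>2 \<partial>M) = (\<integral>x. (S0 + Y (T x) x - S (T x) x)\<^sup>2 \<partial>M)"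
  proof (rule integral_cong_AE)
    show "AE x in M. (S0 + Y' (T x) x - S (T x) x)\<^sup>2 = (S0 + Y (T x) x - S (T x) x)\<^sup>2"
      using i AE_space unfolding FF.indistinguishable_def
      by eventually_elim (use FF.bounded_stopping_timeD(1)[OF T] in auto)
    show "(\<lambda>x. (S0 + Y' (T x) x - S (T x) x)\<^sup>2) \<in> borel_measurable M"
      using FF.eval_stopping_measurable[OF ad c T] S by measurable
    show "(\<lambda>x. (S0 + Y (T x) x - S (T x) x)\<^sup>2) \<in> borel_measurable M"
      using FF.eval_stopping_measurable[OF D(1,2) T] S by measurable
  qed
  also have "\<dots> = (\<integral>x. quad H (T x) x \<partial>M)" using C D(5)[OF T b'] by blast
  finally show "(\<integral>x. (S0 + Y' (T x) x - S (T x) x)\<^sup>2 \<partial>M) = (\<integral>x. quad H (T x) x \<partial>M)" .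
qed

text \<open>Between two consecutive grid points an elementary integrand is constant in time.\<close>

lemma elem_piece:
  assumes el: "elementary M F g n u f" and st: "0 \<le> s" "s < t"
    and no: "\<And>i. i \<le> n \<Longrightarrow> u i \<le> s \<or> t \<le> u i"
  defines "\<phi> \<equiv> \<lambda>x. \<Sum>i<n. of_bool (u i \<le> s \<and> t \<le> u (Suc i)) * f i x"
  shows "r \<in> {s<..t} \<Longrightarrow> elem_process g n u f r x = \<phi> x"
    and "elem_integral n u f X t x - elem_integral n u f X s x = \<phi> x * (X t x - X s x)"
    and "\<phi> \<in> borel_measurable (F s)"
proof -
  have mono: "u i \<le> u (Suc i)" if "i < n" for i using elementary_grid(2)[OF el, of i "Suc i"] that by simp
  show "elem_process g n u f r x = \<phi> x" if r: "r \<in> {s<..t}"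
  proof -
    have "(\<Sum>i<n. f i x * indicator {u i<..u (Suc i)} r) = \<phi> x"
      unfolding \<phi>_def
    proof (rule sum.cong[OF refl])
      fix i assume i: "i \<in> {..<n}"
      then show "f i x * indicator {u i<..u (Suc i)} r = of_bool (u i \<le> s \<and> t \<le> u (Suc i)) * f i x"
        using no[of i] no[of "Suc i"] r by (auto simp: indicator_def)
    qed
    then show ?thesis using r st by (simp add: elem_process_def)
  qed
  show "elem_integral n u f X t x - elem_integral n u f X s x = \<phi> x * (X t x - X s x)"
    unfolding elem_integral_def \<phi>_def sum_subtractf[symmetric] sum_distrib_right
  proof (rule sum.cong[OF refl])
    fix i assume "i \<in> {..<n}"
    then have i: "i < n" by simp
    consider "u i \<le> s \<and> t \<le> u (Suc i)" | "t \<le> u i" | "u (Suc i) \<le> s"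
      using no[of i] no[of "Suc i"] i mono[OF i] by fastforce
    then show "f i x * (X (min t (u (Suc i))) x - X (min t (u i)) x) - f i x * (X (min s (u (Suc i))) x - X (min s (u i)) x) =
       of_bool (u i \<le> s \<and> t \<le> u (Suc i)) * f i x * (X t x - X s x)"
    proof cases
      case 1
      then have "min t (u (Suc i)) = t" "min t (u i) = u i" "min s (u (Suc i)) = s" "min s (u i) = u i"
        using st by auto
      then show ?thesis using 1 by (simp add: algebra_simps)
    next
      case 2
      then have "min t (u (Suc i)) = t" "min t (u i) = t" "min s (u (Suc i)) = s" "min s (u i) = s"
        using st mono[OF i] by auto
      then show ?thesis using 2 st by simp
    next
      case 3
      then have "min t (u (Suc i)) = u (Suc i)" "min t (u i) = u i" "min s (u (Suc i)) = u (Suc i)" "min s (u i) = u i"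
        using st mono[OF i] by auto
      then show ?thesis using 3 st by simp
    qed
  qed
  show "\<phi> \<in> borel_measurable (F s)"
    unfolding \<phi>_def
  proof (rule borel_measurable_sum)
    fix i assume "i \<in> {..<n}"
    then have i: "i < n" by simp
    show "(\<lambda>x. of_bool (u i \<le> s \<and> t \<le> u (Suc i)) * f i x) \<in> borel_measurable (F s)"
    proof (cases "u i \<le> s")
      case True
      have "f i \<in> borel_measurable (F s)"
        by (rule FF.filt_measurable_mono[of "u i"])
          (use el i True elementary_grid(1)[OF el, of i i] in \<open>auto simp: elementary_def\<close>)
      then show ?thesis by measurable
    qed simp
  qed
qed

lemma elementary_bound:
  assumes el: "elementary M F g n u f"
  obtains C where "0 \<le> C" "\<And>i x. i < n \<Longrightarrow> x \<in> space M \<Longrightarrow> \<bar>f i x\<bar> \<le> C"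
proof -
  have "\<forall>i. \<exists>C. i < n \<longrightarrow> (\<forall>x\<in>space M. \<bar>f i x\<bar> \<le> C)" using el unfolding elementary_def by blast
  then obtain D where D: "\<And>i x. i < n \<Longrightarrow> x \<in> space M \<Longrightarrow> \<bar>f i x\<bar> \<le> D i" by metis
  show ?thesis
  proof (rule that[of "\<Sum>i<n. \<bar>D i\<bar>"])
    show "0 \<le> (\<Sum>i<n. \<bar>D i\<bar>)" by (rule sum_nonneg) simp
    fix i x assume "i < n" "x \<in> space M"
    then have "\<bar>f i x\<bar> \<le> \<bar>D i\<bar>" using D[of i x] by linarith
    also have "\<dots> \<le> (\<Sum>i<n. \<bar>D i\<bar>)" using \<open>i < n\<close> by (intro member_le_sum) auto
    finally show "\<bar>f i x\<bar> \<le> (\<Sum>i<n. \<bar>D i\<bar>)" .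
  qed
qed

lemma square_le_exp: "y\<^sup>2 \<le> 2 * exp y" if "0 \<le> y" for y :: real
proof -
  have "1 + y + y\<^sup>2 / 2 \<le> exp y" by (rule exp_lower_Taylor_quadratic[OF that])
  then show ?thesis using that by simp
qed

text \<open>
  \<open>Q\<^sup>2 - quad H\<close> is a martingale, where \<open>Q = S0 + H \<cdot> B - S\<close>.  Over an interval without interior grid
  points this is \<open>isometry_on_piece\<close>; in general it follows by induction on the number of interior
  grid points.  An exponential of \<open>\<bar>B\<bar>\<close> dominates this martingale, so it may be stopped.
\<close>

lemma elementary_isometry:
  assumes el: "elementary M F g n u f"
  shows "isometry (elem_process g n u f) (elem_integral n u f B)"
proof -
  define H where "H = elem_process g n u f"
  define Y where "Y = elem_integral n u f B"
  obtain C where C: "0 \<le> C" "\<And>i x. i < n \<Longrightarrow> x \<in> space M \<Longrightarrow> \<bar>f i x\<bar> \<le> C" by (rule elementary_bound[OF el]) (rule that)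
  have u0: "0 \<le> u i" if "i \<le> n" for i using elementary_grid(1)[OF el order_refl that] .
  have fM[measurable]: "f i \<in> borel_measurable M" if "i < n" for i
    by (rule FF.filt_measurable[of "u i"]) (use el that u0[of i] in \<open>auto simp: elementary_def\<close>)
  have Yad: "adapted F Y" unfolding Y_def by (rule FF.elem_integral_adapted[OF B_adapted el])
  have Yc: "continuous_on {0..} (\<lambda>t. Y t x)" for x
  proof -
    have "continuous_on {0..} (\<lambda>t. B (min t v) x)" if "0 \<le> v" for v
      by (rule continuous_on_compose2[OF B_continuous]) (use that in \<open>auto intro!: continuous_intros\<close>)
    then show ?thesis unfolding Y_def elem_integral_def using u0 by (intro continuous_intros) auto
  qed
  have YM[measurable]: "Y t \<in> borel_measurable M" if "0 \<le> t" for t by (rule FF.adapted_measurable[OF Yad that])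
  have Hm: "(\<lambda>p. indicator {0<..} (fst p) * H (fst p) (snd p)) \<in> borel_measurable (lborel \<Otimes>\<^sub>M M)"
  proof -
    have e: "(\<lambda>p. indicator {0<..} (fst p) * H (fst p) (snd p)) =
       (\<lambda>p. indicator {0<..} (fst p) * (\<Sum>i<n. f i (snd p) * indicator {u i<..u (Suc i)} (fst p)))"
      by (auto simp: H_def elem_process_def fun_eq_iff indicator_def)
    have "(\<lambda>p. f i (snd p)) \<in> borel_measurable (lborel \<Otimes>\<^sub>M M)" if "i < n" for i
      by (rule measurable_compose[OF measurable_snd fM[OF that]])
    then show ?thesis unfolding e by (intro borel_measurable_times borel_measurable_sum) (auto intro!: borel_measurable_indicator' simp: measurable_fst)
  qed
  have Hb: "\<bar>H r x\<bar> \<le> real n * C" if "0 < r" "x \<in> space M" for r x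
  proof -
    have "\<bar>H r x\<bar> \<le> (\<Sum>i<n. \<bar>f i x * indicator {u i<..u (Suc i)} r\<bar>)"
    proof -
      have "H r x = (\<Sum>i<n. f i x * indicator {u i<..u (Suc i)} r)"
        using that by (simp only: H_def elem_process_def) simp
      then show ?thesis by (simp only: sum_abs)
    qed
    also have "\<dots> \<le> (\<Sum>i<n. C)" by (intro sum_mono) (use C that in \<open>auto simp: indicator_def\<close>)
    finally show ?thesis by simp
  qed
  define Q where "Q t x = S0 + Y t x - S t x" for t x
  have QF: "Q t \<in> borel_measurable (F t)" if "0 \<le> t" for t
    unfolding Q_def[abs_def] using Yad S_F[OF that order_refl] that by (auto simp: adapted_def)
  have QM[measurable]: "Q t \<in> borel_measurable M" if "0 \<le> t" for t by (rule FF.filt_measurable[OF that QF[OF that]])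
  have Qc: "continuous_on {0..} (\<lambda>t. Q t x)" for x
    unfolding Q_def by (intro continuous_intros Yc S_continuous)
  have Q0: "Q 0 x = 0" for x unfolding Q_def Y_def using FF.elem_integral_0[OF el] by simp
  define MM where "MM t x = (Q t x)\<^sup>2 - quad H t x" for t x
  \<comment> \<open>\<open>exp (a \<bar>B\<bar>)\<close> dominates both \<open>B\<^sup>2\<close> and the square of \<open>S\<close>.\<close>
  define a where "a = 2 * \<bar>\<sigma>\<bar> + 1"
  have dom: "\<exists>Z. integrable M Z \<and> (AE x in M. \<forall>s\<in>{0..N}. (Q s x)\<^sup>2 \<le> Z x \<and> \<bar>quad H s x\<bar> \<le> Z x)" for N
  proof -
    obtain Z where Z: "integrable M Z" "AE x in M. \<forall>s\<in>{0..N}. \<bar>exp (a * \<bar>B s x\<bar>)\<bar> \<le> Z x"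
      using exp_abs_B_dominated[of a] unfolding dominated_def by blast
    define K1 where "K1 = 3 * (S0\<^sup>2 + 8 * (real n * C)\<^sup>2 + S0\<^sup>2)"
    define K2 where "K2 = \<bar>N\<bar> * (2 * (real n * C)\<^sup>2 + 2 * \<sigma>\<^sup>2 * S0\<^sup>2)"
    have K: "0 \<le> K1" "0 \<le> K2" unfolding K1_def K2_def by auto
    have "AE x in M. \<forall>s\<in>{0..N}. (Q s x)\<^sup>2 \<le> (K1 + K2) * Z x \<and> \<bar>quad H s x\<bar> \<le> (K1 + K2) * Z x"
      using Z(2) AE_space
    proof eventually_elim
      case (elim x)
      have BZ: "(B s x)\<^sup>2 \<le> 2 * Z x" and SZ: "(S s x)\<^sup>2 \<le> S0\<^sup>2 * Z x" and Z1: "1 \<le> Z x" if s: "s \<in> {0..N}" for s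
      proof -
        have z: "exp (a * \<bar>B s x\<bar>) \<le> Z x" using elim s by auto
        have "(B s x)\<^sup>2 \<le> 2 * exp \<bar>B s x\<bar>" using square_le_exp[of "\<bar>B s x\<bar>"] by simp
        also have "exp \<bar>B s x\<bar> \<le> exp (a * \<bar>B s x\<bar>)" by (simp add: a_def distrib_right)
        finally show "(B s x)\<^sup>2 \<le> 2 * Z x" using z by linarith
        show "1 \<le> Z x" using z by (rule order_trans[rotated]) (simp add: a_def)
        have "\<bar>S s x\<bar>\<^sup>2 \<le> (\<bar>S0\<bar> * exp (\<bar>\<sigma>\<bar> * \<bar>B s x\<bar>))\<^sup>2" by (rule power_mono[OF S_le]) (use s in auto)
        also have "\<dots> = S0\<^sup>2 * exp (2 * \<bar>\<sigma>\<bar> * \<bar>B s x\<bar>)"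
          by (simp add: power_mult_distrib exp_double[symmetric] mult.assoc)
        also have "\<dots> \<le> S0\<^sup>2 * exp (a * \<bar>B s x\<bar>)" by (intro mult_left_mono) (auto simp: a_def distrib_right)
        also have "\<dots> \<le> S0\<^sup>2 * Z x" using z by (intro mult_left_mono) auto
        finally show "(S s x)\<^sup>2 \<le> S0\<^sup>2 * Z x" by simp
      qed
      show ?case
      proof
        fix s assume s: "s \<in> {0..N}"
        note z1 = Z1[OF s]
        have Bs: "\<bar>B r x\<bar> \<le> sqrt (2 * Z x)" if "r \<in> {0..N}" for r
          using BZ[OF that] by (simp add: real_le_rsqrt)
        have "\<bar>Y s x\<bar> \<le> (\<Sum>i<n. \<bar>f i x * (B (min s (u (Suc i))) x - B (min s (u i)) x)\<bar>)"
          unfolding Y_def elem_integral_def by (rule sum_abs)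
        also have "\<dots> \<le> (\<Sum>i<n. C * (2 * sqrt (2 * Z x)))"
        proof (rule sum_mono)
          fix i assume "i \<in> {..<n}"
          then have i: "i < n" by simp
          have 1: "min s (u (Suc i)) \<in> {0..N}" "min s (u i) \<in> {0..N}" using s u0[of i] u0[of "Suc i"] i by auto
          have "\<bar>B (min s (u (Suc i))) x - B (min s (u i)) x\<bar> \<le> 2 * sqrt (2 * Z x)"
            using Bs[OF 1(1)] Bs[OF 1(2)] by linarith
          then show "\<bar>f i x * (B (min s (u (Suc i))) x - B (min s (u i)) x)\<bar> \<le> C * (2 * sqrt (2 * Z x))"
            unfolding abs_mult using C(1) C(2)[OF i elim(2)] by (intro mult_mono) auto
        qed
        finally have "\<bar>Y s x\<bar> \<le> real n * C * (2 * sqrt (2 * Z x))" by simp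
        then have "\<bar>Y s x\<bar>\<^sup>2 \<le> (real n * C * (2 * sqrt (2 * Z x)))\<^sup>2" by (rule power_mono) simp
        also have "\<dots> = 8 * (real n * C)\<^sup>2 * Z x" using z1 by (simp add: power_mult_distrib)
        finally have Ys: "(Y s x)\<^sup>2 \<le> 8 * (real n * C)\<^sup>2 * Z x" by simp
        have three: "(p + q - w)\<^sup>2 \<le> 3 * (p\<^sup>2 + q\<^sup>2 + w\<^sup>2)" for p q w :: real
        proof -
          have "0 \<le> (p - q)\<^sup>2 + (p + w)\<^sup>2 + (q + w)\<^sup>2" by simp
          then show ?thesis by (simp add: power2_eq_square algebra_simps)
        qed
        have "S0\<^sup>2 \<le> S0\<^sup>2 * Z x" using z1 by (simp add: mult_le_cancel_left1)
        then have "(Q s x)\<^sup>2 \<le> 3 * (S0\<^sup>2 * Z x + 8 * (real n * C)\<^sup>2 * Z x + S0\<^sup>2 * Z x)"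
          unfolding Q_def
          by (intro order_trans[OF three[of S0 "Y s x" "S s x"]] mult_left_mono add_mono Ys SZ[OF s]) auto
        also have "\<dots> = K1 * Z x" by (simp add: K1_def algebra_simps)
        finally have 1: "(Q s x)\<^sup>2 \<le> K1 * Z x" .
        have hb: "\<bar>(H r x - \<sigma> * S r x)\<^sup>2\<bar> \<le> (2 * (real n * C)\<^sup>2 + 2 * \<sigma>\<^sup>2 * S0\<^sup>2) * Z x" if r: "0 < r" "r \<le> s" for r
        proof -
          have rN: "r \<in> {0..N}" using r s by auto
          have "(H r x)\<^sup>2 \<le> (real n * C)\<^sup>2" using power_mono[OF Hb[OF r(1) elim(2)], of 2] by simp
          also have "\<dots> \<le> (real n * C)\<^sup>2 * Z x" using z1 by (simp add: mult_le_cancel_left1)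
          finally have 1: "(H r x)\<^sup>2 \<le> (real n * C)\<^sup>2 * Z x" .
          have 2: "\<sigma>\<^sup>2 * (S r x)\<^sup>2 \<le> \<sigma>\<^sup>2 * (S0\<^sup>2 * Z x)" by (intro mult_left_mono SZ[OF rN]) simp
          have "0 \<le> (H r x + \<sigma> * S r x)\<^sup>2" by simp
          then have "(H r x - \<sigma> * S r x)\<^sup>2 \<le> 2 * (H r x)\<^sup>2 + 2 * (\<sigma>\<^sup>2 * (S r x)\<^sup>2)"
            by (simp add: power2_eq_square algebra_simps)
          then show ?thesis using 1 2 by (simp add: algebra_simps)
        qed
        have "\<bar>quad H s x\<bar> \<le> ((2 * (real n * C)\<^sup>2 + 2 * \<sigma>\<^sup>2 * S0\<^sup>2) * Z x) * s"
          unfolding quad_def by (rule integral_bounded_interval[OF quad_section_measurable[OF Hm elim(2)] hb]) (use s in auto)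
        also have "\<dots> \<le> ((2 * (real n * C)\<^sup>2 + 2 * \<sigma>\<^sup>2 * S0\<^sup>2) * Z x) * \<bar>N\<bar>"
          using s z1 by (intro mult_left_mono mult_nonneg_nonneg) auto
        also have "\<dots> = K2 * Z x" by (simp add: K2_def)
        finally have 2: "\<bar>quad H s x\<bar> \<le> K2 * Z x" .
        have "K1 * Z x \<le> (K1 + K2) * Z x" "K2 * Z x \<le> (K1 + K2) * Z x"
          using K z1 by (auto intro!: mult_right_mono)
        with 1 2 show "(Q s x)\<^sup>2 \<le> (K1 + K2) * Z x \<and> \<bar>quad H s x\<bar> \<le> (K1 + K2) * Z x" by linarith
      qed
    qed
    moreover have "integrable M (\<lambda>x. (K1 + K2) * Z x)" using Z(1) by simp
    ultimately show ?thesis by (intro exI[of _ "\<lambda>x. (K1 + K2) * Z x"] conjI)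
  qed
  have quadM: "(\<lambda>x. quad H t x) \<in> borel_measurable M" for t by (rule quad_measurable[OF Hm]) simp
  have Qsq: "integrable M (\<lambda>x. (Q t x)\<^sup>2)" and quadi: "integrable M (\<lambda>x. quad H t x)" if t: "0 \<le> t" for t
  proof -
    obtain Z where Z: "integrable M Z" "AE x in M. \<forall>s\<in>{0..t}. (Q s x)\<^sup>2 \<le> Z x \<and> \<bar>quad H s x\<bar> \<le> Z x" using dom by blast
    have b: "AE x in M. (Q t x)\<^sup>2 \<le> \<bar>Z x\<bar> \<and> \<bar>quad H t x\<bar> \<le> \<bar>Z x\<bar>"
      using Z(2)
    proof eventually_elim
      case (elim x)
      then have "(Q t x)\<^sup>2 \<le> Z x" "\<bar>quad H t x\<bar> \<le> Z x" using t by auto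
      then show ?case by linarith
    qed
    show "integrable M (\<lambda>x. (Q t x)\<^sup>2)"
      by (rule Bochner_Integration.integrable_bound[OF Z(1)]) (use b QM[OF t] in \<open>auto elim!: eventually_mono\<close>)
    show "integrable M (\<lambda>x. quad H t x)"
      by (rule Bochner_Integration.integrable_bound[OF Z(1) quadM]) (use b in \<open>auto elim!: eventually_mono\<close>)
  qed
  have MMi: "integrable M (MM t)" if "0 \<le> t" for t unfolding MM_def[abs_def] using Qsq[OF that] quadi[OF that] by auto
  have hbx: "\<exists>D. \<forall>r. 0 < r \<longrightarrow> r \<le> t \<longrightarrow> \<bar>(H r x - \<sigma> * S r x)\<^sup>2\<bar> \<le> D" if x: "x \<in> space M" for t x
  proof -
    obtain D where D: "\<And>s. s \<in> {0..t} \<Longrightarrow> \<bar>S s x\<bar> \<le> real D"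
      using continuous_halfline_bounded[OF S_continuous, of t x] by (meson less_imp_le)
    show ?thesis
    proof (intro exI[of _ "(real n * C + \<bar>\<sigma>\<bar> * real D)\<^sup>2"] allI impI)
      fix r assume r: "0 < r" "r \<le> t"
      have "\<bar>H r x - \<sigma> * S r x\<bar> \<le> \<bar>H r x\<bar> + \<bar>\<sigma>\<bar> * \<bar>S r x\<bar>"
        using abs_triangle_ineq4[of "H r x" "\<sigma> * S r x"] by (simp add: abs_mult)
      also have "\<dots> \<le> real n * C + \<bar>\<sigma>\<bar> * real D" using Hb[OF r(1) x] D[of r] r by (intro add_mono mult_left_mono) auto
      finally have "\<bar>H r x - \<sigma> * S r x\<bar>\<^sup>2 \<le> (real n * C + \<bar>\<sigma>\<bar> * real D)\<^sup>2" by (rule power_mono) simp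
      then show "\<bar>(H r x - \<sigma> * S r x)\<^sup>2\<bar> \<le> (real n * C + \<bar>\<sigma>\<bar> * real D)\<^sup>2" by simp
    qed
  qed
  have step: "(\<integral>x. indicator A x * (MM t x - MM s x) \<partial>M) = 0"
    if "0 \<le> s" "s \<le> t" "A \<in> sets (F s)" "card {u i | i. i \<le> n \<and> s < u i \<and> u i < t} = k" for s t A k
    using that
  proof (induction k arbitrary: s t A rule: less_induct)
    case (less k)
    note st = less.prems(1,2) and A = less.prems(3)
    show ?case
    proof (cases "\<exists>i\<le>n. s < u i \<and> u i < t")
      case True
      then obtain i where i: "i \<le> n" "s < u i" "u i < t" by blast
      let ?J = "\<lambda>s t. {u i | i. i \<le> n \<and> s < u i \<and> u i < t}"
      have fin: "finite (?J s t)" by (rule finite_subset[of _ "u ` {..n}"]) auto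
      have c1: "card (?J s (u i)) < k" "card (?J (u i) t) < k"
        unfolding less.prems(4)[symmetric] using i by (intro psubset_card_mono[OF fin]; force)+
      have A': "A \<in> sets (F (u i))" using A FF.filt_mono[of s "u i"] st i by auto
      have AM: "A \<in> sets M" using A FF.filt_sub[OF st(1)] by (auto simp: subalgebra_def)
      have ui: "0 \<le> u i" "0 \<le> t" using st i by auto
      have ii: "integrable M (\<lambda>x. indicator A x * (MM p x - MM q x))" if "0 \<le> p" "0 \<le> q" for p q
        using integrable_real_mult_indicator[OF AM, of "\<lambda>x. MM p x - MM q x"] MMi[OF that(1)] MMi[OF that(2)]
        by (simp add: mult.commute)
      have 1: "(\<integral>x. indicator A x * (MM (u i) x - MM s x) \<partial>M) = 0"
        by (rule less.IH[OF c1(1) st(1) _ A refl]) (use i in simp)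
      have 2: "(\<integral>x. indicator A x * (MM t x - MM (u i) x) \<partial>M) = 0"
        by (rule less.IH[OF c1(2) ui(1) _ A' refl]) (use i in simp)
      have "indicator A x * (MM t x - MM s x) = indicator A x * (MM (u i) x - MM s x) + indicator A x * (MM t x - MM (u i) x)" for x
        by (simp add: algebra_simps)
      then show ?thesis using 1 2 ii[OF ui(1) st(1)] ii[OF ui(2) ui(1)] by simp
    next
      case False
      show ?thesis
      proof (cases "s = t")
        case True then show ?thesis by simp
      next
        case ne: False
        then have lt: "s < t" using st by simp
        have t: "0 \<le> t" using st by simp
        have no: "u i \<le> s \<or> t \<le> u i" if "i \<le> n" for i using False that by force
        define \<phi> where "\<phi> x = (\<Sum>i<n. of_bool (u i \<le> s \<and> t \<le> u (Suc i)) * f i x)" for x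
        note P = elem_piece[OF el st(1) lt no, folded \<phi>_def]
        have Pm: "\<phi> \<in> borel_measurable (F s)" using P(3) by (simp add: \<phi>_def[abs_def])
        have \<phi>b: "\<bar>\<phi> x\<bar> \<le> real n * C" if x: "x \<in> space M" for x
        proof -
          have "\<bar>\<phi> x\<bar> \<le> (\<Sum>i<n. \<bar>of_bool (u i \<le> s \<and> t \<le> u (Suc i)) * f i x\<bar>)" unfolding \<phi>_def by (rule sum_abs)
          also have "\<dots> \<le> (\<Sum>i<n. C)" by (intro sum_mono) (use C x in \<open>auto simp: abs_mult\<close>)
          finally show ?thesis by simp
        qed
        have Qt: "Q t x = Q s x + \<phi> x * (B t x - B s x) - (S t x - S s x)" for x
          using P(2)[of B x] unfolding Q_def Y_def by simp
        have qd: "quad H t x - quad H s x = (LINT r|lborel. indicator {s<..t} r * (\<phi> x - \<sigma> * S r x)\<^sup>2)" if x: "x \<in> space M" for x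
        proof -
          obtain D where D: "\<And>r. 0 < r \<Longrightarrow> r \<le> t \<Longrightarrow> \<bar>(H r x - \<sigma> * S r x)\<^sup>2\<bar> \<le> D" using hbx[OF x, of t] by blast
          have "quad H t x - quad H s x = (LINT r|lborel. indicator {s<..t} r * (H r x - \<sigma> * S r x)\<^sup>2)"
            unfolding quad_def by (rule interval_integral_diff(1)[OF quad_section_measurable[OF Hm x] D st])
          also have "\<dots> = (LINT r|lborel. indicator {s<..t} r * (\<phi> x - \<sigma> * S r x)\<^sup>2)"
            by (rule Bochner_Integration.integral_cong[OF refl]) (use P(1) in \<open>auto simp: H_def indicator_def\<close>)
          finally show ?thesis .
        qed
        have AM: "A \<in> sets M" using A FF.filt_sub[OF st(1)] by (auto simp: subalgebra_def)
        have "(\<integral>x. indicator A x * (MM t x - MM s x) \<partial>M) =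
            (\<integral>x. indicator A x * ((Q t x)\<^sup>2 - (Q s x)\<^sup>2) - indicator A x * (quad H t x - quad H s x) \<partial>M)"
          by (simp add: MM_def algebra_simps)
        also have "\<dots> = (\<integral>x. indicator A x * ((Q t x)\<^sup>2 - (Q s x)\<^sup>2) \<partial>M) - (\<integral>x. indicator A x * (quad H t x - quad H s x) \<partial>M)"
        proof (rule Bochner_Integration.integral_diff)
          show "integrable M (\<lambda>x. indicator A x * ((Q t x)\<^sup>2 - (Q s x)\<^sup>2))"
            using integrable_real_mult_indicator[OF AM, of "\<lambda>x. (Q t x)\<^sup>2 - (Q s x)\<^sup>2"] Qsq[OF t] Qsq[OF st(1)]
            by (simp add: mult.commute)
          show "integrable M (\<lambda>x. indicator A x * (quad H t x - quad H s x))"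
            using integrable_real_mult_indicator[OF AM, of "\<lambda>x. quad H t x - quad H s x"] quadi[OF t] quadi[OF st(1)]
            by (simp add: mult.commute)
        qed
        also have "(\<integral>x. indicator A x * ((Q t x)\<^sup>2 - (Q s x)\<^sup>2) \<partial>M) =
            (\<integral>x. indicator A x * (LINT r|lborel. indicator {s<..t} r * (\<phi> x - \<sigma> * S r x)\<^sup>2) \<partial>M)"
          unfolding Qt by (rule isometry_on_piece[OF st(1) lt Pm \<phi>b QF[OF st(1)] Qsq[OF st(1)] A])
        also have "(\<integral>x. indicator A x * (quad H t x - quad H s x) \<partial>M) =
            (\<integral>x. indicator A x * (LINT r|lborel. indicator {s<..t} r * (\<phi> x - \<sigma> * S r x)\<^sup>2) \<partial>M)"
          by (rule Bochner_Integration.integral_cong[OF refl]) (use qd in auto)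
        finally show ?thesis by simp
      qed
    qed
  qed
  have mart: "FF.martingale MM"
    unfolding FF.martingale_def using MMi step by blast
  have MMc: "continuous_paths M MM"
    unfolding continuous_paths_def
  proof (rule AE_I2)
    fix x assume x: "x \<in> space M"
    have "continuous_on {0..} (\<lambda>t. quad H t x)"
      unfolding quad_def by (rule interval_integral_continuous[OF quad_section_measurable[OF Hm x] hbx[OF x]])
    then show "continuous_on {0..} (\<lambda>t. MM t x)" unfolding MM_def by (intro continuous_intros Qc)
  qed
  have MMdom: "dominated M MM"
    unfolding dominated_def
  proof
    fix N
    obtain Z where Z: "integrable M Z" "AE x in M. \<forall>s\<in>{0..N}. (Q s x)\<^sup>2 \<le> Z x \<and> \<bar>quad H s x\<bar> \<le> Z x" using dom by blast
    have "AE x in M. \<forall>s\<in>{0..N}. \<bar>MM s x\<bar> \<le> 2 * Z x"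
      using Z(2)
    proof eventually_elim
      case (elim x)
      show ?case
      proof
        fix s assume "s \<in> {0..N}"
        then have "(Q s x)\<^sup>2 \<le> Z x" "\<bar>quad H s x\<bar> \<le> Z x" using elim by auto
        then show "\<bar>MM s x\<bar> \<le> 2 * Z x" unfolding MM_def using zero_le_power2[of "Q s x"] by linarith
      qed
    qed
    moreover have "integrable M (\<lambda>x. 2 * Z x)" using Z(1) by simp
    ultimately show "\<exists>Z. integrable M Z \<and> (AE x in M. \<forall>s\<in>{0..N}. \<bar>MM s x\<bar> \<le> Z x)" by (intro exI[of _ "\<lambda>x. 2 * Z x"] conjI)
  qed
  have "isometry H Y"
    unfolding isometry_def
  proof (intro conjI allI impI)
    show "adapted F Y" by (rule Yad)
    show "continuous_paths M Y" by (simp add: continuous_paths_def Yc)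
    show "AE x in M. Y 0 x = 0" unfolding Y_def using FF.elem_integral_0[OF el] by simp
    show "(\<lambda>p. indicator {0<..} (fst p) * H (fst p) (snd p)) \<in> borel_measurable (lborel \<Otimes>\<^sub>M M)" by (rule Hm)
    fix N T assume T: "FF.bounded_stopping_time N T"
    obtain x0 where x0: "x0 \<in> space M" using not_empty by auto
    have N: "0 \<le> N" using FF.bounded_stopping_timeD(1,2)[OF T x0] by simp
    obtain Z where Z: "integrable M Z" "AE x in M. \<forall>s\<in>{0..N}. (Q s x)\<^sup>2 \<le> Z x \<and> \<bar>quad H s x\<bar> \<le> Z x" using dom by blast
    have TN: "AE x in M. T x \<in> {0..N}" using FF.bounded_stopping_timeD(1,2)[OF T] by (intro AE_I2) auto
    have bT: "AE x in M. (Q (T x) x)\<^sup>2 \<le> \<bar>Z x\<bar> \<and> \<bar>quad H (T x) x\<bar> \<le> \<bar>Z x\<bar>"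
      using Z(2) TN
    proof eventually_elim
      case (elim x)
      then have "(Q (T x) x)\<^sup>2 \<le> Z x" "\<bar>quad H (T x) x\<bar> \<le> Z x" by blast+
      then show ?case by linarith
    qed
    have Qad: "adapted F Q" using QF by (simp add: adapted_def)
    have Qcc: "continuous_paths M Q" by (simp add: continuous_paths_def Qc)
    have Qi: "integrable M (\<lambda>x. (Q (T x) x)\<^sup>2)"
    proof (rule Bochner_Integration.integrable_bound[OF Z(1)])
      show "(\<lambda>x. (Q (T x) x)\<^sup>2) \<in> borel_measurable M" using FF.eval_stopping_measurable[OF Qad Qcc T] by measurable
      show "AE x in M. norm ((Q (T x) x)\<^sup>2) \<le> norm (Z x)" using bT by eventually_elim auto
    qed
    have qi: "integrable M (\<lambda>x. quad H (T x) x)"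
    proof (rule Bochner_Integration.integrable_bound[OF Z(1)])
      show "(\<lambda>x. quad H (T x) x) \<in> borel_measurable M" by (rule quad_measurable[OF Hm FF.bounded_stopping_time_measurable[OF T]])
      show "AE x in M. norm (quad H (T x) x) \<le> norm (Z x)" using bT by eventually_elim auto
    qed
    have MM0: "MM 0 x = 0" for x by (simp add: MM_def Q0 quad_def)
    have "(\<integral>x. 1 * (MM (min (T x) N) x - MM (min (T x) 0) x) \<partial>M) = 0"
      by (rule FF.optional_stopping[OF mart MMc MMdom T order_refl N, where C=1]) auto
    also have "(\<integral>x. 1 * (MM (min (T x) N) x - MM (min (T x) 0) x) \<partial>M) = (\<integral>x. MM (T x) x \<partial>M)"
      by (rule Bochner_Integration.integral_cong[OF refl])
        (use FF.bounded_stopping_timeD(1,2)[OF T] MM0 in \<open>auto simp: min_absorb1 min_absorb2\<close>)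
    also have "\<dots> = (\<integral>x. (Q (T x) x)\<^sup>2 \<partial>M) - (\<integral>x. quad H (T x) x \<partial>M)"
      unfolding MM_def using Qi qi by simp
    finally show "(\<integral>x. (S0 + Y (T x) x - S (T x) x)\<^sup>2 \<partial>M) = (\<integral>x. quad H (T x) x \<partial>M)"
      by (simp add: Q_def)
  qed
  then show ?thesis by (simp add: H_def Y_def)
qed

end

text \<open>
  Iterating the integral inequality \<open>n\<close> times bounds \<open>\<psi> t\<close> by \<open>K (c t)^n / n!\<close>.
\<close>

lemma gronwall_zero:
  fixes \<psi> :: "real \<Rightarrow> ennreal"
  assumes c: "0 \<le> c" and K: "0 \<le> K" and b: "\<And>t. 0 < t \<Longrightarrow> t \<le> N \<Longrightarrow> \<psi> t \<le> ennreal K"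
    and i: "\<And>t. 0 < t \<Longrightarrow> t \<le> N \<Longrightarrow> \<psi> t \<le> ennreal c * (\<integral>\<^sup>+r. indicator {0<..t} r * \<psi> r \<partial>lborel)"
    and t: "0 < t" "t \<le> N"
  shows "\<psi> t = 0"
proof -
  have bound: "\<psi> t \<le> ennreal (K * ((c * t) ^ n / fact n))" if "0 < t" "t \<le> N" for n t
    using that
  proof (induction n arbitrary: t)
    case 0 then show ?case using b by simp
  next
    case (Suc n)
    have pos: "0 \<le> K * ((c * r) ^ n / fact n)" if "0 \<le> r" for r using that c K by simp
    have "\<psi> t \<le> ennreal c * (\<integral>\<^sup>+r. indicator {0<..t} r * \<psi> r \<partial>lborel)" by (rule i[OF Suc.prems])
    also have "(\<integral>\<^sup>+r. indicator {0<..t} r * \<psi> r \<partial>lborel) \<le> (\<integral>\<^sup>+r. ennreal (K * ((c * r) ^ n / fact n)) * indicator {0..t} r \<partial>lborel)"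
    proof (rule nn_integral_mono)
      fix r
      show "indicator {0<..t} r * \<psi> r \<le> ennreal (K * ((c * r) ^ n / fact n)) * indicator {0..t} r"
        using Suc.IH[of r] Suc.prems by (cases "r \<in> {0<..t}") auto
    qed
    then have "ennreal c * (\<integral>\<^sup>+r. indicator {0<..t} r * \<psi> r \<partial>lborel) \<le>
       ennreal c * (\<integral>\<^sup>+r. ennreal (K * ((c * r) ^ n / fact n)) * indicator {0..t} r \<partial>lborel)"
      by (rule mult_left_mono) simp
    also have "\<dots> = (\<integral>\<^sup>+r. ennreal c * (ennreal (K * ((c * r) ^ n / fact n)) * indicator {0..t} r) \<partial>lborel)"
      by (rule nn_integral_cmult[symmetric]) measurable
    also have "\<dots> = (\<integral>\<^sup>+r. ennreal (c * (K * ((c * r) ^ n / fact n))) * indicator {0..t} r \<partial>lborel)"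
    proof (rule nn_integral_cong)
      fix r
      show "ennreal c * (ennreal (K * ((c * r) ^ n / fact n)) * indicator {0..t} r) =
          ennreal (c * (K * ((c * r) ^ n / fact n))) * indicator {0..t} r"
        using ennreal_mult[OF c pos[of r]] by (cases "r \<in> {0..t}") simp_all
    qed
    also have "\<dots> = ennreal (K * ((c * t) ^ Suc n / fact (Suc n)) - K * ((c * 0) ^ Suc n / fact (Suc n)))"
    proof (rule nn_integral_FTC_Icc[where F="\<lambda>r. K * ((c * r) ^ Suc n / fact (Suc n))"])
      fix r assume "r \<in> {0..t}"
      then have r: "0 \<le> r" "r \<le> t" by auto
      show "0 \<le> c * (K * ((c * r) ^ n / fact n))" by (rule mult_nonneg_nonneg[OF c pos[OF r(1)]])
      show "((\<lambda>r. K * ((c * r) ^ Suc n / fact (Suc n))) has_real_derivative c * (K * ((c * r) ^ n / fact n))) (at r)"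
      proof -
        have "((\<lambda>r. c * r) has_real_derivative c) (at r)" using DERIV_cmult_Id[of c] by simp
        from DERIV_power[OF this, of "Suc n"]
        have d: "((\<lambda>r. (c * r) ^ Suc n) has_real_derivative real (Suc n) * (c * (c * r) ^ n)) (at r)" by simp
        have "((\<lambda>r. K * ((c * r) ^ Suc n / fact (Suc n))) has_real_derivative K * (real (Suc n) * (c * (c * r) ^ n) / fact (Suc n))) (at r)"
          by (intro DERIV_cmult DERIV_cdivide d)
        moreover have "K * (real (Suc n) * (c * (c * r) ^ n) / fact (Suc n)) = c * (K * ((c * r) ^ n / fact n))"
          by (simp add: fact_Suc del: of_nat_Suc power_Suc)
        ultimately show ?thesis by (simp only:)
      qed
    qed (use Suc.prems in auto)
    finally show ?case by simp
  qed
  have "(\<lambda>n. K * ((c * t) ^ n / fact n)) \<longlonglongrightarrow> K * 0"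
    using summable_LIMSEQ_zero[OF summable_exp[of "c * t"]]
    by (intro tendsto_mult[OF tendsto_const]) (simp add: divide_inverse mult.commute)
  then have "(\<lambda>n. ennreal (K * ((c * t) ^ n / fact n))) \<longlonglongrightarrow> ennreal 0"
    by (intro tendsto_ennrealI) simp
  then have "\<psi> t \<le> ennreal 0" by (rule LIMSEQ_le_const) (use bound[OF t] in auto)
  then show ?thesis by simp
qed

lemma ennreal_integral_le_nn_integral:
  fixes f :: "'a \<Rightarrow> real"
  assumes "\<And>x. 0 \<le> f x"
  shows "ennreal (\<integral>x. f x \<partial>M) \<le> (\<integral>\<^sup>+x. ennreal (f x) \<partial>M)"
proof (cases "integrable M f")
  case True
  then show ?thesis using nn_integral_eq_integral[OF True] assms by simp
next
  case False then show ?thesis by (simp add: not_integrable_integral_eq)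
qed

context black_scholes begin

lemma bounded_integral_isometry:
  assumes "bounded_integral M F W H Y" shows "isometry H Y"
  using assms
proof induction
  case (elem g n u f)
  have "FF.indistinguishable B W" unfolding FF.indistinguishable_def using B_AE by eventually_elim simp
  then have "FF.indistinguishable (elem_integral n u f B) (elem_integral n u f W)"
    by (rule FF.indistinguishable_elem_integral) (rule elem)
  then show ?case by (rule isometry_cong[OF elementary_isometry[OF elem]])
next
  case (lim H Y C H' Y') then show ?case by (intro isometry_limit[of H Y Y' H' C]) auto
qed

text \<open>
  Up to the first time at which \<open>X\<close> or \<open>B\<close> is large, the truncations of the integrand \<open>\<sigma> X\<close> are
  eventually the integrand itself, so the isometry passes to the limit once more and gives
  Gronwall's inequality for \<open>E (X\<^sub>T - S\<^sub>T)\<^sup>2\<close>.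
\<close>

theorem black_scholes_unique:
  assumes X: "solves_black_scholes M F W \<sigma> S0 X"
  shows "FF.indistinguishable X S"
proof -
  from X have Xad: "adapted F X" and Xc: "continuous_paths M X" and X0: "AE x in M. X 0 x = S0"
    and si: "stoch_integral M F W (\<lambda>t \<omega>. \<sigma> * X t \<omega>) (\<lambda>t \<omega>. X t \<omega> - S0)"
    by (auto simp: solves_black_scholes_def)
  define H where "H k t x = (if \<bar>\<sigma> * X t x\<bar> \<le> real k then \<sigma> * X t x else 0)" for k :: nat and t x
  from si obtain Z where Z: "\<And>k. bounded_integral M F W (H k) (Z k)" and e: "emery_tendsto M F Z (\<lambda>t \<omega>. X t \<omega> - S0)"
    unfolding stoch_integral_def H_def by blast
  have HZ: "isometry (H k) (Z k)" for k by (rule bounded_integral_isometry[OF Z])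
  have ucp: "ucp_tendsto M Z (\<lambda>t \<omega>. X t \<omega> - S0)" using e by (simp add: emery_tendsto_def)
  define X' where "X' t x = X t x - S0" for t x
  have X'ad: "adapted F X'" unfolding adapted_def
  proof (intro allI impI)
    fix t :: real assume "0 \<le> t"
    then have "X t \<in> borel_measurable (F t)" using Xad by (simp add: adapted_def)
    then show "X' t \<in> borel_measurable (F t)" unfolding X'_def[abs_def] by measurable
  qed
  have X'c: "continuous_paths M X'"
    using Xc unfolding continuous_paths_def X'_def by eventually_elim (intro continuous_intros)
  have X'0: "AE x in M. X' 0 x = 0" using X0 by eventually_elim (simp add: X'_def)
  have Hlim: "(\<lambda>k. H k t x) \<longlonglongrightarrow> \<sigma> * X t x" for t x
  proof -
    obtain k0 :: nat where k0: "\<bar>\<sigma> * X t x\<bar> \<le> real k0" using real_arch_simple by blast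
    have "\<forall>\<^sub>F k in sequentially. \<sigma> * X t x = H k t x"
      using eventually_ge_at_top[of k0]
    proof eventually_elim
      case (elim k)
      then have "\<bar>\<sigma> * X t x\<bar> \<le> real k" using k0 by (meson of_nat_le_iff order_trans)
      then show ?case by (simp add: H_def)
    qed
    then show ?thesis by (rule Lim_transform_eventually[OF tendsto_const])
  qed
  have Hm: "(\<lambda>p. indicator {0<..} (fst p) * (\<sigma> * X (fst p) (snd p))) \<in> borel_measurable (lborel \<Otimes>\<^sub>M M)"
  proof (rule borel_measurable_LIMSEQ_real[OF _ isometryD(4)[OF HZ]])
    fix p :: "real \<times> 'a"
    show "(\<lambda>k. indicator {0<..} (fst p) * H k (fst p) (snd p)) \<longlonglongrightarrow> indicator {0<..} (fst p) * (\<sigma> * X (fst p) (snd p))"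
      by (intro tendsto_mult[OF tendsto_const] Hlim)
  qed
  define D where "D t x = X t x - S t x" for t x
  have Dad: "adapted F D"
    unfolding adapted_def
  proof (intro allI impI)
    fix t :: real assume t: "0 \<le> t"
    then have "X t \<in> borel_measurable (F t)" using Xad by (simp add: adapted_def)
    then show "D t \<in> borel_measurable (F t)" unfolding D_def[abs_def] using S_F[OF t order_refl] by measurable
  qed
  have Dc: "continuous_paths M D"
    using Xc unfolding continuous_paths_def D_def by eventually_elim (intro continuous_intros S_continuous)
  have stopped_zero: "AE x in M. D (min (min (FF.hitting N (real (Suc k)) X' x) (FF.hitting N (real (Suc k)) B x)) t) x = 0"
    if N: "0 < N" and t: "0 < t" "t \<le> N" for N t k
  proof -
    define m where "m = real (Suc k)"
    have m: "0 \<le> m" by (simp add: m_def)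
    define T where "T x = min (FF.hitting N m X' x) (FF.hitting N m B x)" for x
    have N0: "0 \<le> N" using N by simp
    have T: "FF.bounded_stopping_time N T"
      unfolding T_def
      by (rule FF.bounded_stopping_time_min[OF FF.hitting_stopping_time[OF X'ad X'c N0] FF.hitting_stopping_time[OF B_adapted B_paths N0]])
    have b: "AE x in M. \<forall>s\<in>{0..T x}. \<bar>X' s x\<bar> \<le> m \<and> \<bar>B s x\<bar> \<le> m"
      using X'c X'0 unfolding continuous_paths_def
    proof eventually_elim
      case (elim x)
      show ?case
      proof
        fix s assume s: "s \<in> {0..T x}"
        have "\<bar>X' s x\<bar> \<le> m"
          by (rule FF.hitting_upto[where Z=X' and x=x and a=m and s=s, OF elim(1) N0]) (use s elim m in \<open>auto simp: T_def\<close>)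
        moreover have "\<bar>B s x\<bar> \<le> m"
          by (rule FF.hitting_upto[where Z=B and x=x and a=m and s=s, OF B_continuous N0]) (use s m in \<open>auto simp: T_def\<close>)
        ultimately show "\<bar>X' s x\<bar> \<le> m \<and> \<bar>B s x\<bar> \<le> m" by blast
      qed
    qed
    define L where "L = \<bar>S0\<bar> + m + \<bar>S0\<bar> * exp (\<bar>\<sigma>\<bar> * m)"
    have L: "0 \<le> L" using m by (simp add: L_def)
    have Db: "AE x in M. \<forall>s\<in>{0..T x}. (D s x)\<^sup>2 \<le> L\<^sup>2"
      using b
    proof eventually_elim
      case (elim x)
      show ?case
      proof
        fix s assume s: "s \<in> {0..T x}"
        then have "\<bar>X' s x\<bar> \<le> m" "\<bar>B s x\<bar> \<le> m" using elim by auto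
        then have "\<bar>X s x\<bar> \<le> \<bar>S0\<bar> + m" "\<bar>S s x\<bar> \<le> \<bar>S0\<bar> * exp (\<bar>\<sigma>\<bar> * m)"
          using S_le_bounded[of s x m] s unfolding X'_def by auto
        then have "\<bar>D s x\<bar> \<le> L" unfolding D_def L_def by linarith
        then have "\<bar>D s x\<bar>\<^sup>2 \<le> L\<^sup>2" by (rule power_mono) simp
        then show "(D s x)\<^sup>2 \<le> L\<^sup>2" by simp
      qed
    qed
    \<comment> \<open>The function to which Gronwall's lemma is applied.\<close>
    define \<psi> where "\<psi> r = (\<integral>\<^sup>+x. ennreal (of_bool (r \<le> T x) * (\<sigma> * X r x - \<sigma> * S r x)\<^sup>2) \<partial>M)" for r
    have TM[measurable]: "T \<in> borel_measurable M" by (rule FF.bounded_stopping_time_measurable[OF T])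
    have E: "(\<integral>\<^sup>+x. ennreal ((D (min (T x) t) x)\<^sup>2) \<partial>M) \<le> (\<integral>\<^sup>+r. indicator {0<..t} r * \<psi> r \<partial>lborel)"
      if t: "0 < t" "t \<le> N" for t
    proof -
      have t0: "0 \<le> t" using t by simp
      define T' where "T' x = min (T x) t" for x
      have T': "FF.bounded_stopping_time N T'" unfolding T'_def
        by (rule FF.bounded_stopping_time_min[OF T FF.bounded_stopping_time_const[OF t0]])
      have T'M: "T' \<in> borel_measurable M" by (rule FF.bounded_stopping_time_measurable[OF T'])
      have T'T: "T' x \<le> T x" for x by (simp add: T'_def)
      have id: "(\<integral>x. (S0 + (X (T' x) x - S0) - S (T' x) x)\<^sup>2 \<partial>M) = (\<integral>x. quad (\<lambda>t x. \<sigma> * X t x) (T' x) x \<partial>M)"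
      proof (rule isometry_limit_identity[OF HZ ucp Hlim T'])
        show "AE x in M. \<forall>s\<in>{0..T' x}. \<bar>X s x - S0\<bar> \<le> m \<and> \<bar>B s x\<bar> \<le> m"
          using b
        proof eventually_elim
          case (elim x) then show ?case using T'T[of x] by (auto simp: X'_def)
        qed
        show "AE x in M. \<forall>s\<in>{0<..T' x}. \<forall>k. \<bar>H k s x\<bar> \<le> \<bar>\<sigma>\<bar> * (\<bar>S0\<bar> + m)"
          using b
        proof eventually_elim
          case (elim x)
          show ?case
          proof (intro ballI allI)
            fix s k assume "s \<in> {0<..T' x}"
            then have "\<bar>X' s x\<bar> \<le> m" using elim T'T[of x] by auto
            then have "\<bar>X s x\<bar> \<le> \<bar>S0\<bar> + m" unfolding X'_def by linarith
            then have "\<bar>\<sigma> * X s x\<bar> \<le> \<bar>\<sigma>\<bar> * (\<bar>S0\<bar> + m)" unfolding abs_mult by (rule mult_left_mono) simp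
            moreover have "0 \<le> \<bar>\<sigma>\<bar> * (\<bar>S0\<bar> + m)" using m by simp
            ultimately show "\<bar>H k s x\<bar> \<le> \<bar>\<sigma>\<bar> * (\<bar>S0\<bar> + m)" by (simp add: H_def)
          qed
        qed
      qed
      have DTm: "(\<lambda>x. D (T' x) x) \<in> borel_measurable M" by (rule FF.eval_stopping_measurable[OF Dad Dc T'])
      have Di: "integrable M (\<lambda>x. (D (T' x) x)\<^sup>2)"
      proof (rule Bochner_Integration.integrable_bound[of M "\<lambda>_. L\<^sup>2"])
        show "AE x in M. norm ((D (T' x) x)\<^sup>2) \<le> norm (L\<^sup>2)"
          using Db AE_space
        proof eventually_elim
          case (elim x)
          have "T' x \<in> {0..T x}" using FF.bounded_stopping_timeD(1)[OF T' elim(2)] T'T by simp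
          then show ?case using elim(1) by auto
        qed
      qed (use DTm in auto)
      have "(\<integral>\<^sup>+x. ennreal ((D (T' x) x)\<^sup>2) \<partial>M) = ennreal (\<integral>x. (D (T' x) x)\<^sup>2 \<partial>M)"
        by (rule nn_integral_eq_integral[OF Di]) simp
      also have "(\<integral>x. (D (T' x) x)\<^sup>2 \<partial>M) = (\<integral>x. quad (\<lambda>t x. \<sigma> * X t x) (T' x) x \<partial>M)"
        using id by (simp add: D_def)
      also have "ennreal (\<integral>x. quad (\<lambda>t x. \<sigma> * X t x) (T' x) x \<partial>M) \<le> (\<integral>\<^sup>+x. ennreal (quad (\<lambda>t x. \<sigma> * X t x) (T' x) x) \<partial>M)"
        by (rule ennreal_integral_le_nn_integral) (auto simp: quad_def)
      also have "\<dots> \<le> (\<integral>\<^sup>+x. (\<integral>\<^sup>+r. ennreal (indicator {0<..T' x} r * (\<sigma> * X r x - \<sigma> * S r x)\<^sup>2) \<partial>lborel) \<partial>M)"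
        unfolding quad_def by (intro nn_integral_mono ennreal_integral_le_nn_integral) simp
      also have "\<dots> = (\<integral>\<^sup>+r. (\<integral>\<^sup>+x. ennreal (indicator {0<..T' x} r * (\<sigma> * X r x - \<sigma> * S r x)\<^sup>2) \<partial>M) \<partial>lborel)"
      proof -
        interpret P: pair_sigma_finite lborel M by unfold_locales
        have "(\<lambda>(r, x). ennreal (indicator {0<..T' x} r * (\<sigma> * X r x - \<sigma> * S r x)\<^sup>2)) \<in> borel_measurable (lborel \<Otimes>\<^sub>M M)"
          using quad_integrand_measurable[OF Hm T'M] by (simp add: split_def)
        from P.Fubini'[OF this] show ?thesis by simp
      qed
      also have "\<dots> = (\<integral>\<^sup>+r. indicator {0<..t} r * \<psi> r \<partial>lborel)"
      proof (rule nn_integral_cong)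
        fix r
        show "(\<integral>\<^sup>+x. ennreal (indicator {0<..T' x} r * (\<sigma> * X r x - \<sigma> * S r x)\<^sup>2) \<partial>M) = indicator {0<..t} r * \<psi> r"
        proof (cases "r \<in> {0<..t}")
          case True
          then have "indicator {0<..T' x} r = (of_bool (r \<le> T x) :: real)" for x by (simp add: T'_def)
          then show ?thesis using True by (simp add: \<psi>_def)
        next
          case False
          then have "indicator {0<..T' x} r = (0 :: real)" for x by (auto simp: T'_def)
          then show ?thesis using False by simp
        qed
      qed
      finally show ?thesis by (simp add: T'_def)
    qed
    have \<psi>D: "\<psi> r \<le> ennreal (\<sigma>\<^sup>2) * (\<integral>\<^sup>+x. ennreal ((D (min (T x) r) x)\<^sup>2) \<partial>M)" if r: "0 < r" for r
    proof -
      have "FF.bounded_stopping_time N (\<lambda>x. min (T x) r)"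
        by (rule FF.bounded_stopping_time_min[OF T FF.bounded_stopping_time_const]) (use r in simp)
      then have "(\<lambda>x. D (min (T x) r) x) \<in> borel_measurable M" by (rule FF.eval_stopping_measurable[OF Dad Dc])
      then have "ennreal (\<sigma>\<^sup>2) * (\<integral>\<^sup>+x. ennreal ((D (min (T x) r) x)\<^sup>2) \<partial>M) =
          (\<integral>\<^sup>+x. ennreal (\<sigma>\<^sup>2) * ennreal ((D (min (T x) r) x)\<^sup>2) \<partial>M)"
        by (intro nn_integral_cmult[symmetric]) measurable
      moreover have "\<psi> r \<le> \<dots>" unfolding \<psi>_def
      proof (rule nn_integral_mono)
        fix x
        have "(\<sigma> * X r x - \<sigma> * S r x)\<^sup>2 = \<sigma>\<^sup>2 * (D r x)\<^sup>2" by (simp add: D_def power_mult_distrib[symmetric] right_diff_distrib)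
        then show "ennreal (of_bool (r \<le> T x) * (\<sigma> * X r x - \<sigma> * S r x)\<^sup>2) \<le> ennreal (\<sigma>\<^sup>2) * ennreal ((D (min (T x) r) x)\<^sup>2)"
          by (auto simp: ennreal_mult[symmetric])
      qed
      ultimately show ?thesis by simp
    qed
    have \<psi>0: "\<psi> r = 0" if r: "0 < r" "r \<le> N" for r
    proof (rule gronwall_zero[where c="\<sigma>\<^sup>2" and K="\<sigma>\<^sup>2 * L\<^sup>2" and N=N])
      show "\<psi> t \<le> ennreal (\<sigma>\<^sup>2 * L\<^sup>2)" if t: "0 < t" "t \<le> N" for t
      proof -
        have "\<psi> t \<le> (\<integral>\<^sup>+x. ennreal (\<sigma>\<^sup>2 * L\<^sup>2) \<partial>M)"
          unfolding \<psi>_def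
        proof (rule nn_integral_mono_AE)
          show "AE x in M. ennreal (of_bool (t \<le> T x) * (\<sigma> * X t x - \<sigma> * S t x)\<^sup>2) \<le> ennreal (\<sigma>\<^sup>2 * L\<^sup>2)"
            using Db
          proof eventually_elim
            case (elim x)
            have "(\<sigma> * X t x - \<sigma> * S t x)\<^sup>2 = \<sigma>\<^sup>2 * (D t x)\<^sup>2" by (simp add: D_def power_mult_distrib[symmetric] right_diff_distrib)
            then show ?case using elim t by (cases "t \<le> T x") (auto intro!: ennreal_leI mult_left_mono)
          qed
        qed
        then show ?thesis by (simp add: emeasure_space_1)
      qed
      show "\<psi> t \<le> ennreal (\<sigma>\<^sup>2) * (\<integral>\<^sup>+r. indicator {0<..t} r * \<psi> r \<partial>lborel)" if t: "0 < t" "t \<le> N" for t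
        using \<psi>D[OF t(1)] mult_left_mono[OF E[OF t], of "ennreal (\<sigma>\<^sup>2)"] by (auto intro: order_trans)
    qed (use r in auto)
    have "(\<integral>\<^sup>+x. ennreal ((D (min (T x) t) x)\<^sup>2) \<partial>M) \<le> (\<integral>\<^sup>+r. indicator {0<..t} r * \<psi> r \<partial>lborel)" by (rule E[OF t])
    also have "\<dots> = (\<integral>\<^sup>+r. 0 \<partial>(lborel :: real measure))"
    proof (rule nn_integral_cong)
      fix r show "indicator {0<..t} r * \<psi> r = 0" using \<psi>0[of r] t by (cases "r \<in> {0<..t}") auto
    qed
    finally have z: "(\<integral>\<^sup>+x. ennreal ((D (min (T x) t) x)\<^sup>2) \<partial>M) = 0" by simp
    have "FF.bounded_stopping_time N (\<lambda>x. min (T x) t)"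
      by (rule FF.bounded_stopping_time_min[OF T FF.bounded_stopping_time_const]) (use t in simp)
    then have "(\<lambda>x. D (min (T x) t) x) \<in> borel_measurable M" by (rule FF.eval_stopping_measurable[OF Dad Dc])
    then have "AE x in M. ennreal ((D (min (T x) t) x)\<^sup>2) = 0"
      using z by (subst (asm) nn_integral_0_iff_AE) auto
    then have "AE x in M. D (min (T x) t) x = 0" by eventually_elim (simp add: ennreal_eq_0_iff)
    then show ?thesis by (simp add: T_def m_def)
  qed
  have zero: "AE x in M. D t x = 0" if t: "0 \<le> t" for t
  proof -
    define N where "N = t + 1"
    have N: "0 < N" "0 \<le> N" "t \<le> N" using t by (auto simp: N_def)
    have "AE x in M. 0 < t \<longrightarrow> (\<forall>k. D (min (min (FF.hitting N (real (Suc k)) X' x) (FF.hitting N (real (Suc k)) B x)) t) x = 0)"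
    proof (cases "0 < t")
      case True
      have "AE x in M. \<forall>k. D (min (min (FF.hitting N (real (Suc k)) X' x) (FF.hitting N (real (Suc k)) B x)) t) x = 0"
        unfolding AE_all_countable using stopped_zero[OF N(1) True N(3)] by blast
      then show ?thesis by eventually_elim simp
    qed simp
    then show ?thesis using X'c X0 unfolding continuous_paths_def
    proof eventually_elim
      case (elim x)
      show ?case
      proof (cases "t = 0")
        case True then show ?thesis using elim(3) by (simp add: D_def)
      next
        case False
        obtain m1 where m1: "\<forall>s\<in>{0..N}. \<bar>X' s x\<bar> < real m1" using continuous_halfline_bounded[OF elim(2)] by blast
        obtain m2 where m2: "\<forall>s\<in>{0..N}. \<bar>B s x\<bar> < real m2" using continuous_halfline_bounded[OF B_continuous] by blast
        define k where "k = m1 + m2"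
        have "FF.hitting N (real (Suc k)) X' x = N" by (rule FF.hitting_eq_N) (use m1 in \<open>force simp: k_def\<close>)
        moreover have "FF.hitting N (real (Suc k)) B x = N" by (rule FF.hitting_eq_N) (use m2 in \<open>force simp: k_def\<close>)
        ultimately show ?thesis using elim(1) False t N by (auto simp: min_def split: if_splits dest!: spec[of _ k])
      qed
    qed
  qed
  have "countable (\<rat> \<inter> {0::real..})" by (intro countable_Int1) (rule countable_rat)
  then have "AE x in M. \<forall>q\<in>\<rat> \<inter> {0..}. D q x = 0" using zero by (subst AE_ball_countable) auto
  then show ?thesis unfolding FF.indistinguishable_def using Dc unfolding continuous_paths_def
  proof eventually_elim
    case (elim x)
    show ?case
    proof (intro allI impI)
      fix t :: real assume t: "0 \<le> t"
      have "0 \<le> - \<bar>D t x\<bar>"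
        by (rule continuous_lower_bound[of "\<lambda>t. - \<bar>D t x\<bar>", OF _ _ t])
          (use elim in \<open>auto intro!: continuous_intros\<close>)
      then show "X t x = S t x" by (simp add: D_def)
    qed
  qed
qed

end

section \<open>Progressive enlargement\<close>

text \<open>
  Traces on \<open>D\<close> can be compared on generators.  Before \<open>\<tau>\<close> the enlarged filtration has the traces of
  \<open>F\<close>; after \<open>\<tau>\<close> it will be compared with a filtration that knows the terminal value.
\<close>

lemma trace_sigma_sets:
  assumes A: "A \<in> sigma_sets (space N) G"
    and G: "\<And>a. a \<in> G \<Longrightarrow> \<exists>b\<in>sets N. a \<inter> D = b \<inter> D"
  shows "\<exists>b\<in>sets N. A \<inter> D = b \<inter> D"
  using A
proof induction
  case (Basic a) then show ?case by (rule G)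
next
  case Empty then show ?case by (intro bexI[of _ "{}"]) auto
next
  case (Compl a)
  then obtain b where b: "b \<in> sets N" "a \<inter> D = b \<inter> D" by blast
  then show ?case by (intro bexI[of _ "space N - b"]) auto
next
  case (Union a)
  then have "\<forall>i. \<exists>b. b \<in> sets N \<and> a i \<inter> D = b \<inter> D" by blast
  then obtain b where b: "\<And>i. b i \<in> sets N" "\<And>i. a i \<inter> D = b i \<inter> D" by metis
  then show ?case by (intro bexI[of _ "\<Union>i. b i"]) auto
qed

locale random_time = brownian +
  fixes \<tau> :: "'a \<Rightarrow> real"
  assumes \<tau>_meas[measurable]: "\<tau> \<in> borel_measurable M" and \<tau>_nonneg: "0 \<le> \<tau> x"
begin

text \<open>The enlargement before passing to right limits.\<close>

definition E :: "real \<Rightarrow> 'a measure" where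
  "E v = sigma (space M) (sets (F v) \<union> {(\<lambda>\<omega>. min (\<tau> \<omega>) v) -` B \<inter> space M | B. B \<in> sets borel})"

abbreviation G :: "real \<Rightarrow> 'a measure" where "G \<equiv> progressive_enlargement M F \<tau>"

lemma sets_E: "sets (E v) = sigma_sets (space M) (sets (F v) \<union> {(\<lambda>\<omega>. min (\<tau> \<omega>) v) -` B \<inter> space M | B. B \<in> sets borel})"
  and space_E[simp]: "space (E v) = space M"
proof -
  have "sets (F v) \<union> {(\<lambda>\<omega>. min (\<tau> \<omega>) v) -` B \<inter> space M | B. B \<in> sets borel} \<subseteq> Pow (space M)"
    using sets.sets_into_space[of _ "F v"] by auto
  then show "sets (E v) = sigma_sets (space M) (sets (F v) \<union> {(\<lambda>\<omega>. min (\<tau> \<omega>) v) -` B \<inter> space M | B. B \<in> sets borel})"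
    and "space (E v) = space M"
    by (simp_all add: E_def)
qed

lemma E_full: assumes v: "0 \<le> v" shows "full_subalgebra M (E v)"
  unfolding full_subalgebra_def subalgebra_def
proof (intro conjI)
  have m: "(\<lambda>\<omega>. min (\<tau> \<omega>) v) \<in> borel_measurable M" by measurable
  show "sets (E v) \<subseteq> sets M"
    unfolding sets_E
  proof (rule sets.sigma_sets_subset)
    show "sets (F v) \<union> {(\<lambda>\<omega>. min (\<tau> \<omega>) v) -` B \<inter> space M | B. B \<in> sets borel} \<subseteq> sets M"
      using full_subalgebraD(2)[OF FF.filt_full[OF v]] measurable_sets[OF m] by auto
  qed
  show "null_sets M \<subseteq> sets (E v)" unfolding sets_E using full_subalgebraD(3)[OF FF.filt_full[OF v]] by blast
qed simp

lemma F_sub_E: "sets (F v) \<subseteq> sets (E v)"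
  unfolding sets_E by blast

lemma min_\<tau>_E: "s \<le> v \<Longrightarrow> (\<lambda>x. min (\<tau> x) s) \<in> borel_measurable (E v)"
proof -
  assume s: "s \<le> v"
  have "(\<lambda>x. min (\<tau> x) v) \<in> borel_measurable (E v)"
    by (rule measurableI) (auto simp: sets_E intro!: sigma_sets.Basic)
  then have "(\<lambda>x. min (min (\<tau> x) v) s) \<in> borel_measurable (E v)" by measurable
  then show ?thesis using s by (simp add: min.assoc min_absorb2)
qed

lemma E_mono: assumes "0 \<le> s" "s \<le> t" shows "sets (E s) \<subseteq> sets (E t)"
proof -
  have "sets (F s) \<union> {(\<lambda>\<omega>. min (\<tau> \<omega>) s) -` B \<inter> space M | B. B \<in> sets borel} \<subseteq> sets (E t)"
    using FF.filt_mono[OF assms] F_sub_E[of t] measurable_sets[OF min_\<tau>_E[OF assms(2)]] by auto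
  from sets.sigma_sets_subset[OF this] show ?thesis by (simp only: sets_E[of s] space_E)
qed

lemma sets_G: "sets (G t) = (\<Inter>\<epsilon>\<in>{0<..}. sets (E (t + \<epsilon>)))"
  and space_G[simp]: "space (G t) = space M"
proof -
  let ?I = "\<Inter>\<epsilon>\<in>{0<..}. sets (E (t + \<epsilon>))"
  have I: "?I \<subseteq> Pow (space M)"
  proof
    fix A assume "A \<in> ?I"
    then have "A \<in> sets (E (t + 1))" by auto
    then show "A \<in> Pow (space M)" using sets.sets_into_space by fastforce
  qed
  have G: "G t = sigma (space M) ?I"
    unfolding progressive_enlargement_def sets_E ..
  have "sigma_sets (space M) ?I \<subseteq> ?I"
  proof
    fix A assume "A \<in> sigma_sets (space M) ?I"
    show "A \<in> ?I"
    proof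
      fix e :: real assume "e \<in> {0<..}"
      then have "?I \<subseteq> sets (E (t + e))" by auto
      then have "sigma_sets (space M) ?I \<subseteq> sets (E (t + e))"
        using sets.sigma_sets_subset[of ?I "E (t + e)"] by simp
      then show "A \<in> sets (E (t + e))" using \<open>A \<in> sigma_sets (space M) ?I\<close> by blast
    qed
  qed
  then show "sets (G t) = ?I" unfolding G using I sigma_sets_superset_generator[of ?I "space M"]
    by (simp only: sets_measure_of subset_antisym)
  show "space (G t) = space M" unfolding G using I by simp
qed

lemma G_sub_E: "0 < e \<Longrightarrow> sets (G t) \<subseteq> sets (E (t + e))"
  unfolding sets_G by auto

lemma measurable_G:
  fixes f :: "'a \<Rightarrow> 'b::topological_space"
  shows "(\<And>e. 0 < e \<Longrightarrow> f \<in> borel_measurable (E (t + e))) \<Longrightarrow> f \<in> borel_measurable (G t)"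
proof (rule measurableI)
  fix B :: "'b set" assume f: "\<And>e. 0 < e \<Longrightarrow> f \<in> borel_measurable (E (t + e))" and B: "B \<in> sets borel"
  have "f -` B \<inter> space M \<in> sets (E (t + e))" if "0 < e" for e
    using measurable_sets[OF f[OF that] B] by simp
  then show "f -` B \<inter> space (G t) \<in> sets (G t)" unfolding sets_G space_G by blast
qed simp

lemma filtered_G: "filtered_space M G"
proof
  fix t :: real assume t: "0 \<le> t"
  have t1: "0 \<le> t + 1" using t by simp
  have "sets (G t) \<subseteq> sets M"
    by (rule order_trans[OF G_sub_E[of 1 t] full_subalgebraD(2)[OF E_full[OF t1]]]) simp
  moreover have "null_sets M \<subseteq> sets (G t)"
    unfolding sets_G
  proof (rule INT_greatest)
    fix e :: real assume "e \<in> {0<..}"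
    then have "0 \<le> t + e" using t by simp
    from full_subalgebraD(3)[OF E_full[OF this]] show "null_sets M \<subseteq> sets (E (t + e))" .
  qed
  ultimately show "full_subalgebra M (G t)" by (simp add: full_subalgebra_def subalgebra_def)
next
  fix s t :: real assume "0 \<le> s" "s \<le> t"
  then show "sets (G s) \<subseteq> sets (G t)"
    unfolding sets_G by (intro INF_superset_mono[OF order_refl] E_mono) auto
qed

sublocale GG: filtered_space M G by (rule filtered_G)

lemma stopped_adapted:
  assumes X: "\<And>s t. 0 \<le> s \<Longrightarrow> s \<le> t \<Longrightarrow> X s \<in> borel_measurable (F t)"
    and c: "\<And>x. x \<in> space M \<Longrightarrow> continuous_on {0..} (\<lambda>t. X t x)"
  shows "adapted G (stopped X \<tau>)"
  unfolding adapted_def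
proof (intro allI impI measurable_G)
  fix t e :: real assume t: "0 \<le> t" and e: "0 < e"
  define g where "g n x = nat \<lfloor>real (Suc n) * min (\<tau> x) t\<rfloor>" for n x
  have te: "0 \<le> t + e" using t e by simp
  show "stopped X \<tau> t \<in> borel_measurable (E (t + e))"
  proof (rule full_subalgebra_AE_lim[OF E_full[OF te]])
    show "(\<lambda>x. X (min (real (g n x) / real (Suc n)) t) x) \<in> borel_measurable (E (t + e))" for n
    proof (rule measurable_compose_countable[where f="\<lambda>i x. X (min (real i / real (Suc n)) t) x" and g="g n"])
      fix i
      have "X (min (real i / real (Suc n)) t) \<in> borel_measurable (F (t + e))" by (rule X) (use t e in auto)
      then show "X (min (real i / real (Suc n)) t) \<in> borel_measurable (E (t + e))"
        using F_sub_E[of "t + e"] by (auto simp: measurable_def)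
      show "g n \<in> measurable (E (t + e)) (count_space UNIV)"
      proof -
        have "(\<lambda>x. min (\<tau> x) t) \<in> borel_measurable (E (t + e))" by (rule min_\<tau>_E) (use e in simp)
        then show ?thesis unfolding g_def by measurable
      qed
    qed
    show "AE x in M. (\<lambda>n. X (min (real (g n x) / real (Suc n)) t) x) \<longlonglongrightarrow> stopped X \<tau> t x"
    proof (rule AE_I2)
      fix x assume x: "x \<in> space M"
      have "(\<lambda>n. real (g n x) / real (Suc n)) \<longlonglongrightarrow> min (\<tau> x) t"
        unfolding g_def by (rule floor_approximation) (use \<tau>_nonneg t in simp)
      then have "(\<lambda>n. min (real (g n x) / real (Suc n)) t) \<longlonglongrightarrow> min (min (\<tau> x) t) t" by (intro tendsto_intros)
      then have "(\<lambda>n. min (real (g n x) / real (Suc n)) t) \<longlonglongrightarrow> min t (\<tau> x)" by (simp add: min.commute min.left_commute)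
      then show "(\<lambda>n. X (min (real (g n x) / real (Suc n)) t) x) \<longlonglongrightarrow> stopped X \<tau> t x"
        unfolding stopped_def by (intro continuous_on_tendsto_compose[OF c[OF x]]) (use t \<tau>_nonneg in auto)
    qed
  qed
qed

lemma stopped_dominated:
  assumes "dominated M X" shows "dominated M (stopped X \<tau>)"
  unfolding dominated_def
proof
  fix N
  obtain Z where Z: "integrable M Z" "AE x in M. \<forall>s\<in>{0..N}. \<bar>X s x\<bar> \<le> Z x"
    using assms unfolding dominated_def by blast
  have "AE x in M. \<forall>s\<in>{0..N}. \<bar>stopped X \<tau> s x\<bar> \<le> Z x"
    using Z(2)
  proof eventually_elim
    case (elim x)
    then show ?case using \<tau>_nonneg[of x] by (auto simp: stopped_def intro!: bspec[OF elim])
  qed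
  with Z(1) show "\<exists>Z. integrable M Z \<and> (AE x in M. \<forall>s\<in>{0..N}. \<bar>stopped X \<tau> s x\<bar> \<le> Z x)" by blast
qed

text \<open>
  For a continuous dominated process the martingale property may be tested in the filtration \<open>E\<close>
  without right limits: an event of \<open>G s\<close> belongs to \<open>E (s + e)\<close> for all \<open>e > 0\<close>, and \<open>e\<close> tends to 0.
\<close>

lemma G_martingaleI:
  assumes m: "\<And>t. 0 \<le> t \<Longrightarrow> Y t \<in> borel_measurable M"
    and c: "\<And>x. x \<in> space M \<Longrightarrow> continuous_on {0..} (\<lambda>t. Y t x)" and dom: "dominated M Y"
    and orth: "\<And>s t A. 0 \<le> s \<Longrightarrow> s \<le> t \<Longrightarrow> A \<in> sets (E s) \<Longrightarrow> (\<integral>x. indicator A x * (Y t x - Y s x) \<partial>M) = 0"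
  shows "GG.martingale Y"
  unfolding GG.martingale_def
proof (intro conjI allI impI)
  show "integrable M (Y t)" if "0 \<le> t" for t by (rule dominated_integrable[OF dom m[OF that] that])
  fix s t :: real and A assume st: "0 \<le> s" "s \<le> t" and A: "A \<in> sets (G s)"
  have t: "0 \<le> t" using st by simp
  obtain Z where Z: "integrable M Z" "AE x in M. \<forall>r\<in>{0..t}. \<bar>Y r x\<bar> \<le> Z x"
    using dom unfolding dominated_def by blast
  have AM[measurable]: "A \<in> sets M" using A GG.filt_sub[OF st(1)] by (auto simp: subalgebra_def)
  show "(\<integral>x. indicator A x * (Y t x - Y s x) \<partial>M) = 0"
  proof (cases "s = t")
    case False
    then have lt: "s < t" using st by simp
    define e where "e n = (t - s) / real (Suc n)" for n
    have e: "0 < e n" "s + e n \<le> t" for n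
    proof -
      show "0 < e n" using lt by (simp add: e_def)
      have "(t - s) / real (Suc n) \<le> (t - s) / 1" using lt by (intro divide_left_mono) auto
      then show "s + e n \<le> t" by (simp add: e_def)
    qed
    have se: "0 \<le> s + e n" for n using e(1)[of n] st by simp
    have e_lim: "e \<longlonglongrightarrow> 0"
      using tendsto_mult_right_zero[OF LIMSEQ_inverse_real_of_nat, of "t - s"] by (simp add: e_def[abs_def] divide_inverse)
    have "(\<lambda>n. \<integral>x. indicator A x * (Y t x - Y (s + e n) x) \<partial>M) \<longlonglongrightarrow> (\<integral>x. indicator A x * (Y t x - Y s x) \<partial>M)"
    proof (rule integral_dominated_convergence[where w="\<lambda>x. 2 * Z x"])
      show "integrable M (\<lambda>x. 2 * Z x)" using Z(1) by simp
      show "(\<lambda>x. indicator A x * (Y t x - Y s x)) \<in> borel_measurable M" using m[OF t] m[OF st(1)] by measurable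
      show "(\<lambda>x. indicator A x * (Y t x - Y (s + e n) x)) \<in> borel_measurable M" for n
        using m[OF t] m[OF se[of n]] by (intro borel_measurable_times borel_measurable_diff) auto
      show "AE x in M. (\<lambda>n. indicator A x * (Y t x - Y (s + e n) x)) \<longlonglongrightarrow> indicator A x * (Y t x - Y s x)"
      proof (rule AE_I2)
        fix x assume x: "x \<in> space M"
        have "(\<lambda>n. s + e n) \<longlonglongrightarrow> s + 0" by (intro tendsto_intros e_lim)
        then have "(\<lambda>n. Y (s + e n) x) \<longlonglongrightarrow> Y s x"
          by (intro continuous_on_tendsto_compose[OF c[OF x]]) (use se st in auto)
        then show "(\<lambda>n. indicator A x * (Y t x - Y (s + e n) x)) \<longlonglongrightarrow> indicator A x * (Y t x - Y s x)"
          by (intro tendsto_intros)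
      qed
      show "AE x in M. norm (indicator A x * (Y t x - Y (s + e n) x)) \<le> 2 * Z x" for n
        using Z(2)
      proof eventually_elim
        case (elim x)
        have "\<bar>Y t x\<bar> \<le> Z x" "\<bar>Y (s + e n) x\<bar> \<le> Z x" using elim t se[of n] e(2)[of n] by auto
        then show ?case by (auto simp: indicator_def)
      qed
    qed
    moreover have "(\<integral>x. indicator A x * (Y t x - Y (s + e n) x) \<partial>M) = 0" for n
      by (rule orth[OF se e(2)]) (use A G_sub_E[OF e(1)] in blast)
    ultimately show ?thesis by (simp add: LIMSEQ_const_iff)
  qed simp
qed

text \<open>On the event \<open>s \<le> \<tau>\<close> the variable \<open>min \<tau> s\<close> is constant.\<close>

lemma trace_before:
  assumes s: "0 \<le> s" and A: "A \<in> sets (E s)"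
  shows "\<exists>B\<in>sets (F s). A \<inter> {x. s \<le> \<tau> x} = B \<inter> {x. s \<le> \<tau> x}"
proof (rule trace_sigma_sets[of A "F s"])
  show "A \<in> sigma_sets (space (F s)) (sets (F s) \<union> {(\<lambda>\<omega>. min (\<tau> \<omega>) s) -` B \<inter> space M | B. B \<in> sets borel})"
    using A by (simp add: sets_E)
  fix a assume "a \<in> sets (F s) \<union> {(\<lambda>\<omega>. min (\<tau> \<omega>) s) -` B \<inter> space M | B. B \<in> sets borel}"
  then consider "a \<in> sets (F s)" | B where "a = (\<lambda>\<omega>. min (\<tau> \<omega>) s) -` B \<inter> space M" by blast
  then show "\<exists>b\<in>sets (F s). a \<inter> {x. s \<le> \<tau> x} = b \<inter> {x. s \<le> \<tau> x}"
  proof cases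
    case 1 then show ?thesis by blast
  next
    case 2
    have "(if s \<in> B then space (F s) else {}) \<in> sets (F s)" by (simp del: space_F)
    moreover have "a \<inter> {x. s \<le> \<tau> x} = (if s \<in> B then space (F s) else {}) \<inter> {x. s \<le> \<tau> x}"
      unfolding 2 by (auto simp: min_absorb2)
    ultimately show ?thesis by blast
  qed
qed

end

section \<open>Pseudo-stopping times\<close>

text \<open>
  Whether \<open>\<tau>\<close> lies after \<open>w\<close> depends on the increments after \<open>w\<close> alone.  In general this is not a
  stopping time, but martingales of \<open>F\<close> stopped at it are still martingales, even of \<open>G\<close>.
\<close>

locale pseudo_stopping_time = random_time +
  assumes \<tau>_future: "0 < w \<Longrightarrow> {x \<in> space M. w \<le> \<tau> x} \<in> sets (future_increments w)"
begin

text \<open>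
  The stopped increment is the limit of the grid sums of \<open>X\<close> over the cells whose right end lies
  before \<open>\<tau>\<close>.  This selection is independent of the past of the right end, in particular of the
  increment over the cell, which has zero expectation against \<open>C\<close>.
\<close>

lemma stopped_past_orthogonal:
  fixes X :: "real \<Rightarrow> 'a \<Rightarrow> real"
  assumes X: "FF.martingale X" and ad: "\<And>s t. 0 \<le> s \<Longrightarrow> s \<le> t \<Longrightarrow> X s \<in> borel_measurable (F t)"
    and c: "\<And>x. x \<in> space M \<Longrightarrow> continuous_on {0..} (\<lambda>t. X t x)" and dom: "dominated M X"
    and wv: "0 \<le> w" "w \<le> v" and C: "C \<in> sets (F w)"
  shows "(\<integral>x. indicator C x * (stopped X \<tau> v x - stopped X \<tau> w x) \<partial>M) = 0"
proof -
  obtain Z where Z: "integrable M Z" "AE x in M. \<forall>r\<in>{0..v}. \<bar>X r x\<bar> \<le> Z x"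
    using dom unfolding dominated_def by blast
  define g where "g n j = w + (v - w) * real j / real (Suc n)" for n j
  have g0: "0 \<le> g n j" "w \<le> g n j" "g n j \<le> g n (Suc j)" for n j
    using wv by (auto simp: g_def intro!: add_nonneg_nonneg divide_right_mono mult_left_mono)
  have XM[measurable]: "X r \<in> borel_measurable M" if "0 \<le> r" for r
    using FF.martingaleD(1)[OF X that] by auto
  have CM[measurable]: "C \<in> sets M" using C FF.filt_sub[OF wv(1)] by (auto simp: subalgebra_def)
  define S where "S n x = (\<Sum>j<Suc n. of_bool (g n (Suc j) \<le> \<tau> x) * (X (g n (Suc j)) x - X (g n j) x))" for n x
  define L where "L x = stopped X \<tau> v x - stopped X \<tau> w x" for x
  have Smeas: "S n \<in> borel_measurable M" for n
    unfolding S_def using XM g0 by (intro borel_measurable_sum borel_measurable_times borel_measurable_diff) auto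
  have Lm: "L \<in> borel_measurable M"
    using GG.adapted_measurable[OF stopped_adapted[of X], of v] GG.adapted_measurable[OF stopped_adapted[of X], of w] ad c wv
    unfolding L_def[abs_def] by auto
  have AEb: "AE x in M. (\<lambda>n. S n x) \<longlonglongrightarrow> L x \<and> (\<forall>n. \<bar>S n x\<bar> \<le> 2 * Z x)"
    using Z(2) AE_space
  proof eventually_elim
    fix x assume Zx: "\<forall>r\<in>{0..v}. \<bar>X r x\<bar> \<le> Z x" and x: "x \<in> space M"
    define cc where "cc = max w (min (\<tau> x) v)"
    have cin: "cc \<in> {w..v}" using wv by (auto simp: cc_def)
    have L: "L x = X cc x - X w x" unfolding L_def cc_def stopped_def using wv by (auto simp: max_def min_def)
    note gs = grid_sum_limit[of w v "\<lambda>r. X r x" cc g "\<lambda>n j. g n (Suc j) \<le> \<tau> x"]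
    have gg: "g n i \<le> g n j" if "i \<le> j" for n i j
      using that wv unfolding g_def by (intro add_left_mono divide_right_mono mult_left_mono) auto
    have pre1: "continuous_on {w..v} (\<lambda>r. X r x)" using c[OF x] wv by (auto elim: continuous_on_subset)
    have pre4: "\<And>n i j. i \<le> j \<Longrightarrow> j < Suc n \<Longrightarrow> g n (Suc j) \<le> \<tau> x \<Longrightarrow> g n (Suc i) \<le> \<tau> x"
      using gg by (meson Suc_le_mono order_trans)
    have gv: "g n j \<le> v" if "j \<le> Suc n" for n j using gg[OF that, of n] by (simp add: g_def del: of_nat_Suc)
    have pre5: "\<And>n j. j < Suc n \<Longrightarrow> g n (Suc j) \<le> \<tau> x \<Longrightarrow> g n j \<le> cc"
    proof -
      fix n j assume "j < Suc n" "g n (Suc j) \<le> \<tau> x"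
      then show "g n j \<le> cc" using gv[of j n] g0(3)[of n j] unfolding cc_def by auto
    qed
    have pre6: "\<And>n j. j < Suc n \<Longrightarrow> \<not> g n (Suc j) \<le> \<tau> x \<Longrightarrow> cc \<le> g n (Suc j)"
      unfolding cc_def using g0(2) by auto
    have "(\<lambda>n. S n x) \<longlonglongrightarrow> L x" unfolding S_def L by (rule gs(1)[OF pre1 cin g_def pre4 pre5 pre6]; assumption)
    moreover have "\<bar>S n x\<bar> \<le> 2 * Z x" for n
    proof -
      have "\<exists>r\<in>{w..v}. S n x = X r x - X w x" unfolding S_def
        by (rule gs(2)[OF pre1 cin g_def pre4 pre5 pre6]; assumption)
      then obtain r where r: "r \<in> {w..v}" "S n x = X r x - X w x" by blast
      have "\<bar>X r x\<bar> \<le> Z x" "\<bar>X w x\<bar> \<le> Z x" using Zx r wv by auto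
      then show ?thesis using r by auto
    qed
    ultimately show "(\<lambda>n. S n x) \<longlonglongrightarrow> L x \<and> (\<forall>n. \<bar>S n x\<bar> \<le> 2 * Z x)" by blast
  qed
  have "(\<lambda>n. \<integral>x. indicator C x * S n x \<partial>M) \<longlonglongrightarrow> (\<integral>x. indicator C x * L x \<partial>M)"
  proof (rule integral_dominated_convergence[where w="\<lambda>x. 2 * Z x"])
    show "integrable M (\<lambda>x. 2 * Z x)" using Z(1) by auto
    show "AE x in M. (\<lambda>n. indicator C x * S n x) \<longlonglongrightarrow> indicator C x * L x" using AEb by eventually_elim (auto intro!: tendsto_intros)
    show "AE x in M. norm (indicator C x * S n x) \<le> 2 * Z x" for n
      using AEb
    proof eventually_elim
      case (elim x)
      then have "\<bar>S n x\<bar> \<le> 2 * Z x" by blast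
      then show ?case by (auto simp: indicator_def)
    qed
  qed (use Smeas Lm in measurable)
  moreover have "(\<integral>x. indicator C x * S n x \<partial>M) = 0" for n
  proof -
    have tj: "integrable M (\<lambda>x. (indicator C x * (X (g n (Suc j)) x - X (g n j) x)) * indicator {x \<in> space M. g n (Suc j) \<le> \<tau> x} x) \<and>
      (\<integral>x. (indicator C x * (X (g n (Suc j)) x - X (g n j) x)) * indicator {x \<in> space M. g n (Suc j) \<le> \<tau> x} x \<partial>M) = 0" for j
    proof (cases "g n (Suc j) = 0")
      case True
      then have z: "g n j = 0" using g0(1)[of n j] g0(3)[of n j] by simp
      show ?thesis unfolding z True by simp
    next
      case False
      then have pos: "0 < g n (Suc j)" using g0(1)[of n "Suc j"] by simp
      have Cj: "C \<in> sets (F (g n j))" "C \<in> sets (F (g n (Suc j)))"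
        using C FF.filt_mono[OF wv(1) g0(2)] by auto
      have gm: "(\<lambda>x. indicator C x * (X (g n (Suc j)) x - X (g n j) x)) \<in> borel_measurable (F (g n (Suc j)))"
        using Cj(2) ad[OF g0(1) order_refl, of n "Suc j"] ad[OF g0(1) g0(3), of n j] by measurable
      have gi: "integrable M (\<lambda>x. indicator C x * (X (g n (Suc j)) x - X (g n j) x))"
        using integrable_real_mult_indicator[OF CM, of "\<lambda>x. X (g n (Suc j)) x - X (g n j) x"]
          FF.martingaleD(1)[OF X g0(1)] by (simp add: mult.commute)
      have hm: "indicator {x \<in> space M. g n (Suc j) \<le> \<tau> x} \<in> borel_measurable (future_increments (g n (Suc j)))"
        using \<tau>_future[OF pos] by simp
      have hi: "integrable M (indicator {x \<in> space M. g n (Suc j) \<le> \<tau> x} :: 'a \<Rightarrow> real)"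
        by (simp add: emeasure_eq_measure)
      show ?thesis
        using past_future_expectation[OF g0(1) gm gi hm hi] FF.martingaleD(2)[OF X g0(1) g0(3) Cj(1)] by simp
    qed
    have "(\<integral>x. indicator C x * S n x \<partial>M) =
       (\<integral>x. (\<Sum>j<Suc n. (indicator C x * (X (g n (Suc j)) x - X (g n j) x)) * indicator {x \<in> space M. g n (Suc j) \<le> \<tau> x} x) \<partial>M)"
    proof (rule Bochner_Integration.integral_cong[OF refl])
      fix x assume x: "x \<in> space M"
      show "indicator C x * S n x = (\<Sum>j<Suc n. (indicator C x * (X (g n (Suc j)) x - X (g n j) x)) * indicator {x \<in> space M. g n (Suc j) \<le> \<tau> x} x)"
        unfolding S_def sum_distrib_left by (intro sum.cong refl) (use x in \<open>auto simp: indicator_def\<close>)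
    qed
    also have "\<dots> = (\<Sum>j<Suc n. \<integral>x. (indicator C x * (X (g n (Suc j)) x - X (g n j) x)) * indicator {x \<in> space M. g n (Suc j) \<le> \<tau> x} x \<partial>M)"
      by (rule Bochner_Integration.integral_sum) (use tj in blast)
    also have "\<dots> = 0" by (intro sum.neutral ballI) (use tj in blast)
    finally show ?thesis .
  qed
  ultimately have "(\<integral>x. indicator C x * L x \<partial>M) = 0" by (simp add: LIMSEQ_const_iff)
  then show ?thesis by (simp add: L_def)
qed

lemma stopped_martingale:
  fixes X :: "real \<Rightarrow> 'a \<Rightarrow> real"
  assumes X: "FF.martingale X" and ad: "\<And>s t. 0 \<le> s \<Longrightarrow> s \<le> t \<Longrightarrow> X s \<in> borel_measurable (F t)"
    and c: "\<And>x. x \<in> space M \<Longrightarrow> continuous_on {0..} (\<lambda>t. X t x)" and dom: "dominated M X"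
  shows "GG.martingale (stopped X \<tau>)"
proof (rule G_martingaleI)
  show "stopped X \<tau> t \<in> borel_measurable M" if "0 \<le> t" for t
    by (rule GG.adapted_measurable[OF stopped_adapted[OF ad c] that])
  show "continuous_on {0..} (\<lambda>t. stopped X \<tau> t x)" if "x \<in> space M" for x
    unfolding stopped_def
    by (rule continuous_on_compose2[OF c[OF that]]) (use \<tau>_nonneg in \<open>auto intro!: continuous_intros\<close>)
  show "dominated M (stopped X \<tau>)" by (rule stopped_dominated[OF dom])
  fix s t :: real and A assume st: "0 \<le> s" "s \<le> t" and A: "A \<in> sets (E s)"
  obtain B where B: "B \<in> sets (F s)" "A \<inter> {x. s \<le> \<tau> x} = B \<inter> {x. s \<le> \<tau> x}"
    using trace_before[OF st(1) A] by blast
  have "(\<lambda>x. indicator A x * (stopped X \<tau> t x - stopped X \<tau> s x)) =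
    (\<lambda>x. indicator B x * (stopped X \<tau> t x - stopped X \<tau> s x) :: real)"
  proof (rule ext)
    fix x
    show "indicator A x * (stopped X \<tau> t x - stopped X \<tau> s x) =
      (indicator B x * (stopped X \<tau> t x - stopped X \<tau> s x) :: real)"
    proof (cases "s \<le> \<tau> x")
      case True
      then have "x \<in> A \<longleftrightarrow> x \<in> B" using B(2) by blast
      then show ?thesis by (simp add: indicator_def)
    next
      case False
      then have "min t (\<tau> x) = \<tau> x" "min s (\<tau> x) = \<tau> x" using st by auto
      then show ?thesis by (simp add: stopped_def)
    qed
  qed
  then show "(\<integral>x. indicator A x * (stopped X \<tau> t x - stopped X \<tau> s x) \<partial>M) = 0"
    using stopped_past_orthogonal[OF X ad c dom st B(1)] by (simp only:)
qed

end

section \<open>The last time at half of the final price\<close>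

text \<open>
  \<open>last_half_time\<close> with the bound 1 on the times replaced by a variable \<open>c\<close>.  On \<open>\<tau> \<le> u\<close> it may be
  computed from the path up to \<open>u\<close> and the terminal value.
\<close>

definition last_zero :: "real \<Rightarrow> (real \<Rightarrow> 'a \<Rightarrow> real) \<Rightarrow> 'a \<Rightarrow> real" where
  "last_zero c Y x = (let T = {t. 0 \<le> t \<and> t \<le> c \<and> Y 1 x - 2 * Y t x = 0} in if T = {} then 0 else Sup T)"

lemma last_half_time_eq: "last_half_time Y x = last_zero 1 Y x"
  by (simp add: last_half_time_def last_zero_def)

lemma last_zero_bounds:
  assumes "0 \<le> c" shows "0 \<le> last_zero c Y x" "last_zero c Y x \<le> c"
proof -
  define T where "T = {t. 0 \<le> t \<and> t \<le> c \<and> Y 1 x - 2 * Y t x = 0}"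
  have e: "last_zero c Y x = (if T = {} then 0 else Sup T)" unfolding last_zero_def T_def[symmetric] Let_def by (rule refl)
  have "0 \<le> last_zero c Y x \<and> last_zero c Y x \<le> c"
  proof (cases "T = {}")
    case True then show ?thesis using assms e by simp
  next
    case False
    then obtain t where t: "t \<in> T" by blast
    have "t \<le> Sup T" by (rule cSup_upper[OF t]) (auto simp: T_def intro!: bdd_aboveI[of _ c])
    moreover have "Sup T \<le> c" by (rule cSup_least[OF False]) (auto simp: T_def)
    ultimately show ?thesis using e False t by (auto simp: T_def)
  qed
  then show "0 \<le> last_zero c Y x" "last_zero c Y x \<le> c" by auto
qed

lemma last_zero_upper:
  assumes "0 \<le> s" "s \<le> c" "Y 1 x - 2 * Y s x = 0" shows "s \<le> last_zero c Y x"
proof -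
  define T where "T = {t. 0 \<le> t \<and> t \<le> c \<and> Y 1 x - 2 * Y t x = 0}"
  have s: "s \<in> T" using assms by (simp add: T_def)
  then have "last_zero c Y x = Sup T" unfolding last_zero_def T_def[symmetric] Let_def by auto
  moreover have "s \<le> Sup T" by (rule cSup_upper[OF s]) (auto simp: T_def intro!: bdd_aboveI[of _ c])
  ultimately show ?thesis by simp
qed

lemma last_zero_attained:
  assumes c: "continuous_on {0..} (\<lambda>t. Y t x)" and ne: "0 \<le> s" "s \<le> c" "Y 1 x - 2 * Y s x = 0"
  shows "Y 1 x - 2 * Y (last_zero c Y x) x = 0"
proof -
  define T where "T = {t. 0 \<le> t \<and> t \<le> c \<and> Y 1 x - 2 * Y t x = 0}"
  have s: "s \<in> T" using ne by (simp add: T_def)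
  then have e: "last_zero c Y x = Sup T" unfolding last_zero_def T_def[symmetric] Let_def by auto
  have "continuous_on {0..c} (\<lambda>t. Y 1 x - 2 * Y t x)"
    by (intro continuous_intros continuous_on_subset[OF c]) auto
  then have "closed ({0..c} \<inter> (\<lambda>t. Y 1 x - 2 * Y t x) -` {0})"
    by (rule continuous_closed_preimage) auto
  moreover have "T = {0..c} \<inter> (\<lambda>t. Y 1 x - 2 * Y t x) -` {0}" by (auto simp: T_def)
  ultimately have "closed T" by simp
  then have "Sup T \<in> T" by (rule closed_contains_Sup[rotated 2]) (use s in \<open>auto simp: T_def intro!: bdd_aboveI[of _ c]\<close>)
  then show ?thesis unfolding e by (simp add: T_def)
qed

lemma last_zero_ge_iff:
  assumes c: "continuous_on {0..} (\<lambda>t. Y t x)" and a: "0 < a" and c0: "0 \<le> c"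
  shows "a \<le> last_zero c Y x \<longleftrightarrow> a \<le> c \<and> (\<exists>s\<in>{a..c}. Y 1 x - 2 * Y s x = 0)"
proof
  assume l: "a \<le> last_zero c Y x"
  then have "last_zero c Y x \<noteq> 0" using a by auto
  then have "\<exists>s. 0 \<le> s \<and> s \<le> c \<and> Y 1 x - 2 * Y s x = 0" by (auto simp: last_zero_def Let_def split: if_splits)
  then obtain s where "0 \<le> s" "s \<le> c" "Y 1 x - 2 * Y s x = 0" by blast
  from last_zero_attained[where Y=Y and x=x, OF c this] l last_zero_bounds[OF c0, of Y x]
  show "a \<le> c \<and> (\<exists>s\<in>{a..c}. Y 1 x - 2 * Y s x = 0)" by (intro conjI bexI[of _ "last_zero c Y x"]) auto
next
  assume "a \<le> c \<and> (\<exists>s\<in>{a..c}. Y 1 x - 2 * Y s x = 0)"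
  then obtain s where s: "a \<le> s" "s \<le> c" "Y 1 x - 2 * Y s x = 0" by auto
  then show "a \<le> last_zero c Y x" using last_zero_upper[of s c Y x] a by simp
qed

lemma last_zero_before:
  assumes "0 \<le> u" "last_zero 1 Y x \<le> u"
  shows "last_zero 1 Y x = last_zero (min u 1) Y x"
proof -
  have "{t. 0 \<le> t \<and> t \<le> 1 \<and> Y 1 x - 2 * Y t x = 0} = {t. 0 \<le> t \<and> t \<le> min u 1 \<and> Y 1 x - 2 * Y t x = 0}"
    using last_zero_upper[of _ 1 Y x] assms by force
  then show ?thesis by (simp add: last_zero_def)
qed

lemma last_zero_measurable:
  fixes Y :: "real \<Rightarrow> 'a \<Rightarrow> real"
  assumes m: "\<And>s. 0 \<le> s \<Longrightarrow> s \<le> c \<Longrightarrow> Y s \<in> borel_measurable N" "Y 1 \<in> borel_measurable N" and c0: "0 \<le> c"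
    and c: "\<And>x. x \<in> space N \<Longrightarrow> continuous_on {0..} (\<lambda>t. Y t x)"
  shows "last_zero c Y \<in> borel_measurable N"
proof (rule borel_measurableI_ge)
  fix a :: real
  show "{x \<in> space N. a \<le> last_zero c Y x} \<in> sets N"
  proof (cases "a \<le> 0")
    case True
    then have "{x \<in> space N. a \<le> last_zero c Y x} = space N" using last_zero_bounds(1)[OF c0, of Y] by (auto intro: order_trans)
    then show ?thesis by simp
  next
    case False
    then have a: "0 < a" by simp
    show ?thesis
    proof (cases "a \<le> c")
      case True
      have "{x \<in> space N. \<exists>s\<in>{a..c}. Y 1 x - 2 * Y s x = 0} \<in> sets N"
      proof (rule zero_exists_sets[OF _ True])
        show "(\<lambda>x. Y 1 x - 2 * Y s x) \<in> borel_measurable N" if "s \<in> {a..c}" for s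
          using m(1)[of s] m(2) that a by auto
        show "continuous_on {a..c} (\<lambda>s. Y 1 x - 2 * Y s x)" if "x \<in> space N" for x
          using a by (intro continuous_intros continuous_on_subset[OF c[OF that]]) auto
      qed
      also have "{x \<in> space N. \<exists>s\<in>{a..c}. Y 1 x - 2 * Y s x = 0} = {x \<in> space N. a \<le> last_zero c Y x}"
        using last_zero_ge_iff[where Y=Y, OF c a c0] True by blast
      finally show ?thesis .
    next
      case False
      then have "{x \<in> space N. a \<le> last_zero c Y x} = {}" using last_zero_bounds(2)[OF c0, of Y] by (force intro: order_trans)
      then show ?thesis by (simp only: sets.empty_sets)
    qed
  qed
qed

locale half_time = black_scholes +
  fixes X :: "real \<Rightarrow> 'a \<Rightarrow> real"
  assumes S0_pos: "0 < S0" and solves: "solves_black_scholes M F W \<sigma> S0 X"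
begin

lemma S_pos: "0 < S t x" using S0_pos by (simp add: S_def)

lemma X_S: "AE x in M. \<forall>t\<ge>0. X t x = S t x"
  using black_scholes_unique[OF solves] by (simp add: FF.indistinguishable_def)

lemma half_time_bounds: "0 \<le> last_half_time X x" "last_half_time X x \<le> 1"
  using last_zero_bounds[of 1 X x] by (simp_all add: last_half_time_eq)

lemma half_time_AE: "AE x in M. last_half_time X x = last_zero 1 S x"
  using X_S
proof eventually_elim
  case (elim x)
  then have "{t. 0 \<le> t \<and> t \<le> 1 \<and> X 1 x - 2 * X t x = 0} = {t. 0 \<le> t \<and> t \<le> 1 \<and> S 1 x - 2 * S t x = 0}" by auto
  then show ?case by (simp add: last_half_time_def last_zero_def)
qed

lemma last_zero_F: "last_zero 1 S \<in> borel_measurable (F 1)"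
  by (rule last_zero_measurable) (auto intro: S_F S_continuous)

lemma half_time_F: "1 \<le> v \<Longrightarrow> last_half_time X \<in> borel_measurable (F v)"
proof -
  assume v: "1 \<le> v"
  have *: "last_zero 1 S \<in> borel_measurable (F v)" by (rule FF.filt_measurable_mono[OF _ v last_zero_F]) simp
  show ?thesis
    by (rule full_subalgebra_AE_cong[OF FF.filt_full *]) (use half_time_AE v in \<open>auto elim!: eventually_mono\<close>)
qed

lemma half_time_meas: "last_half_time X \<in> borel_measurable M"
  using FF.filt_measurable[OF _ half_time_F[of 1]] by simp

text \<open>
  \<open>w \<le> \<tau>\<close> says that \<open>S 1 - 2 S s\<close> vanishes for some \<open>s\<close> in \<open>[w, 1]\<close>.  Division by \<open>S w\<close>, which is
  positive, leaves a condition on the increments after \<open>w\<close>.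
\<close>

lemma half_time_future:
  assumes w: "0 < w" shows "{x \<in> space M. w \<le> last_half_time X x} \<in> sets (future_increments w)"
proof (cases "w \<le> 1")
  case True
  have "{x \<in> space (future_increments w). \<exists>s\<in>{w..1}. ratio \<sigma> w 1 x - 2 * ratio \<sigma> w s x = 0} \<in> sets (future_increments w)"
  proof (rule zero_exists_sets[OF _ True])
    show "(\<lambda>x. ratio \<sigma> w 1 x - 2 * ratio \<sigma> w s x) \<in> borel_measurable (future_increments w)" if "s \<in> {w..1}" for s
      using ratio_future[of w s \<sigma>] ratio_future[of w 1 \<sigma>] w that by auto
    show "continuous_on {w..1} (\<lambda>s. ratio \<sigma> w 1 x - 2 * ratio \<sigma> w s x)" for x
      unfolding ratio_def using w by (intro continuous_intros continuous_on_subset[OF B_continuous]) auto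
  qed
  moreover have "ratio \<sigma> w 1 x - 2 * ratio \<sigma> w s x = 0 \<longleftrightarrow> S 1 x - 2 * S s x = 0" for s x
  proof -
    have "S 1 x - 2 * S s x = S w x * (ratio \<sigma> w 1 x - 2 * ratio \<sigma> w s x)"
      unfolding S_ratio[of 1 x w] S_ratio[of s x w] by (simp add: algebra_simps)
    then show ?thesis using S_pos[of w x] by simp
  qed
  ultimately have *: "{x \<in> space M. w \<le> last_zero 1 S x} \<in> sets (future_increments w)"
    using last_zero_ge_iff[where Y=S and c=1, OF S_continuous w] True by simp
  show ?thesis
    by (rule full_subalgebra_AE_sets[OF future_full *])
      (use w half_time_AE in \<open>auto elim!: eventually_mono\<close>)
next
  case False
  then have "{x \<in> space M. w \<le> last_half_time X x} = {}" using half_time_bounds(2) by (force intro: order_trans)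
  then show ?thesis by (simp only: sets.empty_sets)
qed

sublocale pseudo_stopping_time M W "last_half_time X"
  by unfold_locales (use half_time_meas half_time_bounds half_time_future in auto)

abbreviation \<tau> where "\<tau> \<equiv> last_half_time X"

lemma stopped_S_square: "0 \<le> t \<Longrightarrow> integrable M (\<lambda>x. (stopped S \<tau> t x)\<^sup>2)"
proof -
  assume t: "0 \<le> t"
  have "stopped S \<tau> t \<in> borel_measurable M"
    by (rule GG.adapted_measurable[OF stopped_adapted[OF S_F S_continuous] t])
  then have "integrable M (stopped (\<lambda>t x. (S t x)\<^sup>2) \<tau> t)"
    by (intro dominated_integrable[OF stopped_dominated[OF S_square_dominated] _ t])
      (simp add: stopped_def[abs_def])
  then show ?thesis by (simp add: stopped_def[abs_def])
qed

lemma stopped_S_paths: "continuous_on {0..} (\<lambda>t. stopped S \<tau> t x)"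
  unfolding stopped_def
  by (rule continuous_on_compose2[OF S_continuous]) (use half_time_bounds in \<open>auto intro!: continuous_intros\<close>)

lemma stopped_indistinguishable: "GG.indistinguishable (stopped S \<tau>) (stopped X \<tau>)"
  unfolding GG.indistinguishable_def using X_S by eventually_elim (auto simp: stopped_def half_time_bounds)

text \<open>\<open>\<tau>\<close> is a pseudo-stopping time, so the stopped price is a martingale of the enlarged filtration.\<close>

theorem NA_before: "NA M G (stopped X \<tau>)"
proof (rule GG.continuous_martingale_NA)
  note i = stopped_indistinguishable
  have ad: "adapted G (stopped S \<tau>)" by (rule stopped_adapted[OF S_F S_continuous])
  have mart: "GG.martingale (stopped S \<tau>)" by (rule stopped_martingale[OF S_martingale S_F S_continuous S_dominated])
  have c: "continuous_paths M (stopped S \<tau>)" by (simp add: continuous_paths_def stopped_S_paths)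
  show ad': "adapted G (stopped X \<tau>)" by (rule GG.indistinguishable_adapted[OF i ad])
  show mart': "GG.martingale (stopped X \<tau>)" by (rule GG.indistinguishable_martingale[OF i mart ad])
  show c': "continuous_paths M (stopped X \<tau>)" by (rule GG.indistinguishable_continuous[OF i c])
  show sq: "integrable M (\<lambda>x. (stopped X \<tau> t x)\<^sup>2)" if t: "0 \<le> t" for t
  proof -
    have [measurable]: "stopped S \<tau> t \<in> borel_measurable M" "stopped X \<tau> t \<in> borel_measurable M"
      using GG.adapted_measurable[OF ad t] GG.adapted_measurable[OF ad' t] by auto
    have "AE x in M. (stopped S \<tau> t x)\<^sup>2 = (stopped X \<tau> t x)\<^sup>2"
      using i t unfolding GG.indistinguishable_def by (auto elim!: eventually_mono)
    then show ?thesis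
      using integrable_cong_AE[of "\<lambda>x. (stopped S \<tau> t x)\<^sup>2" M "\<lambda>x. (stopped X \<tau> t x)\<^sup>2"] stopped_S_square[OF t] by simp
  qed
qed

end

section \<open>The initial enlargement by the terminal value\<close>

lemma (in prob_space) indep_var_decouple:
  fixes X Y :: "'a \<Rightarrow> real" and \<phi> :: "real \<times> real \<Rightarrow> real"
  assumes ind: "indep_var borel X borel Y" and [measurable]: "\<phi> \<in> borel_measurable (borel \<Otimes>\<^sub>M borel)"
    and i: "integrable M (\<lambda>x. \<phi> (X x, Y x))"
  shows "(\<integral>x. \<phi> (X x, Y x) \<partial>M) = (\<integral>y. (\<integral>x. \<phi> (X x, Y y) \<partial>M) \<partial>M)"
proof -
  have [measurable]: "X \<in> borel_measurable M" "Y \<in> borel_measurable M"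
    using ind unfolding indep_var_distribution_eq by auto
  have d: "distr M borel X \<Otimes>\<^sub>M distr M borel Y = distr M (borel \<Otimes>\<^sub>M borel) (\<lambda>x. (X x, Y x))"
    using ind unfolding indep_var_distribution_eq by auto
  interpret X: prob_space "distr M borel X" by (rule prob_space_distr) simp
  interpret Y: prob_space "distr M borel Y" by (rule prob_space_distr) simp
  interpret P: pair_sigma_finite "distr M borel X" "distr M borel Y" by unfold_locales
  have "integrable (distr M borel X \<Otimes>\<^sub>M distr M borel Y) \<phi>"
    unfolding d using i by (subst integrable_distr_eq) auto
  then have ii: "integrable (distr M borel X \<Otimes>\<^sub>M distr M borel Y) (\<lambda>(x, y). \<phi> (x, y))" by simp
  have "(\<integral>x. \<phi> (X x, Y x) \<partial>M) = (\<integral>p. \<phi> p \<partial>distr M (borel \<Otimes>\<^sub>M borel) (\<lambda>x. (X x, Y x)))"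
    by (subst integral_distr) auto
  also have "\<dots> = (\<integral>y. (\<integral>x. \<phi> (x, y) \<partial>distr M borel X) \<partial>distr M borel Y)"
    unfolding d[symmetric] using P.integral_snd[OF ii] by simp
  also have "\<dots> = (\<integral>y. (\<integral>x. \<phi> (x, Y y) \<partial>distr M borel X) \<partial>M)"
    by (subst integral_distr) auto
  also have "\<dots> = (\<integral>y. (\<integral>x. \<phi> (X x, Y y) \<partial>M) \<partial>M)"
    by (intro Bochner_Integration.integral_cong refl) (subst integral_distr, auto)
  finally show ?thesis .
qed

lemma (in prob_space) abs_expectation_le_sqrt:
  fixes f :: "'a \<Rightarrow> real"
  assumes [measurable]: "f \<in> borel_measurable M" and sq: "integrable M (\<lambda>x. (f x)\<^sup>2)"
  shows "(\<integral>x. \<bar>f x\<bar> \<partial>M) \<le> sqrt (\<integral>x. (f x)\<^sup>2 \<partial>M)"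
proof -
  have i: "integrable M f" by (rule square_integrable_imp_integrable[OF _ sq]) simp
  have "variance (\<lambda>x. \<bar>f x\<bar>) = (\<integral>x. (f x)\<^sup>2 \<partial>M) - (\<integral>x. \<bar>f x\<bar> \<partial>M)\<^sup>2"
    using variance_eq[of "\<lambda>x. \<bar>f x\<bar>"] i sq by simp
  moreover have "0 \<le> variance (\<lambda>x. \<bar>f x\<bar>)" by (rule variance_positive)
  ultimately show ?thesis by (intro real_le_rsqrt) simp
qed

context brownian begin

text \<open>The initial enlargement of \<open>F\<close> by the value of the Brownian motion at time 1.\<close>

definition terminal :: "real \<Rightarrow> 'a measure" where
  "terminal v = sigma (space M) (sets (F v) \<union> {B 1 -` A \<inter> space M | A. A \<in> sets borel})"

lemma sets_terminal: "sets (terminal v) = sigma_sets (space M) (sets (F v) \<union> {B 1 -` A \<inter> space M | A. A \<in> sets borel})"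
  and space_terminal[simp]: "space (terminal v) = space M"
proof -
  have "sets (F v) \<union> {B 1 -` A \<inter> space M | A. A \<in> sets borel} \<subseteq> Pow (space M)"
    using sets.sets_into_space[of _ "F v"] by auto
  then show "sets (terminal v) = sigma_sets (space M) (sets (F v) \<union> {B 1 -` A \<inter> space M | A. A \<in> sets borel})"
    and "space (terminal v) = space M"
    by (simp_all add: terminal_def)
qed

lemma F_sub_terminal: "sets (F v) \<subseteq> sets (terminal v)"
  unfolding sets_terminal by blast

lemma B1_terminal: "B 1 \<in> borel_measurable (terminal v)"
  by (rule measurableI) (auto simp: sets_terminal intro!: sigma_sets.Basic)

lemma terminal_full: assumes v: "0 \<le> v" shows "full_subalgebra M (terminal v)"
  unfolding full_subalgebra_def subalgebra_def
proof (intro conjI)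
  show "sets (terminal v) \<subseteq> sets M"
    unfolding sets_terminal
  proof (rule sets.sigma_sets_subset)
    show "sets (F v) \<union> {B 1 -` A \<inter> space M | A. A \<in> sets borel} \<subseteq> sets M"
      using full_subalgebraD(2)[OF FF.filt_full[OF v]] measurable_sets[OF B_meas[of 1]] by auto
  qed
  show "null_sets M \<subseteq> sets (terminal v)" unfolding sets_terminal using full_subalgebraD(3)[OF FF.filt_full[OF v]] by blast
qed simp

lemma terminal_mono: "0 \<le> s \<Longrightarrow> s \<le> t \<Longrightarrow> sets (terminal s) \<subseteq> sets (terminal t)"
  unfolding sets_terminal using FF.filt_mono[of s t] by (intro sigma_sets_mono') auto

lemma F_measurable_terminal: "f \<in> borel_measurable (F v) \<Longrightarrow> f \<in> borel_measurable (terminal v)"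
  using F_sub_terminal[of v] by (auto simp: measurable_def)

text \<open>
  \<open>terminal a\<close> is generated by products of past events with events of \<open>B 1 - B a\<close>, because the past
  determines \<open>B a\<close>.
\<close>

lemma terminal_orthogonal_induct:
  assumes a: "0 \<le> a" "a \<le> 1" and D: "integrable M D"
    and basic: "\<And>A C. A \<in> sets (F a) \<Longrightarrow> C \<in> sets borel \<Longrightarrow>
      (\<integral>x. indicator A x * (indicator C (B 1 x - B a x) * D x) \<partial>M) = 0"
    and T: "T \<in> sets (terminal a)"
  shows "(\<integral>x. indicator T x * D x \<partial>M) = (0::real)"
proof -
  let ?Z = "\<lambda>x. B 1 x - B a x"
  define \<C> where "\<C> = {A \<inter> (?Z -` C \<inter> space M) | A C. A \<in> sets (F a) \<and> C \<in> sets borel}"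
  have Zm: "?Z \<in> borel_measurable M" using a by measurable
  have FM: "A \<in> sets M" if "A \<in> sets (F a)" for A using that FF.filt_sub[OF a(1)] by (auto simp: subalgebra_def)
  have CM: "\<C> \<subseteq> sets M"
  proof
    fix p assume "p \<in> \<C>"
    then obtain A C where p: "p = A \<inter> (?Z -` C \<inter> space M)" "A \<in> sets (F a)" "C \<in> sets borel" unfolding \<C>_def by blast
    show "p \<in> sets M" unfolding p(1) by (rule sets.Int[OF FM[OF p(2)] measurable_sets[OF Zm p(3)]])
  qed
  have Csp: "\<C> \<subseteq> Pow (space M)" using CM sets.sets_into_space by blast
  have stable: "Int_stable \<C>"
  proof (rule Int_stableI)
    fix p q assume "p \<in> \<C>" "q \<in> \<C>"
    then obtain A C A' C' where p: "p = A \<inter> (?Z -` C \<inter> space M)" "A \<in> sets (F a)" "C \<in> sets borel"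
      and q: "q = A' \<inter> (?Z -` C' \<inter> space M)" "A' \<in> sets (F a)" "C' \<in> sets borel" unfolding \<C>_def by blast
    have "p \<inter> q = (A \<inter> A') \<inter> (?Z -` (C \<inter> C') \<inter> space M)" unfolding p q by auto
    then show "p \<inter> q \<in> \<C>" using p q unfolding \<C>_def by blast
  qed
  have gen: "sets (terminal a) \<subseteq> sigma_sets (space M) \<C>"
  proof -
    define N where "N = sigma (space M) \<C>"
    have N: "space N = space M" "sets N = sigma_sets (space M) \<C>" using Csp by (simp_all add: N_def)
    have FN: "sets (F a) \<subseteq> sets N"
    proof
      fix A assume A: "A \<in> sets (F a)"
      have "A \<in> \<C>" unfolding \<C>_def
        by (rule CollectI, rule exI[of _ A], rule exI[of _ UNIV]) (use A sets.sets_into_space[OF A] in auto)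
      then show "A \<in> sets N" unfolding N by (rule sigma_sets.Basic)
    qed
    have "?Z \<in> borel_measurable N"
    proof (rule measurableI)
      fix C :: "real set" assume C: "C \<in> sets borel"
      have "?Z -` C \<inter> space N = space (F a) \<inter> (?Z -` C \<inter> space M)" by (auto simp: N)
      also have "\<dots> \<in> \<C>" unfolding \<C>_def
        by (rule CollectI, rule exI[of _ "space (F a)"], rule exI[of _ C]) (use C sets.top[of "F a"] in blast)
      finally show "?Z -` C \<inter> space N \<in> sets N" unfolding N(2) by (rule sigma_sets.Basic)
    qed simp
    moreover have "B a \<in> borel_measurable N"
      using B_F[OF a(1) order_refl] FN N(1) by (auto simp: measurable_def)
    ultimately have "(\<lambda>x. ?Z x + B a x) \<in> borel_measurable N" by measurable
    then have B1: "B 1 \<in> borel_measurable N" by simp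
    have "sets (F a) \<union> {B 1 -` A \<inter> space M | A. A \<in> sets borel} \<subseteq> sets N"
      using FN measurable_sets[OF B1] N(1) by auto
    from sets.sigma_sets_subset[OF this] show ?thesis unfolding sets_terminal N by simp
  qed
  have TM: "\<And>p. p \<in> sigma_sets (space M) \<C> \<Longrightarrow> p \<in> sets M" using sets.sigma_sets_subset[OF CM] by auto
  have ii: "integrable M (\<lambda>x. indicator p x * D x)" if "p \<in> sets M" for p
    using integrable_real_mult_indicator[OF that D] by (simp add: mult.commute)
  have bb: "(\<integral>x. indicator p x * D x \<partial>M) = 0" if pC: "p \<in> \<C>" for p
  proof -
    from pC obtain A C where p: "p = A \<inter> (?Z -` C \<inter> space M)" "A \<in> sets (F a)" "C \<in> sets borel" unfolding \<C>_def by blast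
    have "(\<integral>x. indicator p x * D x \<partial>M) = (\<integral>x. indicator A x * (indicator C (B 1 x - B a x) * D x) \<partial>M)"
      by (rule Bochner_Integration.integral_cong[OF refl]) (auto simp: p indicator_def)
    then show ?thesis using basic[OF p(2,3)] by simp
  qed
  have "T \<in> sigma_sets (space M) \<C>" using T gen by blast
  then show ?thesis
  proof (induction rule: sigma_sets_induct_disjoint[OF stable Csp, consumes 1, case_names basic empty compl union])
    case (basic p) then show ?case by (rule bb)
  next
    case empty show ?case by simp
  next
    case (compl p)
    have "space M \<in> \<C>"
      unfolding \<C>_def by (rule CollectI, rule exI[of _ "space M"], rule exI[of _ UNIV]) (use sets.top[of "F a"] in auto)
    from bb[OF this] have z: "(\<integral>x. indicator (space M) x * D x \<partial>M) = 0" .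
    have "(\<integral>x. indicator (space M - p) x * D x \<partial>M) = (\<integral>x. indicator (space M) x * D x - indicator p x * D x \<partial>M)"
      by (rule Bochner_Integration.integral_cong[OF refl]) (auto simp: indicator_def)
    also have "\<dots> = 0" using z compl ii[OF TM[OF compl(1)]] ii[OF sets.top] by simp
    finally show ?case .
  next
    case (union A)
    have AM: "A i \<in> sets M" for i using union TM by blast
    have "(LINT x:(\<Union>i. A i)|M. D x) = (\<Sum>i. LINT x:A i|M. D x)"
      by (rule lebesgue_integral_countable_add)
        (use AM union(1) ii[OF sets.countable_UN[of A UNIV]] in \<open>auto simp: disjoint_family_on_def set_integrable_def\<close>)
    then show ?case using union by (simp add: set_lebesgue_integral_def)
  qed
qed

end

context black_scholes begin

text \<open>
  The conditional expectation of \<open>S b - S a\<close> given \<open>terminal a\<close>.  Given the past, \<open>Z = B 1 - B a\<close>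
  determines the law of the increment \<open>B b - B a\<close>: with \<open>r = (b - a) / (1 - a)\<close> it is normal with
  mean \<open>r Z\<close> and variance \<open>(b - a) (1 - r)\<close>, as for the Brownian bridge.
\<close>

definition compensator :: "real \<Rightarrow> real \<Rightarrow> 'a \<Rightarrow> real" where
  "compensator a b x = S a x * (exp ((\<sigma> * ((b - a) / (1 - a))) * (B 1 x - B a x) - (\<sigma> * ((b - a) / (1 - a)))\<^sup>2 * (1 - a) / 2) - 1)"

text \<open>
  Both exponential weights shift the law of \<open>B 1 - B a\<close> by \<open>\<sigma> (b - a)\<close>: the left one through the
  increment over \<open>[a, b]\<close>, which is one of two independent summands, the right one directly.
\<close>

lemma bridge_exponential:
  assumes ab: "0 \<le> a" "a < b" "b \<le> 1" and [measurable]: "C \<in> sets borel"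
  defines "c \<equiv> \<sigma> * ((b - a) / (1 - a))"
  shows "(\<integral>x. indicator C (B 1 x - B a x) * ratio \<sigma> a b x \<partial>M) =
    (\<integral>x. indicator C (B 1 x - B a x) * exp (c * (B 1 x - B a x) - c\<^sup>2 * (1 - a) / 2) \<partial>M)"
proof (cases "b = 1")
  case True
  then have "c = \<sigma>" using ab by (simp add: c_def)
  then show ?thesis using True by (simp add: ratio_def)
next
  case False
  then have b1: "b < 1" and a1: "a < 1" and b0: "0 \<le> b" using ab by auto
  let ?X = "\<lambda>x. B b x - B a x" and ?Y = "\<lambda>x. B 1 x - B b x" and ?Z = "\<lambda>x. B 1 x - B a x"
  have [measurable]: "B a \<in> borel_measurable M" "B b \<in> borel_measurable M" "B 1 \<in> borel_measurable M" using ab by auto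
  have Xd: "distributed M lborel ?X (normal_density 0 (sqrt (b - a)))" by (rule B_dist[OF ab(1,2)])
  have Zd: "distributed M lborel ?Z (normal_density 0 (sqrt (1 - a)))" by (rule B_dist[OF ab(1) a1])
  have XF: "?X \<in> borel_measurable (F b)" using B_F[of a b] B_F[of b b] ab by auto
  have ind: "indep_var borel ?X borel ?Y"
    by (rule past_future_indep_var[OF b0 XF B_future[OF b0 ab(3)]])
  let ?h = "b - a"
  have sq: "(sqrt ?h)\<^sup>2 = ?h" "sqrt ?h > 0" "(sqrt (1 - a))\<^sup>2 = 1 - a" "sqrt (1 - a) > 0" using ab a1 by auto
  define \<phi> where "\<phi> p = (indicator C (fst p + snd p) * exp (\<sigma> * fst p - \<sigma>\<^sup>2 * ?h / 2) :: real)" for p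
  define \<psi> where "\<psi> p = (indicator C (fst p + snd p + \<sigma> * ?h) :: real)" for p
  have \<phi>m[measurable]: "\<phi> \<in> borel_measurable (borel \<Otimes>\<^sub>M borel)" unfolding \<phi>_def[abs_def] by measurable
  have \<psi>m[measurable]: "\<psi> \<in> borel_measurable (borel \<Otimes>\<^sub>M borel)" unfolding \<psi>_def[abs_def] by measurable
  have \<phi>i: "integrable M (\<lambda>x. \<phi> (?X x, ?Y x))"
  proof (rule Bochner_Integration.integrable_bound[OF ratio_expectation(1)[OF ab(1), of b \<sigma>]])
    show "AE x in M. norm (\<phi> (?X x, ?Y x)) \<le> norm (ratio \<sigma> a b x)"
      by (intro AE_I2) (auto simp: \<phi>_def ratio_def indicator_def)
  qed (use ab in auto)
  have \<psi>i: "integrable M (\<lambda>x. \<psi> (?X x, ?Y x))"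
    by (rule integrable_const_bound[where B=1]) (auto simp: \<psi>_def indicator_def)
  have inner: "(\<integral>x. \<phi> (?X x, y) \<partial>M) = (\<integral>x. \<psi> (?X x, y) \<partial>M)" for y
  proof -
    have "(\<integral>x. indicator C (?X x + \<sigma> * (sqrt ?h)\<^sup>2 + y) \<partial>M) = (\<integral>x. indicator C (?X x + y) * exp (\<sigma> * ?X x - \<sigma>\<^sup>2 * (sqrt ?h)\<^sup>2 / 2) \<partial>M)"
      by (rule gaussian_shift(2)[OF Xd sq(2), where \<phi>="\<lambda>z. indicator C (z + y)"]) measurable
    then show ?thesis unfolding sq(1) by (simp add: \<phi>_def \<psi>_def add_ac)
  qed
  have "(\<integral>x. indicator C (?Z x) * ratio \<sigma> a b x \<partial>M) = (\<integral>x. \<phi> (?X x, ?Y x) \<partial>M)"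
    by (simp add: \<phi>_def ratio_def)
  also have "\<dots> = (\<integral>y. (\<integral>x. \<phi> (?X x, ?Y y) \<partial>M) \<partial>M)" by (rule indep_var_decouple[OF ind \<phi>m \<phi>i])
  also have "\<dots> = (\<integral>y. (\<integral>x. \<psi> (?X x, ?Y y) \<partial>M) \<partial>M)" by (simp only: inner)
  also have "\<dots> = (\<integral>x. \<psi> (?X x, ?Y x) \<partial>M)" by (rule indep_var_decouple[OF ind \<psi>m \<psi>i, symmetric])
  also have "\<dots> = (\<integral>x. indicator C (?Z x + c * (sqrt (1 - a))\<^sup>2) \<partial>M)"
    unfolding sq(3) using a1 by (simp add: \<psi>_def c_def)
  also have "\<dots> = (\<integral>x. indicator C (?Z x) * exp (c * ?Z x - c\<^sup>2 * (sqrt (1 - a))\<^sup>2 / 2) \<partial>M)"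
    by (rule gaussian_shift(2)[OF Zd sq(4)]) measurable
  finally show ?thesis unfolding sq(3) .
qed

lemma compensator_terminal:
  assumes "0 \<le> a" shows "compensator a b \<in> borel_measurable (terminal a)"
  unfolding compensator_def[abs_def]
  using F_measurable_terminal[OF S_F[OF assms order_refl]] F_measurable_terminal[OF B_F[OF assms order_refl]] B1_terminal[of a]
  by measurable

text \<open>
  The compensator is of order \<open>(b - a) / sqrt (1 - a)\<close>, which is at most
  \<open>2 (sqrt (1 - a) - sqrt (1 - b))\<close>.  In this form the bound telescopes over a grid, in spite of the
  singularity of the bridge drift at time 1.
\<close>

lemma compensator_moments:
  assumes ab: "0 \<le> a" "a < b" "b \<le> 1"
  shows "integrable M (\<lambda>x. (compensator a b x)\<^sup>2)"
    and "(\<integral>x. \<bar>compensator a b x\<bar> \<partial>M) \<le> (2 * \<bar>S0\<bar> * \<bar>\<sigma>\<bar> * exp (\<sigma>\<^sup>2 / 2)) * (sqrt (1 - a) - sqrt (1 - b))"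
proof -
  define c where "c = \<sigma> * ((b - a) / (1 - a))"
  let ?Z = "\<lambda>x. B 1 x - B a x"
  have a1: "a < 1" and a1': "a \<le> 1" using ab by auto
  define v where "v = 1 - a"
  have v: "0 < v" using a1 by (simp add: v_def)
  define h where "h x = exp (c * ?Z x - c\<^sup>2 * (1 - a) / 2) - 1" for x
  have hr: "h x = ratio c a 1 x - 1" for x by (simp add: h_def ratio_def)
  have hF: "h \<in> borel_measurable (future_increments a)" unfolding hr[abs_def] using ratio_future[OF ab(1) a1'] by measurable
  have h2F: "(\<lambda>x. (h x)\<^sup>2) \<in> borel_measurable (future_increments a)" "(\<lambda>x. \<bar>h x\<bar>) \<in> borel_measurable (future_increments a)"
    using hF by measurable
  note R = ratio_expectation[OF ab(1) a1', of c] ratio_square_expectation[OF ab(1) a1', of c]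
  have e: "(h x)\<^sup>2 = (ratio c a 1 x)\<^sup>2 - 2 * ratio c a 1 x + 1" for x by (simp add: hr power2_eq_square algebra_simps)
  have h2: "integrable M (\<lambda>x. (h x)\<^sup>2)" "(\<integral>x. (h x)\<^sup>2 \<partial>M) = exp (c\<^sup>2 * v) - 1"
    unfolding e using R by (simp_all add: prob_space v_def)
  have hi: "integrable M h" unfolding hr[abs_def] using R by simp
  have hM: "h \<in> borel_measurable M" using hi by simp
  have SM: "(\<lambda>x. (S a x)\<^sup>2) \<in> borel_measurable (F a)" "(\<lambda>x. \<bar>S a x\<bar>) \<in> borel_measurable (F a)"
    using S_F[OF ab(1) order_refl] by measurable
  have Si: "integrable M (S a)" unfolding S_def[abs_def] using expm_expectation(1)[OF ab(1)] by simp
  have comp: "compensator a b x = S a x * h x" for x by (simp add: compensator_def h_def c_def)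
  show "integrable M (\<lambda>x. (compensator a b x)\<^sup>2)"
    unfolding comp power_mult_distrib
    by (rule past_future_expectation(1)[OF ab(1) SM(1) S_square[OF ab(1)] h2F(1) h2(1)])
  have "(\<integral>x. \<bar>compensator a b x\<bar> \<partial>M) = (\<integral>x. \<bar>S a x\<bar> \<partial>M) * (\<integral>x. \<bar>h x\<bar> \<partial>M)"
    unfolding comp abs_mult by (rule past_future_expectation(2)[OF ab(1) SM(2) _ h2F(2)]) (use Si hi in auto)
  also have "(\<integral>x. \<bar>S a x\<bar> \<partial>M) = \<bar>S0\<bar>"
    using expm_expectation(2)[OF ab(1), of \<sigma>] abs_of_pos[OF expm_pos] by (simp add: S_def abs_mult)
  also have "\<bar>S0\<bar> * (\<integral>x. \<bar>h x\<bar> \<partial>M) \<le> \<bar>S0\<bar> * ((2 * \<bar>\<sigma>\<bar> * exp (\<sigma>\<^sup>2 / 2)) * (sqrt (1 - a) - sqrt (1 - b)))"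
  proof (rule mult_left_mono)
    have "(\<integral>x. \<bar>h x\<bar> \<partial>M) \<le> sqrt (exp (c\<^sup>2 * v) - 1)"
      using abs_expectation_le_sqrt[OF hM h2(1)] h2(2) by simp
    also have "\<dots> \<le> sqrt (c\<^sup>2 * v * exp (\<sigma>\<^sup>2))"
    proof (rule real_sqrt_le_mono)
      have x: "c\<^sup>2 * v \<le> \<sigma>\<^sup>2"
      proof -
        have "((b - a) / v)\<^sup>2 * v = (b - a) * ((b - a) / v)" using v by (simp add: power2_eq_square)
        also have "\<dots> \<le> 1 * 1" using ab v by (intro mult_mono) (auto simp: v_def divide_le_eq)
        finally have "((b - a) / v)\<^sup>2 * v \<le> 1" by simp
        then have "\<sigma>\<^sup>2 * (((b - a) / v)\<^sup>2 * v) \<le> \<sigma>\<^sup>2 * 1" by (rule mult_left_mono) simp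
        moreover have "c\<^sup>2 * v = \<sigma>\<^sup>2 * (((b - a) / v)\<^sup>2 * v)"
          unfolding c_def v_def[symmetric] power_mult_distrib by (rule mult.assoc)
        ultimately show ?thesis by (simp only: mult_1_right)
      qed
      have "exp (c\<^sup>2 * v) - 1 = exp (c\<^sup>2 * v) * (1 - exp (- (c\<^sup>2 * v)))" by (simp add: right_diff_distrib exp_add[symmetric])
      also have "\<dots> \<le> exp (c\<^sup>2 * v) * (c\<^sup>2 * v)"
        using exp_ge_add_one_self[of "- (c\<^sup>2 * v)"] by (intro mult_left_mono) auto
      also have "\<dots> \<le> exp (\<sigma>\<^sup>2) * (c\<^sup>2 * v)" using x v by (intro mult_right_mono) auto
      finally show "exp (c\<^sup>2 * v) - 1 \<le> c\<^sup>2 * v * exp (\<sigma>\<^sup>2)" by (simp add: mult.commute)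
    qed
    also have "\<dots> = \<bar>\<sigma>\<bar> * exp (\<sigma>\<^sup>2 / 2) * ((b - a) / sqrt v)"
    proof -
      have "c\<^sup>2 * v * exp (\<sigma>\<^sup>2) = (\<bar>\<sigma>\<bar> * exp (\<sigma>\<^sup>2 / 2) * ((b - a) / sqrt v))\<^sup>2"
      proof -
        have "(exp (\<sigma>\<^sup>2 / 2))\<^sup>2 = exp (\<sigma>\<^sup>2)" by (simp add: exp_double[symmetric])
        moreover have "((b - a) / sqrt v)\<^sup>2 = ((b - a) / v)\<^sup>2 * v" using v by (simp add: power_divide power2_eq_square)
        moreover have "(\<bar>\<sigma>\<bar> * exp (\<sigma>\<^sup>2 / 2) * ((b - a) / sqrt v))\<^sup>2 = \<sigma>\<^sup>2 * (exp (\<sigma>\<^sup>2 / 2))\<^sup>2 * ((b - a) / sqrt v)\<^sup>2"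
          by (simp only: power_mult_distrib power2_abs)
        moreover have "c\<^sup>2 * v = \<sigma>\<^sup>2 * (((b - a) / v)\<^sup>2 * v)"
          unfolding c_def v_def[symmetric] power_mult_distrib by (rule mult.assoc)
        ultimately show ?thesis by (simp only: mult_ac)
      qed
      then show ?thesis using ab v by (simp add: real_sqrt_abs abs_mult)
    qed
    also have "(b - a) / sqrt v \<le> 2 * (sqrt (1 - a) - sqrt (1 - b))"
    proof -
      define p q where "p = sqrt (1 - a)" and "q = sqrt (1 - b)"
      have pq: "0 < p" "0 \<le> q" "q \<le> p" "p\<^sup>2 - q\<^sup>2 = b - a" using ab by (auto simp: p_def q_def)
      have "b - a = (p - q) * (p + q)" using pq(4) by (simp add: power2_eq_square algebra_simps)
      also have "\<dots> \<le> (p - q) * (2 * p)" using pq by (intro mult_left_mono) auto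
      finally show ?thesis using pq(1) by (simp add: v_def p_def[symmetric] q_def[symmetric] divide_le_eq mult_ac)
    qed
    then have "\<bar>\<sigma>\<bar> * exp (\<sigma>\<^sup>2 / 2) * ((b - a) / sqrt v) \<le> \<bar>\<sigma>\<bar> * exp (\<sigma>\<^sup>2 / 2) * (2 * (sqrt (1 - a) - sqrt (1 - b)))"
      by (rule mult_left_mono) simp
    finally show "(\<integral>x. \<bar>h x\<bar> \<partial>M) \<le> (2 * \<bar>\<sigma>\<bar> * exp (\<sigma>\<^sup>2 / 2)) * (sqrt (1 - a) - sqrt (1 - b))" by (simp only: mult_ac)
  qed simp
  finally show "(\<integral>x. \<bar>compensator a b x\<bar> \<partial>M) \<le> (2 * \<bar>S0\<bar> * \<bar>\<sigma>\<bar> * exp (\<sigma>\<^sup>2 / 2)) * (sqrt (1 - a) - sqrt (1 - b))"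
    by (simp add: mult_ac)
qed

lemma compensator_orthogonal:
  assumes ab: "0 \<le> a" "a < b" "b \<le> 1" and T: "T \<in> sets (terminal a)"
  shows "(\<integral>x. indicator T x * (S b x - S a x - compensator a b x) \<partial>M) = 0"
proof (rule terminal_orthogonal_induct[OF ab(1) _ _ _ T])
  define c where "c = \<sigma> * ((b - a) / (1 - a))"
  let ?Z = "\<lambda>x. B 1 x - B a x"
  have a1': "a \<le> 1" and b0: "0 \<le> b" using ab by auto
  show "a \<le> 1" by fact
  have cm: "compensator a b \<in> borel_measurable M"
    using measurable_from_subalg[OF full_subalgebraD(4)[OF terminal_full[OF ab(1)]] compensator_terminal[OF ab(1)]] .
  have ci: "integrable M (compensator a b)"
    by (rule square_integrable_imp_integrable[OF cm compensator_moments(1)[OF ab]])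
  have Si: "integrable M (S t)" if "0 \<le> t" for t unfolding S_def[abs_def] using expm_expectation(1)[OF that] by simp
  show "integrable M (\<lambda>x. S b x - S a x - compensator a b x)" using ci Si[OF b0] Si[OF ab(1)] by auto
  fix A C assume A: "A \<in> sets (F a)" and C[measurable]: "C \<in> sets (borel :: real measure)"
  have AM: "A \<in> sets M" using A FF.filt_sub[OF ab(1)] by (auto simp: subalgebra_def)
  let ?g = "\<lambda>x. indicator A x * S a x"
  let ?h = "\<lambda>x. indicator C (?Z x) * ratio \<sigma> a b x - indicator C (?Z x) * ratio c a 1 x"
  have g: "?g \<in> borel_measurable (F a)" using A S_F[OF ab(1) order_refl] by measurable
  have gi: "integrable M ?g" using integrable_real_mult_indicator[OF AM Si[OF ab(1)]] by (simp add: mult.commute)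
  have Zf: "?Z \<in> borel_measurable (future_increments a)" by (rule B_future[OF ab(1) a1'])
  have If: "(\<lambda>x. indicator C (?Z x) :: real) \<in> borel_measurable (future_increments a)" using Zf by measurable
  have rf: "ratio \<sigma> a b \<in> borel_measurable (future_increments a)" "ratio c a 1 \<in> borel_measurable (future_increments a)"
    using ratio_future ab by auto
  have h: "?h \<in> borel_measurable (future_increments a)" using If rf by measurable
  have IM: "(\<lambda>x. indicator C (?Z x) :: real) \<in> borel_measurable M" using measurable_from_subalg[OF future_sub[OF ab(1)] If] .
  have ri: "integrable M (\<lambda>x. indicator C (?Z x) * r x)" if "integrable M r" for r :: "'a \<Rightarrow> real"
    by (rule Bochner_Integration.integrable_bound[OF that]) (use IM that in \<open>auto simp: indicator_def\<close>)
  have r1: "integrable M (\<lambda>x. indicator C (?Z x) * ratio \<sigma> a b x)" by (rule ri[OF ratio_expectation(1)[OF ab(1)]]) (use ab in simp)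
  have r2: "integrable M (\<lambda>x. indicator C (?Z x) * ratio c a 1 x)" by (rule ri[OF ratio_expectation(1)[OF ab(1) a1']])
  have hi: "integrable M ?h" using r1 r2 by simp
  have "(\<integral>x. indicator C (?Z x) * ratio \<sigma> a b x \<partial>M) = (\<integral>x. indicator C (?Z x) * ratio c a 1 x \<partial>M)"
    using bridge_exponential[OF ab C] by (simp add: c_def ratio_def)
  then have hE: "(\<integral>x. ?h x \<partial>M) = 0" using r1 r2 by simp
  have "(\<lambda>x. indicator A x * (indicator C (?Z x) * (S b x - S a x - compensator a b x))) = (\<lambda>x. ?g x * ?h x)"
    unfolding S_ratio[of b _ a] compensator_def c_def ratio_def by (auto simp: algebra_simps)
  then show "(\<integral>x. indicator A x * (indicator C (?Z x) * (S b x - S a x - compensator a b x)) \<partial>M) = 0"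
    using past_future_expectation(2)[OF ab(1) g gi h hi] hE by simp
qed

text \<open>
  The residual of an orthogonal projection is not longer than the increment that is projected.
\<close>

lemma residual_second_moment:
  assumes ab: "0 \<le> a" "a < b" "b \<le> 1"
  shows "integrable M (\<lambda>x. (S b x - S a x - compensator a b x)\<^sup>2)"
    and "(\<integral>x. (S b x - S a x - compensator a b x)\<^sup>2 \<partial>M) \<le> S0\<^sup>2 * (exp (\<sigma>\<^sup>2 * b) - exp (\<sigma>\<^sup>2 * a))"
proof -
  let ?c = "compensator a b" and ?D = "\<lambda>x. S b x - S a x - compensator a b x"
  have b0: "0 \<le> b" and ab': "a \<le> b" using ab by auto
  have cm[measurable]: "?c \<in> borel_measurable M"
    using measurable_from_subalg[OF full_subalgebraD(4)[OF terminal_full[OF ab(1)]] compensator_terminal[OF ab(1)]] .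
  have [measurable]: "S a \<in> borel_measurable M" "S b \<in> borel_measurable M" using ab b0 by auto
  have d2: "integrable M (\<lambda>x. (S b x - S a x)\<^sup>2)"
    using integrable_square_add[of "S b" M "\<lambda>x. - S a x"] S_square[OF b0] S_square[OF ab(1)] by simp
  have c2: "integrable M (\<lambda>x. (?c x)\<^sup>2)" by (rule compensator_moments(1)[OF ab])
  show D2: "integrable M (\<lambda>x. (?D x)\<^sup>2)"
    using integrable_square_add[of "\<lambda>x. S b x - S a x" M "\<lambda>x. - ?c x"] d2 c2 by simp
  have Di: "integrable M ?D" by (rule square_integrable_imp_integrable[OF _ D2]) measurable
  have cD: "integrable M (\<lambda>x. ?c x * ?D x)" by (rule integrable_product_of_squares[OF _ _ c2 D2]) measurable
  have z: "(\<integral>x. ?c x * ?D x \<partial>M) = 0"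
    by (rule integral_sub_test[OF finite_measure_axioms full_subalgebraD(4)[OF terminal_full[OF ab(1)]] Di compensator_orthogonal[OF ab] compensator_terminal[OF ab(1)] cD])
  have e: "(S b x - S a x)\<^sup>2 = (?c x)\<^sup>2 + (?D x)\<^sup>2 + 2 * (?c x * ?D x)" for x by (simp add: power2_eq_square algebra_simps)
  have "(\<integral>x. (S b x - S a x)\<^sup>2 \<partial>M) = (\<integral>x. (?c x)\<^sup>2 \<partial>M) + (\<integral>x. (?D x)\<^sup>2 \<partial>M)"
    unfolding e using c2 D2 cD z by simp
  moreover have "0 \<le> (\<integral>x. (?c x)\<^sup>2 \<partial>M)" by simp
  moreover have "(\<integral>x. (S b x - S a x)\<^sup>2 \<partial>M) = S0\<^sup>2 * (exp (\<sigma>\<^sup>2 * b) - exp (\<sigma>\<^sup>2 * a))"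
  proof -
    have "(\<integral>x. (S t x)\<^sup>2 \<partial>M) = S0\<^sup>2 * exp (\<sigma>\<^sup>2 * t)" if "0 \<le> t" for t
      unfolding S_def power_mult_distrib using expm_square_expectation(2)[OF that, of \<sigma>] by simp
    then show ?thesis
      using FF.martingale_square_diff(2)[OF S_martingale S_adapted S_square ab(1) ab'] ab(1) b0
      by (simp add: right_diff_distrib)
  qed
  ultimately show "(\<integral>x. (?D x)\<^sup>2 \<partial>M) \<le> S0\<^sup>2 * (exp (\<sigma>\<^sup>2 * b) - exp (\<sigma>\<^sup>2 * a))" by linarith
qed

end

text \<open>
  If the superlevel sets of \<open>f\<close> have the traces on \<open>D\<close> of sets in \<open>N\<close>, then \<open>f\<close> coincides on \<open>D\<close> with
  the supremum of those rational \<open>q\<close> whose set \<open>b q\<close> contains the point.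
\<close>

lemma measurable_extension:
  fixes f :: "'a \<Rightarrow> real"
  assumes d: "0 < \<delta>" and f: "\<And>x. x \<in> D \<Longrightarrow> \<bar>f x\<bar> \<le> \<delta>" and D: "D \<subseteq> space N"
    and tr: "\<And>q. \<exists>b\<in>sets N. {x \<in> space N. q < f x} \<inter> D = b \<inter> D"
  obtains k where "k \<in> borel_measurable N" "\<And>x. \<bar>k x\<bar> \<le> \<delta>" "\<And>x. x \<in> D \<Longrightarrow> k x = f x"
proof -
  obtain b where b: "\<And>q. b q \<in> sets N" "\<And>q. {x \<in> space N. q < f x} \<inter> D = b q \<inter> D" using tr by metis
  define Q where "Q = \<rat> \<inter> {-\<delta><..<\<delta>}"
  obtain q0 where "q0 \<in> Q" using Rats_dense_in_real[of "-\<delta>" \<delta>] d by (auto simp: Q_def)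
  then have Q: "Q \<noteq> {}" "countable Q" by (auto simp: Q_def intro: countable_Int1 countable_rat)
  define g where "g x q = (if x \<in> b q then q else - \<delta>)" for x q
  have gb: "- \<delta> \<le> g x q" "g x q \<le> \<delta>" if "q \<in> Q" for x q using that d by (auto simp: g_def Q_def)
  have bdd: "bdd_above (g x ` Q)" for x using gb by (intro bdd_aboveI[of _ \<delta>]) auto
  define k where "k x = (SUP q\<in>Q. g x q)" for x
  show ?thesis
  proof (rule that[of k])
    show "k \<in> borel_measurable N"
      unfolding k_def[abs_def]
    proof (rule borel_measurable_cSUP[OF Q(2)])
      show "(\<lambda>x. g x q) \<in> borel_measurable N" for q
        unfolding g_def using b(1)[of q] by (intro measurable_If_set) (auto simp: sets.Int_space_eq2)
    qed (use bdd in auto)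
    show "\<bar>k x\<bar> \<le> \<delta>" for x
    proof -
      have "k x \<le> \<delta>" unfolding k_def by (rule cSUP_least[OF Q(1)]) (rule gb)
      moreover have "- \<delta> \<le> k x" unfolding k_def using \<open>q0 \<in> Q\<close> gb by (intro cSUP_upper2[OF bdd, of q0]) auto
      ultimately show ?thesis by simp
    qed
    fix x assume x: "x \<in> D"
    then have xs: "x \<in> space N" using D by blast
    have mem: "x \<in> b q \<longleftrightarrow> q < f x" for q using b(2)[of q] x xs by blast
    show "k x = f x"
    proof (rule antisym)
      show "k x \<le> f x" unfolding k_def
      proof (rule cSUP_least[OF Q(1)])
        fix q assume "q \<in> Q"
        then show "g x q \<le> f x" using f[OF x] mem[of q] by (auto simp: g_def)
      qed
      show "f x \<le> k x"
      proof (rule ccontr)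
        assume "\<not> f x \<le> k x"
        then have "max (k x) (- \<delta>) < f x"
          using \<open>\<bar>k x\<bar> \<le> \<delta>\<close> by auto
        then obtain q where q: "q \<in> \<rat>" "max (k x) (- \<delta>) < q" "q < f x" using Rats_dense_in_real by blast
        then have qQ: "q \<in> Q" using f[OF x] by (auto simp: Q_def)
        then have "q \<le> k x" unfolding k_def using mem[of q] q(3) by (intro cSUP_upper2[OF bdd qQ]) (auto simp: g_def)
        then show False using q(2) by simp
      qed
    qed
  qed
qed

section \<open>The price after the last passage is a semimartingale\<close>

context black_scholes begin

text \<open>
  Bounds, over all grids of \<open>[0, 1]\<close>, for the total size of the compensators and for the sum of the
  second moments of the residuals.
\<close>

definition K1 :: real where "K1 = 2 * \<bar>S0\<bar> * \<bar>\<sigma>\<bar> * exp (\<sigma>\<^sup>2 / 2)"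
definition K2 :: real where "K2 = S0\<^sup>2 * exp (\<sigma>\<^sup>2)"

lemma K1_nonneg: "0 \<le> K1" and K2_nonneg: "0 \<le> K2" by (simp_all add: K1_def K2_def)

lemma compensator_refl[simp]: "compensator a a x = 0" by (simp add: compensator_def)

lemma compensator_le:
  assumes ab: "0 \<le> a" "a \<le> b" "b \<le> 1"
  shows "integrable M (\<lambda>x. (compensator a b x)\<^sup>2)"
    and "(\<integral>x. \<bar>compensator a b x\<bar> \<partial>M) \<le> K1 * (sqrt (1 - a) - sqrt (1 - b))"
    and "integrable M (\<lambda>x. (S b x - S a x - compensator a b x)\<^sup>2)"
    and "(\<integral>x. (S b x - S a x - compensator a b x)\<^sup>2 \<partial>M) \<le> S0\<^sup>2 * (exp (\<sigma>\<^sup>2 * b) - exp (\<sigma>\<^sup>2 * a))"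
    and "T \<in> sets (terminal a) \<Longrightarrow> (\<integral>x. indicator T x * (S b x - S a x - compensator a b x) \<partial>M) = 0"
  using compensator_moments[of a b] residual_second_moment[of a b] compensator_orthogonal[of a b T] assms
  by (cases "a = b"; simp add: K1_def)+

text \<open>
  The increments of \<open>S\<close> split into compensators, whose absolute sum has bounded expectation, and
  martingale differences of the filtration \<open>terminal\<close>, which are controlled by Doob's inequality.  One
  covering set \<open>A\<close> serves all tails of the sum: the starting index \<open>m\<close> will be the first grid point
  after \<open>\<tau>\<close>, and whether \<open>\<tau>\<close> has passed is not known in \<open>terminal\<close>.
\<close>

lemma tail_bound:
  assumes v: "\<And>i. 0 \<le> v i" "\<And>i. v i \<le> v (Suc i)" "\<And>i. v i \<le> 1"
    and k: "\<And>i. k i \<in> borel_measurable (terminal (v i))" "\<And>i x. x \<in> space M \<Longrightarrow> \<bar>k i x\<bar> \<le> \<delta>"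
    and d: "0 \<le> \<delta>" and l: "0 < l"
  obtains A where "A \<in> sets M" "prob A \<le> 2 * \<delta> * K1 / l + 16 * \<delta>\<^sup>2 * K2 / l\<^sup>2"
    "\<And>x m. x \<in> space M - A \<Longrightarrow> m \<le> n \<Longrightarrow> \<bar>\<Sum>i\<in>{m..<n}. k i x * (S (v (Suc i)) x - S (v i) x)\<bar> \<le> l"
proof -
  define c where "c i = compensator (v i) (v (Suc i))" for i
  define D where "D i x = S (v (Suc i)) x - S (v i) x - c i x" for i x
  note CL = compensator_le[OF v(1,2,3)]
  have SmT: "S (v i) \<in> borel_measurable (terminal (v j))" if "v i \<le> v j" for i j
    by (rule F_measurable_terminal[OF S_F[OF v(1) that]])
  have cT: "c i \<in> borel_measurable (terminal (v i))" for i unfolding c_def by (rule compensator_terminal[OF v(1)])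
  interpret MD: martingale_differences M "\<lambda>i. terminal (v i)" k D \<delta>
  proof
    fix i
    show "subalgebra M (terminal (v i))" by (rule full_subalgebraD(4)[OF terminal_full[OF v(1)]])
    show mono: "sets (terminal (v i)) \<subseteq> sets (terminal (v (Suc i)))" by (rule terminal_mono[OF v(1,2)])
    show "k i \<in> borel_measurable (terminal (v i))" by (rule k(1))
    show "\<bar>k i x\<bar> \<le> \<delta>" if "x \<in> space M" for x by (rule k(2)[OF that])
    have "c i \<in> borel_measurable (terminal (v (Suc i)))" using cT[of i] mono by (auto simp: measurable_def)
    then show "D i \<in> borel_measurable (terminal (v (Suc i)))"
      unfolding D_def[abs_def] using SmT[of "Suc i" "Suc i"] SmT[of i "Suc i"] v(2) by auto
    show "integrable M (\<lambda>x. (D i x)\<^sup>2)" unfolding D_def c_def by (rule CL(3))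
    show "(\<integral>x. indicator A x * D i x \<partial>M) = 0" if "A \<in> sets (terminal (v i))" for A
      unfolding D_def c_def by (rule CL(5)[OF that])
  qed
  have cM[measurable]: "c i \<in> borel_measurable M" for i by (rule MD.G_meas[OF cT])
  have ci: "integrable M (c i)" for i
    by (rule square_integrable_imp_integrable[OF cM]) (use CL(1) in \<open>simp add: c_def\<close>)
  define V where "V x = (\<Sum>i<n. \<bar>c i x\<bar>)" for x
  have Vi: "integrable M V" unfolding V_def[abs_def] using ci by auto
  have EV: "(\<integral>x. V x \<partial>M) \<le> K1"
  proof -
    have "(\<integral>x. V x \<partial>M) = (\<Sum>i<n. \<integral>x. \<bar>c i x\<bar> \<partial>M)"
      unfolding V_def by (rule Bochner_Integration.integral_sum) (use ci in auto)
    also have "\<dots> \<le> (\<Sum>i<n. K1 * (sqrt (1 - v i) - sqrt (1 - v (Suc i))))"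
      unfolding c_def by (intro sum_mono CL(2))
    also have "\<dots> = K1 * (sqrt (1 - v 0) - sqrt (1 - v n))"
      unfolding sum_distrib_left[symmetric] using sum_lessThan_telescope'[of "\<lambda>i. sqrt (1 - v i)" n] by simp
    also have "\<dots> \<le> K1 * 1"
    proof (rule mult_left_mono[OF _ K1_nonneg])
      have 1: "sqrt (1 - v 0) \<le> 1" using v(1)[of 0] by simp
      have 2: "0 \<le> sqrt (1 - v n)" using v(3)[of n] by simp
      show "sqrt (1 - v 0) - sqrt (1 - v n) \<le> 1" using 1 2 by linarith
    qed
    finally show ?thesis by simp
  qed
  have V0: "0 \<le> V x" for x unfolding V_def by (intro sum_nonneg) simp
  define A1 where "A1 = {x \<in> space M. l / 2 \<le> \<delta> * V x}"
  define A2 where "A2 = {x \<in> space M. \<exists>j\<le>n. l / 4 \<le> \<bar>MD.partial j x\<bar>}"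
  have A1: "A1 \<in> sets M" unfolding A1_def using Vi by measurable
  have A2: "A2 \<in> sets M"
  proof -
    have "A2 = (\<Union>j\<in>{..n}. {x \<in> space M. l / 4 \<le> \<bar>MD.partial j x\<bar>})" by (auto simp: A2_def)
    also have "\<dots> \<in> sets M" by (rule sets.finite_UN) auto
    finally show ?thesis .
  qed
  have P1: "prob A1 \<le> 2 * \<delta> * K1 / l"
  proof -
    have "prob A1 \<le> (\<integral>x. \<delta> * V x \<partial>M) / (l / 2)"
      unfolding A1_def by (rule integral_Markov_inequality_measure[where A="{}"])
        (use Vi d l V0 in auto)
    also have "\<dots> = 2 * \<delta> * (\<integral>x. V x \<partial>M) / l" using Vi by simp
    also have "\<dots> \<le> 2 * \<delta> * K1 / l" using EV d l by (intro divide_right_mono mult_left_mono) auto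
    finally show ?thesis .
  qed
  have P2: "prob A2 \<le> 16 * \<delta>\<^sup>2 * K2 / l\<^sup>2"
  proof -
    have "(\<Sum>i<n. \<integral>x. (D i x)\<^sup>2 \<partial>M) \<le> (\<Sum>i<n. S0\<^sup>2 * (exp (\<sigma>\<^sup>2 * v (Suc i)) - exp (\<sigma>\<^sup>2 * v i)))"
      unfolding D_def c_def by (intro sum_mono CL(4))
    also have "\<dots> = S0\<^sup>2 * (exp (\<sigma>\<^sup>2 * v n) - exp (\<sigma>\<^sup>2 * v 0))"
      unfolding sum_distrib_left[symmetric] using sum_lessThan_telescope[of "\<lambda>i. exp (\<sigma>\<^sup>2 * v i)" n] by simp
    also have "\<dots> \<le> S0\<^sup>2 * exp (\<sigma>\<^sup>2)"
    proof (rule mult_left_mono)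
      have "exp (\<sigma>\<^sup>2 * v n) \<le> exp (\<sigma>\<^sup>2)" using v(3)[of n] by (simp add: mult_left_le)
      then show "exp (\<sigma>\<^sup>2 * v n) - exp (\<sigma>\<^sup>2 * v 0) \<le> exp (\<sigma>\<^sup>2)" by (smt (verit) exp_ge_zero)
    qed simp
    finally have s: "(\<Sum>i<n. \<integral>x. (D i x)\<^sup>2 \<partial>M) \<le> K2" by (simp add: K2_def)
    have "prob A2 \<le> (\<integral>x. (MD.partial n x)\<^sup>2 \<partial>M) / (l / 4)\<^sup>2"
      unfolding A2_def by (rule MD.doob_maximal) (use l in simp)
    also have "\<dots> \<le> (\<delta>\<^sup>2 * K2) / (l / 4)\<^sup>2"
      using MD.partial_second_moment[of n] mult_left_mono[OF s, of "\<delta>\<^sup>2"] by (intro divide_right_mono) auto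
    finally show ?thesis by (simp add: power_divide mult_ac)
  qed
  show ?thesis
  proof (rule that[of "A1 \<union> A2"])
    show "A1 \<union> A2 \<in> sets M" using A1 A2 by auto
    have "prob (A1 \<union> A2) \<le> prob A1 + prob A2" by (rule measure_Un_le[OF A1 A2])
    then show "prob (A1 \<union> A2) \<le> 2 * \<delta> * K1 / l + 16 * \<delta>\<^sup>2 * K2 / l\<^sup>2" using P1 P2 by linarith
    fix x m assume x: "x \<in> space M - (A1 \<union> A2)" and m: "m \<le> n"
    then have xs: "x \<in> space M" by simp
    have 1: "\<delta> * V x < l / 2" using x by (auto simp: A1_def not_le)
    have 2: "\<bar>MD.partial j x\<bar> < l / 4" if "j \<le> n" for j
    proof (rule ccontr)
      assume "\<not> \<bar>MD.partial j x\<bar> < l / 4"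
      then have "x \<in> A2" unfolding A2_def using xs that by (intro CollectI conjI exI[of _ j]) auto
      then show False using x by simp
    qed
    have "(\<Sum>i\<in>{m..<n}. k i x * (S (v (Suc i)) x - S (v i) x)) = (\<Sum>i\<in>{m..<n}. k i x * c i x) + (\<Sum>i\<in>{m..<n}. k i x * D i x)"
      unfolding sum.distrib[symmetric] by (intro sum.cong refl) (simp add: D_def algebra_simps)
    moreover have "(\<Sum>i\<in>{m..<n}. k i x * D i x) = MD.partial n x - MD.partial m x"
    proof -
      have "MD.partial n x = MD.partial m x + (\<Sum>i\<in>{m..<n}. k i x * D i x)"
        unfolding MD.partial_def using m sum.atLeastLessThan_concat[of 0 m n "\<lambda>i. k i x * D i x"] by (simp add: lessThan_atLeast0)
      then show ?thesis by simp
    qed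
    moreover have "\<bar>\<Sum>i\<in>{m..<n}. k i x * c i x\<bar> \<le> \<delta> * V x"
    proof -
      have "\<bar>\<Sum>i\<in>{m..<n}. k i x * c i x\<bar> \<le> (\<Sum>i\<in>{m..<n}. \<bar>k i x * c i x\<bar>)" by (rule sum_abs)
      also have "\<dots> \<le> (\<Sum>i\<in>{m..<n}. \<delta> * \<bar>c i x\<bar>)"
        unfolding abs_mult by (intro sum_mono mult_right_mono k(2) xs) auto
      also have "\<dots> \<le> (\<Sum>i<n. \<delta> * \<bar>c i x\<bar>)" by (rule sum_mono2) (use d in auto)
      also have "\<dots> = \<delta> * V x" by (simp add: V_def sum_distrib_left)
      finally show ?thesis .
    qed
    ultimately show "\<bar>\<Sum>i\<in>{m..<n}. k i x * (S (v (Suc i)) x - S (v i) x)\<bar> \<le> l"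
      using 1 2[OF m] 2[OF order_refl] by linarith
  qed
qed

end

context half_time begin

text \<open>
  On \<open>\<tau> \<le> u\<close> the time \<open>\<tau>\<close> is the last zero before \<open>u\<close> and is determined by the path up to \<open>u\<close> and
  the terminal value.  The event is intersected with the almost sure event on which the last zero
  for the given price \<open>X\<close> agrees with that for \<open>S\<close>.
\<close>

lemma trace_after:
  assumes u: "0 \<le> u" and e: "0 \<le> e" and A: "A \<in> sets (E (u + e))"
  shows "\<exists>b\<in>sets (terminal (u + e)). A \<inter> {x \<in> space M. \<tau> x \<le> u \<and> \<tau> x = last_zero 1 S x} = b \<inter> {x \<in> space M. \<tau> x \<le> u \<and> \<tau> x = last_zero 1 S x}"
proof (rule trace_sigma_sets[of A "terminal (u + e)"])
  let ?D = "{x \<in> space M. \<tau> x \<le> u \<and> \<tau> x = last_zero 1 S x}"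
  show "A \<in> sigma_sets (space (terminal (u + e))) (sets (F (u + e)) \<union> {(\<lambda>\<omega>. min (\<tau> \<omega>) (u + e)) -` C \<inter> space M | C. C \<in> sets borel})"
    using A by (simp add: sets_E)
  fix a assume "a \<in> sets (F (u + e)) \<union> {(\<lambda>\<omega>. min (\<tau> \<omega>) (u + e)) -` C \<inter> space M | C. C \<in> sets borel}"
  then consider "a \<in> sets (F (u + e))" | C where "a = (\<lambda>\<omega>. min (\<tau> \<omega>) (u + e)) -` C \<inter> space M" "C \<in> sets borel" by blast
  then show "\<exists>b\<in>sets (terminal (u + e)). a \<inter> ?D = b \<inter> ?D"
  proof cases
    case 1 then show ?thesis using F_sub_terminal[of "u + e"] by blast
  next
    case 2
    have "S 1 \<in> borel_measurable (terminal (u + e))"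
      unfolding S_def[abs_def] expm_def using B1_terminal[of "u + e"] by measurable
    then have m: "last_zero (min u 1) S \<in> borel_measurable (terminal (u + e))"
      using u e by (intro last_zero_measurable) (auto intro!: F_measurable_terminal S_F S_continuous)
    let ?b = "last_zero (min u 1) S -` C \<inter> space M"
    have "?b \<in> sets (terminal (u + e))" using measurable_sets[OF m 2(2)] by simp
    moreover have "a \<inter> ?D = ?b \<inter> ?D"
    proof -
      have "min (\<tau> x) (u + e) = last_zero (min u 1) S x" if "x \<in> ?D" for x
      proof -
        have "\<tau> x = last_zero (min u 1) S x" using that last_zero_before[OF u, of S x] by simp
        then show ?thesis using that e by simp
      qed
      then show ?thesis unfolding 2(1) by auto
    qed
    ultimately show ?thesis by blast
  qed
qed

lemma extension_after:
  fixes f :: "'a \<Rightarrow> real"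
  assumes u: "0 \<le> u" and e: "0 < e" and d: "0 < \<delta>" and f: "f \<in> borel_measurable (G u)" "\<And>x. x \<in> space M \<Longrightarrow> \<bar>f x\<bar> \<le> \<delta>"
  obtains k where "k \<in> borel_measurable (terminal (u + e))" "\<And>x. \<bar>k x\<bar> \<le> \<delta>"
    "\<And>x. x \<in> space M \<Longrightarrow> \<tau> x \<le> u \<Longrightarrow> \<tau> x = last_zero 1 S x \<Longrightarrow> k x = f x"
proof (rule measurable_extension[OF d, of "{x \<in> space M. \<tau> x \<le> u \<and> \<tau> x = last_zero 1 S x}" f "terminal (u + e)"])
  show "\<exists>b\<in>sets (terminal (u + e)). {x \<in> space (terminal (u + e)). q < f x} \<inter> {x \<in> space M. \<tau> x \<le> u \<and> \<tau> x = last_zero 1 S x} =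
      b \<inter> {x \<in> space M. \<tau> x \<le> u \<and> \<tau> x = last_zero 1 S x}" for q
  proof -
    have "{x \<in> space M. q < f x} = f -` {q<..} \<inter> space (G u)" by auto
    also have "\<dots> \<in> sets (G u)" by (rule measurable_sets[OF f(1)]) simp
    also have "sets (G u) \<subseteq> sets (E (u + e))" by (rule G_sub_E[OF e])
    finally have "{x \<in> space M. q < f x} \<in> sets (E (u + e))" .
    from trace_after[OF u less_imp_le[OF e] this] show ?thesis by simp
  qed
  fix k assume k: "k \<in> borel_measurable (terminal (u + e))" "\<And>x. \<bar>k x\<bar> \<le> \<delta>"
    "\<And>x. x \<in> {x \<in> space M. \<tau> x \<le> u \<and> \<tau> x = last_zero 1 S x} \<Longrightarrow> k x = f x"
  show thesis by (rule that[OF k(1,2)]) (use k(3) in auto)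
qed (use f in auto)

text \<open>The part of \<open>S - stopped S \<tau>\<close> that happens up to time 1.\<close>

definition after :: "real \<Rightarrow> 'a \<Rightarrow> real" where
  "after t x = S (min t 1) x - stopped S \<tau> (min t 1) x"

lemma after_adapted: "adapted G after"
  unfolding adapted_def
proof (intro allI impI)
  fix t :: real assume t: "0 \<le> t"
  have "S (min t 1) \<in> borel_measurable (G t)"
  proof (rule measurable_G)
    fix e :: real assume e: "0 < e"
    have "S (min t 1) \<in> borel_measurable (F (t + e))" by (rule S_F) (use t e in auto)
    then show "S (min t 1) \<in> borel_measurable (E (t + e))" using F_sub_E[of "t + e"] by (auto simp: measurable_def)
  qed
  moreover have "stopped S \<tau> (min t 1) \<in> borel_measurable (G t)"
    by (rule GG.filt_measurable_mono[of "min t 1" t]) (use t stopped_adapted[OF S_F S_continuous] in \<open>auto simp: adapted_def\<close>)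
  ultimately show "after t \<in> borel_measurable (G t)" unfolding after_def[abs_def] by measurable
qed

text \<open>
  The contribution of the intervals that lie after \<open>\<tau>\<close>.  The coefficient \<open>f i\<close> is measurable for
  \<open>G (u i)\<close>, hence replaced after \<open>\<tau>\<close> by a function \<open>k i j\<close> measurable for the terminal filtration
  at the later time \<open>u i + e j\<close>.  The grid is moved to these later times, and \<open>e j\<close> tends to 0.
\<close>

lemma after_tail_probability:
  assumes el: "elementary M G g n u f" and b: "bounded_by M (elem_process g n u f) \<delta>" and d: "0 < \<delta>" and l: "0 < l"
    and t: "0 \<le> t" "t \<le> 1"
  defines "T \<equiv> \<lambda>x. \<Sum>i<n. of_bool (\<tau> x \<le> u i) * f i x * (S (min t (u (Suc i))) x - S (min t (u i)) x)"
  shows "T \<in> borel_measurable M"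
    and "prob {x \<in> space M. l < \<bar>T x\<bar>} \<le> 2 * \<delta> * K1 / l + 16 * \<delta>\<^sup>2 * K2 / l\<^sup>2"
proof -
  have u0: "0 \<le> u i" if "i \<le> n" for i using elementary_grid(1)[OF el order_refl that] .
  have um: "u i \<le> u j" if "i \<le> j" "j \<le> n" for i j using elementary_grid(2)[OF el that] .
  have fG: "f i \<in> borel_measurable (G (u i))" if "i < n" for i using el that by (auto simp: elementary_def)
  have fM: "f i \<in> borel_measurable M" if "i < n" for i by (rule GG.filt_measurable[OF u0 fG]) (use that in auto)
  show Tm: "T \<in> borel_measurable M"
    unfolding T_def
  proof (rule borel_measurable_sum)
    fix i assume "i \<in> {..<n}"
    then have [measurable]: "f i \<in> borel_measurable M" "S (min t (u (Suc i))) \<in> borel_measurable M" "S (min t (u i)) \<in> borel_measurable M"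
      using fM[of i] u0[of i] u0[of "Suc i"] t by auto
    show "(\<lambda>x. of_bool (\<tau> x \<le> u i) * f i x * (S (min t (u (Suc i))) x - S (min t (u i)) x)) \<in> borel_measurable M" by measurable
  qed
  define e where "e k = inverse (real (Suc k))" for k
  have e: "0 < e k" for k by (simp add: e_def)
  have elim: "e \<longlonglongrightarrow> 0" unfolding e_def[abs_def] by (rule LIMSEQ_inverse_real_of_nat)
  define extends where "extends i j k \<longleftrightarrow> (i < n \<and> u i < u (Suc i) \<longrightarrow> k \<in> borel_measurable (terminal (u i + e j)) \<and> (\<forall>x. \<bar>k x\<bar> \<le> \<delta>) \<and>
     (\<forall>x\<in>space M. \<tau> x \<le> u i \<longrightarrow> \<tau> x = last_zero 1 S x \<longrightarrow> k x = f i x))" for i j and k :: "'a \<Rightarrow> real"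
  have "\<exists>k. extends i j k" for i j
  proof (cases "i < n \<and> u i < u (Suc i)")
    case True
    then have i: "i < n" "u i < u (Suc i)" by auto
    have fb: "\<bar>f i x\<bar> \<le> \<delta>" if "x \<in> space M" for x by (rule elem_process_bound[OF el b i that])
    have ui: "0 \<le> u i" using u0[of i] i by simp
    obtain k where "k \<in> borel_measurable (terminal (u i + e j))" "\<And>x. \<bar>k x\<bar> \<le> \<delta>"
      "\<And>x. x \<in> space M \<Longrightarrow> \<tau> x \<le> u i \<Longrightarrow> \<tau> x = last_zero 1 S x \<Longrightarrow> k x = f i x"
      by (rule extension_after[OF ui e[of j] d fG[OF i(1)] fb]) (assumption | rule that)+
    then show ?thesis unfolding extends_def by blast
  next
    case False
    then show ?thesis unfolding extends_def by blast
  qed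
  then obtain k where kg: "\<And>i j. extends i j (k i j)" by metis
  have k: "i < n \<Longrightarrow> u i < u (Suc i) \<Longrightarrow> k i j \<in> borel_measurable (terminal (u i + e j))"
    "i < n \<Longrightarrow> u i < u (Suc i) \<Longrightarrow> \<bar>k i j x\<bar> \<le> \<delta>"
    "i < n \<Longrightarrow> u i < u (Suc i) \<Longrightarrow> x \<in> space M \<Longrightarrow> \<tau> x \<le> u i \<Longrightarrow> \<tau> x = last_zero 1 S x \<Longrightarrow> k i j x = f i x" for i j x
    using kg[of i j] unfolding extends_def by auto
  \<comment> \<open>After the shift an interval that starts beyond \<open>t\<close> has no increment, and its coefficient may be
    set to zero.\<close>
  define kk where "kk j i = (if i < n \<and> u i < u (Suc i) \<and> u i + e j < t then k i j else (\<lambda>_. 0))" for j i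
  define vv where "vv j i = min t (u (min i n) + e j)" for j i
  have vv0: "0 \<le> vv j i" for j i using u0[of "min i n"] e[of j] t by (auto simp: vv_def)
  have "\<exists>A. A \<in> sets M \<and> prob A \<le> 2 * \<delta> * K1 / l + 16 * \<delta>\<^sup>2 * K2 / l\<^sup>2 \<and>
    (\<forall>x\<in>space M - A. \<forall>m\<le>n. \<bar>\<Sum>i\<in>{m..<n}. kk j i x * (S (vv j (Suc i)) x - S (vv j i) x)\<bar> \<le> l)" for j
  proof -
    have v2: "vv j i \<le> vv j (Suc i)" for i
      using um[of "min i n" "min (Suc i) n"] by (auto simp: vv_def min_le_iff_disj)
    have v3: "vv j i \<le> 1" for i using t by (simp add: vv_def)
    have k1: "kk j i \<in> borel_measurable (terminal (vv j i))" for i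
    proof (cases "i < n \<and> u i < u (Suc i) \<and> u i + e j < t")
      case True
      then have "vv j i = u i + e j" by (simp add: vv_def)
      then show ?thesis using k(1)[of i j] True by (simp add: kk_def)
    next
      case False
      then have "kk j i = (\<lambda>_. 0)" by (simp only: kk_def if_False)
      then show ?thesis by simp
    qed
    have k2: "\<bar>kk j i x\<bar> \<le> \<delta>" for i x using k(2)[of i j x] d by (auto simp: kk_def)
    show ?thesis
      by (rule tail_bound[where v="vv j" and k="kk j" and n=n, OF vv0 v2 v3 k1 k2 less_imp_le[OF d] l]) blast
  qed
  then have "\<forall>j. \<exists>A. A \<in> sets M \<and> prob A \<le> 2 * \<delta> * K1 / l + 16 * \<delta>\<^sup>2 * K2 / l\<^sup>2 \<and>
    (\<forall>x\<in>space M - A. \<forall>m\<le>n. \<bar>\<Sum>i\<in>{m..<n}. kk j i x * (S (vv j (Suc i)) x - S (vv j i) x)\<bar> \<le> l)" ..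
  from choice[OF this] obtain A where AA: "\<forall>j. A j \<in> sets M \<and> prob (A j) \<le> 2 * \<delta> * K1 / l + 16 * \<delta>\<^sup>2 * K2 / l\<^sup>2 \<and>
    (\<forall>x\<in>space M - A j. \<forall>m\<le>n. \<bar>\<Sum>i\<in>{m..<n}. kk j i x * (S (vv j (Suc i)) x - S (vv j i) x)\<bar> \<le> l)" ..
  then have A: "A j \<in> sets M" "prob (A j) \<le> 2 * \<delta> * K1 / l + 16 * \<delta>\<^sup>2 * K2 / l\<^sup>2"
    "\<And>x m. x \<in> space M - A j \<Longrightarrow> m \<le> n \<Longrightarrow> \<bar>\<Sum>i\<in>{m..<n}. kk j i x * (S (vv j (Suc i)) x - S (vv j i) x)\<bar> \<le> l" for j
    by simp_all
  define Tj where "Tj j x = (\<Sum>i<n. of_bool (\<tau> x \<le> u i) * f i x * (S (vv j (Suc i)) x - S (vv j i) x))" for j x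
  define Q where "Q = {x \<in> space M. l < \<bar>T x\<bar>}"
  have QM: "Q \<in> sets M" unfolding Q_def using Tm by measurable
  have Tjb: "\<bar>Tj j x\<bar> \<le> l" if x: "x \<in> space M - A j" and eq: "\<tau> x = last_zero 1 S x" for j x
  proof -
    \<comment> \<open>The first grid point after \<open>\<tau>\<close>: the restriction to \<open>\<tau> \<le> u i\<close> selects a tail of the sum.\<close>
    define m where "m = (LEAST i. i = n \<or> \<tau> x \<le> u i)"
    have m1: "m \<le> n" unfolding m_def by (rule Least_le) simp
    have m2: "\<tau> x \<le> u i \<longleftrightarrow> m \<le> i" if "i < n" for i
    proof
      assume "\<tau> x \<le> u i" then show "m \<le> i" unfolding m_def by (intro Least_le) simp
    next
      assume mi: "m \<le> i"
      have "m = n \<or> \<tau> x \<le> u m" unfolding m_def by (rule LeastI[of _ n]) simp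
      then have "\<tau> x \<le> u m" using mi that by auto
      also have "u m \<le> u i" using um[OF mi] that by simp
      finally show "\<tau> x \<le> u i" .
    qed
    have "Tj j x = (\<Sum>i\<in>{m..<n}. kk j i x * (S (vv j (Suc i)) x - S (vv j i) x))"
      unfolding Tj_def
    proof (rule sum.mono_neutral_cong_right)
      show "\<forall>i\<in>{..<n} - {m..<n}. of_bool (\<tau> x \<le> u i) * f i x * (S (vv j (Suc i)) x - S (vv j i) x) = 0"
        using m2 by auto
      fix i assume i: "i \<in> {m..<n}"
      then have tau: "\<tau> x \<le> u i" using m2[of i] by simp
      show "of_bool (\<tau> x \<le> u i) * f i x * (S (vv j (Suc i)) x - S (vv j i) x) = kk j i x * (S (vv j (Suc i)) x - S (vv j i) x)"
      proof (cases "u i < u (Suc i) \<and> u i + e j < t")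
        case True
        then have "kk j i x = f i x" using k(3)[of i x j] i tau x eq by (simp add: kk_def)
        then show ?thesis using tau by simp
      next
        case False
        then have "vv j (Suc i) = vv j i" using um[of i "Suc i"] i by (auto simp: vv_def min_absorb1)
        then show ?thesis by simp
      qed
    qed auto
    then show ?thesis using A(3)[OF x m1] by simp
  qed
  have Tlim: "(\<lambda>j. Tj j x) \<longlonglongrightarrow> T x" for x
    unfolding Tj_def T_def
  proof (intro tendsto_sum tendsto_mult tendsto_const tendsto_diff)
    fix i assume "i \<in> {..<n}"
    then have i: "i < n" by simp
    have "(\<lambda>j. S (vv j i') x) \<longlonglongrightarrow> S (min t (u i')) x" if i': "i' \<le> n" for i'
    proof (rule continuous_on_tendsto_compose[OF S_continuous])
      have "(\<lambda>j. min t (u i' + e j)) \<longlonglongrightarrow> min t (u i' + 0)" by (intro tendsto_intros elim)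
      then show "(\<lambda>j. vv j i') \<longlonglongrightarrow> min t (u i')" using i' by (simp add: vv_def min_absorb1)
      show "min t (u i') \<in> {0..}" using t u0[OF i'] by simp
      show "\<forall>\<^sub>F j in sequentially. vv j i' \<in> {0..}" using vv0 by simp
    qed
    then show "(\<lambda>j. S (vv j (Suc i)) x) \<longlonglongrightarrow> S (min t (u (Suc i))) x" "(\<lambda>j. S (vv j i) x) \<longlonglongrightarrow> S (min t (u i)) x"
      using i by auto
  qed
  have "(\<integral>\<^sup>+x. ennreal (indicator Q x) \<partial>M) \<le> ennreal (2 * \<delta> * K1 / l + 16 * \<delta>\<^sup>2 * K2 / l\<^sup>2)"
  proof (rule nn_integral_AE_limit_le[of "\<lambda>j. indicator (Q \<inter> A j)"])
    show "AE x in M. (\<lambda>j. indicator (Q \<inter> A j) x :: real) \<longlonglongrightarrow> indicator Q x"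
      using half_time_AE
    proof eventually_elim
      case (elim x)
      show ?case
      proof (cases "x \<in> Q")
        case True
        then have x: "x \<in> space M" "l < \<bar>T x\<bar>" by (auto simp: Q_def)
        have "(\<lambda>j. \<bar>Tj j x\<bar>) \<longlonglongrightarrow> \<bar>T x\<bar>" by (intro tendsto_intros Tlim)
        then have "\<forall>\<^sub>F j in sequentially. l < \<bar>Tj j x\<bar>" using x(2) by (rule order_tendstoD)
        then have "\<forall>\<^sub>F j in sequentially. indicator Q x = (indicator (Q \<inter> A j) x :: real)"
        proof eventually_elim
          fix j assume "l < \<bar>Tj j x\<bar>"
          then have "x \<in> A j" using Tjb[of x j] x(1) \<open>\<tau> x = last_zero 1 S x\<close> by force
          then show "indicator Q x = (indicator (Q \<inter> A j) x :: real)" using True by simp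
        qed
        then show ?thesis by (rule Lim_transform_eventually[OF tendsto_const])
      next
        case False
        then have "indicator (Q \<inter> A j) x = (0::real)" "indicator Q x = (0::real)" for j by auto
        then show ?thesis by (simp only: tendsto_const)
      qed
    qed
    show "(\<integral>\<^sup>+x. ennreal (indicator (Q \<inter> A j) x) \<partial>M) \<le> ennreal (2 * \<delta> * K1 / l + 16 * \<delta>\<^sup>2 * K2 / l\<^sup>2)" for j
    proof -
      have "(\<integral>\<^sup>+x. ennreal (indicator (Q \<inter> A j) x) \<partial>M) = ennreal (prob (Q \<inter> A j))"
        using QM A(1)[of j] by (simp add: ennreal_indicator emeasure_eq_measure)
      also have "\<dots> \<le> ennreal (prob (A j))" using A(1) by (intro ennreal_leI finite_measure_mono) auto
      also have "\<dots> \<le> ennreal (2 * \<delta> * K1 / l + 16 * \<delta>\<^sup>2 * K2 / l\<^sup>2)" by (rule ennreal_leI[OF A(2)])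
      finally show ?thesis .
    qed
  qed (use QM A(1) in auto)
  moreover have "0 \<le> 2 * \<delta> * K1 / l + 16 * \<delta>\<^sup>2 * K2 / l\<^sup>2" using d l K1_nonneg K2_nonneg by simp
  ultimately show "prob {x \<in> space M. l < \<bar>T x\<bar>} \<le> 2 * \<delta> * K1 / l + 16 * \<delta>\<^sup>2 * K2 / l\<^sup>2"
    using QM by (simp add: ennreal_indicator emeasure_eq_measure Q_def[symmetric])
qed

text \<open>
  Intervals before \<open>\<tau>\<close> contribute nothing, and at most one interval contains \<open>\<tau>\<close> in its interior.
\<close>

lemma after_straddle:
  assumes el: "elementary M G g n u f" and b: "bounded_by M (elem_process g n u f) \<delta>" and d: "0 < \<delta>"
    and t: "0 \<le> t" and x: "x \<in> space M" and z: "\<And>r. r \<in> {0..1} \<Longrightarrow> \<bar>S r x\<bar> \<le> z"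
  shows "\<bar>elem_integral n u f after t x - (\<Sum>i<n. of_bool (\<tau> x \<le> u i) * f i x * (S (min (min t 1) (u (Suc i))) x - S (min (min t 1) (u i)) x))\<bar> \<le> 2 * \<delta> * z"
proof -
  have um: "u i \<le> u j" if "i \<le> j" "j \<le> n" for i j using elementary_grid(2)[OF el that] .
  have u0: "0 \<le> u i" if "i \<le> n" for i using elementary_grid(1)[OF el order_refl that] .
  have z0: "0 \<le> z" using z[of 0] by simp
  define v where "v i = min (min t 1) (u i)" for i
  have aft: "after (min t (u i)) x = S (v i) x - S (min (v i) (\<tau> x)) x" for i
    by (simp add: after_def stopped_def v_def min.commute min.left_commute)
  define p where "p i = f i x * (after (min t (u (Suc i))) x - after (min t (u i)) x)" for i
  define q where "q i = of_bool (\<tau> x \<le> u i) * f i x * (S (v (Suc i)) x - S (v i) x)" for i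
  have pq: "\<bar>p i - q i\<bar> \<le> of_bool (u i < \<tau> x \<and> \<tau> x < u (Suc i)) * (2 * \<delta> * z)" if i: "i < n" for i
  proof -
    have vm: "v i \<le> v (Suc i)" using um[of i "Suc i"] i by (auto simp: v_def min_le_iff_disj)
    consider "\<tau> x \<le> u i" "u i \<le> min t 1" | "\<tau> x \<le> u i" "min t 1 < u i" | "u i < \<tau> x" "u (Suc i) \<le> \<tau> x" | "u i < \<tau> x" "\<tau> x < u (Suc i)"
      by linarith
    then show ?thesis
    proof cases
      case 1
      then have "\<tau> x \<le> v i" by (simp add: v_def)
      then have "min (v i) (\<tau> x) = \<tau> x" "min (v (Suc i)) (\<tau> x) = \<tau> x" using vm by auto
      then show ?thesis unfolding p_def q_def aft using 1 by simp
    next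
      case 2
      then have "v i = min t 1" "v (Suc i) = min t 1" using um[of i "Suc i"] i by (auto simp: v_def)
      then show ?thesis unfolding p_def q_def aft using 2 by simp
    next
      case 3
      then have "v i \<le> \<tau> x" "v (Suc i) \<le> \<tau> x" by (auto simp: v_def)
      then show ?thesis unfolding p_def q_def aft using 3 by simp
    next
      case 4
      then have "v i \<le> \<tau> x" by (auto simp: v_def)
      then have pe: "p i = f i x * (S (v (Suc i)) x - S (min (v (Suc i)) (\<tau> x)) x)" unfolding p_def aft by simp
      have fi: "\<bar>f i x\<bar> \<le> \<delta>" by (rule elem_process_bound[OF el b i _ x]) (use 4 in simp)
      have "v (Suc i) \<in> {0..1}" "min (v (Suc i)) (\<tau> x) \<in> {0..1}" using u0[of "Suc i"] i t half_time_bounds[of x] by (auto simp: v_def)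
      then have "\<bar>S (v (Suc i)) x - S (min (v (Suc i)) (\<tau> x)) x\<bar> \<le> 2 * z" using z[of "v (Suc i)"] z[of "min (v (Suc i)) (\<tau> x)"] by linarith
      then have "\<bar>p i\<bar> \<le> \<delta> * (2 * z)" unfolding pe abs_mult using fi d by (intro mult_mono) auto
      then show ?thesis using 4 by (simp add: q_def)
    qed
  qed
  have "\<bar>(\<Sum>i<n. p i) - (\<Sum>i<n. q i)\<bar> \<le> (\<Sum>i<n. \<bar>p i - q i\<bar>)"
    unfolding sum_subtractf[symmetric] by (rule sum_abs)
  also have "\<dots> \<le> (\<Sum>i<n. of_bool (u i < \<tau> x \<and> \<tau> x < u (Suc i)) * (2 * \<delta> * z))" by (intro sum_mono pq) simp
  also have "\<dots> = real (card {i \<in> {..<n}. u i < \<tau> x \<and> \<tau> x < u (Suc i)}) * (2 * \<delta> * z)"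
    unfolding sum_distrib_right[symmetric] by (simp add: Int_def)
  also have "\<dots> \<le> 1 * (2 * \<delta> * z)"
  proof (rule mult_right_mono)
    have "card {i \<in> {..<n}. u i < \<tau> x \<and> \<tau> x < u (Suc i)} \<le> Suc 0"
    proof (subst card_le_Suc0_iff_eq)
      show "\<forall>i\<in>{i \<in> {..<n}. u i < \<tau> x \<and> \<tau> x < u (Suc i)}. \<forall>j\<in>{i \<in> {..<n}. u i < \<tau> x \<and> \<tau> x < u (Suc i)}. i = j"
      proof (intro ballI)
        fix i j assume i: "i \<in> {i \<in> {..<n}. u i < \<tau> x \<and> \<tau> x < u (Suc i)}" and j: "j \<in> {i \<in> {..<n}. u i < \<tau> x \<and> \<tau> x < u (Suc i)}"
        have "\<not> i < j" using um[of "Suc i" j] i j by auto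
        moreover have "\<not> j < i" using um[of "Suc j" i] i j by auto
        ultimately show "i = j" by simp
      qed
    qed simp
    then show "real (card {i \<in> {..<n}. u i < \<tau> x \<and> \<tau> x < u (Suc i)}) \<le> 1" by simp
    show "0 \<le> 2 * \<delta> * z" using d z0 by simp
  qed
  finally show ?thesis by (simp add: elem_integral_def p_def q_def v_def)
qed

lemma after_good_integrator: "GG.good_integrator after"
  unfolding GG.good_integrator_def
proof (intro allI impI)
  fix t \<epsilon> :: real assume t: "0 \<le> t" and e: "0 < \<epsilon>"
  obtain Z where Z: "integrable M Z" "AE x in M. \<forall>r\<in>{0..1}. \<bar>S r x\<bar> \<le> Z x"
    using S_dominated unfolding dominated_def by blast
  have Zpos: "AE x in M. 0 \<le> Z x" using Z(2)
  proof eventually_elim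
    case (elim x)
    have "\<bar>S 0 x\<bar> \<le> Z x" by (rule bspec[OF elim]) simp
    then show ?case by linarith
  qed
  define z where "z = (\<integral>x. Z x \<partial>M)"
  have z: "0 \<le> z" unfolding z_def by (rule integral_nonneg_AE[OF Zpos])
  define Q where "Q = 4 * K1 / \<epsilon> + 64 * K2 / \<epsilon>\<^sup>2 + 4 * z / \<epsilon>"
  have Q: "0 \<le> Q" using K1_nonneg K2_nonneg z e by (simp add: Q_def)
  define \<delta> where "\<delta> = min 1 (\<epsilon> / (Q + 1))"
  have d: "0 < \<delta>" "\<delta> \<le> 1" "\<delta> * Q \<le> \<epsilon>"
  proof -
    show "0 < \<delta>" "\<delta> \<le> 1" using e Q by (auto simp: \<delta>_def)
    have "\<delta> * Q \<le> (\<epsilon> / (Q + 1)) * (Q + 1)" using e Q by (intro mult_mono) (auto simp: \<delta>_def)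
    then show "\<delta> * Q \<le> \<epsilon>" using Q by simp
  qed
  have t1: "0 \<le> min t 1" "min t 1 \<le> 1" using t by auto
  show "\<exists>\<delta>>0. \<forall>g n u f. elementary M G g n u f \<and> bounded_by M (elem_process g n u f) \<delta> \<longrightarrow>
        measure M {\<omega>\<in>space M. \<bar>elem_integral n u f after t \<omega>\<bar> > \<epsilon>} \<le> \<epsilon>"
  proof (intro exI[of _ \<delta>] conjI d(1) allI impI, elim conjE)
    fix g n u f assume el: "elementary M G g n u f" and b: "bounded_by M (elem_process g n u f) \<delta>"
    define T where "T x = (\<Sum>i<n. of_bool (\<tau> x \<le> u i) * f i x * (S (min (min t 1) (u (Suc i))) x - S (min (min t 1) (u i)) x))" for x
    have e2: "0 < \<epsilon> / 2" using e by simp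
    have Tm: "T \<in> borel_measurable M" and PT: "prob {x \<in> space M. \<epsilon> / 2 < \<bar>T x\<bar>} \<le> 2 * \<delta> * K1 / (\<epsilon> / 2) + 16 * \<delta>\<^sup>2 * K2 / (\<epsilon> / 2)\<^sup>2"
      using after_tail_probability[OF el b d(1) e2 t1] unfolding T_def[abs_def] by auto
    let ?Y = "elem_integral n u f after t"
    have Ym: "?Y \<in> borel_measurable M" by (rule GG.adapted_measurable[OF GG.elem_integral_adapted[OF after_adapted el] t])
    let ?A = "{x \<in> space M. \<epsilon> / 2 < \<bar>T x\<bar>}" and ?C = "{x \<in> space M. \<epsilon> / 2 \<le> 2 * \<delta> * Z x}"
    have AC: "?A \<in> sets M" "?C \<in> sets M" using Tm Z(1) by measurable
    have "prob {x\<in>space M. \<bar>?Y x\<bar> > \<epsilon>} \<le> prob (?A \<union> ?C)"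
    proof (rule finite_measure_mono_AE)
      show "AE x in M. x \<in> {x\<in>space M. \<bar>?Y x\<bar> > \<epsilon>} \<longrightarrow> x \<in> ?A \<union> ?C"
        using Z(2)
      proof eventually_elim
        case (elim x)
        show ?case
        proof
          assume x: "x \<in> {x\<in>space M. \<bar>?Y x\<bar> > \<epsilon>}"
          have "\<bar>?Y x - T x\<bar> \<le> 2 * \<delta> * Z x" unfolding T_def
            by (rule after_straddle[OF el b d(1) t]) (use x elim in auto)
          then show "x \<in> ?A \<union> ?C" using x by (cases "\<epsilon> / 2 < \<bar>T x\<bar>") auto
        qed
      qed
    qed (use AC in auto)
    also have "\<dots> \<le> prob ?A + prob ?C" by (rule measure_Un_le[OF AC])
    also have "prob ?C \<le> (\<integral>x. 2 * \<delta> * Z x \<partial>M) / (\<epsilon> / 2)"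
      by (rule integral_Markov_inequality_measure[where A="{}"]) (use Z(1) Zpos d e in auto)
    also have "prob ?A + (\<integral>x. 2 * \<delta> * Z x \<partial>M) / (\<epsilon> / 2) \<le> 2 * \<delta> * K1 / (\<epsilon> / 2) + 16 * \<delta>\<^sup>2 * K2 / (\<epsilon> / 2)\<^sup>2 + 2 * \<delta> * z / (\<epsilon> / 2)"
      using PT Z(1) by (simp add: z_def)
    also have "\<dots> \<le> 2 * \<delta> * K1 / (\<epsilon> / 2) + 16 * \<delta> * K2 / (\<epsilon> / 2)\<^sup>2 + 2 * \<delta> * z / (\<epsilon> / 2)"
    proof -
      have "\<delta>\<^sup>2 \<le> \<delta>" using d by (simp add: power2_eq_square mult_left_le)
      then have "16 * \<delta>\<^sup>2 * K2 / (\<epsilon> / 2)\<^sup>2 \<le> 16 * \<delta> * K2 / (\<epsilon> / 2)\<^sup>2"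
        using K2_nonneg by (intro divide_right_mono mult_right_mono mult_left_mono) auto
      then show ?thesis by simp
    qed
    also have "\<dots> = \<delta> * Q" using e by (simp add: Q_def power_divide field_simps)
    also have "\<dots> \<le> \<epsilon>" by (rule d(3))
    finally show "measure M {\<omega>\<in>space M. \<bar>?Y \<omega>\<bar> > \<epsilon>} \<le> \<epsilon>" by simp
  qed
qed

end

section \<open>Arbitrage after the last passage\<close>

context half_time begin

lemma E_sub_F: "1 \<le> v \<Longrightarrow> sets (E v) \<subseteq> sets (F v)"
proof -
  assume v: "1 \<le> v"
  have "sigma_sets (space (F v)) (sets (F v) \<union> {(\<lambda>\<omega>. min (\<tau> \<omega>) v) -` C \<inter> space M | C. C \<in> sets borel}) \<subseteq> sets (F v)"
  proof (rule sets.sigma_sets_subset, safe)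
    fix C :: "real set" assume C: "C \<in> sets borel"
    have "(\<lambda>x. min (\<tau> x) v) \<in> borel_measurable (F v)" using half_time_F[OF v] by measurable
    from measurable_sets[OF this C] show "(\<lambda>\<omega>. min (\<tau> \<omega>) v) -` C \<inter> space M \<in> sets (F v)" by simp
  qed
  then show ?thesis by (simp add: sets_E)
qed

text \<open>The part of \<open>S - stopped S \<tau>\<close> after time 1, when \<open>\<tau>\<close> is known in \<open>F\<close>.\<close>

definition late :: "real \<Rightarrow> 'a \<Rightarrow> real" where "late t x = S (max t 1) x - S 1 x"

lemma late_adapted: "adapted G late"
  unfolding adapted_def
proof (intro allI impI)
  fix t :: real assume t: "0 \<le> t"
  show "late t \<in> borel_measurable (G t)"
  proof (cases "t \<le> 1")
    case True
    then have "late t = (\<lambda>_. 0)" by (simp add: late_def max_absorb2 fun_eq_iff)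
    then show ?thesis by simp
  next
    case False
    have "late t \<in> borel_measurable (F t)"
      unfolding late_def[abs_def] using S_F[of "max t 1" t] S_F[of 1 t] False by simp
    then have "late t \<in> borel_measurable (F (t + e))" if "0 < e" for e
      by (rule FF.filt_measurable_mono[rotated 2]) (use t that in auto)
    then show ?thesis
      using F_sub_E by (intro measurable_G) (force simp: measurable_def)
  qed
qed

lemma late_martingale: "GG.martingale late"
proof (rule G_martingaleI)
  show "late t \<in> borel_measurable M" if "0 \<le> t" for t by (rule GG.adapted_measurable[OF late_adapted that])
  show "continuous_on {0..} (\<lambda>t. late t x)" for x
    unfolding late_def
    by (intro continuous_intros continuous_on_compose2[OF S_continuous]) auto
  show "dominated M late"
    unfolding dominated_def
  proof
    fix N
    obtain Z where Z: "integrable M Z" "AE x in M. \<forall>s\<in>{0..max N 1}. \<bar>S s x\<bar> \<le> Z x"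
      using S_dominated unfolding dominated_def by blast
    have "AE x in M. \<forall>s\<in>{0..N}. \<bar>late s x\<bar> \<le> 2 * Z x"
      using Z(2)
    proof eventually_elim
      case (elim x)
      show ?case
      proof
        fix s assume s: "s \<in> {0..N}"
        have "max s 1 \<in> {0..max N 1}" "1 \<in> {0..max N 1}" using s by auto
        then have "\<bar>S (max s 1) x\<bar> \<le> Z x" "\<bar>S 1 x\<bar> \<le> Z x" using elim by blast+
        then show "\<bar>late s x\<bar> \<le> 2 * Z x" by (simp add: late_def)
      qed
    qed
    then show "\<exists>Z. integrable M Z \<and> (AE x in M. \<forall>s\<in>{0..N}. \<bar>late s x\<bar> \<le> Z x)"
      using Z(1) by (intro exI[of _ "\<lambda>x. 2 * Z x"]) simp
  qed
  fix s t :: real and A assume st: "0 \<le> s" "s \<le> t" and A: "A \<in> sets (E s)"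
  have "A \<in> sets (F (max s 1))" using A E_mono[of s "max s 1"] E_sub_F[of "max s 1"] st by auto
  then have "(\<integral>x. indicator A x * (S (max t 1) x - S (max s 1) x) \<partial>M) = 0"
    by (intro FF.martingaleD(2)[OF S_martingale]) (use st in auto)
  then show "(\<integral>x. indicator A x * (late t x - late s x) \<partial>M) = 0" by (simp add: late_def)
qed

abbreviation gain :: "real \<Rightarrow> 'a \<Rightarrow> real" where "gain \<equiv> \<lambda>t x. X t x - stopped X \<tau> t x"

lemma gain_indistinguishable: "GG.indistinguishable (\<lambda>t x. after t x + late t x) gain"
  unfolding GG.indistinguishable_def using X_S
proof eventually_elim
  case (elim x)
  show ?case
  proof (intro allI impI)
    fix t :: real assume t: "0 \<le> t"
    have "min (min t 1) (\<tau> x) = min t (\<tau> x)" using half_time_bounds(2)[of x] by simp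
    moreover have "S (min t 1) x + S (max t 1) x = S t x + S 1 x" by (simp add: min_def max_def)
    ultimately have "after t x + late t x = S t x - S (min t (\<tau> x)) x" by (simp add: after_def late_def stopped_def)
    then show "after t x + late t x = X t x - stopped X \<tau> t x"
      using elim t half_time_bounds(1)[of x] by (simp add: stopped_def)
  qed
qed

lemma gain_adapted: "adapted G gain"
  and gain_continuous: "continuous_paths M gain"
  and gain_semimartingale: "semimartingale M G gain"
proof -
  have ad: "adapted G (\<lambda>t x. after t x + late t x)"
    using after_adapted late_adapted by (simp add: adapted_def borel_measurable_add)
  show ad': "adapted G gain" by (rule GG.indistinguishable_adapted[OF gain_indistinguishable ad])
  show c: "continuous_paths M gain"
    unfolding continuous_paths_def using X_S
  proof eventually_elim
    case (elim x)
    have "continuous_on {0..} (\<lambda>t. S t x - stopped S \<tau> t x)" by (intro continuous_intros S_continuous stopped_S_paths)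
    then show ?case by (rule continuous_on_eq) (use elim half_time_bounds in \<open>auto simp: stopped_def\<close>)
  qed
  have sq: "integrable M (\<lambda>x. (late t x)\<^sup>2)" if "0 \<le> t" for t
    unfolding late_def using integrable_square_add[of "S (max t 1)" M "\<lambda>x. - S 1 x"] S_square[of "max t 1"] S_square[of 1] by simp
  have "GG.good_integrator (\<lambda>t x. after t x + late t x)"
    by (rule GG.good_integrator_add[OF after_good_integrator after_adapted
      GG.martingale_good_integrator[OF late_martingale late_adapted sq] late_adapted])
  from GG.indistinguishable_good_integrator[OF gain_indistinguishable this ad]
  show "semimartingale M G gain"
    using ad' GG.continuous_paths_cadlag[OF c] by (simp add: GG.semimartingale_iff)
qed

text \<open>
  The event on which the price passes through half of its final value after time 0.  By right
  continuity it belongs to \<open>G 0\<close>.  Since \<open>gain\<close> is zero up to \<open>\<tau>\<close>, holding one unit from time 0 on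
  this event amounts to buying at \<open>\<tau>\<close>, and the strategy is an elementary integrand.
\<close>

definition passed :: "'a set" where "passed = {x \<in> space M. 0 < \<tau> x}"

lemma passed_G0: "passed \<in> sets (G 0)"
  unfolding sets_G
proof (rule INT_I)
  fix e :: real assume "e \<in> {0<..}"
  then have e: "0 < e" by simp
  have "(\<lambda>x. min (\<tau> x) e) \<in> borel_measurable (E (0 + e))" by (rule min_\<tau>_E) simp
  then have "(\<lambda>x. min (\<tau> x) e) -` {0<..} \<inter> space (E (0 + e)) \<in> sets (E (0 + e))" by (rule measurable_sets) simp
  moreover have "space (E (0 + e)) = space M" by (rule space_E)
  moreover have "(\<lambda>x. min (\<tau> x) e) -` {0<..} \<inter> space M = passed" using e by (auto simp: passed_def)
  ultimately show "passed \<in> sets (E (0 + e))" by simp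
qed

definition buy_and_hold :: "real \<Rightarrow> 'a \<Rightarrow> real" where
  "buy_and_hold = elem_process (\<lambda>_. 0) 1 real (\<lambda>_. indicator passed)"

definition wealth :: "real \<Rightarrow> 'a \<Rightarrow> real" where
  "wealth = elem_integral 1 real (\<lambda>_. indicator passed) gain"

lemma buy_and_hold_eq: "buy_and_hold t x = indicator passed x * indicator {0<..1} t"
  by (simp add: buy_and_hold_def elem_process_def)

lemma buy_and_hold_elementary: "elementary M G (\<lambda>_. 0) 1 real (\<lambda>_. indicator passed)"
  using passed_G0 by (auto simp: elementary_def indicator_def intro!: exI[of _ 1])

lemma no_holding_elementary: "elementary M G (\<lambda>_. 0) 0 real f"
  by (auto simp: elementary_def)

text \<open>
  The truncations in the definition of the integral are the whole integrand, except for the zeroth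
  one, which vanishes.
\<close>

lemma wealth_integral: "stoch_integral M G gain buy_and_hold wealth"
  unfolding stoch_integral_def
proof (intro conjI)
  show "semimartingale M G gain" by (rule gain_semimartingale)
  show "adapted G wealth" unfolding wealth_def by (rule GG.elem_integral_adapted[OF gain_adapted buy_and_hold_elementary])
  show "cadlag_paths M wealth"
    unfolding wealth_def by (intro GG.continuous_paths_cadlag GG.elem_integral_continuous[OF gain_continuous buy_and_hold_elementary])
  show "predictable M G buy_and_hold"
  proof -
    have m: "{0<..1} \<times> passed \<in> sets (predictable_sigma M G)"
      unfolding predictable_sigma_def
    proof (subst sets_measure_of)
      have sub: "A \<subseteq> space M" if "A \<in> sets (G s)" for A s using sets.sets_into_space[OF that] by (simp only: space_G)
      show "{{0} \<times> A |A. A \<in> sets (G 0)} \<union> {{s<..t} \<times> A |s t A. 0 \<le> s \<and> s < t \<and> A \<in> sets (G s)} \<subseteq> Pow ({0..} \<times> space M)"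
        by (intro Un_least subsetI; elim CollectE exE conjE; use sub in \<open>force\<close>)
      have "{0<..1} \<times> passed \<in> {{s<..t} \<times> A |s t A. 0 \<le> s \<and> s < t \<and> A \<in> sets (G s)}"
        by (intro CollectI exI[of _ 0] exI[of _ 1] exI[of _ passed] conjI refl passed_G0) auto
      then show "{0<..1} \<times> passed \<in> sigma_sets ({0..} \<times> space M) ({{0} \<times> A |A. A \<in> sets (G 0)} \<union> {{s<..t} \<times> A |s t A. 0 \<le> s \<and> s < t \<and> A \<in> sets (G s)})"
        by (intro sigma_sets.Basic) blast
    qed
    have "(\<lambda>(t, x). buy_and_hold t x) = indicator ({0<..1} \<times> passed)"
      by (auto simp: buy_and_hold_eq indicator_def fun_eq_iff)
    then show ?thesis unfolding predictable_def using m by simp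
  qed
  define Z where "Z k = (if k = 0 then elem_integral 0 real (\<lambda>_. indicator passed) gain else wealth)" for k :: nat
  have "bounded_integral M G gain (\<lambda>t x. if \<bar>buy_and_hold t x\<bar> \<le> real k then buy_and_hold t x else 0) (Z k)" for k
  proof (cases "k = 0")
    case True
    have "(\<lambda>t x. if \<bar>buy_and_hold t x\<bar> \<le> real k then buy_and_hold t x else 0) = elem_process (\<lambda>_. 0) 0 real (\<lambda>_. indicator passed)"
      using True by (simp add: elem_process_def fun_eq_iff)
    then show ?thesis using bounded_integral.elem[OF no_holding_elementary, of gain "\<lambda>_. indicator passed"] True by (simp only: Z_def if_True refl)
  next
    case False
    have "\<bar>buy_and_hold t x\<bar> \<le> real k" for t x using False by (auto simp: buy_and_hold_eq indicator_def)
    then have "(\<lambda>t x. if \<bar>buy_and_hold t x\<bar> \<le> real k then buy_and_hold t x else 0) = buy_and_hold"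
      by (simp add: fun_eq_iff)
    then show ?thesis
      using bounded_integral.elem[OF buy_and_hold_elementary] False by (simp only: Z_def if_False buy_and_hold_def wealth_def)
  qed
  moreover have "emery_tendsto M G Z wealth"
  proof -
    have ev: "\<forall>\<^sub>F k in sequentially. (\<lambda>s x. Z k s x - wealth s x) = (\<lambda>s x. 0)"
      using eventually_gt_at_top[of 0] by eventually_elim (simp add: Z_def)
    have us: "unif_small M (\<lambda>s x. 0) t \<epsilon>" if "0 < \<epsilon>" for t \<epsilon>
      unfolding unif_small_def using that by (intro bexI[of _ "{}"]) auto
    have e0: "elem_integral n u f (\<lambda>s x. 0) = (\<lambda>s x. 0)" for n u and f :: "nat \<Rightarrow> 'a \<Rightarrow> real"
      by (simp add: elem_integral_def fun_eq_iff)
    show ?thesis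
      unfolding emery_tendsto_def ucp_tendsto_def
    proof (intro conjI allI impI)
      fix t \<epsilon> :: real assume "0 < \<epsilon>"
      show "\<forall>\<^sub>F k in sequentially. unif_small M (\<lambda>s \<omega>. Z k s \<omega> - wealth s \<omega>) t \<epsilon>"
        using ev by eventually_elim (simp only: us[OF \<open>0 < \<epsilon>\<close>])
      show "\<forall>\<^sub>F k in sequentially. \<forall>g n u f. elementary M G g n u f \<and> bounded_by M (elem_process g n u f) 1 \<longrightarrow>
          unif_small M (elem_integral n u f (\<lambda>s \<omega>. Z k s \<omega> - wealth s \<omega>)) t \<epsilon>"
        using ev by eventually_elim (simp only: e0 us[OF \<open>0 < \<epsilon>\<close>] simp_thms)
    qed
  qed
  ultimately show "\<exists>Z. (\<forall>k. bounded_integral M G gain (\<lambda>t \<omega>. if \<bar>buy_and_hold t \<omega>\<bar> \<le> real k then buy_and_hold t \<omega> else 0) (Z k)) \<and> emery_tendsto M G Z wealth"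
    by blast
qed

lemma wealth_eq:
  assumes X: "\<forall>t\<ge>0. X t x = S t x" and t: "0 \<le> t"
  shows "wealth t x = indicator passed x * (S (min t 1) x - S (min (min t 1) (\<tau> x)) x)"
  using X t half_time_bounds[of x] by (simp add: wealth_def elem_integral_def stopped_def)

text \<open>
  Were the price between \<open>\<tau>\<close> and 1 below half of its final value, it would pass through this half
  again on its way to the final value.
\<close>

lemma price_after_half_time:
  assumes tau: "\<tau> x = last_zero 1 S x" and pos: "0 < \<tau> x"
  shows "S 1 x = 2 * S (\<tau> x) x" and "\<tau> x \<le> s \<Longrightarrow> s \<le> 1 \<Longrightarrow> S (\<tau> x) x \<le> S s x"
proof -
  have "{t. 0 \<le> t \<and> t \<le> 1 \<and> S 1 x - 2 * S t x = 0} \<noteq> {}"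
    using pos unfolding tau last_zero_def Let_def by (auto split: if_splits)
  then obtain r where r: "0 \<le> r" "r \<le> 1" "S 1 x - 2 * S r x = 0" by auto
  from last_zero_attained[where Y=S and x=x, OF S_continuous r]
  show e: "S 1 x = 2 * S (\<tau> x) x" using tau by simp
  assume s: "\<tau> x \<le> s" "s \<le> 1"
  show "S (\<tau> x) x \<le> S s x"
  proof (rule ccontr)
    assume "\<not> S (\<tau> x) x \<le> S s x"
    then have l: "2 * S s x < S 1 x" using e by simp
    have "\<exists>r\<ge>s. r \<le> 1 \<and> S r x = S 1 x / 2"
    proof (rule IVT')
      show "S s x \<le> S 1 x / 2" using l by simp
      show "S 1 x / 2 \<le> S 1 x" using S_pos[of 1 x] by simp
      show "continuous_on {s..1} (\<lambda>r. S r x)" by (rule continuous_on_subset[OF S_continuous]) (use s pos in auto)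
    qed (rule s)
    then obtain r where r: "s \<le> r" "r \<le> 1" "S r x = S 1 x / 2" by blast
    then have "r \<le> last_zero 1 S x" using s pos by (intro last_zero_upper) auto
    then have "r = s" using r(1) s(1) tau by simp
    then show False using l r(3) by simp
  qed
qed

lemma wealth_constant: "1 \<le> t \<Longrightarrow> wealth t x = wealth 1 x"
  by (simp add: wealth_def elem_integral_def)

lemma wealth_limit: "((\<lambda>t. wealth t x) \<longlongrightarrow> wealth 1 x) at_top"
proof (rule Lim_transform_eventually[OF tendsto_const])
  show "\<forall>\<^sub>F t in at_top. wealth 1 x = wealth t x"
    using eventually_ge_at_top[of "1::real"] by eventually_elim (rule wealth_constant[symmetric])
qed

lemma wealth_Lim: "Lim at_top (\<lambda>t. wealth t x) = wealth 1 x"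
  by (rule tendsto_Lim[OF _ wealth_limit]) simp

lemma wealth_final: "AE x in M. (\<forall>t\<ge>0. 0 \<le> wealth t x) \<and> (x \<in> passed \<longrightarrow> 0 < wealth 1 x)"
  using X_S half_time_AE
proof eventually_elim
  case (elim x)
  note w = wealth_eq[OF elim(1)]
  show ?case
  proof (intro conjI allI impI)
    fix t :: real assume t: "0 \<le> t"
    show "0 \<le> wealth t x"
    proof (cases "x \<in> passed \<and> \<tau> x \<le> min t 1")
      case True
      then have "S (\<tau> x) x \<le> S (min t 1) x" by (intro price_after_half_time(2)[OF elim(2)]) (auto simp: passed_def)
      then show ?thesis using w[OF t] True by (simp add: min_absorb2)
    next
      case False
      then show ?thesis using w[OF t] by (cases "x \<in> passed") (auto simp: min_absorb1)
    qed
  next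
    assume x: "x \<in> passed"
    have "S 1 x = 2 * S (\<tau> x) x" by (rule price_after_half_time(1)[OF elim(2)]) (use x in \<open>simp add: passed_def\<close>)
    then show "0 < wealth 1 x" using w[of 1] x S_pos[of "\<tau> x" x] half_time_bounds(2)[of x] by (simp add: min_absorb2)
  qed
qed

text \<open>
  If the final value exceeds \<open>2 * S0\<close>, the price passes through half of it after time 0; this happens
  when \<open>B 1\<close> exceeds the threshold \<open>b\<close>.
\<close>

lemma passed_positive:
  assumes s: "0 < \<sigma>" shows "0 < prob passed"
proof -
  define b where "b = (ln 2 + \<sigma>\<^sup>2 / 2) / \<sigma>"
  have pm: "passed \<in> sets M" using full_subalgebraD(2)[OF GG.filt_full[of 0]] passed_G0 by auto
  have d: "distributed M lborel (\<lambda>x. B 1 x) (normal_density 0 1)" using B_dist[of 0 1] by simp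
  have "prob {x \<in> space M. b < B 1 x} \<le> prob passed"
  proof (rule finite_measure_mono_AE[OF _ pm])
    show "AE x in M. x \<in> {x \<in> space M. b < B 1 x} \<longrightarrow> x \<in> passed"
      using half_time_AE
    proof eventually_elim
      case (elim x)
      show ?case
      proof
        assume x: "x \<in> {x \<in> space M. b < B 1 x}"
        then have "ln 2 < \<sigma> * B 1 x - \<sigma>\<^sup>2 / 2" using s by (simp add: b_def field_simps)
        then have "exp (ln 2) < expm \<sigma> 1 x" unfolding expm_def by (subst exp_less_cancel_iff) simp
        then have big: "2 * S 0 x < S 1 x" using S0_pos by (simp add: S_def)
        have "\<exists>r\<ge>0. r \<le> 1 \<and> S r x = S 1 x / 2"
        proof (rule IVT')
          show "S 0 x \<le> S 1 x / 2" using big by simp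
          show "S 1 x / 2 \<le> S 1 x" using S_pos[of 1 x] by simp
          show "continuous_on {0..1} (\<lambda>r. S r x)" by (rule continuous_on_subset[OF S_continuous]) auto
        qed simp
        then obtain r where r: "0 \<le> r" "r \<le> 1" "S r x = S 1 x / 2" by blast
        then have "r \<noteq> 0" using big by auto
        moreover have "r \<le> last_zero 1 S x" by (rule last_zero_upper) (use r in auto)
        ultimately show "x \<in> passed" using r(1) x elim by (simp add: passed_def)
      qed
    qed
  qed
  moreover have "prob {x \<in> space M. b < B 1 x} \<noteq> 0"
  proof
    assume "prob {x \<in> space M. b < B 1 x} = 0"
    moreover have "{x \<in> space M. b < B 1 x} = (\<lambda>x. B 1 x) -` {b<..} \<inter> space M" by auto
    ultimately have "emeasure M ((\<lambda>x. B 1 x) -` {b<..} \<inter> space M) = 0" by (simp add: emeasure_eq_measure)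
    then have "(\<integral>\<^sup>+y. ennreal (normal_density 0 1 y) * indicator {b<..} y \<partial>lborel) = 0"
      using distributed_emeasure[OF d, of "{b<..}"] by simp
    then have "AE y in lborel. ennreal (normal_density 0 1 y) * indicator {b<..} y = 0"
      by (subst (asm) nn_integral_0_iff_AE) auto
    then have "AE y in lborel. y \<notin> {b<..<b+1}"
    proof eventually_elim
      case (elim y)
      have "0 < normal_density 0 1 y" by (rule normal_density_pos) simp
      then show ?case using elim by (auto simp: indicator_def)
    qed
    then have "emeasure lborel {b<..<b+1} = 0" by (subst (asm) AE_iff_measurable[where N="{b<..<b+1}"]) auto
    then show False by simp
  qed
  ultimately show ?thesis using measure_nonneg[of M "{x \<in> space M. b < B 1 x}"] by linarith
qed

theorem arbitrage_after:
  assumes "0 < \<sigma>"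
  shows "classical_arbitrage M G gain buy_and_hold"
  unfolding classical_arbitrage_def
proof (intro exI[of _ wealth] conjI)
  show "admissible M G gain buy_and_hold wealth"
    unfolding admissible_def
  proof (intro conjI exI[of _ 0] allI impI)
    show "AE x in M. - 0 \<le> wealth t x" if "0 \<le> t" for t using wealth_final by eventually_elim (use that in auto)
    show "AE x in M. \<exists>l. ((\<lambda>t. wealth t x) \<longlongrightarrow> l) at_top" by (rule AE_I2) (blast intro: wealth_limit)
  qed (use wealth_integral in auto)
  show "AE x in M. 0 \<le> Lim at_top (\<lambda>t. wealth t x)" unfolding wealth_Lim using wealth_final by eventually_elim auto
  have "wealth 1 \<in> borel_measurable M"
    unfolding wealth_def by (rule GG.adapted_measurable[OF GG.elem_integral_adapted[OF gain_adapted buy_and_hold_elementary]]) simp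
  then have "{x \<in> space M. 0 < wealth 1 x} \<in> sets M" by measurable
  then have "prob passed \<le> prob {x \<in> space M. 0 < wealth 1 x}"
    by (rule finite_measure_mono_AE[rotated]) (use wealth_final in \<open>auto elim!: eventually_mono simp: passed_def\<close>)
  then show "0 < prob {x \<in> space M. 0 < Lim at_top (\<lambda>t. wealth t x)}"
    unfolding wealth_Lim using passed_positive[OF assms] by simp
qed

end

theorem proposition5p1:
  fixes M :: "'a measure" and W S :: "real \<Rightarrow> 'a \<Rightarrow> real" and \<sigma> S0 :: real
    and F G :: "real \<Rightarrow> 'a measure" and \<tau> :: "'a \<Rightarrow> real"
  assumes "prob_space M" and "complete_measure M"
    and "brownian_motion M W"
    and F: "F = augmented_filtration M W"
    and "\<sigma> > 0" and "S0 > 0"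
    and "solves_black_scholes M F W \<sigma> S0 S"
    and tau: "\<tau> = last_half_time S"
    and G: "G = progressive_enlargement M F \<tau>"
  shows "NA M G (stopped S \<tau>) \<and>
    (\<exists>\<theta>. classical_arbitrage M G (\<lambda>t \<omega>. S t \<omega> - stopped S \<tau> t \<omega>) \<theta>)"
proof -
  interpret prob_space M by fact
  interpret complete_measure M by fact
  interpret half_time M W \<sigma> S0 S by unfold_locales (use assms in auto)
  show ?thesis
    unfolding G F tau using NA_before arbitrage_after[OF \<open>\<sigma> > 0\<close>] by blast
qed

end
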